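(* Let $T>0$, $\gamma\in(1/2,1]$, $\alpha\in(1-\gamma,1/2)$ and $X_0\in\mathbb{R}$. Let $W$ be a standard $\mathcal F_t$-Wiener process, and let $Z$ and $\overline Z$ be $\mathcal F_t$-adapted processes which are almost surely $\gamma$-Hölder continuous on $[0,T]$. Suppose that $a,b,c:[0,T]\times\mathbb{R}\to\mathbb{R}$, with $c$ differentiable in its second argument, satisfy for some $K>0$ and $\beta>1/2$ and for all $t,s\in[0,T]$, $x,y\in\mathbb{R}$: $$|a(t,x)|+|b(t,x)|+|c(t,x)|\le K(1+|x|),\qquad |\partial_x c(t,x)|\le K,$$ $$|a(t,x)-a(t,y)|+|b(t,x)-b(t,y)|+|\partial_x c(t,x)-\partial_x c(t,y)|\le K|x-y|,$$ $$|a(s,x)-a(t,x)|+|b(s,x)-b(t,x)|+|c(s,x)-c(t,x)|+|\partial_x c(s,x)-\partial_x c(t,x)|\le K|s-t|^\beta.$$ For $N\ge1$ and $Y\in\{Z,\overline Z\}$ let $Y^N_t=Y_{t\wedge\tau_N^Y}$, where $\tau^Y_N=\inf\{t:\|Y\|_{0,t}\ge N\}\wedge T$, and let $X^N$ and $\overline X^N$ be the unique solutions (with a.s. finite $\|\cdot\|_{\infty,T}$) of $$X^N_t=X_0+\int_0^t a(s,X^N_s)\,ds+\int_0^t b(s,X^N_s)\,dW_s+\int_0^t c(s,X^N_s)\,dZ^N_s,\quad t\in[0,T],$$ $$\overline X^N_t=X_0+\int_0^t a(s,\overline X^N_s)\,ds+\int_0^t b(s,\overline X^N_s)\,dW_s+\int_0^t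 c(s,\overline X^N_s)\,d\overline Z^N_s,\quad t\in[0,T].$$ For $R>0$ let $A_T^{N,R}=\{\|X^N\|_{\infty,T}+\|\overline X^N\|_{\infty,T}\le R\}$. Then $$\mathsf{E}\Big[\|X^N-\overline X^N\|_{2,T}^2\,\mathbf 1_{A_T^{N,R}}\Big]\le C_{N,R}\,\mathsf{E}\Big[\|Z^N-\overline Z^N\|_{0,T}\Big]$$ with a constant $C_{N,R}$ independent of $Z$ and $\overline Z$.
   Context: $(\Omega,\mathcal F,\{\mathcal F_t\}_{t\in[0,T]},P)$ is a complete probability space with a filtration satisfying the standard assumptions. The processes $W$, $Z$, $\overline Z$ may be dependent. A solution is a continuous $\mathcal F_t$-adapted process satisfying the equation almost surely for all $t\in[0,T]$. The constant $C_{N,R}$ may depend on $N,R$ and on the fixed data $T,\alpha,\beta,K,X_0$. Norms: for $\alpha$ fixed, $$\|f\|_{t}=|f(t)|+\int_0^t|f(t)-f(s)|(t-s)^{-1-\alpha}ds,\qquad \|f\|_{\infty,t}=\sup_{s\in[0,t]}\|f\|_{s},$$ $$\|f\|_{2,t}^2=\int_0^t\|f\|_{s}^2\,g(t,s)\,ds,\qquad g(t,s)=s^{-\alpha}+(t-s)^{-\alpha-1/2},$$ $$\|f\|_{0,t}=\sup_{0\le u<v<t}\Big(\frac{|f(v)-f(u)|}{(v-u)^{1-\alpha}}+\int_u^v\frac{|f(u)-f(z)|}{(z-u)^{2-\alpha}}dz\Big).$$ Integrals: the integral with respect to $W$ is the Itô integral. The integrals with respect to $Z^N$ and $\overline Z^N$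 are pathwise generalized Lebesgue–Stieltjes integrals $$\int_u^v f(x)\,dg(x)=e^{i\pi\alpha}\int_u^v (D^{\alpha}_{u+}f)(x)\,(D^{1-\alpha}_{v-}g_{v-})(x)\,dx,\qquad g_{v-}(x)=g(x)-g(v),$$ defined when $D^\alpha_{u+}f\in L_1[u,v]$ and $D^{1-\alpha}_{v-}g_{v-}\in L_\infty[u,v]$, where for $x\in(u,v)$ $$(D_{u+}^{\alpha}f)(x)=\frac{1}{\Gamma(1-\alpha)}\Big(\frac{f(x)}{(x-u)^\alpha}+\alpha\int_u^x\frac{f(x)-f(y)}{(x-y)^{1+\alpha}}dy\Big),$$ $$(D_{v-}^{1-\alpha}g)(x)=\frac{e^{-i\pi\alpha}}{\Gamma(\alpha)}\Big(\frac{g(x)}{(v-x)^{1-\alpha}}+(1-\alpha)\int_x^v\frac{g(x)-g(y)}{(y-x)^{2-\alpha}}dy\Big).$$ *)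

theory Defs
  imports "HOL-Probability.Probability"
begin

section \<open>Norms of paths\<close>

text \<open>All norms take values in \<open>[0, \<infinity>]\<close>, so that each is defined for every path. The
  integrands vanish wherever a base is \<open>0\<close>, since \<open>0 powr a = 0\<close> and \<open>x / 0 = 0\<close>; this
  only concerns end points of the intervals of integration.\<close>

definition norm_at :: "real \<Rightarrow> real \<Rightarrow> (real \<Rightarrow> real) \<Rightarrow> ennreal" where
  "norm_at \<alpha> t f = ennreal \<bar>f t\<bar> +
     (\<integral>\<^sup>+s\<in>{0..t}. ennreal (\<bar>f t - f s\<bar> * (t - s) powr (- 1 - \<alpha>)) \<partial>lborel)"

definition norm_infty :: "real \<Rightarrow> real \<Rightarrow> (real \<Rightarrow> real) \<Rightarrow> ennreal" where
  "norm_infty \<alpha> t f = (SUP s\<in>{0..t}. norm_at \<alpha> s f)"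

definition norm_two_sq :: "real \<Rightarrow> real \<Rightarrow> (real \<Rightarrow> real) \<Rightarrow> ennreal" where
  "norm_two_sq \<alpha> t f =
     (\<integral>\<^sup>+s\<in>{0..t}. (norm_at \<alpha> s f)\<^sup>2 *
        ennreal (s powr (- \<alpha>) + (t - s) powr (- \<alpha> - 1/2)) \<partial>lborel)"

definition norm_zero :: "real \<Rightarrow> real \<Rightarrow> (real \<Rightarrow> real) \<Rightarrow> ennreal" where
  "norm_zero \<alpha> t f =
     (SUP (u, v)\<in>{(u, v). 0 \<le> u \<and> u < v \<and> v < t}.
        ennreal (\<bar>f v - f u\<bar> / (v - u) powr (1 - \<alpha>)) +
        (\<integral>\<^sup>+z\<in>{u..v}. ennreal (\<bar>f u - f z\<bar> / (z - u) powr (2 - \<alpha>)) \<partial>lborel))"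

section \<open>The generalized Lebesgue-Stieltjes integral\<close>

definition frac_deriv_left :: "real \<Rightarrow> real \<Rightarrow> (real \<Rightarrow> real) \<Rightarrow> real \<Rightarrow> real" where
  "frac_deriv_left \<alpha> u f x = 1 / Gamma (1 - \<alpha>) *
     (f x / (x - u) powr \<alpha> +
      \<alpha> * (LINT y:{u<..<x}|lborel. (f x - f y) / (x - y) powr (1 + \<alpha>)))"

text \<open>The right-sided derivative below is the one of order \<open>1 - \<alpha>\<close>.\<close>

definition frac_deriv_right :: "real \<Rightarrow> real \<Rightarrow> (real \<Rightarrow> real) \<Rightarrow> real \<Rightarrow> complex" where
  "frac_deriv_right \<alpha> v g x = cis (- pi * \<alpha>) / of_real (Gamma \<alpha>) *
     of_real (g x / (v - x) powr (1 - \<alpha>) +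
      (1 - \<alpha>) * (LINT y:{x<..<v}|lborel. (g x - g y) / (y - x) powr (2 - \<alpha>)))"

definition gls_integral ::
  "real \<Rightarrow> real \<Rightarrow> real \<Rightarrow> (real \<Rightarrow> real) \<Rightarrow> (real \<Rightarrow> real) \<Rightarrow> complex" where
  "gls_integral \<alpha> u v f g = cis (pi * \<alpha>) *
     (LINT x:{u<..<v}|lborel.
        of_real (frac_deriv_left \<alpha> u f x) * frac_deriv_right \<alpha> v (\<lambda>y. g y - g v) x)"

text \<open>The first and third condition say that the fractional derivatives exist almost
  everywhere; the others that they belong to \<open>L\<^sub>1\<close> and \<open>L\<^sub>\<infinity>\<close>, respectively.\<close>

definition gls_integrable ::
  "real \<Rightarrow> real \<Rightarrow> real \<Rightarrow> (real \<Rightarrow> real) \<Rightarrow> (real \<Rightarrow> real) \<Rightarrow> bool" where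
  "gls_integrable \<alpha> u v f g \<longleftrightarrow>
     (AE x in lborel. x \<in> {u<..<v} \<longrightarrow>
        set_integrable lborel {u<..<x} (\<lambda>y. (f x - f y) / (x - y) powr (1 + \<alpha>))) \<and>
     set_integrable lborel {u<..<v} (frac_deriv_left \<alpha> u f) \<and>
     (AE x in lborel. x \<in> {u<..<v} \<longrightarrow>
        set_integrable lborel {x<..<v} (\<lambda>y. (g x - g y) / (y - x) powr (2 - \<alpha>))) \<and>
     set_borel_measurable lborel {u<..<v} (frac_deriv_right \<alpha> v (\<lambda>y. g y - g v)) \<and>
     (\<exists>B. AE x in lborel. x \<in> {u<..<v} \<longrightarrow>
        cmod (frac_deriv_right \<alpha> v (\<lambda>y. g y - g v) x) \<le> B)"

section \<open>Filtrations and processes on a bounded time interval\<close>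

text \<open>Processes and filtrations are indexed by \<open>real\<close>, but only their values at times in
  \<open>{0..T}\<close> are constrained.\<close>

definition standard_filtration :: "'a measure \<Rightarrow> (real \<Rightarrow> 'a measure) \<Rightarrow> real \<Rightarrow> bool" where
  "standard_filtration M F T \<longleftrightarrow>
     (\<forall>t\<in>{0..T}. subalgebra M (F t)) \<and>
     (\<forall>s\<in>{0..T}. \<forall>t\<in>{s..T}. sets (F s) \<subseteq> sets (F t)) \<and>
     (\<forall>t\<in>{0..<T}. sets (F t) = (\<Inter>s\<in>{t<..T}. sets (F s))) \<and>
     null_sets M \<subseteq> sets (F 0)"

definition adapted :: "(real \<Rightarrow> 'a measure) \<Rightarrow> real \<Rightarrow> (real \<Rightarrow> 'a \<Rightarrow> real) \<Rightarrow> bool" where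
  "adapted F T Y \<longleftrightarrow> (\<forall>t\<in>{0..T}. Y t \<in> borel_measurable (F t))"

definition continuous_process :: "'a measure \<Rightarrow> real \<Rightarrow> (real \<Rightarrow> 'a \<Rightarrow> real) \<Rightarrow> bool" where
  "continuous_process M T Y \<longleftrightarrow> (AE \<omega> in M. continuous_on {0..T} (\<lambda>t. Y t \<omega>))"

definition hoelder_process :: "'a measure \<Rightarrow> real \<Rightarrow> real \<Rightarrow> (real \<Rightarrow> 'a \<Rightarrow> real) \<Rightarrow> bool" where
  "hoelder_process M T \<gamma> Y \<longleftrightarrow>
     (AE \<omega> in M. \<exists>L. \<forall>s\<in>{0..T}. \<forall>t\<in>{0..T}. \<bar>Y t \<omega> - Y s \<omega>\<bar> \<le> L * \<bar>t - s\<bar> powr \<gamma>)"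

definition wiener_process ::
  "'a measure \<Rightarrow> (real \<Rightarrow> 'a measure) \<Rightarrow> real \<Rightarrow> (real \<Rightarrow> 'a \<Rightarrow> real) \<Rightarrow> bool" where
  "wiener_process M F T W \<longleftrightarrow>
     adapted F T W \<and> continuous_process M T W \<and> (AE \<omega> in M. W 0 \<omega> = 0) \<and>
     (\<forall>s\<in>{0..T}. \<forall>t\<in>{s<..T}.
        distributed M lborel (\<lambda>\<omega>. W t \<omega> - W s \<omega>) (normal_density 0 (sqrt (t - s))) \<and>
        prob_space.indep_set M (sets (F s))
          {(\<lambda>\<omega>. W t \<omega> - W s \<omega>) -` B \<inter> space M | B. B \<in> sets borel})"

text \<open>Taking \<open>inf \<emptyset> = \<infinity>\<close>, the time \<open>inf {t. \<parallel>Y\<parallel> \<ge> N} \<and> T\<close> is the infimum of the set with \<open>T\<close> added.\<close>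

definition stop_time :: "real \<Rightarrow> real \<Rightarrow> real \<Rightarrow> (real \<Rightarrow> 'a \<Rightarrow> real) \<Rightarrow> 'a \<Rightarrow> real" where
  "stop_time \<alpha> T N Y \<omega> =
     Inf (insert T {t\<in>{0..T}. norm_zero \<alpha> t (\<lambda>s. Y s \<omega>) \<ge> ennreal N})"

definition stopped :: "real \<Rightarrow> real \<Rightarrow> real \<Rightarrow> (real \<Rightarrow> 'a \<Rightarrow> real) \<Rightarrow> real \<Rightarrow> 'a \<Rightarrow> real" where
  "stopped \<alpha> T N Y t \<omega> = Y (min t (stop_time \<alpha> T N Y \<omega>)) \<omega>"

section \<open>The It\^o integral\<close>

definition simple_process ::
  "'a measure \<Rightarrow> (real \<Rightarrow> 'a measure) \<Rightarrow> real \<Rightarrow> nat \<Rightarrow> (nat \<Rightarrow> real) \<Rightarrow> (nat \<Rightarrow> 'a \<Rightarrow> real) \<Rightarrow> bool" where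
  "simple_process M F T n p \<xi> \<longleftrightarrow>
     p 0 = 0 \<and> p n = T \<and> (\<forall>i<n. p i < p (Suc i)) \<and>
     (\<forall>i<n. \<xi> i \<in> borel_measurable (F (p i)) \<and> (\<exists>B. \<forall>\<omega>\<in>space M. \<bar>\<xi> i \<omega>\<bar> \<le> B))"

definition simple_val ::
  "nat \<Rightarrow> (nat \<Rightarrow> real) \<Rightarrow> (nat \<Rightarrow> 'a \<Rightarrow> real) \<Rightarrow> real \<Rightarrow> 'a \<Rightarrow> real" where
  "simple_val n p \<xi> t \<omega> = (\<Sum>i<n. \<xi> i \<omega> * indicator {p i<..p (Suc i)} t)"

definition simple_integral ::
  "(real \<Rightarrow> 'a \<Rightarrow> real) \<Rightarrow> nat \<Rightarrow> (nat \<Rightarrow> real) \<Rightarrow> (nat \<Rightarrow> 'a \<Rightarrow> real) \<Rightarrow> real \<Rightarrow> 'a \<Rightarrow> real" where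
  "simple_integral W n p \<xi> t \<omega> =
     (\<Sum>i<n. \<xi> i \<omega> * (W (min (p (Suc i)) t) \<omega> - W (min (p i) t) \<omega>))"

definition tends_to_zero_in_prob :: "'a measure \<Rightarrow> (nat \<Rightarrow> 'a \<Rightarrow> ennreal) \<Rightarrow> bool" where
  "tends_to_zero_in_prob M Y \<longleftrightarrow>
     (\<forall>k. Y k \<in> borel_measurable M) \<and>
     (\<forall>\<epsilon>>0. (\<lambda>k. measure M {\<omega>\<in>space M. Y k \<omega> > ennreal \<epsilon>}) \<longlonglongrightarrow> 0)"

text \<open>\<open>I\<close> is (a version of) the process \<open>t \<mapsto> \<integral>\<^sub>0\<^sup>t H dW\<close> on \<open>{0..T}\<close>: the continuous adapted
  process obtained as limit in probability of the integrals of simple processes that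
  approximate \<open>H\<close> in \<open>L\<^sub>2[0,T]\<close>, in probability. By the It\^o isometry and localization,
  \<open>I\<close> is determined by \<open>H\<close> and \<open>W\<close> up to indistinguishability. The existence of the approximating
  sequence subsumes progressive measurability (up to a \<open>dt \<otimes> P\<close>-null set) and almost sure square
  integrability of \<open>H\<close>.\<close>

definition has_ito_integral ::
  "'a measure \<Rightarrow> (real \<Rightarrow> 'a measure) \<Rightarrow> real \<Rightarrow> (real \<Rightarrow> 'a \<Rightarrow> real) \<Rightarrow>
     (real \<Rightarrow> 'a \<Rightarrow> real) \<Rightarrow> (real \<Rightarrow> 'a \<Rightarrow> real) \<Rightarrow> bool" where
  "has_ito_integral M F T W H I \<longleftrightarrow>
     adapted F T H \<and> (AE \<omega> in M. set_borel_measurable lborel {0..T} (\<lambda>s. H s \<omega>)) \<and>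
     adapted F T I \<and> continuous_process M T I \<and>
     (\<exists>n p \<xi>. (\<forall>k. simple_process M F T (n k) (p k) (\<xi> k)) \<and>
        tends_to_zero_in_prob M
          (\<lambda>k \<omega>. \<integral>\<^sup>+s\<in>{0..T}. ennreal ((simple_val (n k) (p k) (\<xi> k) s \<omega> - H s \<omega>)\<^sup>2) \<partial>lborel) \<and>
        (\<forall>t\<in>{0..T}. tends_to_zero_in_prob M
          (\<lambda>k \<omega>. ennreal \<bar>simple_integral W (n k) (p k) (\<xi> k) t \<omega> - I t \<omega>\<bar>)))"

section \<open>The equation\<close>

definition coefficient_conditions ::
  "real \<Rightarrow> real \<Rightarrow> real \<Rightarrow> (real \<Rightarrow> real \<Rightarrow> real) \<Rightarrow> (real \<Rightarrow> real \<Rightarrow> real) \<Rightarrow> (real \<Rightarrow> real \<Rightarrow> real) \<Rightarrow> bool" where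
  "coefficient_conditions T \<beta> K a b c \<longleftrightarrow>
     (\<forall>t\<in>{0..T}. \<forall>x. c t field_differentiable at x) \<and>
     (\<forall>t\<in>{0..T}. \<forall>x. \<bar>a t x\<bar> + \<bar>b t x\<bar> + \<bar>c t x\<bar> \<le> K * (1 + \<bar>x\<bar>) \<and> \<bar>deriv (c t) x\<bar> \<le> K) \<and>
     (\<forall>t\<in>{0..T}. \<forall>x y.
        \<bar>a t x - a t y\<bar> + \<bar>b t x - b t y\<bar> + \<bar>deriv (c t) x - deriv (c t) y\<bar> \<le> K * \<bar>x - y\<bar>) \<and>
     (\<forall>s\<in>{0..T}. \<forall>t\<in>{0..T}. \<forall>x.
        \<bar>a s x - a t x\<bar> + \<bar>b s x - b t x\<bar> + \<bar>c s x - c t x\<bar>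
          + \<bar>deriv (c s) x - deriv (c t) x\<bar> \<le> K * \<bar>s - t\<bar> powr \<beta>)"

text \<open>The generalized Lebesgue-Stieltjes integral is complex-valued by definition, so the
  equation is read in \<open>complex\<close>.\<close>

definition sde_solution ::
  "'a measure \<Rightarrow> (real \<Rightarrow> 'a measure) \<Rightarrow> real \<Rightarrow> real \<Rightarrow> real \<Rightarrow>
     (real \<Rightarrow> real \<Rightarrow> real) \<Rightarrow> (real \<Rightarrow> real \<Rightarrow> real) \<Rightarrow> (real \<Rightarrow> real \<Rightarrow> real) \<Rightarrow>
     (real \<Rightarrow> 'a \<Rightarrow> real) \<Rightarrow> (real \<Rightarrow> 'a \<Rightarrow> real) \<Rightarrow> (real \<Rightarrow> 'a \<Rightarrow> real) \<Rightarrow> bool" where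
  "sde_solution M F T \<alpha> x0 a b c W Z X \<longleftrightarrow>
     adapted F T X \<and> continuous_process M T X \<and>
     (\<exists>I. has_ito_integral M F T W (\<lambda>s \<omega>. b s (X s \<omega>)) I \<and>
        (AE \<omega> in M. \<forall>t\<in>{0..T}.
           gls_integrable \<alpha> 0 t (\<lambda>s. c s (X s \<omega>)) (\<lambda>s. Z s \<omega>) \<and>
           complex_of_real (X t \<omega>) =
             of_real (x0 + (LINT s:{0..t}|lborel. a s (X s \<omega>)) + I t \<omega>)
             + gls_integral \<alpha> 0 t (\<lambda>s. c s (X s \<omega>)) (\<lambda>s. Z s \<omega>)))"

end

theory Submission
  imports Defs
begin

text \<open>
  Write \<open>\<Delta> = X - Xb\<close> for the difference of the two solutions, \<open>\<zeta>\<close> for the norm \<open>norm_zero\<close> of the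
  difference of the two stopped drivers, and \<open>J\<close> for the difference of the two It\^o integrals. The
  theorem is a Gronwall estimate for \<open>\<phi> t = E[(norm_at t \<Delta>)\<^sup>2; G t]\<close>, where \<open>G t\<close> is the event that
  the norms \<open>norm_at q\<close> of both solutions add up to at most \<open>R\<close> for all rational \<open>q < t\<close>
  (\<open>good_event\<close>). These events decrease with \<open>t\<close>, are adapted, and contain the event of the theorem
  up to a null set, so the localization passes inside the stochastic integral.

  \<^bold>\<open>Pathwise part.\<close> The process \<open>\<Delta> - J\<close> consists of a drift and of the generalized
  Lebesgue-Stieltjes integrals of \<open>c(X) - c(Xb)\<close> against the first driver and of \<open>c(Xb)\<close> against the
  difference of the drivers. Its \<open>norm_at\<close> requires bounds of the increments of such integrals. An
  integral over \<open>[0, t]\<close> is \<open>\<integral>\<^sub>0\<^sup>t d(x) q\<^sub>t(x) dx\<close>, in which the left-sided derivative \<open>d\<close> of the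
  integrand does not depend on \<open>t\<close>. Hence additivity over adjacent intervals, which would need an
  approximation argument, can be avoided: it suffices to bound the kernel by
  \<open>\<bar>q\<^sub>t(x)\<bar> \<le> \<Lambda>\<close> and \<open>\<bar>q\<^sub>t(x) - q\<^sub>s(x)\<bar> \<le> 3 \<Lambda> (t - s)\<^sup>1\<^sup>/\<^sup>2 (s - x)\<^sup>-\<^sup>1\<^sup>/\<^sup>2\<close>
  (\<open>right_kernel_diff_bound\<close>), where \<open>\<Lambda>\<close> bounds the norm of the driver. With the bound of \<open>d\<close> by
  \<open>r powr (- \<alpha>) * norm_at r \<Delta>\<close>, which comes from a second order difference estimate for \<open>c\<close>, this
  gives \<open>pathwise_estimate\<close>: \<open>norm_at t \<Delta>\<close> is at most \<open>norm_at t J\<close> plus a constant times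
  \<open>\<integral>\<^sub>0\<^sup>t (norm_at r \<Delta> + \<zeta>) (r powr (- \<mu>) + (t - r) powr (- \<mu>)) dr\<close>, for \<open>\<mu> = \<alpha> + 1/2 < 1\<close>.

  \<^bold>\<open>Stochastic part.\<close> The isometry, localized to the events \<open>G\<close> (\<open>ito_localized_isometry\<close>), bounds
  \<open>E[(J t - J s)\<^sup>2; G t]\<close> by a multiple of \<open>\<integral>\<^sub>s\<^sup>t \<phi>\<close>. After the Cauchy-Schwarz inequality,
  \<open>E[(norm_at t J)\<^sup>2; G t]\<close> is at most a multiple of the integral of \<open>\<phi>\<close> against the same kernel
  (\<open>ito_norm_estimate\<close>).

  \<^bold>\<open>Conclusion.\<close> Squaring the pathwise estimate leaves \<open>\<zeta>\<^sup>2\<close>. Stopping bounds the norm of each driver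
  by \<open>4 N\<close> (\<open>norm_zero_stopped_le\<close>), so \<open>\<zeta>\<^sup>2 \<le> 8 N \<zeta>\<close>; this is why the first power of \<open>\<zeta>\<close>
  suffices on the right-hand side. Altogether \<open>\<phi>\<close> is bounded by a constant times \<open>E[\<zeta>]\<close> plus its own
  integral against an integrable kernel, and \<open>\<phi> \<le> R\<^sup>2\<close>, so the Gronwall lemma \<open>singular_gronwall\<close>
  applies. Integrating \<open>\<phi>\<close> against the weight of \<open>norm_two_sq\<close> gives the theorem.

  Expectations are integrals with values in \<open>[0, \<infinity>]\<close>, which are additive for measurable functions
  only. Therefore all processes are replaced by indistinguishable ones all of whose paths are
  continuous, and the norms are shown to be measurable by lower semicontinuity.
\<close>

section \<open>Integrals of power kernels\<close>

lemma powr_neg_exponent_mono: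
  fixes a b x T :: real
  assumes "0 < x" "x \<le> T" "a \<le> b"
  shows "x powr (-a) \<le> T powr (b - a) * x powr (-b)"
proof -
  have "x powr (-a) = x powr (b - a) * x powr (-b)"
    using assms by (simp add: powr_add[symmetric])
  also have "\<dots> \<le> T powr (b - a) * x powr (-b)"
    using assms by (intro mult_right_mono powr_mono2) auto
  finally show ?thesis .
qed

text \<open>The smaller of the two bases can carry the whole exponent.\<close>

lemma powr_neg_mult_le_add:
  fixes x y p q :: real
  assumes "0 < x" "0 < y" "0 \<le> p" "0 \<le> q"
  shows "x powr (-p) * y powr (-q) \<le> x powr (-(p+q)) + y powr (-(p+q))"
proof (cases "x \<le> y")
  case True
  then have "y powr (-q) \<le> x powr (-q)"
    using assms by (intro powr_mono2') auto
  then have "x powr (-p) * y powr (-q) \<le> x powr (-p) * x powr (-q)"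
    by (intro mult_left_mono) auto
  also have "\<dots> = x powr (-(p+q))" by (simp add: powr_add[symmetric])
  finally show ?thesis by (simp add: add_increasing2)
next
  case False
  then have "x powr (-p) \<le> y powr (-p)"
    using assms by (intro powr_mono2') auto
  then have "x powr (-p) * y powr (-q) \<le> y powr (-p) * y powr (-q)"
    by (intro mult_right_mono) auto
  also have "\<dots> = y powr (-(p+q))" by (simp add: powr_add[symmetric])
  finally show ?thesis by (simp add: add_increasing)
qed

lemma nn_integral_powr_left:
  fixes a b p :: real
  assumes "a \<le> b" "p < 1"
  shows "(\<integral>\<^sup>+u\<in>{a..b}. ennreal ((u - a) powr (-p)) \<partial>lborel) = ennreal ((b - a) powr (1 - p) / (1 - p))"
proof -
  have "((\<lambda>x::real. x powr (-p)) has_integral ((b-a) powr (-p+1) / (-p+1))) {0..b-a}"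
    using assms by (intro has_integral_powr_from_0) auto
  then have "(\<integral>\<^sup>+u. ennreal (u powr (-p)) * indicator {0..b-a} u \<partial>lborel) = ennreal ((b - a) powr (1 - p) / (1 - p))"
    by (subst nn_integral_has_integral_lebesgue'[where I="(b - a) powr (1 - p) / (1 - p)"])
      (auto intro!: nn_integral_cong split: split_indicator)
  moreover have "(\<integral>\<^sup>+u\<in>{a..b}. ennreal ((u - a) powr (-p)) \<partial>lborel)
      = (\<integral>\<^sup>+u. ennreal (u powr (-p)) * indicator {0..b-a} u \<partial>lborel)"
    by (subst nn_integral_real_affine[where c=1 and t="a"])
      (auto intro!: nn_integral_cong split: split_indicator)
  ultimately show ?thesis by simp
qed

lemma nn_integral_powr_right:
  fixes a b p :: real
  assumes "a \<le> b" "p < 1"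
  shows "(\<integral>\<^sup>+u\<in>{a..b}. ennreal ((b - u) powr (-p)) \<partial>lborel) = ennreal ((b - a) powr (1 - p) / (1 - p))"
proof -
  have "(\<integral>\<^sup>+u\<in>{a..b}. ennreal ((b - u) powr (-p)) \<partial>lborel)
      = (\<integral>\<^sup>+u\<in>{a..b}. ennreal ((u - a) powr (-p)) \<partial>lborel)"
    by (subst nn_integral_real_affine[where c="-1" and t="a+b"])
      (auto intro!: nn_integral_cong split: split_indicator)
  then show ?thesis using nn_integral_powr_left[OF assms] by simp
qed

lemma nn_integral_powr_tail:
  fixes a u t p :: real
  assumes "a \<le> u" "u < t" "0 < p"
  shows "(\<integral>\<^sup>+s\<in>{a..u}. ennreal ((t - s) powr (-1 - p)) \<partial>lborel) \<le> ennreal ((t - u) powr (-p) / p)"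
proof -
  have "(\<integral>\<^sup>+s. ennreal ((t - s) powr (-1 - p)) * indicator {a..u} s \<partial>lborel)
     = ennreal ((t - u) powr (-p) / p - (t - a) powr (-p) / p)"
  proof (rule nn_integral_FTC_Icc)
    fix s assume s: "s \<in> {a..u}"
    have e: "- p - 1 = - 1 - p" by simp
    show "((\<lambda>s. (t - s) powr (-p) / p) has_real_derivative (t - s) powr (-1 - p)) (at s)"
      using s assms by (auto intro!: derivative_eq_intros simp: e)
  qed (use assms in auto)
  also have "\<dots> \<le> ennreal ((t - u) powr (-p) / p)"
    using assms by (intro ennreal_leI) auto
  finally show ?thesis .
qed

lemma nn_integral_powr_head:
  fixes x s t p :: real
  assumes "x < s" "s \<le> t" "0 < p"
  shows "(\<integral>\<^sup>+y\<in>{s..t}. ennreal ((y - x) powr (-1 - p)) \<partial>lborel) \<le> ennreal ((s - x) powr (-p) / p)"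
proof -
  have "(\<integral>\<^sup>+y\<in>{s..t}. ennreal ((y - x) powr (-1 - p)) \<partial>lborel)
     = (\<integral>\<^sup>+y\<in>{-t..-s}. ennreal ((-x - y) powr (-1 - p)) \<partial>lborel)"
    by (subst nn_integral_real_affine[where c="-1" and t="0"])
      (auto intro!: nn_integral_cong split: split_indicator)
  also have "\<dots> \<le> ennreal ((-x - (-s)) powr (-p) / p)"
    using assms by (intro nn_integral_powr_tail) auto
  finally show ?thesis by simp
qed

text \<open>Split the interval at its midpoint: on either half one of the two factors is bounded. The
  exponent on the right-hand side is dictated by scaling.\<close>

lemma nn_integral_powr_beta:
  fixes r t p :: real
  assumes "r < t" "1/2 \<le> p" "p < 1"
  shows "(\<integral>\<^sup>+s\<in>{r..t}. ennreal ((t - s) powr (-p) * (s - r) powr (-(1/2))) \<partial>lborel)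
    \<le> ennreal (6 / (1 - p) * (t - r) powr (-(p - 1/2)))"
proof -
  define L where "L = t - r"
  have L: "L > 0" using assms by (simp add: L_def)
  have pt: "(t - s) powr (-p) * (s - r) powr (-(1/2))
     \<le> (L/2) powr (-p) * (s - r) powr (-(1/2)) + (L/2) powr (-(1/2)) * (t - s) powr (-p)"
    if s: "s \<in> {r..t}" for s
  proof (cases "s \<le> (r + t)/2")
    case True
    then have "(t - s) powr (-p) \<le> (L/2) powr (-p)"
      using assms L by (intro powr_mono2') (auto simp: L_def field_simps)
    then show ?thesis by (intro add_increasing2 mult_right_mono) auto
  next
    case False
    then have "(s - r) powr (-(1/2)) \<le> (L/2) powr (-(1/2))"
      using assms L by (intro powr_mono2') (auto simp: L_def field_simps)
    then have "(t - s) powr (-p) * (s - r) powr (-(1/2)) \<le> (L/2) powr (-(1/2)) * (t - s) powr (-p)"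
      by (subst mult.commute) (intro mult_right_mono, auto)
    then show ?thesis by (intro add_increasing) auto
  qed
  have "(\<integral>\<^sup>+s\<in>{r..t}. ennreal ((t - s) powr (-p) * (s - r) powr (-(1/2))) \<partial>lborel)
     \<le> (\<integral>\<^sup>+s. ennreal ((L/2) powr (-p)) * (ennreal ((s - r) powr (-(1/2))) * indicator {r..t} s)
         + ennreal ((L/2) powr (-(1/2))) * (ennreal ((t - s) powr (-p)) * indicator {r..t} s) \<partial>lborel)"
    using pt by (intro nn_integral_mono)
      (auto split: split_indicator simp flip: ennreal_mult ennreal_plus intro!: ennreal_leI)
  also have "\<dots> = ennreal ((L/2) powr (-p)) * ennreal (L powr (1 - 1/2) / (1 - 1/2))
      + ennreal ((L/2) powr (-(1/2))) * ennreal (L powr (1 - p) / (1 - p))"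
    using assms nn_integral_powr_left[of r t "1/2"] nn_integral_powr_right[of r t p]
    by (subst nn_integral_add, measurable) (simp add: nn_integral_cmult L_def)
  also have "\<dots> = ennreal ((L/2) powr (-p) * (L powr (1/2) * 2) + (L/2) powr (-(1/2)) * (L powr (1 - p) / (1 - p)))"
    using assms by (simp add: ennreal_mult[symmetric] ennreal_plus[symmetric] del: ennreal_plus)
  also have "\<dots> \<le> ennreal (6 / (1 - p) * L powr (-(p - 1/2)))"
  proof (rule ennreal_leI)
    have 1: "(L/2) powr (-p) = 2 powr p * L powr (-p)"
      using L by (simp add: powr_divide powr_minus field_simps)
    have 2: "(L/2) powr (-(1/2)) = 2 powr (1/2) * L powr (-(1/2))"
      using L by (simp add: powr_divide powr_minus field_simps)
    have e1: "L powr (-p) * L powr (1/2) = L powr (-(p - 1/2))" by (simp add: powr_add[symmetric])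
    have e2: "L powr (-(1/2)) * L powr (1 - p) = L powr (-(p - 1/2))" by (simp add: powr_add[symmetric])
    have b1: "(2::real) powr p \<le> 2 powr 1" using assms by (intro powr_mono) auto
    have b2: "(2::real) powr (1/2) \<le> 2 powr 1" by (intro powr_mono) auto
    have b3: "4 \<le> 4 / (1 - p)" using assms by (simp add: field_simps)
    have "(L/2) powr (-p) * (L powr (1/2) * 2) + (L/2) powr (-(1/2)) * (L powr (1 - p) / (1 - p))
      = (2 powr p * 2) * (L powr (-p) * L powr (1/2)) + (2 powr (1/2) / (1 - p)) * (L powr (-(1/2)) * L powr (1 - p))"
      unfolding 1 2 by (simp add: field_simps)
    also have "\<dots> = (2 powr p * 2 + 2 powr (1/2) / (1 - p)) * L powr (-(p - 1/2))"
      unfolding e1 e2 by (simp add: algebra_simps)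
    also have "\<dots> \<le> (4 + 2 / (1 - p)) * L powr (-(p - 1/2))"
      using b1 b2 assms by (intro mult_right_mono add_mono divide_right_mono) auto
    also have "\<dots> \<le> (4 / (1 - p) + 2 / (1 - p)) * L powr (-(p - 1/2))"
      using b3 by (intro mult_right_mono add_mono) auto
    finally show "(L/2) powr (-p) * (L powr (1/2) * 2) + (L/2) powr (-(1/2)) * (L powr (1 - p) / (1 - p))
      \<le> 6 / (1 - p) * L powr (-(p - 1/2))" by (simp add: add_divide_distrib[symmetric])
  qed
  finally show ?thesis by (simp add: L_def)
qed

section \<open>Paths whose increments are bounded by a density\<close>

text \<open>This is the form in which the increments of the drift and of a generalized
  Lebesgue-Stieltjes integral are bounded. The weight in the second integral accounts for the
  change of the kernel on \<open>[0, s]\<close> when the upper end of the integral moves from \<open>s\<close> to \<open>t\<close>.\<close>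

definition incr_bound :: "real \<Rightarrow> (real \<Rightarrow> real) \<Rightarrow> (real \<Rightarrow> ennreal) \<Rightarrow> bool" where
  "incr_bound t P m \<longleftrightarrow> m \<in> borel_measurable borel \<and>
     ennreal \<bar>P t\<bar> \<le> (\<integral>\<^sup>+r\<in>{0..t}. m r \<partial>lborel) \<and>
     (\<forall>s\<in>{0..<t}. ennreal \<bar>P t - P s\<bar> \<le> (\<integral>\<^sup>+r\<in>{s..t}. m r \<partial>lborel) +
        (\<integral>\<^sup>+r\<in>{0..s}. m r * ennreal (3 * (t - s) powr (1/2) * (s - r) powr (-(1/2))) \<partial>lborel))"

lemma incr_bound_add:
  assumes "incr_bound t P m" "incr_bound t Q n"
  shows "incr_bound t (\<lambda>s. P s + Q s) (\<lambda>r. m r + n r)"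
proof -
  have [measurable]: "m \<in> borel_measurable borel" "n \<in> borel_measurable borel"
    using assms by (auto simp: incr_bound_def)
  have tri: "ennreal \<bar>x + y\<bar> \<le> ennreal \<bar>x\<bar> + ennreal \<bar>y\<bar>" for x y :: real
    by (subst ennreal_plus[symmetric]) (auto intro!: ennreal_leI simp del: ennreal_plus)
  have 1: "ennreal \<bar>P t + Q t\<bar> \<le> (\<integral>\<^sup>+r\<in>{0..t}. (m r + n r) \<partial>lborel)"
    using assms order_trans[OF tri add_mono] unfolding incr_bound_def
    by (simp add: distrib_right nn_integral_add)
  have 2: "ennreal \<bar>(P t + Q t) - (P s + Q s)\<bar> \<le> (\<integral>\<^sup>+r\<in>{s..t}. (m r + n r) \<partial>lborel) +
        (\<integral>\<^sup>+r\<in>{0..s}. (m r + n r) * ennreal (3 * (t - s) powr (1/2) * (s - r) powr (-(1/2))) \<partial>lborel)"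
    (is "_ \<le> ?R")
    if s: "s \<in> {0..<t}" for s
  proof -
    have "ennreal \<bar>(P t + Q t) - (P s + Q s)\<bar> = ennreal \<bar>(P t - P s) + (Q t - Q s)\<bar>"
      by (simp add: algebra_simps)
    also have "\<dots> \<le> ennreal \<bar>P t - P s\<bar> + ennreal \<bar>Q t - Q s\<bar>" by (rule tri)
    also have "\<dots> \<le> ((\<integral>\<^sup>+r\<in>{s..t}. m r \<partial>lborel) +
        (\<integral>\<^sup>+r\<in>{0..s}. m r * ennreal (3 * (t - s) powr (1/2) * (s - r) powr (-(1/2))) \<partial>lborel)) +
      ((\<integral>\<^sup>+r\<in>{s..t}. n r \<partial>lborel) +
        (\<integral>\<^sup>+r\<in>{0..s}. n r * ennreal (3 * (t - s) powr (1/2) * (s - r) powr (-(1/2))) \<partial>lborel))"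
      using assms s unfolding incr_bound_def by (intro add_mono) blast+
    also have "\<dots> = ?R"
      by (simp add: distrib_right nn_integral_add algebra_simps)
    finally show ?thesis .
  qed
  show ?thesis using 1 2 unfolding incr_bound_def by auto
qed

text \<open>Exchange the integrations over \<open>s\<close> and \<open>r\<close>. The weight that \<open>m r\<close> receives is
  \<open>\<integral>\<^sub>0\<^sup>r (t - s) powr (- 1 - \<alpha>) ds + 3 \<integral>\<^sub>r\<^sup>t (t - s) powr (- 1/2 - \<alpha>) (s - r) powr (- 1/2) ds\<close>, and
  both integrals are multiples of \<open>(t - r) powr (- \<alpha>)\<close>. The second one converges because
  \<open>\<alpha> < 1/2\<close>.\<close>

lemma norm_at_le_of_incr_bound:
  assumes \<alpha>: "0 < \<alpha>" "\<alpha> < 1/2" and t: "0 < t" and P: "incr_bound t P m"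
  shows "norm_at \<alpha> t P \<le> (\<integral>\<^sup>+r\<in>{0..t}. m r * ennreal (1 + (1/\<alpha> + 18/(1/2 - \<alpha>)) * (t - r) powr (-\<alpha>)) \<partial>lborel)"
proof -
  have [measurable]: "m \<in> borel_measurable borel" using P by (auto simp: incr_bound_def)
  define k where "k s r = indicator {(s,r). 0 \<le> s \<and> s \<le> r \<and> r \<le> t} (s,r) * ennreal ((t - s) powr (-1 - \<alpha>))
     + indicator {(s,r). 0 \<le> r \<and> r \<le> s \<and> s \<le> t} (s,r) * ennreal (3 * ((t - s) powr (-(1/2 + \<alpha>)) * (s - r) powr (-(1/2))))"
    for s r :: real
  have [measurable]: "(\<lambda>(s,r). k s r) \<in> borel_measurable (borel \<Otimes>\<^sub>M borel)"
    unfolding k_def by measurable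
  have step: "ennreal (\<bar>P t - P s\<bar> * (t - s) powr (-1 - \<alpha>)) * indicator {0..t} s \<le> (\<integral>\<^sup>+r. m r * k s r \<partial>lborel)"
    for s
  proof (cases "s \<in> {0..<t}")
    case True
    have "ennreal \<bar>P t - P s\<bar> * ennreal ((t - s) powr (-1 - \<alpha>))
      \<le> ((\<integral>\<^sup>+r\<in>{s..t}. m r \<partial>lborel) +
        (\<integral>\<^sup>+r\<in>{0..s}. m r * ennreal (3 * (t - s) powr (1/2) * (s - r) powr (-(1/2))) \<partial>lborel))
         * ennreal ((t - s) powr (-1 - \<alpha>))"
      using P True unfolding incr_bound_def by (intro mult_right_mono) auto
    also have "\<dots> = (\<integral>\<^sup>+r. m r * indicator {s..t} r * ennreal ((t - s) powr (-1 - \<alpha>)) \<partial>lborel) +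
        (\<integral>\<^sup>+r. m r * ennreal (3 * (t - s) powr (1/2) * (s - r) powr (-(1/2))) * indicator {0..s} r
           * ennreal ((t - s) powr (-1 - \<alpha>)) \<partial>lborel)"
      by (simp add: distrib_right nn_integral_multc)
    also have "\<dots> = (\<integral>\<^sup>+r. m r * indicator {s..t} r * ennreal ((t - s) powr (-1 - \<alpha>)) +
        m r * ennreal (3 * (t - s) powr (1/2) * (s - r) powr (-(1/2))) * indicator {0..s} r
           * ennreal ((t - s) powr (-1 - \<alpha>)) \<partial>lborel)"
      by (subst nn_integral_add) auto
    also have "\<dots> = (\<integral>\<^sup>+r. m r * k s r \<partial>lborel)"
    proof (intro nn_integral_cong)
      fix r
      have e: "(t - s) powr (1/2) * (t - s) powr (-1 - \<alpha>) = (t - s) powr (-(1/2 + \<alpha>))"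
        by (simp add: powr_add[symmetric])
      have e2: "ennreal (3 * (t - s) powr (1/2) * (s - r) powr (-(1/2))) * ennreal ((t - s) powr (-1 - \<alpha>))
        = ennreal (3 * ((t - s) powr (-(1/2 + \<alpha>)) * (s - r) powr (-(1/2))))"
        unfolding e[symmetric] by (simp add: ennreal_mult[symmetric] algebra_simps)
      show "m r * indicator {s..t} r * ennreal ((t - s) powr (-1 - \<alpha>)) +
        m r * ennreal (3 * (t - s) powr (1/2) * (s - r) powr (-(1/2))) * indicator {0..s} r
           * ennreal ((t - s) powr (-1 - \<alpha>)) = m r * k s r"
        using True e2 unfolding k_def
        by (auto split: split_indicator simp: distrib_left mult.assoc)
    qed
    finally show ?thesis using True by (simp add: ennreal_mult)
  qed (auto split: split_indicator)
  have ks: "(\<integral>\<^sup>+s. k s r \<partial>lborel) \<le> ennreal ((1/\<alpha> + 18/(1/2 - \<alpha>)) * (t - r) powr (-\<alpha>)) * indicator {0..t} r"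
    if "r \<noteq> t" for r
  proof (cases "0 \<le> r \<and> r < t")
    case True
    have "(\<integral>\<^sup>+s. k s r \<partial>lborel) = (\<integral>\<^sup>+s\<in>{0..r}. ennreal ((t - s) powr (-1 - \<alpha>)) \<partial>lborel)
       + 3 * (\<integral>\<^sup>+s\<in>{r..t}. ennreal ((t - s) powr (-(1/2 + \<alpha>)) * (s - r) powr (-(1/2))) \<partial>lborel)"
      using True by (subst nn_integral_cmult[symmetric], simp, subst nn_integral_add[symmetric], simp, simp)
        (auto intro!: nn_integral_cong split: split_indicator simp: k_def ennreal_mult)
    also have "\<dots> \<le> ennreal ((t - r) powr (-\<alpha>) / \<alpha>) + 3 * ennreal (6 / (1 - (1/2 + \<alpha>)) * (t - r) powr (-(1/2 + \<alpha> - 1/2)))"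
      using True \<alpha> by (intro add_mono mult_left_mono nn_integral_powr_tail nn_integral_powr_beta) auto
    also have "\<dots> = ennreal ((1/\<alpha> + 18/(1/2 - \<alpha>)) * (t - r) powr (-\<alpha>))"
      using \<alpha> by (subst ennreal_numeral[symmetric], subst ennreal_mult[symmetric], simp, simp,
          subst ennreal_plus[symmetric]) (auto simp: field_simps)
    finally show ?thesis using True by simp
  next
    case False
    then have "k s r = 0" for s using that by (auto simp: k_def split: split_indicator)
    then show ?thesis by simp
  qed
  have "(\<integral>\<^sup>+s\<in>{0..t}. ennreal (\<bar>P t - P s\<bar> * (t - s) powr (-1 - \<alpha>)) \<partial>lborel)
     \<le> (\<integral>\<^sup>+s. (\<integral>\<^sup>+r. m r * k s r \<partial>lborel) \<partial>lborel)"
    by (intro nn_integral_mono step)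
  also have "\<dots> = (\<integral>\<^sup>+r. (\<integral>\<^sup>+s. m r * k s r \<partial>lborel) \<partial>lborel)"
    by (rule lborel_pair.Fubini') measurable
  also have "\<dots> = (\<integral>\<^sup>+r. m r * (\<integral>\<^sup>+s. k s r \<partial>lborel) \<partial>lborel)"
    by (subst nn_integral_cmult) auto
  also have "\<dots> \<le> (\<integral>\<^sup>+r. m r * (ennreal ((1/\<alpha> + 18/(1/2 - \<alpha>)) * (t - r) powr (-\<alpha>)) * indicator {0..t} r) \<partial>lborel)"
    by (intro nn_integral_mono_AE) (use AE_lborel_singleton[of t] in \<open>eventually_elim; auto intro!: mult_left_mono ks\<close>)
  finally have "norm_at \<alpha> t P \<le> (\<integral>\<^sup>+r\<in>{0..t}. m r \<partial>lborel) +
     (\<integral>\<^sup>+r. m r * (ennreal ((1/\<alpha> + 18/(1/2 - \<alpha>)) * (t - r) powr (-\<alpha>)) * indicator {0..t} r) \<partial>lborel)"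
    using P unfolding norm_at_def incr_bound_def by (intro add_mono) auto
  also have "\<dots> = (\<integral>\<^sup>+r\<in>{0..t}. m r * ennreal (1 + (1/\<alpha> + 18/(1/2 - \<alpha>)) * (t - r) powr (-\<alpha>)) \<partial>lborel)"
    using \<alpha> by (subst nn_integral_add[symmetric], simp, simp)
      (auto intro!: nn_integral_cong split: split_indicator simp: distrib_left)
  finally show ?thesis .
qed

lemma incr_bound_integral:
  assumes "t \<le> T" and a: "set_integrable lborel {0..T} a"
    and m: "m \<in> borel_measurable borel" "\<And>r. r \<in> {0..T} \<Longrightarrow> ennreal \<bar>a r\<bar> \<le> m r"
  shows "incr_bound t (\<lambda>t. LINT r:{0..t}|lborel. a r) m"
proof -
  have int: "set_integrable lborel A a" if "A \<subseteq> {0..T}" "A \<in> sets borel" for A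
    using set_integrable_subset[OF a] that by auto
  have bnd: "ennreal \<bar>LINT r:A|lborel. a r\<bar> \<le> (\<integral>\<^sup>+r\<in>A. m r \<partial>lborel)" if "A \<subseteq> {0..T}" "A \<in> sets borel" for A
  proof -
    have "ennreal \<bar>LINT r:A|lborel. a r\<bar> \<le> (\<integral>\<^sup>+r. ennreal (norm (indicator A r *\<^sub>R a r)) \<partial>lborel)"
      using int[OF that] integral_norm_bound_ennreal[of lborel "\<lambda>r. indicator A r *\<^sub>R a r"]
      unfolding set_integrable_def set_lebesgue_integral_def by simp
    also have "\<dots> \<le> (\<integral>\<^sup>+r\<in>A. m r \<partial>lborel)"
      using m(2) that by (intro nn_integral_mono) (auto split: split_indicator)
    finally show ?thesis .
  qed
  show ?thesis unfolding incr_bound_def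
  proof (intro conjI ballI)
    show "ennreal \<bar>LINT r:{0..t}|lborel. a r\<bar> \<le> (\<integral>\<^sup>+r\<in>{0..t}. m r \<partial>lborel)"
      using assms(1) by (intro bnd) auto
    fix s assume s: "s \<in> {0..<t}"
    have "{0..t} = {0..s} \<union> {s<..t}" using s by auto
    moreover have "(LINT r:{0..s} \<union> {s<..t}|lborel. a r) = (LINT r:{0..s}|lborel. a r) + (LINT r:{s<..t}|lborel. a r)"
      using s assms(1) by (intro set_integral_Un int) auto
    ultimately have "(LINT r:{0..t}|lborel. a r) - (LINT r:{0..s}|lborel. a r) = (LINT r:{s<..t}|lborel. a r)" by simp
    then have "ennreal \<bar>(LINT r:{0..t}|lborel. a r) - (LINT r:{0..s}|lborel. a r)\<bar> \<le> (\<integral>\<^sup>+r\<in>{s<..t}. m r \<partial>lborel)"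
      using s assms(1) bnd[of "{s<..t}"] by (auto simp: subset_eq)
    also have "\<dots> \<le> (\<integral>\<^sup>+r\<in>{s..t}. m r \<partial>lborel)"
      by (intro nn_integral_mono) (auto split: split_indicator)
    also have "\<dots> \<le> (\<integral>\<^sup>+r\<in>{s..t}. m r \<partial>lborel) +
        (\<integral>\<^sup>+r\<in>{0..s}. m r * ennreal (3 * (t - s) powr (1/2) * (s - r) powr (-(1/2))) \<partial>lborel)" by simp
    finally show "ennreal \<bar>(LINT r:{0..t}|lborel. a r) - (LINT r:{0..s}|lborel. a r)\<bar> \<le> \<dots>" .
  qed fact
qed

section \<open>The kernels of the generalized Lebesgue-Stieltjes integral\<close>

text \<open>Up to a constant factor, this is the right-sided fractional derivative of order \<open>1 - \<alpha>\<close> of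
  \<open>g - g t\<close>; likewise \<open>left_kernel\<close> is the left-sided one of order \<open>\<alpha>\<close> on intervals that start
  at \<open>0\<close>.\<close>

definition right_kernel :: "real \<Rightarrow> (real \<Rightarrow> real) \<Rightarrow> real \<Rightarrow> real \<Rightarrow> real" where
  "right_kernel \<alpha> g t x = (g x - g t) / (t - x) powr (1 - \<alpha>) +
     (1 - \<alpha>) * (LINT y:{x<..<t}|lborel. (g x - g y) / (y - x) powr (2 - \<alpha>))"

definition left_kernel :: "real \<Rightarrow> (real \<Rightarrow> real) \<Rightarrow> real \<Rightarrow> real" where
  "left_kernel \<alpha> f x = f x / x powr \<alpha> + \<alpha> * (LINT y:{0<..<x}|lborel. (f x - f y) / (x - y) powr (1 + \<alpha>))"

definition zero_term :: "real \<Rightarrow> (real \<Rightarrow> real) \<Rightarrow> real \<Rightarrow> real \<Rightarrow> ennreal" where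
  "zero_term \<alpha> f u v = ennreal (\<bar>f v - f u\<bar> / (v - u) powr (1 - \<alpha>)) +
        (\<integral>\<^sup>+z\<in>{u..v}. ennreal (\<bar>f u - f z\<bar> / (z - u) powr (2 - \<alpha>)) \<partial>lborel)"

lemma norm_zero_eq: "norm_zero \<alpha> t f = (SUP (u, v)\<in>{(u, v). 0 \<le> u \<and> u < v \<and> v < t}. zero_term \<alpha> f u v)"
  by (simp add: norm_zero_def zero_term_def)

lemma norm_zero_leI:
  assumes "\<And>u v. 0 \<le> u \<Longrightarrow> u < v \<Longrightarrow> v < t \<Longrightarrow> zero_term \<alpha> f u v \<le> C"
  shows "norm_zero \<alpha> t f \<le> C"
  unfolding norm_zero_eq using assms by (intro SUP_least) auto

lemma zero_term_le_norm_zero: "0 \<le> u \<Longrightarrow> u < v \<Longrightarrow> v < t \<Longrightarrow> zero_term \<alpha> f u v \<le> norm_zero \<alpha> t f"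
  unfolding norm_zero_eq by (intro SUP_upper2[of "(u,v)"]) auto

lemma norm_zero_hoelder:
  assumes "norm_zero \<alpha> T g \<le> ennreal \<Lambda>" "0 \<le> \<Lambda>" "0 \<le> u" "u \<le> v" "v < T"
  shows "\<bar>g v - g u\<bar> \<le> \<Lambda> * (v - u) powr (1 - \<alpha>)"
proof (cases "u = v")
  case False
  then have "u < v" using assms by simp
  have "ennreal (\<bar>g v - g u\<bar> / (v - u) powr (1 - \<alpha>)) \<le> ennreal \<Lambda>"
    using order_trans[OF add_increasing2[OF zero_le order_refl] order_trans[OF zero_term_le_norm_zero[unfolded zero_term_def, OF assms(3) \<open>u < v\<close> assms(5)] assms(1)]] .
  then show ?thesis using \<open>u < v\<close> assms(2) by (simp add: field_simps)
qed simp

lemma norm_zero_set_integrable: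
  assumes "norm_zero \<alpha> T g \<le> ennreal \<Lambda>" and g [measurable]: "g \<in> borel_measurable borel"
    and "0 \<le> u" "u < v" "v < T"
  shows "set_integrable lborel {u<..<v} (\<lambda>y. (g u - g y) / (y - u) powr (2 - \<alpha>))"
proof -
  have "(\<integral>\<^sup>+z\<in>{u..v}. ennreal (\<bar>g u - g z\<bar> / (z - u) powr (2 - \<alpha>)) \<partial>lborel) \<le> ennreal \<Lambda>"
    using order_trans[OF add_increasing[OF zero_le order_refl] order_trans[OF zero_term_le_norm_zero[unfolded zero_term_def, OF assms(3-5)] assms(1)]] .
  moreover have "(\<integral>\<^sup>+z. ennreal (norm (indicator {u<..<v} z *\<^sub>R ((g u - g z) / (z - u) powr (2 - \<alpha>)))) \<partial>lborel)
     \<le> (\<integral>\<^sup>+z\<in>{u..v}. ennreal (\<bar>g u - g z\<bar> / (z - u) powr (2 - \<alpha>)) \<partial>lborel)"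
    by (intro nn_integral_mono) (auto split: split_indicator)
  ultimately show ?thesis unfolding set_integrable_def
    by (intro integrableI_bounded) (auto simp: le_less_trans[OF order_trans ennreal_less_top])
qed

lemma right_kernel_bound:
  assumes \<alpha>: "0 < \<alpha>" "\<alpha> < 1" and \<Lambda>: "norm_zero \<alpha> T g \<le> ennreal \<Lambda>" "0 \<le> \<Lambda>"
    and g [measurable]: "g \<in> borel_measurable borel" and "0 \<le> x" "x < t" "t < T"
  shows "\<bar>right_kernel \<alpha> g t x\<bar> \<le> \<Lambda>"
proof -
  let ?F = "\<lambda>y. (g x - g y) / (y - x) powr (2 - \<alpha>)"
  note int = norm_zero_set_integrable[OF \<Lambda>(1) g assms(6-8)]
  have "ennreal \<bar>LINT y:{x<..<t}|lborel. ?F y\<bar> \<le> (\<integral>\<^sup>+y. ennreal (norm (indicator {x<..<t} y *\<^sub>R ?F y)) \<partial>lborel)"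
    using int integral_norm_bound_ennreal[of lborel "\<lambda>y. indicator {x<..<t} y *\<^sub>R ?F y"]
    unfolding set_integrable_def set_lebesgue_integral_def by simp
  also have "\<dots> \<le> (\<integral>\<^sup>+z\<in>{x..t}. ennreal (\<bar>g x - g z\<bar> / (z - x) powr (2 - \<alpha>)) \<partial>lborel)"
    by (intro nn_integral_mono) (auto split: split_indicator)
  finally have "ennreal (\<bar>g t - g x\<bar> / (t - x) powr (1 - \<alpha>)) + ennreal \<bar>LINT y:{x<..<t}|lborel. ?F y\<bar> \<le> ennreal \<Lambda>"
    using order_trans[OF add_left_mono order_trans[OF zero_term_le_norm_zero[unfolded zero_term_def, OF assms(6-8)] \<Lambda>(1)]] by blast
  then have 1: "\<bar>g t - g x\<bar> / (t - x) powr (1 - \<alpha>) + \<bar>LINT y:{x<..<t}|lborel. ?F y\<bar> \<le> \<Lambda>"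
    using \<Lambda>(2) by (simp flip: ennreal_plus)
  have "\<bar>(1 - \<alpha>) * (LINT y:{x<..<t}|lborel. ?F y)\<bar> \<le> 1 * \<bar>LINT y:{x<..<t}|lborel. ?F y\<bar>"
    unfolding abs_mult using \<alpha> by (intro mult_right_mono) auto
  moreover have "\<bar>(g x - g t) / (t - x) powr (1 - \<alpha>)\<bar> = \<bar>g t - g x\<bar> / (t - x) powr (1 - \<alpha>)"
    by (simp add: abs_minus_commute)
  ultimately show ?thesis using 1 unfolding right_kernel_def by linarith
qed

text \<open>Only the values of \<open>g\<close> on \<open>[s, t]\<close> matter: as
  \<open>(1 - \<alpha>) \<integral>\<^sub>s\<^sup>t (y - x) powr (\<alpha> - 2) dy = (s - x) powr (\<alpha> - 1) - (t - x) powr (\<alpha> - 1)\<close>, all terms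
  with \<open>g x\<close> cancel.\<close>

lemma right_kernel_diff_eq:
  assumes \<alpha>: "0 < \<alpha>" "\<alpha> < 1" and \<Lambda>: "norm_zero \<alpha> T g \<le> ennreal \<Lambda>" "0 \<le> \<Lambda>"
    and g [measurable]: "g \<in> borel_measurable borel" and x: "0 \<le> x" "x < s" "s < t" "t < T"
  shows "right_kernel \<alpha> g t x - right_kernel \<alpha> g s x = (g s - g t) / (t - x) powr (1 - \<alpha>) +
     (1 - \<alpha>) * (LINT y:{s<..<t}|lborel. (g s - g y) / (y - x) powr (2 - \<alpha>))"
    and "set_integrable lborel {s<..<t} (\<lambda>y. (g s - g y) / (y - x) powr (2 - \<alpha>))"
proof -
  let ?F = "\<lambda>y. (g x - g y) / (y - x) powr (2 - \<alpha>)"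
  let ?w = "\<lambda>y. 1 / (y - x) powr (2 - \<alpha>)"
  let ?E = "\<lambda>y. (g s - g y) / (y - x) powr (2 - \<alpha>)"
  have int: "set_integrable lborel {x<..<t} ?F"
    using norm_zero_set_integrable[OF \<Lambda>(1) g] x by auto
  have sub: "set_integrable lborel A ?F" if "A \<subseteq> {x<..<t}" "A \<in> sets borel" for A
    using set_integrable_subset[OF int] that by auto
  have un: "{x<..<t} = {x<..s} \<union> {s<..<t}" using x by auto
  have "(LINT y:{x<..s} \<union> {s<..<t}|lborel. ?F y) = (LINT y:{x<..s}|lborel. ?F y) + (LINT y:{s<..<t}|lborel. ?F y)"
    using x by (intro set_integral_Un sub) auto
  moreover have "(LINT y:{x<..s}|lborel. ?F y) = (LINT y:{x<..<s}|lborel. ?F y)"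
  proof -
    have "AE y in lborel. indicator {x<..s} y *\<^sub>R ?F y = indicator {x<..<s} y *\<^sub>R ?F y"
      using AE_lborel_singleton[of s] by eventually_elim (auto split: split_indicator)
    then show ?thesis unfolding set_lebesgue_integral_def by (intro integral_cong_AE) auto
  qed
  ultimately have split: "(LINT y:{x<..<t}|lborel. ?F y) = (LINT y:{x<..<s}|lborel. ?F y) + (LINT y:{s<..<t}|lborel. ?F y)"
    unfolding un by simp
  have FTC: "has_bochner_integral lborel (\<lambda>y. ?w y * indicator {s..t} y)
     (- ((t - x) powr (\<alpha> - 1)) / (1 - \<alpha>) - (- ((s - x) powr (\<alpha> - 1)) / (1 - \<alpha>)))"
  proof (rule has_bochner_integral_FTC_Icc_nonneg)
    fix y assume y: "y \<in> {s..t}"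
    have "(y - x) powr (\<alpha> - 2) = (y - x) powr (- (2 - \<alpha>))" by simp
    also have "\<dots> = ?w y" by (simp only: powr_minus_divide)
    finally have e: "(y - x) powr (\<alpha> - 2) = ?w y" .
    have e2: "\<alpha> - 1 - 1 = \<alpha> - 2" by simp
    have "((\<lambda>y. - ((y - x) powr (\<alpha> - 1)) / (1 - \<alpha>)) has_real_derivative
        - ((\<alpha> - 1) * (y - x) powr (\<alpha> - 1 - 1)) / (1 - \<alpha>)) (at y)"
      using y x \<alpha> by (auto intro!: derivative_eq_intros)
    also have "- ((\<alpha> - 1) * (y - x) powr (\<alpha> - 1 - 1)) / (1 - \<alpha>) = ?w y"
    proof -
      have "- ((\<alpha> - 1) * c) / (1 - \<alpha>) = c" for c :: real using \<alpha> by (simp add: field_simps)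
      then show ?thesis unfolding e2 e .
    qed
    finally show "((\<lambda>y. - ((y - x) powr (\<alpha> - 1)) / (1 - \<alpha>)) has_real_derivative ?w y) (at y)" .
  qed (use x in auto)
  have wI: "set_integrable lborel {s..t} ?w"
    using has_bochner_integral_iff[THEN iffD1, OF FTC] by (simp add: set_integrable_def mult.commute)
  have "(LINT y:{s<..<t}|lborel. ?w y) = (\<integral>y. ?w y * indicator {s..t} y \<partial>lborel)"
  proof -
    have "AE y in lborel. indicator {s<..<t} y *\<^sub>R ?w y = ?w y * indicator {s..t} y"
      using AE_lborel_singleton[of s] AE_lborel_singleton[of t] by eventually_elim (auto split: split_indicator)
    then show ?thesis unfolding set_lebesgue_integral_def by (intro integral_cong_AE) auto
  qed
  also have "\<dots> = ((s - x) powr (\<alpha> - 1) - (t - x) powr (\<alpha> - 1)) / (1 - \<alpha>)"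
    using has_bochner_integral_iff[THEN iffD1, OF FTC] by (simp add: diff_divide_distrib)
  finally have wv: "(LINT y:{s<..<t}|lborel. ?w y) = ((s - x) powr (\<alpha> - 1) - (t - x) powr (\<alpha> - 1)) / (1 - \<alpha>)" .
  have pw: "z powr (\<alpha> - 1) = 1 / z powr (1 - \<alpha>)" for z :: real
    using powr_minus_divide[of z "1 - \<alpha>"] by simp
  have w: "(1 - \<alpha>) * (LINT y:{s<..<t}|lborel. ?w y) = 1 / (s - x) powr (1 - \<alpha>) - 1 / (t - x) powr (1 - \<alpha>)"
    unfolding wv pw using \<alpha> by simp
  have wI': "set_integrable lborel {s<..<t} (\<lambda>y. (g x - g s) * ?w y)"
    using set_integrable_subset[OF wI, of "{s<..<t}"] by (intro set_integrable_mult_right) (auto simp: subset_eq)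
  have E_eq: "?E = (\<lambda>y. ?F y - (g x - g s) * ?w y)"
    by (simp add: fun_eq_iff diff_divide_distrib)
  show EI: "set_integrable lborel {s<..<t} ?E"
    unfolding E_eq using x by (intro set_integral_diff(1) sub wI') auto
  have "(LINT y:{s<..<t}|lborel. ?E y) = (LINT y:{s<..<t}|lborel. ?F y) - (g x - g s) * (LINT y:{s<..<t}|lborel. ?w y)"
  proof -
    have "(LINT y:{s<..<t}|lborel. ?F y - (g x - g s) * ?w y)
      = (LINT y:{s<..<t}|lborel. ?F y) - (LINT y:{s<..<t}|lborel. (g x - g s) * ?w y)"
      using x by (intro set_integral_diff(2) sub wI') auto
    then show ?thesis unfolding E_eq set_integral_mult_right .
  qed
  then have E': "(LINT y:{s<..<t}|lborel. ?F y) = (LINT y:{s<..<t}|lborel. ?E y) + (g x - g s) * (LINT y:{s<..<t}|lborel. ?w y)"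
    by simp
  have FE: "(1 - \<alpha>) * (LINT y:{s<..<t}|lborel. ?F y) = (1 - \<alpha>) * (LINT y:{s<..<t}|lborel. ?E y)
      + (g x - g s) * ((1 - \<alpha>) * (LINT y:{s<..<t}|lborel. ?w y))"
    unfolding E' distrib_left mult.left_commute[of "1 - \<alpha>" "g x - g s"] ..
  show "right_kernel \<alpha> g t x - right_kernel \<alpha> g s x = (g s - g t) / (t - x) powr (1 - \<alpha>) +
     (1 - \<alpha>) * (LINT y:{s<..<t}|lborel. ?E y)"
    unfolding right_kernel_def split distrib_left FE w by (simp add: algebra_simps diff_divide_distrib)
qed

text \<open>The norm of \<open>g\<close> gives \<open>\<bar>g y - g s\<bar> \<le> \<Lambda> (y - s) powr (1 - \<alpha>)\<close>, which is at most
  \<open>\<Lambda> (t - s) powr (1/2) (y - x) powr (1/2 - \<alpha>)\<close>. The factor \<open>(t - s) powr (1/2)\<close> makes the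
  weight \<open>(t - s) powr (- 1 - \<alpha>)\<close> of \<open>norm_at\<close> integrable in \<open>s\<close>, and what remains,
  \<open>\<integral>\<^sub>s\<^sup>t (y - x) powr (- 3/2) dy\<close>, is at most \<open>2 (s - x) powr (- 1/2)\<close>.\<close>

lemma right_kernel_diff_bound:
  assumes \<alpha>: "0 < \<alpha>" "\<alpha> < 1/2" and \<Lambda>: "norm_zero \<alpha> T g \<le> ennreal \<Lambda>" "0 \<le> \<Lambda>"
    and g [measurable]: "g \<in> borel_measurable borel" and x: "0 \<le> x" "x < s" "s < t" "t < T"
  shows "\<bar>right_kernel \<alpha> g t x - right_kernel \<alpha> g s x\<bar> \<le> \<Lambda> * (3 * (t - s) powr (1/2) * (s - x) powr (-(1/2)))"
proof -
  let ?E = "\<lambda>y. (g s - g y) / (y - x) powr (2 - \<alpha>)"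
  have \<alpha>1: "\<alpha> < 1" using \<alpha> by simp
  note eq = right_kernel_diff_eq[OF \<alpha>(1) \<alpha>1 \<Lambda> g x]
  have H: "\<bar>g y - g s\<bar> \<le> \<Lambda> * (y - s) powr (1 - \<alpha>)" if "s \<le> y" "y \<le> t" for y
    using norm_zero_hoelder[OF \<Lambda>, of s y] that x by auto
  have ptE: "\<bar>?E y\<bar> \<le> \<Lambda> * (t - s) powr (1/2) * (y - x) powr (-1 - 1/2)" if y: "y \<in> {s<..<t}" for y
  proof -
    have "(y - s) powr (1 - \<alpha>) = (y - s) powr (1/2) * (y - s) powr (1/2 - \<alpha>)"
      by (simp add: powr_add[symmetric])
    also have "\<dots> \<le> (t - s) powr (1/2) * (y - x) powr (1/2 - \<alpha>)"
      using y x \<alpha> by (intro mult_mono powr_mono2) auto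
    finally have *: "(y - s) powr (1 - \<alpha>) \<le> (t - s) powr (1/2) * (y - x) powr (1/2 - \<alpha>)" .
    have "\<bar>g s - g y\<bar> \<le> \<Lambda> * ((t - s) powr (1/2) * (y - x) powr (1/2 - \<alpha>))"
      using order_trans[OF H mult_left_mono[OF * \<Lambda>(2)]] y by (simp add: abs_minus_commute)
    then have "\<bar>?E y\<bar> \<le> \<Lambda> * ((t - s) powr (1/2) * (y - x) powr (1/2 - \<alpha>)) / (y - x) powr (2 - \<alpha>)"
      unfolding abs_divide by (intro divide_mono) (use y x in auto)
    also have "(y - x) powr (1/2 - \<alpha>) = (y - x) powr (-1 - 1/2) * (y - x) powr (2 - \<alpha>)"
      by (simp add: powr_add[symmetric])
    finally show ?thesis using y x by (simp add: algebra_simps)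
  qed
  have "ennreal \<bar>LINT y:{s<..<t}|lborel. ?E y\<bar> \<le> (\<integral>\<^sup>+y. ennreal (norm (indicator {s<..<t} y *\<^sub>R ?E y)) \<partial>lborel)"
    using eq(2) integral_norm_bound_ennreal[of lborel "\<lambda>y. indicator {s<..<t} y *\<^sub>R ?E y"]
    unfolding set_integrable_def set_lebesgue_integral_def by simp
  also have "\<dots> \<le> (\<integral>\<^sup>+y. ennreal (\<Lambda> * (t - s) powr (1/2)) * (ennreal ((y - x) powr (-1 - 1/2)) * indicator {s..t} y) \<partial>lborel)"
    using ptE \<Lambda>(2)
    by (intro nn_integral_mono) (auto split: split_indicator intro!: ennreal_leI simp: ennreal_mult[symmetric])
  also have "\<dots> = ennreal (\<Lambda> * (t - s) powr (1/2)) * (\<integral>\<^sup>+y\<in>{s..t}. ennreal ((y - x) powr (-1 - 1/2)) \<partial>lborel)"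
    by (rule nn_integral_cmult) auto
  also have "\<dots> \<le> ennreal (\<Lambda> * (t - s) powr (1/2)) * ennreal ((s - x) powr (-(1/2)) / (1/2))"
    using x by (intro mult_left_mono nn_integral_powr_head) auto
  also have "\<dots> = ennreal (\<Lambda> * (t - s) powr (1/2) * ((s - x) powr (-(1/2)) / (1/2)))"
    using \<Lambda>(2) by (subst ennreal_mult[symmetric]) auto
  finally have L: "\<bar>LINT y:{s<..<t}|lborel. ?E y\<bar> \<le> \<Lambda> * (2 * (t - s) powr (1/2) * (s - x) powr (-(1/2)))"
    using \<Lambda>(2) by (subst (asm) ennreal_le_iff) (auto simp: algebra_simps)
  have "\<bar>(1 - \<alpha>) * (LINT y:{s<..<t}|lborel. ?E y)\<bar> \<le> 1 * \<bar>LINT y:{s<..<t}|lborel. ?E y\<bar>"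
    unfolding abs_mult using \<alpha> by (intro mult_right_mono) auto
  moreover have "\<bar>(g s - g t) / (t - x) powr (1 - \<alpha>)\<bar> \<le> \<Lambda> * ((t - s) powr (1/2) * (s - x) powr (-(1/2)))"
  proof -
    have "\<bar>(g s - g t) / (t - x) powr (1 - \<alpha>)\<bar> \<le> \<Lambda> * (t - s) powr (1 - \<alpha>) / (t - x) powr (1 - \<alpha>)"
      unfolding abs_divide using H[of t] x by (intro divide_mono) (auto simp: abs_minus_commute)
    also have "\<dots> = \<Lambda> * ((t - s) / (t - x)) powr (1 - \<alpha>)"
      using x by (simp add: powr_divide)
    also have "\<dots> \<le> \<Lambda> * ((t - s) / (t - x)) powr (1/2)"
      using x \<alpha> \<Lambda>(2) by (intro mult_left_mono powr_mono') auto
    also have "\<dots> = \<Lambda> * ((t - s) powr (1/2) * (t - x) powr (-(1/2)))"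
      unfolding powr_minus_divide using x by (simp add: powr_divide)
    also have "\<dots> \<le> \<Lambda> * ((t - s) powr (1/2) * (s - x) powr (-(1/2)))"
      using x \<Lambda>(2) by (intro mult_left_mono powr_mono2') auto
    finally show ?thesis .
  qed
  ultimately have "\<bar>right_kernel \<alpha> g t x - right_kernel \<alpha> g s x\<bar>
     \<le> \<Lambda> * ((t - s) powr (1/2) * (s - x) powr (-(1/2))) + \<Lambda> * (2 * (t - s) powr (1/2) * (s - x) powr (-(1/2)))"
    using L unfolding eq(1) by linarith
  then show ?thesis by (simp add: algebra_simps)
qed

text \<open>As \<open>d\<close> does not depend on the upper end of the integral, its increment from \<open>s\<close> to \<open>t\<close> is
  the integral of \<open>d\<close> times the kernel over \<open>[s, t]\<close>, plus the integral of \<open>d\<close> times the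
  difference of the two kernels over \<open>[0, s]\<close>.\<close>

lemma incr_bound_kernel_integral:
  assumes \<alpha>: "0 < \<alpha>" "\<alpha> < 1/2" and \<Lambda>: "norm_zero \<alpha> T g \<le> ennreal \<Lambda>" "0 \<le> \<Lambda>"
    and g: "g \<in> borel_measurable borel" and "t < T"
    and d: "set_integrable lborel {0<..<t} d"
    and m [measurable]: "m \<in> borel_measurable borel" and dm: "\<And>x. x \<in> {0<..<t} \<Longrightarrow> ennreal \<bar>d x\<bar> \<le> m x"
    and q: "\<And>s. s \<in> {0<..t} \<Longrightarrow> set_borel_measurable lborel {0<..<s} (right_kernel \<alpha> g s)"
  shows "incr_bound t (\<lambda>s. LINT x:{0<..<s}|lborel. d x * right_kernel \<alpha> g s x) (\<lambda>x. ennreal \<Lambda> * m x)"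
    and "\<And>s. s \<in> {0..t} \<Longrightarrow> set_integrable lborel {0<..<s} (\<lambda>x. d x * right_kernel \<alpha> g s x)"
proof -
  let ?q = "right_kernel \<alpha> g"
  have \<alpha>1: "\<alpha> < 1" using \<alpha> by simp
  have dsub: "set_integrable lborel A d" if "A \<subseteq> {0<..<t}" "A \<in> sets borel" for A
    using set_integrable_subset[OF d] that by auto
  have qb: "\<bar>?q s x\<bar> \<le> \<Lambda>" if "s \<in> {0..t}" "x \<in> {0<..<s}" for s x
    using right_kernel_bound[OF \<alpha>(1) \<alpha>1 \<Lambda> g, of x s] that \<open>t < T\<close> by auto
  show int: "set_integrable lborel {0<..<s} (\<lambda>x. d x * ?q s x)" if s: "s \<in> {0..t}" for s
  proof (cases "s = 0")
    case False
    have "set_integrable lborel {0<..<s} (\<lambda>x. \<Lambda> * d x)"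
      using s by (intro set_integrable_mult_right dsub) auto
    then show ?thesis
    proof (rule set_integrable_bound)
      have "(\<lambda>x. (indicator {0<..<s} x *\<^sub>R d x) * (indicator {0<..<s} x *\<^sub>R ?q s x)) \<in> borel_measurable lborel"
        using q[of s] dsub[of "{0<..<s}"] s False
        unfolding set_integrable_def set_borel_measurable_def
        by (intro borel_measurable_times) (auto simp: subset_eq)
      then show "set_borel_measurable lborel {0<..<s} (\<lambda>x. d x * ?q s x)"
        unfolding set_borel_measurable_def by (rule measurable_cong[THEN iffD1, rotated]) (auto split: split_indicator)
      show "AE x in lborel. x \<in> {0<..<s} \<longrightarrow> norm (d x * ?q s x) \<le> norm (\<Lambda> * d x)"
        using qb[OF s] \<Lambda>(2) by (intro AE_I2) (auto simp: abs_mult mult.commute[of \<Lambda>] intro!: mult_left_mono)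
    qed
  qed (simp add: set_integrable_def)
  have bnd: "ennreal \<bar>LINT x:A|lborel. F x\<bar> \<le> (\<integral>\<^sup>+x\<in>B. ennreal \<Lambda> * m x * ennreal (w x) \<partial>lborel)"
    if F: "set_integrable lborel A F" and "A \<subseteq> B" "A \<subseteq> {0<..<t}" and le: "\<And>x. x \<in> A \<Longrightarrow> \<bar>F x\<bar> \<le> \<bar>d x\<bar> * (\<Lambda> * w x)"
     and w: "\<And>x. 0 \<le> w x"
    for A B F w
  proof -
    have "ennreal \<bar>LINT x:A|lborel. F x\<bar> \<le> (\<integral>\<^sup>+x. ennreal (norm (indicator A x *\<^sub>R F x)) \<partial>lborel)"
      using F integral_norm_bound_ennreal[of lborel "\<lambda>r. indicator A r *\<^sub>R F r"]
      unfolding set_integrable_def set_lebesgue_integral_def by simp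
    also have "\<dots> \<le> (\<integral>\<^sup>+x\<in>B. ennreal \<Lambda> * m x * ennreal (w x) \<partial>lborel)"
    proof (intro nn_integral_mono)
      fix x
      show "ennreal (norm (indicator A x *\<^sub>R F x)) \<le> ennreal \<Lambda> * m x * ennreal (w x) * indicator B x"
      proof (cases "x \<in> A")
        case True
        have "ennreal \<bar>F x\<bar> \<le> ennreal (\<bar>d x\<bar> * (\<Lambda> * w x))" by (intro ennreal_leI le True)
        also have "\<dots> = ennreal \<bar>d x\<bar> * (ennreal \<Lambda> * ennreal (w x))"
          using \<Lambda>(2) w by (simp add: ennreal_mult)
        also have "\<dots> \<le> m x * (ennreal \<Lambda> * ennreal (w x))"
          using True that by (intro mult_right_mono dm) auto
        finally show ?thesis using True that by (auto simp: ac_simps)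
      qed simp
    qed
    finally show ?thesis .
  qed
  let ?P = "\<lambda>s. LINT x:{0<..<s}|lborel. d x * ?q s x"
  show "incr_bound t ?P (\<lambda>x. ennreal \<Lambda> * m x)"
    unfolding incr_bound_def
  proof (intro conjI ballI)
    show "ennreal \<bar>?P t\<bar> \<le> (\<integral>\<^sup>+r\<in>{0..t}. ennreal \<Lambda> * m r \<partial>lborel)"
    proof (cases "0 \<le> t")
      case True
      have "ennreal \<bar>?P t\<bar> \<le> (\<integral>\<^sup>+x\<in>{0..t}. ennreal \<Lambda> * m x * ennreal 1 \<partial>lborel)"
        using True \<open>t < T\<close> qb[of t] by (intro bnd int) (auto simp: abs_mult intro!: mult_left_mono)
      then show ?thesis by simp
    qed (simp add: set_lebesgue_integral_def)
    fix s assume s: "s \<in> {0..<t}"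
    have eq: "?P t - ?P s = (LINT x:{0<..<s}|lborel. d x * (?q t x - ?q s x)) + (LINT x:{s..<t}|lborel. d x * ?q t x)"
      and I1: "set_integrable lborel {0<..<s} (\<lambda>x. d x * (?q t x - ?q s x))"
      and I2: "s > 0 \<Longrightarrow> set_integrable lborel {s..<t} (\<lambda>x. d x * ?q t x)"
      if "s > 0"
    proof -
      have i1: "set_integrable lborel {0<..<s} (\<lambda>x. d x * ?q t x)" and i2: "set_integrable lborel {s..<t} (\<lambda>x. d x * ?q t x)"
        using s that by (auto intro!: set_integrable_subset[OF int[of t]])
      then show "set_integrable lborel {s..<t} (\<lambda>x. d x * ?q t x)" by simp
      have i3: "set_integrable lborel {0<..<s} (\<lambda>x. d x * ?q s x)" using s by (intro int) auto
      show "set_integrable lborel {0<..<s} (\<lambda>x. d x * (?q t x - ?q s x))"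
        using set_integral_diff(1)[OF i1 i3] by (simp add: algebra_simps)
      have un: "{0<..<t} = {0<..<s} \<union> {s..<t}" using s that by auto
      have "?P t = (LINT x:{0<..<s}|lborel. d x * ?q t x) + (LINT x:{s..<t}|lborel. d x * ?q t x)"
        unfolding un by (intro set_integral_Un i1 i2) auto
      moreover have "(LINT x:{0<..<s}|lborel. d x * (?q t x - ?q s x)) = (LINT x:{0<..<s}|lborel. d x * ?q t x) - ?P s"
        using set_integral_diff(2)[OF i1 i3] by (simp add: algebra_simps)
      ultimately show "?P t - ?P s = (LINT x:{0<..<s}|lborel. d x * (?q t x - ?q s x)) + (LINT x:{s..<t}|lborel. d x * ?q t x)"
        by simp
    qed
    show "ennreal \<bar>?P t - ?P s\<bar> \<le> (\<integral>\<^sup>+r\<in>{s..t}. ennreal \<Lambda> * m r \<partial>lborel) +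
        (\<integral>\<^sup>+r\<in>{0..s}. ennreal \<Lambda> * m r * ennreal (3 * (t - s) powr (1/2) * (s - r) powr (-(1/2))) \<partial>lborel)"
    proof (cases "s = 0")
      case True
      have "ennreal \<bar>?P t\<bar> \<le> (\<integral>\<^sup>+x\<in>{0..t}. ennreal \<Lambda> * m x * ennreal 1 \<partial>lborel)"
        using s \<open>t < T\<close> qb[of t] by (intro bnd int) (auto simp: abs_mult intro!: mult_left_mono)
      then show ?thesis using True by (simp add: set_lebesgue_integral_def add_increasing2)
    next
      case False
      then have s0: "s > 0" using s by simp
      have "\<bar>?P t - ?P s\<bar> \<le> \<bar>LINT x:{s..<t}|lborel. d x * ?q t x\<bar> + \<bar>LINT x:{0<..<s}|lborel. d x * (?q t x - ?q s x)\<bar>"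
        unfolding eq[OF s0] by linarith
      then have "ennreal \<bar>?P t - ?P s\<bar> \<le> ennreal \<bar>LINT x:{s..<t}|lborel. d x * ?q t x\<bar>
          + ennreal \<bar>LINT x:{0<..<s}|lborel. d x * (?q t x - ?q s x)\<bar>"
        by (subst ennreal_plus[symmetric]) (auto intro!: ennreal_leI simp del: ennreal_plus)
      also have "\<dots> \<le> (\<integral>\<^sup>+x\<in>{s..t}. ennreal \<Lambda> * m x * ennreal 1 \<partial>lborel)
         + (\<integral>\<^sup>+r\<in>{0..s}. ennreal \<Lambda> * m r * ennreal (3 * (t - s) powr (1/2) * (s - r) powr (-(1/2))) \<partial>lborel)"
        using s s0 \<open>t < T\<close> qb[of t] right_kernel_diff_bound[OF \<alpha> \<Lambda> g]
        by (intro add_mono bnd I1 I2) (auto simp: abs_mult intro!: mult_left_mono)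
      finally show ?thesis by simp
    qed
  qed measurable
qed

section \<open>Estimates for the coefficients\<close>

text \<open>The mean value theorem is applied to \<open>G\<close>, the difference of \<open>\<psi>\<close> along the segment from \<open>y\<close>
  to \<open>x\<close> and along the segment from \<open>y'\<close> to \<open>x'\<close>.\<close>

lemma four_point_estimate:
  fixes \<psi> :: "real \<Rightarrow> real"
  assumes d: "\<And>z. (\<psi> has_real_derivative \<psi>' z) (at z)"
    and b: "\<And>z. \<bar>\<psi>' z\<bar> \<le> K" and l: "\<And>z w. \<bar>\<psi>' z - \<psi>' w\<bar> \<le> K * \<bar>z - w\<bar>"
  shows "\<bar>(\<psi> x - \<psi> y) - (\<psi> x' - \<psi> y')\<bar>
    \<le> K * \<bar>(x - y) - (x' - y')\<bar> + K * \<bar>x - y\<bar> * (\<bar>x - x'\<bar> + \<bar>y - y'\<bar>)"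
proof -
  define G where "G \<theta> = \<psi> (y + \<theta> * (x - y)) - \<psi> (y' + \<theta> * (x' - y'))" for \<theta> :: real
  have K: "0 \<le> K" using b[of 0] by linarith
  have "\<exists>\<theta>. 0 < \<theta> \<and> \<theta> < 1 \<and> G 1 - G 0 = (1 - 0) * (\<psi>' (y + \<theta> * (x - y)) * (x - y) - \<psi>' (y' + \<theta> * (x' - y')) * (x' - y'))"
    unfolding G_def
    by (rule MVT2) (auto intro!: derivative_eq_intros DERIV_chain2[OF d])
  then obtain \<theta> where \<theta>: "0 < \<theta>" "\<theta> < 1"
    and G: "G 1 - G 0 = \<psi>' (y + \<theta> * (x - y)) * (x - y) - \<psi>' (y' + \<theta> * (x' - y')) * (x' - y')" by auto
  let ?p = "y + \<theta> * (x - y)" and ?q = "y' + \<theta> * (x' - y')"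
  have "?p - ?q = (1 - \<theta>) * (y - y') + \<theta> * (x - x')" by (simp add: algebra_simps)
  also have "\<bar>\<dots>\<bar> \<le> \<bar>(1 - \<theta>) * (y - y')\<bar> + \<bar>\<theta> * (x - x')\<bar>" by (rule abs_triangle_ineq)
  also have "\<dots> \<le> 1 * \<bar>y - y'\<bar> + 1 * \<bar>x - x'\<bar>"
    unfolding abs_mult using \<theta> by (intro add_mono mult_right_mono) auto
  finally have pq: "\<bar>?p - ?q\<bar> \<le> \<bar>x - x'\<bar> + \<bar>y - y'\<bar>" by simp
  have "(\<psi> x - \<psi> y) - (\<psi> x' - \<psi> y') = G 1 - G 0" by (simp add: G_def)
  also have "\<dots> = \<psi>' ?q * ((x - y) - (x' - y')) + (\<psi>' ?p - \<psi>' ?q) * (x - y)"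
    unfolding G by (simp add: algebra_simps)
  also have "\<bar>\<dots>\<bar> \<le> \<bar>\<psi>' ?q\<bar> * \<bar>(x - y) - (x' - y')\<bar> + \<bar>\<psi>' ?p - \<psi>' ?q\<bar> * \<bar>x - y\<bar>"
    by (simp only: abs_mult[symmetric] abs_triangle_ineq)
  also have "\<dots> \<le> K * \<bar>(x - y) - (x' - y')\<bar> + (K * (\<bar>x - x'\<bar> + \<bar>y - y'\<bar>)) * \<bar>x - y\<bar>"
    using K by (intro add_mono mult_right_mono b order_trans[OF l mult_left_mono[OF pq]]) auto
  finally show ?thesis by (simp add: algebra_simps)
qed

lemma lipschitz_of_deriv_bound:
  fixes f :: "real \<Rightarrow> real"
  assumes "\<And>z. (f has_real_derivative f' z) (at z)" "\<And>z. \<bar>f' z\<bar> \<le> B"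
  shows "\<bar>f x - f y\<bar> \<le> B * \<bar>x - y\<bar>"
  using field_differentiable_bound[of UNIV f f' B x y] assms by (simp add: has_field_derivative_at_within)

context
  fixes T \<beta> K :: real and a b c :: "real \<Rightarrow> real \<Rightarrow> real"
  assumes cc: "coefficient_conditions T \<beta> K a b c"
begin

lemma coeff_growth: "t \<in> {0..T} \<Longrightarrow> \<bar>c t x\<bar> \<le> K * (1 + \<bar>x\<bar>)"
proof -
  assume "t \<in> {0..T}"
  then have "\<bar>a t x\<bar> + \<bar>b t x\<bar> + \<bar>c t x\<bar> \<le> K * (1 + \<bar>x\<bar>)" using cc unfolding coefficient_conditions_def by blast
  then show ?thesis by linarith
qed

lemma coeff_lipschitz:
  assumes "t \<in> {0..T}"
  shows "\<bar>a t x - a t y\<bar> \<le> K * \<bar>x - y\<bar>" "\<bar>b t x - b t y\<bar> \<le> K * \<bar>x - y\<bar>"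
    "\<bar>deriv (c t) x - deriv (c t) y\<bar> \<le> K * \<bar>x - y\<bar>"
proof -
  have "\<bar>a t x - a t y\<bar> + \<bar>b t x - b t y\<bar> + \<bar>deriv (c t) x - deriv (c t) y\<bar> \<le> K * \<bar>x - y\<bar>"
    using cc assms unfolding coefficient_conditions_def by blast
  then show "\<bar>a t x - a t y\<bar> \<le> K * \<bar>x - y\<bar>" "\<bar>b t x - b t y\<bar> \<le> K * \<bar>x - y\<bar>"
    "\<bar>deriv (c t) x - deriv (c t) y\<bar> \<le> K * \<bar>x - y\<bar>" by linarith+
qed

lemma coeff_time:
  assumes "s \<in> {0..T}" "t \<in> {0..T}"
  shows "\<bar>a s x - a t x\<bar> \<le> K * \<bar>s - t\<bar> powr \<beta>" "\<bar>b s x - b t x\<bar> \<le> K * \<bar>s - t\<bar> powr \<beta>"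
    "\<bar>c s x - c t x\<bar> \<le> K * \<bar>s - t\<bar> powr \<beta>"
    "\<bar>deriv (c s) x - deriv (c t) x\<bar> \<le> K * \<bar>s - t\<bar> powr \<beta>"
proof -
  have "\<bar>a s x - a t x\<bar> + \<bar>b s x - b t x\<bar> + \<bar>c s x - c t x\<bar> + \<bar>deriv (c s) x - deriv (c t) x\<bar> \<le> K * \<bar>s - t\<bar> powr \<beta>"
    using cc assms unfolding coefficient_conditions_def by blast
  then show "\<bar>a s x - a t x\<bar> \<le> K * \<bar>s - t\<bar> powr \<beta>" "\<bar>b s x - b t x\<bar> \<le> K * \<bar>s - t\<bar> powr \<beta>"
    "\<bar>c s x - c t x\<bar> \<le> K * \<bar>s - t\<bar> powr \<beta>"
    "\<bar>deriv (c s) x - deriv (c t) x\<bar> \<le> K * \<bar>s - t\<bar> powr \<beta>" by linarith+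
qed

lemma coeff_c_deriv:
  assumes "t \<in> {0..T}"
  shows "(c t has_real_derivative deriv (c t) x) (at x)" "\<bar>deriv (c t) x\<bar> \<le> K"
  using cc assms unfolding coefficient_conditions_def
  by (auto simp: DERIV_deriv_iff_field_differentiable)

lemma coeff_c_lipschitz:
  assumes "t \<in> {0..T}" shows "\<bar>c t x - c t y\<bar> \<le> K * \<bar>x - y\<bar>"
  using coeff_c_deriv[OF assms] by (rule lipschitz_of_deriv_bound)

lemma coeff_c_increment:
  assumes "s \<in> {0..T}" "t \<in> {0..T}"
  shows "\<bar>c t x - c s y\<bar> \<le> K * (\<bar>t - s\<bar> powr \<beta> + \<bar>x - y\<bar>)"
  using coeff_time(3)[OF assms(2,1), of x] coeff_c_lipschitz[OF assms(1), of x y]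
  by (simp add: algebra_simps)

text \<open>First the time is changed while \<open>x\<close> and \<open>y\<close> stay fixed, using that \<open>c t - c s\<close> has a
  derivative of size \<open>\<bar>t - s\<bar> powr \<beta>\<close>; then the points are changed at the time \<open>s\<close>.\<close>

lemma coeff_c_difference_increment:
  assumes "s \<in> {0..T}" "t \<in> {0..T}"
  shows "\<bar>(c t x - c t y) - (c s x' - c s y')\<bar>
    \<le> K * (\<bar>(x - y) - (x' - y')\<bar> + \<bar>x - y\<bar> * (\<bar>t - s\<bar> powr \<beta> + (\<bar>x - x'\<bar> + \<bar>y - y'\<bar>)))"
proof -
  have "\<bar>(c t x - c s x) - (c t y - c s y)\<bar> \<le> (K * \<bar>t - s\<bar> powr \<beta>) * \<bar>x - y\<bar>"
    by (rule lipschitz_of_deriv_bound[where f="\<lambda>z. c t z - c s z" and f'="\<lambda>z. deriv (c t) z - deriv (c s) z"])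
      (intro DERIV_diff coeff_c_deriv assms coeff_time)+
  moreover have "\<bar>(c s x - c s y) - (c s x' - c s y')\<bar>
    \<le> K * \<bar>(x - y) - (x' - y')\<bar> + K * \<bar>x - y\<bar> * (\<bar>x - x'\<bar> + \<bar>y - y'\<bar>)"
    by (rule four_point_estimate[OF coeff_c_deriv(1)[OF assms(1)] coeff_c_deriv(2)[OF assms(1)] coeff_lipschitz(3)[OF assms(1)]])
  ultimately have "\<bar>(c t x - c t y) - (c s x' - c s y')\<bar> \<le> (K * \<bar>t - s\<bar> powr \<beta>) * \<bar>x - y\<bar> +
    (K * \<bar>(x - y) - (x' - y')\<bar> + K * \<bar>x - y\<bar> * (\<bar>x - x'\<bar> + \<bar>y - y'\<bar>))" by linarith
  then show ?thesis by (simp add: algebra_simps)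
qed

lemma coeff_continuous:
  assumes "0 < \<beta>" and X: "continuous_on {0..T} X"
  shows "continuous_on {0..T} (\<lambda>s. a s (X s))" "continuous_on {0..T} (\<lambda>s. b s (X s))" "continuous_on {0..T} (\<lambda>s. c s (X s))"
proof -
  have *: "continuous_on {0..T} (\<lambda>s. f s (X s))"
    if le: "\<And>s t x y. s \<in> {0..T} \<Longrightarrow> t \<in> {0..T} \<Longrightarrow> \<bar>f t x - f s y\<bar> \<le> K * (\<bar>t - s\<bar> powr \<beta> + \<bar>x - y\<bar>)"
    for f :: "real \<Rightarrow> real \<Rightarrow> real"
    unfolding continuous_on_def
  proof
    fix s assume s: "s \<in> {0..T}"
    have "((\<lambda>t. \<bar>t - s\<bar> powr \<beta>) \<longlongrightarrow> 0) (at s within {0..T})"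
      using assms(1) by (auto intro!: tendsto_eq_intros tendsto_powr' eventually_at_filter[THEN iffD2])
    moreover have "(X \<longlongrightarrow> X s) (at s within {0..T})" using X s by (simp add: continuous_on_def)
    ultimately have "((\<lambda>t. K * (\<bar>t - s\<bar> powr \<beta> + \<bar>X t - X s\<bar>)) \<longlongrightarrow> K * (0 + \<bar>X s - X s\<bar>)) (at s within {0..T})"
      by (intro tendsto_intros)
    then have "((\<lambda>t. K * (\<bar>t - s\<bar> powr \<beta> + \<bar>X t - X s\<bar>)) \<longlongrightarrow> 0) (at s within {0..T})" by simp
    then show "((\<lambda>t. f t (X t)) \<longlongrightarrow> f s (X s)) (at s within {0..T})"
      by (intro Lim_transform_bound[where f="\<lambda>t. f t (X t) - f s (X s)", THEN LIM_zero_cancel])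
        (auto simp: eventually_at_filter intro!: always_eventually order_trans[OF le abs_ge_self] s)
  qed
  have le: "\<bar>f t x - f s y\<bar> \<le> K * (\<bar>t - s\<bar> powr \<beta> + \<bar>x - y\<bar>)"
    if "\<bar>f t x - f s x\<bar> \<le> K * \<bar>t - s\<bar> powr \<beta>" "\<bar>f s x - f s y\<bar> \<le> K * \<bar>x - y\<bar>"
    for f :: "real \<Rightarrow> real \<Rightarrow> real" and t s x y
    using that by (simp add: algebra_simps)
  show "continuous_on {0..T} (\<lambda>s. a s (X s))" "continuous_on {0..T} (\<lambda>s. b s (X s))" "continuous_on {0..T} (\<lambda>s. c s (X s))"
    by (intro * le coeff_time coeff_lipschitz coeff_c_lipschitz; assumption)+
qed

end

lemma left_kernel_bound:
  assumes "0 < \<alpha>" "\<alpha> < 1" "0 < x"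
  shows "ennreal \<bar>left_kernel \<alpha> f x\<bar> \<le> ennreal (\<bar>f x\<bar> * x powr (-\<alpha>)) +
     (\<integral>\<^sup>+s\<in>{0..x}. ennreal (\<bar>f x - f s\<bar> * (x - s) powr (- 1 - \<alpha>)) \<partial>lborel)"
proof -
  let ?F = "\<lambda>y. (f x - f y) / (x - y) powr (1 + \<alpha>)"
  have pw: "(x - s) powr (- 1 - \<alpha>) = 1 / (x - s) powr (1 + \<alpha>)" for s
    using powr_minus_divide[of "x - s" "1 + \<alpha>"] by simp
  have "ennreal \<bar>LINT y:{0<..<x}|lborel. ?F y\<bar> \<le> (\<integral>\<^sup>+y. ennreal (norm (indicator {0<..<x} y *\<^sub>R ?F y)) \<partial>lborel)"
    using integral_norm_bound_ennreal[of lborel "\<lambda>y. indicator {0<..<x} y *\<^sub>R ?F y"] not_integrable_integral_eq[of lborel "\<lambda>y. indicator {0<..<x} y *\<^sub>R ?F y"]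
    unfolding set_lebesgue_integral_def by (cases "integrable lborel (\<lambda>y. indicator {0<..<x} y *\<^sub>R ?F y)") auto
  also have "\<dots> \<le> (\<integral>\<^sup>+s\<in>{0..x}. ennreal (\<bar>f x - f s\<bar> * (x - s) powr (- 1 - \<alpha>)) \<partial>lborel)"
    unfolding pw by (intro nn_integral_mono) (auto split: split_indicator)
  finally have 1: "ennreal \<bar>LINT y:{0<..<x}|lborel. ?F y\<bar> \<le> \<dots>" .
  have "\<bar>left_kernel \<alpha> f x\<bar> \<le> \<bar>f x / x powr \<alpha>\<bar> + \<bar>\<alpha> * (LINT y:{0<..<x}|lborel. ?F y)\<bar>"
    unfolding left_kernel_def by (rule abs_triangle_ineq)
  also have "\<dots> \<le> \<bar>f x\<bar> * x powr (-\<alpha>) + 1 * \<bar>LINT y:{0<..<x}|lborel. ?F y\<bar>"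
    unfolding abs_mult using assms by (intro add_mono mult_right_mono) (auto simp: powr_minus_divide)
  finally have "ennreal \<bar>left_kernel \<alpha> f x\<bar> \<le> ennreal (\<bar>f x\<bar> * x powr (-\<alpha>)) + ennreal \<bar>LINT y:{0<..<x}|lborel. ?F y\<bar>"
    by (subst ennreal_plus[symmetric]) (auto intro!: ennreal_leI simp del: ennreal_plus)
  then show ?thesis using add_left_mono[OF 1] order_trans by blast
qed

lemma left_kernel_set_integrable:
  assumes f: "(\<integral>\<^sup>+s\<in>{0..x}. ennreal (\<bar>f x - f s\<bar> * (x - s) powr (- 1 - \<alpha>)) \<partial>lborel) < \<infinity>"
    and m: "set_borel_measurable borel {0..x} f"
  shows "set_integrable lborel {0<..<x} (\<lambda>y. (f x - f y) / (x - y) powr (1 + \<alpha>))"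
  unfolding set_integrable_def
proof (rule integrableI_bounded)
  have pw: "(x - s) powr (- 1 - \<alpha>) = 1 / (x - s) powr (1 + \<alpha>)" for s
    using powr_minus_divide[of "x - s" "1 + \<alpha>"] by simp
  have [measurable]: "(\<lambda>y. indicator {0..x} y *\<^sub>R f y) \<in> borel_measurable borel"
    using m by (simp add: set_borel_measurable_def)
  have "(\<lambda>y. indicator {0<..<x} y *\<^sub>R ((f x - indicator {0..x} y *\<^sub>R f y) / (x - y) powr (1 + \<alpha>))) \<in> borel_measurable lborel"
    by measurable
  also have "(\<lambda>y. indicator {0<..<x} y *\<^sub>R ((f x - indicator {0..x} y *\<^sub>R f y) / (x - y) powr (1 + \<alpha>)))
     = (\<lambda>y. indicator {0<..<x} y *\<^sub>R ((f x - f y) / (x - y) powr (1 + \<alpha>)))"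
    by (auto split: split_indicator)
  finally show "\<dots> \<in> borel_measurable lborel" .
  have "(\<integral>\<^sup>+ y. ennreal (norm (indicator {0<..<x} y *\<^sub>R ((f x - f y) / (x - y) powr (1 + \<alpha>)))) \<partial>lborel)
     \<le> (\<integral>\<^sup>+s\<in>{0..x}. ennreal (\<bar>f x - f s\<bar> * (x - s) powr (- 1 - \<alpha>)) \<partial>lborel)"
    unfolding pw by (intro nn_integral_mono) (auto split: split_indicator)
  also note f
  finally show "(\<integral>\<^sup>+ y. ennreal (norm (indicator {0<..<x} y *\<^sub>R ((f x - f y) / (x - y) powr (1 + \<alpha>)))) \<partial>lborel) < \<infinity>" .
qed

lemma left_kernel_diff:
  assumes "set_integrable lborel {0<..<x} (\<lambda>y. (f x - f y) / (x - y) powr (1 + \<alpha>))"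
    "set_integrable lborel {0<..<x} (\<lambda>y. (g x - g y) / (x - y) powr (1 + \<alpha>))"
  shows "left_kernel \<alpha> (\<lambda>y. f y - g y) x = left_kernel \<alpha> f x - left_kernel \<alpha> g x"
proof -
  have "(LINT y:{0<..<x}|lborel. (f x - g x - (f y - g y)) / (x - y) powr (1 + \<alpha>))
    = (LINT y:{0<..<x}|lborel. (f x - f y) / (x - y) powr (1 + \<alpha>) - (g x - g y) / (x - y) powr (1 + \<alpha>))"
  proof -
    have "(f x - g x - (f y - g y)) / w = (f x - f y) / w - (g x - g y) / w" for y w :: real
      by (simp add: diff_divide_distrib)
    then show ?thesis by simp
  qed
  also have "\<dots> = (LINT y:{0<..<x}|lborel. (f x - f y) / (x - y) powr (1 + \<alpha>)) - (LINT y:{0<..<x}|lborel. (g x - g y) / (x - y) powr (1 + \<alpha>))"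
    by (rule set_integral_diff(2)[OF assms])
  finally have I: "(LINT y:{0<..<x}|lborel. (f x - g x - (f y - g y)) / (x - y) powr (1 + \<alpha>)) = \<dots>" .
  have "(p - q) / w + k * (A - B) = (p / w + k * A) - (q / w + k * B)" for p q w k A B :: real
    by (simp add: diff_divide_distrib right_diff_distrib)
  then show ?thesis unfolding left_kernel_def I .
qed

lemma right_kernel_diff_fun:
  assumes "set_integrable lborel {x<..<t} (\<lambda>y. (f x - f y) / (y - x) powr (2 - \<alpha>))"
    "set_integrable lborel {x<..<t} (\<lambda>y. (g x - g y) / (y - x) powr (2 - \<alpha>))"
  shows "right_kernel \<alpha> (\<lambda>y. f y - g y) t x = right_kernel \<alpha> f t x - right_kernel \<alpha> g t x"
proof -
  have "(LINT y:{x<..<t}|lborel. (f x - g x - (f y - g y)) / (y - x) powr (2 - \<alpha>))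
    = (LINT y:{x<..<t}|lborel. (f x - f y) / (y - x) powr (2 - \<alpha>) - (g x - g y) / (y - x) powr (2 - \<alpha>))"
  proof -
    have "(f x - g x - (f y - g y)) / w = (f x - f y) / w - (g x - g y) / w" for y w :: real
      by (simp add: diff_divide_distrib)
    then show ?thesis by simp
  qed
  also have "\<dots> = (LINT y:{x<..<t}|lborel. (f x - f y) / (y - x) powr (2 - \<alpha>)) - (LINT y:{x<..<t}|lborel. (g x - g y) / (y - x) powr (2 - \<alpha>))"
    by (rule set_integral_diff(2)[OF assms])
  finally have I: "(LINT y:{x<..<t}|lborel. (f x - g x - (f y - g y)) / (y - x) powr (2 - \<alpha>)) = \<dots>" .
  have "(p - p' - (q - q')) / w + k * (A - B) = ((p - q) / w + k * A) - ((p' - q') / w + k * B)" for p p' q q' w k A B :: real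
    by (simp add: diff_divide_distrib right_diff_distrib)
  then show ?thesis unfolding right_kernel_def I .
qed

text \<open>The unimodular factors cancel, so the integral is real.\<close>

lemma gls_integral_eq_kernels:
  "gls_integral \<alpha> 0 t f g = complex_of_real (1 / (Gamma \<alpha> * Gamma (1 - \<alpha>)) *
     (LINT x:{0<..<t}|lborel. left_kernel \<alpha> f x * right_kernel \<alpha> g t x))"
proof -
  have L: "frac_deriv_left \<alpha> 0 f x = 1 / Gamma (1 - \<alpha>) * left_kernel \<alpha> f x" for x
    by (simp add: frac_deriv_left_def left_kernel_def)
  have R: "frac_deriv_right \<alpha> t (\<lambda>y. g y - g t) x = cis (- pi * \<alpha>) / of_real (Gamma \<alpha>) * of_real (right_kernel \<alpha> g t x)" for x
    by (simp add: frac_deriv_right_def right_kernel_def)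
  have "of_real (frac_deriv_left \<alpha> 0 f x) * frac_deriv_right \<alpha> t (\<lambda>y. g y - g t) x
     = cis (- pi * \<alpha>) * complex_of_real (1 / (Gamma \<alpha> * Gamma (1 - \<alpha>))) * of_real (left_kernel \<alpha> f x * right_kernel \<alpha> g t x)" for x
    unfolding L R by (simp add: field_simps)
  then have "gls_integral \<alpha> 0 t f g = (cis (pi * \<alpha>) * cis (- pi * \<alpha>)) * complex_of_real (1 / (Gamma \<alpha> * Gamma (1 - \<alpha>)))
     * (LINT x:{0<..<t}|lborel. complex_of_real (left_kernel \<alpha> f x * right_kernel \<alpha> g t x))"
    unfolding gls_integral_def by (simp only: set_integral_mult_right mult.assoc)
  also have "\<dots> = complex_of_real (1 / (Gamma \<alpha> * Gamma (1 - \<alpha>)))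
     * complex_of_real (LINT x:{0<..<t}|lborel. left_kernel \<alpha> f x * right_kernel \<alpha> g t x)"
    by (simp only: set_integral_complex_of_real) (simp add: cis_mult)
  finally show ?thesis by simp
qed

lemma gls_integrable_kernels:
  assumes "gls_integrable \<alpha> 0 t f g" "0 < \<alpha>" "\<alpha> < 1"
  shows "set_integrable lborel {0<..<t} (left_kernel \<alpha> f)"
    and "set_borel_measurable lborel {0<..<t} (right_kernel \<alpha> g t)"
proof -
  have "0 < Gamma \<alpha>" "0 < Gamma (1 - \<alpha>)" using assms by (auto intro: Gamma_real_pos)
  then have G: "Gamma \<alpha> \<noteq> 0" "Gamma (1 - \<alpha>) \<noteq> 0" by linarith+
  have L: "left_kernel \<alpha> f = (\<lambda>x. Gamma (1 - \<alpha>) * frac_deriv_left \<alpha> 0 f x)"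
    using G by (simp add: frac_deriv_left_def left_kernel_def fun_eq_iff)
  show "set_integrable lborel {0<..<t} (left_kernel \<alpha> f)"
    unfolding L using assms(1) by (intro set_integrable_mult_right) (simp add: gls_integrable_def)
  have R: "right_kernel \<alpha> g t = (\<lambda>x. Re (frac_deriv_right \<alpha> t (\<lambda>y. g y - g t) x * (of_real (Gamma \<alpha>) / cis (- pi * \<alpha>))))"
    using G by (simp add: frac_deriv_right_def right_kernel_def fun_eq_iff)
  have "(\<lambda>x. indicator {0<..<t} x *\<^sub>R frac_deriv_right \<alpha> t (\<lambda>y. g y - g t) x) \<in> borel_measurable lborel"
    using assms(1) by (simp add: gls_integrable_def set_borel_measurable_def)
  then have "(\<lambda>x. Re ((indicator {0<..<t} x *\<^sub>R frac_deriv_right \<alpha> t (\<lambda>y. g y - g t) x) * (of_real (Gamma \<alpha>) / cis (- pi * \<alpha>)))) \<in> borel_measurable lborel"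
    by measurable
  then show "set_borel_measurable lborel {0<..<t} (right_kernel \<alpha> g t)"
    unfolding set_borel_measurable_def R
    by (rule measurable_cong[THEN iffD1, rotated]) (auto split: split_indicator)
qed

lemma norm_at_add_le:
  assumes [measurable]: "f \<in> borel_measurable borel" "g \<in> borel_measurable borel"
  shows "norm_at \<alpha> t (\<lambda>s. f s + g s) \<le> norm_at \<alpha> t f + norm_at \<alpha> t g"
proof -
  have tri: "ennreal (\<bar>x + y\<bar> * w) \<le> ennreal (\<bar>x\<bar> * w) + ennreal (\<bar>y\<bar> * w)" if "0 \<le> w" for x y w :: real
    using that by (subst ennreal_plus[symmetric]) (auto intro!: ennreal_leI mult_right_mono simp del: ennreal_plus simp flip: distrib_right)
  have "(\<integral>\<^sup>+s\<in>{0..t}. ennreal (\<bar>(f t + g t) - (f s + g s)\<bar> * (t - s) powr (- 1 - \<alpha>)) \<partial>lborel)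
    \<le> (\<integral>\<^sup>+s. ennreal (\<bar>f t - f s\<bar> * (t - s) powr (- 1 - \<alpha>)) * indicator {0..t} s +
        ennreal (\<bar>g t - g s\<bar> * (t - s) powr (- 1 - \<alpha>)) * indicator {0..t} s \<partial>lborel)"
  proof (intro nn_integral_mono)
    fix s
    show "ennreal (\<bar>(f t + g t) - (f s + g s)\<bar> * (t - s) powr (- 1 - \<alpha>)) * indicator {0..t} s \<le>
       ennreal (\<bar>f t - f s\<bar> * (t - s) powr (- 1 - \<alpha>)) * indicator {0..t} s +
        ennreal (\<bar>g t - g s\<bar> * (t - s) powr (- 1 - \<alpha>)) * indicator {0..t} s"
      using tri[of "(t - s) powr (- 1 - \<alpha>)" "f t - f s" "g t - g s"]
      by (auto split: split_indicator simp: algebra_simps)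
  qed
  also have "\<dots> = (\<integral>\<^sup>+s\<in>{0..t}. ennreal (\<bar>f t - f s\<bar> * (t - s) powr (- 1 - \<alpha>)) \<partial>lborel)
     + (\<integral>\<^sup>+s\<in>{0..t}. ennreal (\<bar>g t - g s\<bar> * (t - s) powr (- 1 - \<alpha>)) \<partial>lborel)"
    by (rule nn_integral_add) measurable
  finally have "norm_at \<alpha> t (\<lambda>s. f s + g s) \<le> (ennreal \<bar>f t\<bar> + ennreal \<bar>g t\<bar>) + \<dots>"
    unfolding norm_at_def using tri[of 1 "f t" "g t"] by (intro add_mono) auto
  then show ?thesis unfolding norm_at_def by (simp add: algebra_simps)
qed

lemma norm_at_cong: "0 \<le> t \<Longrightarrow> (\<And>s. s \<in> {0..t} \<Longrightarrow> f s = g s) \<Longrightarrow> norm_at \<alpha> t f = norm_at \<alpha> t g"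
  unfolding norm_at_def by (auto intro!: arg_cong2[where f="(+)"] nn_integral_cong split: split_indicator)

lemma norm_at_measurable [measurable]:
  assumes [measurable]: "f \<in> borel_measurable borel"
  shows "(\<lambda>t. norm_at \<alpha> t f) \<in> borel_measurable borel"
proof -
  have "(\<lambda>t. norm_at \<alpha> t f) = (\<lambda>t. ennreal \<bar>f t\<bar> +
     (\<integral>\<^sup>+s. ennreal (\<bar>f t - f s\<bar> * (t - s) powr (- 1 - \<alpha>)) * indicator {(t, s). 0 \<le> s \<and> s \<le> t} (t, s) \<partial>lborel))"
    unfolding norm_at_def
    by (intro ext arg_cong2[where f="(+)"] refl nn_integral_cong) (auto split: split_indicator)
  also have "\<dots> \<in> borel_measurable borel" by measurable
  finally show ?thesis .
qed

text \<open>By the previous estimates for \<open>c\<close>, the increments of \<open>c(X) - c(Xb)\<close> are bounded by those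
  of \<open>X - Xb\<close> and by \<open>\<bar>X x - Xb x\<bar>\<close> times the time increment to the power \<open>\<beta>\<close> and the increments
  of \<open>X\<close> and \<open>Xb\<close>. After integration the time increments contribute \<open>B\<close>, which is finite because
  \<open>\<alpha> < 1/2 < \<beta>\<close>, and the increments of the solutions at most \<open>R\<close>. Terms without a power of \<open>x\<close>
  are absorbed by \<open>1 \<le> T powr \<alpha> * x powr (- \<alpha>)\<close>.\<close>

lemma coeff_left_kernel_bounds:
  fixes X Xb :: "real \<Rightarrow> real"
  assumes cc: "coefficient_conditions T \<beta> K a b c" and K: "0 < K" and \<alpha>: "0 < \<alpha>" "\<alpha> < 1/2" and \<beta>: "1/2 < \<beta>"
    and R: "0 \<le> R" and x: "0 < x" "x \<le> T"
    and X [measurable]: "X \<in> borel_measurable borel" "Xb \<in> borel_measurable borel"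
    and bd: "norm_at \<alpha> x X + norm_at \<alpha> x Xb \<le> ennreal R"
  defines "B \<equiv> T powr (\<beta> - \<alpha>) / (\<beta> - \<alpha>)"
  shows "ennreal \<bar>left_kernel \<alpha> (\<lambda>s. c s (X s) - c s (Xb s)) x\<bar>
      \<le> ennreal (K * (1 + T powr \<alpha> * (1 + B + R)) * x powr (-\<alpha>)) * norm_at \<alpha> x (\<lambda>s. X s - Xb s)" (is ?A)
    and "ennreal \<bar>left_kernel \<alpha> (\<lambda>s. c s (Xb s)) x\<bar> \<le> ennreal (K * (1 + R + T powr \<alpha> * (B + R)) * x powr (-\<alpha>))" (is ?B)
    and "(\<integral>\<^sup>+s\<in>{0..x}. ennreal (\<bar>c x (X x) - c s (X s)\<bar> * (x - s) powr (- 1 - \<alpha>)) \<partial>lborel) < \<infinity>" (is ?C)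
    and "(\<integral>\<^sup>+s\<in>{0..x}. ennreal (\<bar>c x (Xb x) - c s (Xb s)\<bar> * (x - s) powr (- 1 - \<alpha>)) \<partial>lborel) < \<infinity>" (is ?D)
proof -
  have \<alpha>1: "\<alpha> < 1" using \<alpha> by simp
  have B: "0 \<le> B" using \<alpha> \<beta> by (simp add: B_def)
  let ?w = "\<lambda>s. (x - s) powr (- 1 - \<alpha>)"
  define S where "S f = (\<integral>\<^sup>+s\<in>{0..x}. ennreal (\<bar>f x - f s\<bar> * ?w s) \<partial>lborel)" for f :: "real \<Rightarrow> real"
  have xT: "x \<in> {0..T}" "\<And>s. s \<in> {0..x} \<Longrightarrow> s \<in> {0..T}" using x by auto
  have time: "(\<integral>\<^sup>+s\<in>{0..x}. ennreal (\<bar>x - s\<bar> powr \<beta> * ?w s) \<partial>lborel) \<le> ennreal B"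
  proof -
    have "(\<integral>\<^sup>+s\<in>{0..x}. ennreal (\<bar>x - s\<bar> powr \<beta> * ?w s) \<partial>lborel) = (\<integral>\<^sup>+s\<in>{0..x}. ennreal ((x - s) powr (-(1 + \<alpha> - \<beta>))) \<partial>lborel)"
    proof (intro nn_integral_cong)
      fix s
      have "\<beta> + (- 1 - \<alpha>) = - (1 + \<alpha> - \<beta>)" by simp
      then have "(x - s) powr \<beta> * ?w s = (x - s) powr (-(1 + \<alpha> - \<beta>))"
        by (metis powr_add)
      then show "ennreal (\<bar>x - s\<bar> powr \<beta> * ?w s) * indicator {0..x} s = ennreal ((x - s) powr (-(1 + \<alpha> - \<beta>))) * indicator {0..x} s"
        by (simp split: split_indicator)
    qed
    also have "\<dots> = ennreal (x powr (\<beta> - \<alpha>) / (\<beta> - \<alpha>))"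
      using x \<alpha> \<beta> nn_integral_powr_right[of 0 x "1 + \<alpha> - \<beta>"] by simp
    also have "\<dots> \<le> ennreal B"
      unfolding B_def using x \<alpha> \<beta> by (intro ennreal_leI divide_right_mono powr_mono2) auto
    finally show ?thesis .
  qed
  have SX: "S X + S Xb \<le> ennreal R" and absX: "\<bar>X x\<bar> + \<bar>Xb x\<bar> \<le> R"
  proof -
    have e: "norm_at \<alpha> x X + norm_at \<alpha> x Xb = ennreal (\<bar>X x\<bar> + \<bar>Xb x\<bar>) + (S X + S Xb)"
      unfolding norm_at_def S_def by (simp add: algebra_simps)
    show "S X + S Xb \<le> ennreal R" using bd unfolding e by (rule order_trans[rotated]) simp
    have "ennreal (\<bar>X x\<bar> + \<bar>Xb x\<bar>) \<le> ennreal R" using bd unfolding e by (rule order_trans[rotated]) simp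
    then show "\<bar>X x\<bar> + \<bar>Xb x\<bar> \<le> R" using R by (simp del: ennreal_plus)
  qed
  have SX1: "S X \<le> ennreal R" "S Xb \<le> ennreal R"
    using SX by (auto intro: order_trans[rotated])
  have c1: "(\<integral>\<^sup>+s\<in>{0..x}. ennreal (\<bar>c x (Y x) - c s (Y s)\<bar> * ?w s) \<partial>lborel) \<le> ennreal (K * (B + R))"
    if Y: "S Y \<le> ennreal R" and [measurable]: "Y \<in> borel_measurable borel" for Y
  proof -
    have "(\<integral>\<^sup>+s\<in>{0..x}. ennreal (\<bar>c x (Y x) - c s (Y s)\<bar> * ?w s) \<partial>lborel)
      \<le> (\<integral>\<^sup>+s. ennreal K * (ennreal (\<bar>x - s\<bar> powr \<beta> * ?w s) * indicator {0..x} s + ennreal (\<bar>Y x - Y s\<bar> * ?w s) * indicator {0..x} s) \<partial>lborel)"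
    proof (intro nn_integral_mono)
      fix s
      show "ennreal (\<bar>c x (Y x) - c s (Y s)\<bar> * ?w s) * indicator {0..x} s
        \<le> ennreal K * (ennreal (\<bar>x - s\<bar> powr \<beta> * ?w s) * indicator {0..x} s + ennreal (\<bar>Y x - Y s\<bar> * ?w s) * indicator {0..x} s)"
      proof (cases "s \<in> {0..x}")
        case True
        have "\<bar>c x (Y x) - c s (Y s)\<bar> * ?w s \<le> (K * (\<bar>x - s\<bar> powr \<beta> + \<bar>Y x - Y s\<bar>)) * ?w s"
          using True xT by (intro mult_right_mono coeff_c_increment[OF cc]) auto
        also have "\<dots> = K * (\<bar>x - s\<bar> powr \<beta> * ?w s + \<bar>Y x - Y s\<bar> * ?w s)" by (simp add: algebra_simps)
        finally show ?thesis using True K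
          by (simp add: ennreal_leI flip: ennreal_mult ennreal_plus)
      qed simp
    qed
    also have "\<dots> = ennreal K * ((\<integral>\<^sup>+s\<in>{0..x}. ennreal (\<bar>x - s\<bar> powr \<beta> * ?w s) \<partial>lborel) + S Y)"
      unfolding S_def by (subst nn_integral_cmult, measurable) (subst nn_integral_add, auto)
    also have "\<dots> \<le> ennreal K * (ennreal B + ennreal R)"
      by (intro mult_left_mono add_mono time Y) auto
    also have "\<dots> = ennreal (K * (B + R))" using K B R by (simp add: ennreal_mult)
    finally show ?thesis .
  qed
  show ?C ?D using c1[of X] c1[of Xb] SX1 by (auto intro: le_less_trans)
  have x1: "1 \<le> T powr \<alpha> * x powr (-\<alpha>)"
    using powr_neg_exponent_mono[of x T 0 \<alpha>] x \<alpha> by simp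
  show ?B
  proof -
    have "\<bar>c x (Xb x)\<bar> \<le> K * (1 + R)"
      using order_trans[OF coeff_growth[OF cc xT(1)], of "Xb x" "K * (1 + R)"] absX K by auto
    then have "ennreal \<bar>left_kernel \<alpha> (\<lambda>s. c s (Xb s)) x\<bar> \<le> ennreal (K * (1 + R) * x powr (-\<alpha>)) + ennreal (K * (B + R))"
      using x c1[of Xb] SX1
      by (intro order_trans[OF left_kernel_bound[OF \<alpha>(1) \<alpha>1 x(1)]] add_mono ennreal_leI mult_right_mono) auto
    also have "\<dots> = ennreal (K * (1 + R) * x powr (-\<alpha>) + K * (B + R) * 1)" using K B R by simp
    also have "\<dots> \<le> ennreal (K * (1 + R) * x powr (-\<alpha>) + K * (B + R) * (T powr \<alpha> * x powr (-\<alpha>)))"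
      using K B R x1 by (intro ennreal_leI add_left_mono mult_left_mono) auto
    finally show ?thesis by (simp add: algebra_simps)
  qed
  show ?A
  proof -
    let ?D = "\<lambda>s. X s - Xb s"
    let ?h = "\<lambda>s. c s (X s) - c s (Xb s)"
    have hs: "ennreal (\<bar>?h x - ?h s\<bar> * ?w s) * indicator {0..x} s
        \<le> ennreal K * (ennreal (\<bar>?D x - ?D s\<bar> * ?w s) * indicator {0..x} s + ennreal \<bar>?D x\<bar> *
          (ennreal (\<bar>x - s\<bar> powr \<beta> * ?w s) * indicator {0..x} s + (ennreal (\<bar>X x - X s\<bar> * ?w s) * indicator {0..x} s
            + ennreal (\<bar>Xb x - Xb s\<bar> * ?w s) * indicator {0..x} s)))" for s
    proof (cases "s \<in> {0..x}")
      case True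
      have "\<bar>?h x - ?h s\<bar> * ?w s \<le> (K * (\<bar>?D x - ?D s\<bar> + \<bar>?D x\<bar> * (\<bar>x - s\<bar> powr \<beta> + (\<bar>X x - X s\<bar> + \<bar>Xb x - Xb s\<bar>)))) * ?w s"
        using True xT by (intro mult_right_mono coeff_c_difference_increment[OF cc]) auto
      also have "\<dots> = K * (\<bar>?D x - ?D s\<bar> * ?w s + \<bar>?D x\<bar> * (\<bar>x - s\<bar> powr \<beta> * ?w s + (\<bar>X x - X s\<bar> * ?w s + \<bar>Xb x - Xb s\<bar> * ?w s)))"
        by (simp add: algebra_simps)
      finally show ?thesis using True K
        by (simp add: ennreal_leI flip: ennreal_mult ennreal_plus)
    qed simp
    have "(\<integral>\<^sup>+s\<in>{0..x}. ennreal (\<bar>?h x - ?h s\<bar> * ?w s) \<partial>lborel)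
      \<le> (\<integral>\<^sup>+s. ennreal K * (ennreal (\<bar>?D x - ?D s\<bar> * ?w s) * indicator {0..x} s + ennreal \<bar>?D x\<bar> *
          (ennreal (\<bar>x - s\<bar> powr \<beta> * ?w s) * indicator {0..x} s + (ennreal (\<bar>X x - X s\<bar> * ?w s) * indicator {0..x} s
            + ennreal (\<bar>Xb x - Xb s\<bar> * ?w s) * indicator {0..x} s))) \<partial>lborel)"
      by (rule nn_integral_mono) (rule hs)
    also have "\<dots> = ennreal K * (S ?D + ennreal \<bar>?D x\<bar> *
          ((\<integral>\<^sup>+s\<in>{0..x}. ennreal (\<bar>x - s\<bar> powr \<beta> * ?w s) \<partial>lborel) + (S X + S Xb)))"
      unfolding S_def by (simp add: nn_integral_cmult nn_integral_add)
    also have "\<dots> \<le> ennreal K * (S ?D + ennreal \<bar>?D x\<bar> * (ennreal B + ennreal R))"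
      by (intro mult_left_mono add_mono time SX) auto
    finally have hS: "(\<integral>\<^sup>+s\<in>{0..x}. ennreal (\<bar>?h x - ?h s\<bar> * ?w s) \<partial>lborel) \<le> \<dots>" .
    have "\<bar>?h x\<bar> * x powr (-\<alpha>) \<le> (K * \<bar>?D x\<bar>) * x powr (-\<alpha>)"
      by (intro mult_right_mono coeff_c_lipschitz[OF cc xT(1)]) auto
    then have "ennreal \<bar>left_kernel \<alpha> ?h x\<bar> \<le> ennreal ((K * \<bar>?D x\<bar>) * x powr (-\<alpha>)) + ennreal K * (S ?D + ennreal \<bar>?D x\<bar> * (ennreal B + ennreal R))"
      by (intro order_trans[OF left_kernel_bound[OF \<alpha>(1) \<alpha>1 x(1)]] add_mono ennreal_leI hS)
    also have "\<dots> = ennreal (K * x powr (-\<alpha>) + K * (B + R) * 1) * ennreal \<bar>?D x\<bar> + ennreal (K * 1) * S ?D"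
      using K B R by (simp add: ennreal_mult[symmetric] ennreal_plus[symmetric] distrib_left mult.assoc[symmetric] del: ennreal_plus)
        (simp add: algebra_simps)
    also have "\<dots> \<le> ennreal (K * (1 + T powr \<alpha> * (1 + B + R)) * x powr (-\<alpha>)) * ennreal \<bar>?D x\<bar>
         + ennreal (K * (1 + T powr \<alpha> * (1 + B + R)) * x powr (-\<alpha>)) * S ?D"
    proof (intro add_mono mult_right_mono ennreal_leI)
      have "K * (B + R) * 1 \<le> K * (B + R) * (T powr \<alpha> * x powr (-\<alpha>))"
        using K B R x1 by (intro mult_left_mono) auto
      moreover have "0 \<le> K * (T powr \<alpha> * x powr (-\<alpha>))" using K by simp
      ultimately show "K * x powr (-\<alpha>) + K * (B + R) * 1 \<le> K * (1 + T powr \<alpha> * (1 + B + R)) * x powr (-\<alpha>)"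
        by (simp add: algebra_simps)
      have "K * 1 \<le> K * (T powr \<alpha> * x powr (-\<alpha>))" using K x1 by (intro mult_left_mono) auto
      moreover have "0 \<le> K * x powr (-\<alpha>)" "0 \<le> K * (B + R) * (T powr \<alpha> * x powr (-\<alpha>))" using K B R by auto
      ultimately show "K * 1 \<le> K * (1 + T powr \<alpha> * (1 + B + R)) * x powr (-\<alpha>)"
        by (simp add: algebra_simps)
    qed auto
    also have "\<dots> = ennreal (K * (1 + T powr \<alpha> * (1 + B + R)) * x powr (-\<alpha>)) * norm_at \<alpha> x ?D"
      unfolding norm_at_def S_def by (simp add: distrib_left)
    finally show ?thesis .
  qed
qed

text \<open>Up to constants, all kernels of the proof are dominated by this one for \<open>\<mu> = \<alpha> + 1/2\<close>, an
  exponent that the stochastic integral requires.\<close>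

definition vol_kernel :: "real \<Rightarrow> real \<Rightarrow> real \<Rightarrow> real" where
  "vol_kernel \<mu> t r = r powr (-\<mu>) + (t - r) powr (-\<mu>)"

lemma vol_kernel_measurable [measurable]:
  "(\<lambda>(t, r). vol_kernel \<mu> t r) \<in> borel_measurable (borel \<Otimes>\<^sub>M borel)"
  unfolding vol_kernel_def by measurable

lemma vol_kernel_nonneg: "0 \<le> vol_kernel \<mu> t r"
  by (simp add: vol_kernel_def)

lemma vol_kernel_dominates:
  assumes "0 < \<alpha>" "\<alpha> < 1/2" "0 < r" "r < t" "t \<le> T" "0 \<le> C"
  defines "\<mu> \<equiv> \<alpha> + 1/2"
  shows "1 + C * (t - r) powr (-\<alpha>) \<le> (T powr \<mu> + C * T powr (1/2)) * vol_kernel \<mu> t r"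
    and "r powr (-\<alpha>) * (1 + C * (t - r) powr (-\<alpha>)) \<le> (T powr (1/2) + C * T powr (1/2 - \<alpha>)) * vol_kernel \<mu> t r"
proof -
  have 1: "1 \<le> T powr \<mu> * r powr (-\<mu>)"
    using powr_neg_exponent_mono[of r T 0 \<mu>] assms by simp
  have 2: "(t - r) powr (-\<alpha>) \<le> T powr (1/2) * (t - r) powr (-\<mu>)"
    using powr_neg_exponent_mono[of "t - r" T \<alpha> \<mu>] assms by simp
  have 3: "r powr (-\<alpha>) \<le> T powr (1/2) * r powr (-\<mu>)"
    using powr_neg_exponent_mono[of r T \<alpha> \<mu>] assms by simp
  have 4: "r powr (-\<alpha>) * (t - r) powr (-\<alpha>) \<le> r powr (-(\<alpha>+\<alpha>)) + (t - r) powr (-(\<alpha>+\<alpha>))"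
    using assms by (intro powr_neg_mult_le_add) auto
  have 5: "r powr (-(\<alpha>+\<alpha>)) \<le> T powr (1/2 - \<alpha>) * r powr (-\<mu>)" "(t - r) powr (-(\<alpha>+\<alpha>)) \<le> T powr (1/2 - \<alpha>) * (t - r) powr (-\<mu>)"
    using powr_neg_exponent_mono[of r T "\<alpha>+\<alpha>" \<mu>] powr_neg_exponent_mono[of "t - r" T "\<alpha>+\<alpha>" \<mu>] assms by (auto simp: algebra_simps)
  have "1 + C * (t - r) powr (-\<alpha>) \<le> T powr \<mu> * r powr (-\<mu>) + C * (T powr (1/2) * (t - r) powr (-\<mu>))"
    using assms by (intro add_mono mult_left_mono 1 2)
  also have "\<dots> \<le> T powr \<mu> * vol_kernel \<mu> t r + C * (T powr (1/2) * vol_kernel \<mu> t r)"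
    unfolding vol_kernel_def using assms by (intro add_mono mult_left_mono) auto
  finally show "1 + C * (t - r) powr (-\<alpha>) \<le> (T powr \<mu> + C * T powr (1/2)) * vol_kernel \<mu> t r"
    by (simp add: algebra_simps)
  have "r powr (-\<alpha>) * (1 + C * (t - r) powr (-\<alpha>)) = r powr (-\<alpha>) + C * (r powr (-\<alpha>) * (t - r) powr (-\<alpha>))"
    by (simp add: algebra_simps)
  also have "\<dots> \<le> T powr (1/2) * r powr (-\<mu>) + C * (T powr (1/2 - \<alpha>) * r powr (-\<mu>) + T powr (1/2 - \<alpha>) * (t - r) powr (-\<mu>))"
    using assms order_trans[OF 4 add_mono[OF 5]] by (intro add_mono mult_left_mono 3) auto
  also have "\<dots> \<le> T powr (1/2) * vol_kernel \<mu> t r + C * (T powr (1/2 - \<alpha>) * vol_kernel \<mu> t r)"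
    unfolding vol_kernel_def using assms by (intro add_mono mult_left_mono) (auto simp: algebra_simps)
  finally show "r powr (-\<alpha>) * (1 + C * (t - r) powr (-\<alpha>)) \<le> (T powr (1/2) + C * T powr (1/2 - \<alpha>)) * vol_kernel \<mu> t r"
    by (simp add: algebra_simps)
qed

section \<open>The pathwise estimate\<close>

lemma incr_bound_cmult:
  assumes "incr_bound t P m" "0 \<le> c"
  shows "incr_bound t (\<lambda>s. c * P s) (\<lambda>r. ennreal c * m r)"
proof -
  have [measurable]: "m \<in> borel_measurable borel" using assms by (simp add: incr_bound_def)
  have e: "ennreal \<bar>c * x\<bar> = ennreal c * ennreal \<bar>x\<bar>" for x :: real
    using assms(2) by (simp add: abs_mult ennreal_mult)
  show ?thesis
    unfolding incr_bound_def right_diff_distrib[symmetric] e mult.assoc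
  proof (intro conjI ballI)
    show "ennreal c * ennreal \<bar>P t\<bar> \<le> (\<integral>\<^sup>+r. ennreal c * (m r * indicator {0..t} r) \<partial>lborel)"
      using assms by (subst nn_integral_cmult) (auto simp: incr_bound_def intro!: mult_left_mono)
    fix s assume "s \<in> {0..<t}"
    with assms show "ennreal c * ennreal \<bar>P t - P s\<bar> \<le> (\<integral>\<^sup>+r. ennreal c * (m r * indicator {s..t} r) \<partial>lborel)
       + (\<integral>\<^sup>+r. ennreal c * (m r * (ennreal (3 * ((t - s) powr (1/2) * (s - r) powr (-(1/2)))) * indicator {0..s} r)) \<partial>lborel)"
      by (subst nn_integral_cmult, measurable, subst nn_integral_cmult, measurable)
        (auto simp: incr_bound_def distrib_left[symmetric] mult.assoc intro!: mult_left_mono)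
  qed simp
qed

text \<open>The constant of the theorem has to be chosen before the processes, so the one of the
  pathwise estimate is given explicitly.\<close>

definition path_const :: "real \<Rightarrow> real \<Rightarrow> real \<Rightarrow> real \<Rightarrow> real \<Rightarrow> real \<Rightarrow> real" where
  "path_const \<alpha> \<beta> K T R \<Lambda> =
    (let B = T powr (\<beta> - \<alpha>) / (\<beta> - \<alpha>); C = 1/\<alpha> + 18/(1/2 - \<alpha>)
     in K * (T powr (\<alpha> + 1/2) + C * T powr (1/2)) +
        1 / (Gamma \<alpha> * Gamma (1 - \<alpha>)) *
        (\<Lambda> * (K * (1 + T powr \<alpha> * (1 + B + R))) + K * (1 + R + T powr \<alpha> * (B + R))) *
        (T powr (1/2) + C * T powr (1/2 - \<alpha>)))"

lemma path_const_nonneg: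
  assumes "0 < \<alpha>" "\<alpha> < 1/2" "1/2 < \<beta>" "0 < K" "0 \<le> R" "0 \<le> \<Lambda>"
  shows "0 \<le> path_const \<alpha> \<beta> K T R \<Lambda>"
proof -
  have "0 < Gamma \<alpha>" "0 < Gamma (1 - \<alpha>)" using assms by (auto intro: Gamma_real_pos)
  then show ?thesis using assms unfolding path_const_def Let_def
    by (intro add_nonneg_nonneg mult_nonneg_nonneg divide_nonneg_nonneg) auto
qed

text \<open>Subtract the equations. With \<open>h = c(X) - c(Xb)\<close>, the identity
  \<open>c(X) dg - c(Xb) dgb = h dg + c(Xb) d(g - gb)\<close> splits the difference of the two generalized
  integrals into \<open>D1\<close>, governed by \<open>norm_at r (X - Xb)\<close>, and \<open>D2\<close>, governed by the norm \<open>z\<close> of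
  the difference of the drivers. Each of these and the drift \<open>A\<close> satisfies an increment bound.\<close>

lemma pathwise_estimate:
  fixes X Xb g gb I Ib :: "real \<Rightarrow> real"
  assumes cc: "coefficient_conditions T \<beta> K a b c" and K: "0 < K" and \<alpha>: "0 < \<alpha>" "\<alpha> < 1/2" and \<beta>: "1/2 < \<beta>"
    and R: "0 \<le> R" and \<Lambda>: "0 \<le> \<Lambda>" and z: "0 \<le> z" and t: "0 < t" "t < T"
    and meas [measurable]: "X \<in> borel_measurable borel" "Xb \<in> borel_measurable borel" "g \<in> borel_measurable borel"
      "gb \<in> borel_measurable borel" "I \<in> borel_measurable borel" "Ib \<in> borel_measurable borel"
    and cont: "continuous_on {0..T} X" "continuous_on {0..T} Xb"
    and g: "norm_zero \<alpha> T g \<le> ennreal \<Lambda>" and gb: "norm_zero \<alpha> T gb \<le> ennreal \<Lambda>"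
    and gg: "norm_zero \<alpha> T (\<lambda>s. g s - gb s) \<le> ennreal z"
    and bd: "\<And>s. s \<in> {0<..t} \<Longrightarrow> norm_at \<alpha> s X + norm_at \<alpha> s Xb \<le> ennreal R"
    and eqX: "\<And>s. s \<in> {0..t} \<Longrightarrow> gls_integrable \<alpha> 0 s (\<lambda>r. c r (X r)) g \<and>
       complex_of_real (X s) = of_real (x0 + (LINT r:{0..s}|lborel. a r (X r)) + I s) + gls_integral \<alpha> 0 s (\<lambda>r. c r (X r)) g"
    and eqXb: "\<And>s. s \<in> {0..t} \<Longrightarrow> gls_integrable \<alpha> 0 s (\<lambda>r. c r (Xb r)) gb \<and>
       complex_of_real (Xb s) = of_real (x0 + (LINT r:{0..s}|lborel. a r (Xb r)) + Ib s) + gls_integral \<alpha> 0 s (\<lambda>r. c r (Xb r)) gb"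
  shows "norm_at \<alpha> t (\<lambda>s. X s - Xb s) \<le> norm_at \<alpha> t (\<lambda>s. I s - Ib s) + ennreal (path_const \<alpha> \<beta> K T R \<Lambda>) *
     (\<integral>\<^sup>+r\<in>{0..t}. (norm_at \<alpha> r (\<lambda>s. X s - Xb s) + ennreal z) * ennreal (vol_kernel (\<alpha> + 1/2) t r) \<partial>lborel)"
proof -
  have \<alpha>1: "\<alpha> < 1" and \<beta>0: "0 < \<beta>" using \<alpha> \<beta> by auto
  define B where "B = T powr (\<beta> - \<alpha>) / (\<beta> - \<alpha>)"
  define C where "C = 1/\<alpha> + 18/(1/2 - \<alpha>)"
  define C1 where "C1 = K * (1 + T powr \<alpha> * (1 + B + R))"
  define C2 where "C2 = K * (1 + R + T powr \<alpha> * (B + R))"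
  define k where "k = 1 / (Gamma \<alpha> * Gamma (1 - \<alpha>))"
  have B0: "0 \<le> B" and C0: "0 \<le> C" using \<alpha> \<beta> by (auto simp: B_def C_def)
  have C1: "0 \<le> C1" and C2: "0 \<le> C2" using B0 K R by (auto simp: C1_def C2_def)
  have k: "0 \<le> k" using \<alpha> Gamma_real_pos[of \<alpha>] Gamma_real_pos[of "1 - \<alpha>"] by (auto simp: k_def)
  let ?D = "\<lambda>s. X s - Xb s" and ?J = "\<lambda>s. I s - Ib s" and ?n = "\<lambda>r. norm_at \<alpha> r (\<lambda>s. X s - Xb s)"
  let ?f = "\<lambda>r. c r (X r)" and ?fb = "\<lambda>r. c r (Xb r)" and ?h = "\<lambda>r. c r (X r) - c r (Xb r)"
  let ?gg = "\<lambda>s. g s - gb s"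
  let ?L = "left_kernel \<alpha>" and ?Q = "right_kernel \<alpha>"
  have lk: "ennreal \<bar>?L ?h x\<bar> \<le> ennreal (C1 * x powr (-\<alpha>)) * ?n x"
    "ennreal \<bar>?L ?fb x\<bar> \<le> ennreal (C2 * x powr (-\<alpha>))"
    "?L ?h x = ?L ?f x - ?L ?fb x" if x: "x \<in> {0<..<t}" for x
  proof -
    have x': "0 < x" "x \<le> T" "x \<in> {0<..t}" using x t by auto
    note * = coeff_left_kernel_bounds[OF cc K \<alpha> \<beta> R x'(1,2) meas(1,2) bd[OF x'(3)], folded B_def]
    show "ennreal \<bar>?L ?h x\<bar> \<le> ennreal (C1 * x powr (-\<alpha>)) * ?n x" "ennreal \<bar>?L ?fb x\<bar> \<le> ennreal (C2 * x powr (-\<alpha>))"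
      using *(1,2) unfolding C1_def C2_def by auto
    have sub: "{0..x} \<subseteq> {0..T}" using x' by auto
    have m: "set_borel_measurable borel {0..x} ?f" "set_borel_measurable borel {0..x} ?fb"
      using continuous_on_subset[OF coeff_continuous(3)[OF cc \<beta>0 cont(1)] sub]
        continuous_on_subset[OF coeff_continuous(3)[OF cc \<beta>0 cont(2)] sub]
      unfolding set_borel_measurable_def by (intro borel_measurable_continuous_on_indicator; simp)+
    show "?L ?h x = ?L ?f x - ?L ?fb x"
      by (intro left_kernel_diff left_kernel_set_integrable *(3,4) m)
  qed
  have rk: "?Q ?gg s x = ?Q g s x - ?Q gb s x" if s: "s \<in> {0..t}" "x \<in> {0<..<s}" for s x
    using s t by (intro right_kernel_diff_fun norm_zero_set_integrable[OF g meas(3)] norm_zero_set_integrable[OF gb meas(4)]) auto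
  have tin: "t \<in> {0..t}" using t by simp
  have Lf: "set_integrable lborel {0<..<t} (?L ?f)" and Lfb: "set_integrable lborel {0<..<t} (?L ?fb)"
    using gls_integrable_kernels(1)[OF conjunct1[OF eqX[OF tin]] \<alpha>(1) \<alpha>1]
      gls_integrable_kernels(1)[OF conjunct1[OF eqXb[OF tin]] \<alpha>(1) \<alpha>1] by auto
  have Lh: "set_integrable lborel {0<..<t} (?L ?h)"
    using set_integral_diff(1)[OF Lf Lfb] by (rule set_integrable_cong[THEN iffD1, rotated -1]) (auto simp: lk(3))
  have Qg: "set_borel_measurable lborel {0<..<s} (?Q g s)" and Qgb: "set_borel_measurable lborel {0<..<s} (?Q gb s)"
    and Qgg: "set_borel_measurable lborel {0<..<s} (?Q ?gg s)" if s: "s \<in> {0<..t}" for s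
  proof -
    have s': "s \<in> {0..t}" using s by auto
    show 1: "set_borel_measurable lborel {0<..<s} (?Q g s)" and 2: "set_borel_measurable lborel {0<..<s} (?Q gb s)"
      using gls_integrable_kernels(2)[OF conjunct1[OF eqX[OF s']] \<alpha>(1) \<alpha>1]
        gls_integrable_kernels(2)[OF conjunct1[OF eqXb[OF s']] \<alpha>(1) \<alpha>1] by auto
    have "(\<lambda>x. indicator {0<..<s} x *\<^sub>R ?Q g s x - indicator {0<..<s} x *\<^sub>R ?Q gb s x) \<in> borel_measurable lborel"
      using 1 2 unfolding set_borel_measurable_def by (rule borel_measurable_diff)
    also have "(\<lambda>x. indicator {0<..<s} x *\<^sub>R ?Q g s x - indicator {0<..<s} x *\<^sub>R ?Q gb s x) = (\<lambda>x. indicator {0<..<s} x *\<^sub>R ?Q ?gg s x)"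
      using rk[OF s'] by (auto split: split_indicator)
    finally show "set_borel_measurable lborel {0<..<s} (?Q ?gg s)" unfolding set_borel_measurable_def .
  qed
  define D1 where "D1 s = (LINT x:{0<..<s}|lborel. ?L ?h x * ?Q g s x)" for s
  define D2 where "D2 s = (LINT x:{0<..<s}|lborel. ?L ?fb x * ?Q ?gg s x)" for s
  have m1: "(\<lambda>x. ennreal (C1 * x powr (-\<alpha>)) * ?n x) \<in> borel_measurable borel"
    and m2: "(\<lambda>x. ennreal (C2 * x powr (-\<alpha>))) \<in> borel_measurable borel" by measurable
  have ggm: "?gg \<in> borel_measurable borel" by measurable
  have ib1: "incr_bound t D1 (\<lambda>x. ennreal \<Lambda> * (ennreal (C1 * x powr (-\<alpha>)) * ?n x))"
    unfolding D1_def by (intro incr_bound_kernel_integral(1)[OF \<alpha> g \<Lambda> meas(3) t(2) Lh m1] lk(1) Qg)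
  have ib2: "incr_bound t D2 (\<lambda>x. ennreal z * ennreal (C2 * x powr (-\<alpha>)))"
    unfolding D2_def by (intro incr_bound_kernel_integral(1)[OF \<alpha> gg z ggm t(2) Lfb m2] lk(2) Qgg)
  have cm: "(\<lambda>x::real. \<top>::ennreal) \<in> borel_measurable borel" by measurable
  have ints: "(LINT x:{0<..<s}|lborel. ?L ?f x * ?Q g s x) - (LINT x:{0<..<s}|lborel. ?L ?fb x * ?Q gb s x) = D1 s + D2 s"
    if s: "s \<in> {0..t}" for s
  proof -
    have i1: "set_integrable lborel {0<..<s} (\<lambda>x. ?L ?f x * ?Q g s x)"
      by (rule incr_bound_kernel_integral(2)[OF \<alpha> g \<Lambda> meas(3) t(2) Lf cm _ Qg s]) auto
    have i2: "set_integrable lborel {0<..<s} (\<lambda>x. ?L ?fb x * ?Q gb s x)"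
      by (rule incr_bound_kernel_integral(2)[OF \<alpha> gb \<Lambda> meas(4) t(2) Lfb cm _ Qgb s]) auto
    have i3: "set_integrable lborel {0<..<s} (\<lambda>x. ?L ?h x * ?Q g s x)"
      by (rule incr_bound_kernel_integral(2)[OF \<alpha> g \<Lambda> meas(3) t(2) Lh cm _ Qg s]) auto
    have i4: "set_integrable lborel {0<..<s} (\<lambda>x. ?L ?fb x * ?Q ?gg s x)"
      by (rule incr_bound_kernel_integral(2)[OF \<alpha> gg z ggm t(2) Lfb cm _ Qgg s]) auto
    have "(LINT x:{0<..<s}|lborel. ?L ?f x * ?Q g s x) - (LINT x:{0<..<s}|lborel. ?L ?fb x * ?Q gb s x)
       = (LINT x:{0<..<s}|lborel. ?L ?f x * ?Q g s x - ?L ?fb x * ?Q gb s x)"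
      by (rule set_integral_diff(2)[OF i1 i2, symmetric])
    also have "\<dots> = (LINT x:{0<..<s}|lborel. ?L ?h x * ?Q g s x + ?L ?fb x * ?Q ?gg s x)"
      using s by (intro set_lebesgue_integral_cong) (auto simp: lk(3) rk[OF s] algebra_simps)
    also have "\<dots> = D1 s + D2 s" unfolding D1_def D2_def by (rule set_integral_add(2)[OF i3 i4])
    finally show ?thesis .
  qed
  define A where "A s = (LINT r:{0..s}|lborel. a r (X r) - a r (Xb r))" for s
  have ai: "set_integrable lborel {0..T} (\<lambda>r. a r (X r))" "set_integrable lborel {0..T} (\<lambda>r. a r (Xb r))"
    using coeff_continuous(1)[OF cc \<beta>0 cont(1)] coeff_continuous(1)[OF cc \<beta>0 cont(2)]
    by (auto intro!: borel_integrable_atLeastAtMost' )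
  have mA: "(\<lambda>x. ennreal K * ?n x) \<in> borel_measurable borel" by measurable
  have ibA: "incr_bound t A (\<lambda>x. ennreal K * ?n x)"
    unfolding A_def
  proof (rule incr_bound_integral[OF less_imp_le[OF t(2)] set_integral_diff(1)[OF ai] mA])
    fix r assume r: "r \<in> {0..T}"
    have "ennreal \<bar>a r (X r) - a r (Xb r)\<bar> \<le> ennreal (K * \<bar>X r - Xb r\<bar>)"
      by (intro ennreal_leI coeff_lipschitz(1)[OF cc r])
    also have "\<dots> = ennreal K * ennreal \<bar>X r - Xb r\<bar>" using K by (simp add: ennreal_mult)
    also have "\<dots> \<le> ennreal K * ?n r" unfolding norm_at_def by (intro mult_left_mono) auto
    finally show "ennreal \<bar>a r (X r) - a r (Xb r)\<bar> \<le> ennreal K * ?n r" .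
  qed
  define P where "P s = A s + k * (D1 s + D2 s)" for s
  define m where "m r = ennreal K * ?n r + ennreal k * (ennreal \<Lambda> * (ennreal (C1 * r powr (-\<alpha>)) * ?n r) + ennreal z * ennreal (C2 * r powr (-\<alpha>)))" for r
  have ibP: "incr_bound t P m"
    unfolding P_def m_def by (intro incr_bound_add ibA incr_bound_cmult ib1 ib2 k)
  have P: "P s = ?D s - ?J s" if s: "s \<in> {0..t}" for s
  proof -
    have "complex_of_real (X s) = of_real (x0 + (LINT r:{0..s}|lborel. a r (X r)) + I s + k * (LINT x:{0<..<s}|lborel. ?L ?f x * ?Q g s x))"
      using eqX[OF s] unfolding gls_integral_eq_kernels k_def by simp
    then have 1: "X s = x0 + (LINT r:{0..s}|lborel. a r (X r)) + I s + k * (LINT x:{0<..<s}|lborel. ?L ?f x * ?Q g s x)"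
      by (rule of_real_eq_iff[THEN iffD1])
    have "complex_of_real (Xb s) = of_real (x0 + (LINT r:{0..s}|lborel. a r (Xb r)) + Ib s + k * (LINT x:{0<..<s}|lborel. ?L ?fb x * ?Q gb s x))"
      using eqXb[OF s] unfolding gls_integral_eq_kernels k_def by simp
    then have 2: "Xb s = x0 + (LINT r:{0..s}|lborel. a r (Xb r)) + Ib s + k * (LINT x:{0<..<s}|lborel. ?L ?fb x * ?Q gb s x)"
      by (rule of_real_eq_iff[THEN iffD1])
    have sub: "{0..s} \<subseteq> {0..T}" using s t by auto
    have 3: "A s = (LINT r:{0..s}|lborel. a r (X r)) - (LINT r:{0..s}|lborel. a r (Xb r))"
      unfolding A_def using sub by (intro set_integral_diff(2) set_integrable_subset[OF ai(1)] set_integrable_subset[OF ai(2)]) auto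
    show ?thesis unfolding P_def ints[OF s, symmetric] 3 right_diff_distrib using 1 2 by linarith
  qed
  have "norm_at \<alpha> t ?D = norm_at \<alpha> t (\<lambda>s. ?J s + (?D s - ?J s))" by simp
  also have "\<dots> \<le> norm_at \<alpha> t ?J + norm_at \<alpha> t (\<lambda>s. ?D s - ?J s)"
    by (rule norm_at_add_le) measurable
  also have "norm_at \<alpha> t (\<lambda>s. ?D s - ?J s) = norm_at \<alpha> t P"
    using t by (intro norm_at_cong) (auto simp: P)
  also have "\<dots> \<le> (\<integral>\<^sup>+r\<in>{0..t}. m r * ennreal (1 + C * (t - r) powr (-\<alpha>)) \<partial>lborel)"
    unfolding C_def by (rule norm_at_le_of_incr_bound[OF \<alpha> t(1) ibP])
  also have "\<dots> \<le> (\<integral>\<^sup>+r. ennreal (path_const \<alpha> \<beta> K T R \<Lambda>) * ((?n r + ennreal z) * ennreal (vol_kernel (\<alpha> + 1/2) t r) * indicator {0..t} r) \<partial>lborel)"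
  proof (rule nn_integral_mono_AE, use AE_lborel_singleton[of 0] AE_lborel_singleton[of t] in eventually_elim)
    fix r assume "r \<noteq> 0" "r \<noteq> t"
    show "m r * ennreal (1 + C * (t - r) powr (-\<alpha>)) * indicator {0..t} r
      \<le> ennreal (path_const \<alpha> \<beta> K T R \<Lambda>) * ((?n r + ennreal z) * ennreal (vol_kernel (\<alpha> + 1/2) t r) * indicator {0..t} r)"
    proof (cases "r \<in> {0..t}")
      case True
      with \<open>r \<noteq> 0\<close> \<open>r \<noteq> t\<close> have r: "0 < r" "r < t" by auto
      define w where "w = 1 + C * (t - r) powr (-\<alpha>)"
      define ra where "ra = r powr (-\<alpha>)"
      define \<kappa> where "\<kappa> = vol_kernel (\<alpha> + 1/2) t r"
      define c1 where "c1 = T powr (\<alpha> + 1/2) + C * T powr (1/2)"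
      define c2 where "c2 = T powr (1/2) + C * T powr (1/2 - \<alpha>)"
      have w0: "0 \<le> w" "0 \<le> ra" "0 \<le> \<kappa>" "0 \<le> c1" "0 \<le> c2"
        using C0 by (auto simp: w_def ra_def \<kappa>_def vol_kernel_nonneg c1_def c2_def)
      have v: "w \<le> c1 * \<kappa>" "ra * w \<le> c2 * \<kappa>"
        unfolding w_def ra_def c1_def c2_def \<kappa>_def
        using vol_kernel_dominates[OF \<alpha> r less_imp_le[OF t(2)] C0] by auto
      have pc: "path_const \<alpha> \<beta> K T R \<Lambda> = K * c1 + k * (\<Lambda> * C1 + C2) * c2"
        unfolding path_const_def Let_def k_def c1_def c2_def C1_def C2_def B_def C_def by simp
      have "m r * ennreal w = ennreal (K * w + k * \<Lambda> * C1 * (ra * w)) * ?n r + ennreal (k * C2 * (ra * w)) * ennreal z"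
        unfolding m_def ra_def[symmetric] using K k \<Lambda> C1 C2 w0
        by (simp add: ennreal_mult ennreal_plus distrib_left distrib_right mult_ac)
      also have "\<dots> \<le> ennreal (path_const \<alpha> \<beta> K T R \<Lambda> * \<kappa>) * ?n r + ennreal (path_const \<alpha> \<beta> K T R \<Lambda> * \<kappa>) * ennreal z"
      proof (intro add_mono mult_right_mono ennreal_leI)
        have e1: "K * w \<le> K * (c1 * \<kappa>)" using K v by (intro mult_left_mono) auto
        have e2: "k * \<Lambda> * C1 * (ra * w) \<le> k * \<Lambda> * C1 * (c2 * \<kappa>)" using k \<Lambda> C1 v by (intro mult_left_mono) auto
        have e3: "k * C2 * (ra * w) \<le> k * C2 * (c2 * \<kappa>)" using k C2 v by (intro mult_left_mono) auto
        have e4: "0 \<le> K * (c1 * \<kappa>)" "0 \<le> k * \<Lambda> * C1 * (c2 * \<kappa>)" "0 \<le> k * C2 * (c2 * \<kappa>)"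
          using K k \<Lambda> C1 C2 w0 by auto
        have pc': "path_const \<alpha> \<beta> K T R \<Lambda> * \<kappa> = K * (c1 * \<kappa>) + k * \<Lambda> * C1 * (c2 * \<kappa>) + k * C2 * (c2 * \<kappa>)"
          unfolding pc by (simp add: algebra_simps)
        show "K * w + k * \<Lambda> * C1 * (ra * w) \<le> path_const \<alpha> \<beta> K T R \<Lambda> * \<kappa>"
          and "k * C2 * (ra * w) \<le> path_const \<alpha> \<beta> K T R \<Lambda> * \<kappa>"
          unfolding pc' using e1 e2 e3 e4 by linarith+
      qed auto
      also have "\<dots> = ennreal (path_const \<alpha> \<beta> K T R \<Lambda>) * ((?n r + ennreal z) * ennreal \<kappa>)"
        using path_const_nonneg[OF \<alpha> \<beta> K R \<Lambda>] w0 by (simp add: ennreal_mult distrib_left mult_ac)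
      finally show ?thesis using True unfolding w_def \<kappa>_def by simp
    qed simp
  qed
  also have "\<dots> = ennreal (path_const \<alpha> \<beta> K T R \<Lambda>) *
     (\<integral>\<^sup>+r\<in>{0..t}. (?n r + ennreal z) * ennreal (vol_kernel (\<alpha> + 1/2) t r) \<partial>lborel)"
    by (rule nn_integral_cmult) measurable
  finally show ?thesis by (auto intro: add_left_mono)
qed

section \<open>A Gronwall lemma for singular kernels\<close>

lemma exp_neg_le_powr:
  fixes x \<eta> :: real
  assumes "0 < x" "0 \<le> \<eta>" "\<eta> \<le> 1"
  shows "exp (- x) \<le> x powr (-\<eta>)"
proof -
  have "x powr \<eta> \<le> exp x"
  proof (cases "x \<le> 1")
    case True
    then have "x powr \<eta> \<le> 1" using assms by (simp add: powr_le1)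
    then show ?thesis using assms exp_ge_add_one_self[of x] by linarith
  next
    case False
    then have "x powr \<eta> \<le> x powr 1" using assms by (intro powr_mono) auto
    then have "x powr \<eta> \<le> x" using assms by simp
    then show ?thesis using exp_ge_add_one_self[of x] by linarith
  qed
  then show ?thesis using assms by (simp add: exp_minus powr_minus le_imp_inverse_le)
qed

text \<open>Part of the decay of the exponential is traded for a power: as \<open>exp (- x) \<le> x powr (- \<eta>)\<close>,
  the weight costs an additional singularity of order \<open>\<eta>\<close>, for which \<open>1 - \<mu>\<close> leaves room, and
  gains a negative power of \<open>\<theta>\<close>.\<close>

lemma vol_kernel_exp_integral:
  assumes \<mu>: "0 < \<mu>" "\<mu> < 1" and \<theta>: "0 < \<theta>" and t: "0 < t" "t \<le> T"
  defines "\<eta> \<equiv> (1 - \<mu>) / 2"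
  shows "(\<integral>\<^sup>+u\<in>{0..t}. ennreal (vol_kernel \<mu> t u * exp (- \<theta> * (t - u))) \<partial>lborel)
    \<le> ennreal (\<theta> powr (-\<eta>) * (3 * T powr \<eta> / \<eta>))"
proof -
  have \<eta>: "0 < \<eta>" "\<eta> \<le> 1" "1 - (\<mu> + \<eta>) = \<eta>" "\<mu> + \<eta> < 1" using \<mu> by (auto simp: \<eta>_def field_simps)
  let ?p = "\<mu> + \<eta>"
  have pt: "vol_kernel \<mu> t u * exp (- \<theta> * (t - u)) \<le> \<theta> powr (-\<eta>) * (u powr (-?p) + 2 * (t - u) powr (-?p))"
    if u: "0 < u" "u < t" for u
  proof -
    have "exp (- (\<theta> * (t - u))) \<le> (\<theta> * (t - u)) powr (-\<eta>)" using u \<theta> \<eta> by (intro exp_neg_le_powr) auto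
    also have "\<dots> = \<theta> powr (-\<eta>) * (t - u) powr (-\<eta>)" using u \<theta> by (simp add: powr_mult)
    finally have e: "exp (- \<theta> * (t - u)) \<le> \<theta> powr (-\<eta>) * (t - u) powr (-\<eta>)" by simp
    have "u powr (-\<mu>) * (t - u) powr (-\<eta>) \<le> u powr (-?p) + (t - u) powr (-?p)"
      using u \<mu> \<eta> by (intro powr_neg_mult_le_add) auto
    moreover have "(t - u) powr (-\<mu>) * (t - u) powr (-\<eta>) = (t - u) powr (-?p)" by (simp add: powr_add[symmetric])
    ultimately have k: "vol_kernel \<mu> t u * (t - u) powr (-\<eta>) \<le> u powr (-?p) + 2 * (t - u) powr (-?p)"
      unfolding vol_kernel_def by (simp add: distrib_right)
    have "vol_kernel \<mu> t u * exp (- \<theta> * (t - u)) \<le> vol_kernel \<mu> t u * (\<theta> powr (-\<eta>) * (t - u) powr (-\<eta>))"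
      by (intro mult_left_mono e vol_kernel_nonneg)
    also have "\<dots> = \<theta> powr (-\<eta>) * (vol_kernel \<mu> t u * (t - u) powr (-\<eta>))" by simp
    also have "\<dots> \<le> \<theta> powr (-\<eta>) * (u powr (-?p) + 2 * (t - u) powr (-?p))"
      by (intro mult_left_mono k) auto
    finally show ?thesis .
  qed
  have "(\<integral>\<^sup>+u\<in>{0..t}. ennreal (vol_kernel \<mu> t u * exp (- \<theta> * (t - u))) \<partial>lborel)
    \<le> (\<integral>\<^sup>+u. ennreal (\<theta> powr (-\<eta>)) * (ennreal ((u - 0) powr (-?p)) * indicator {0..t} u + 2 * (ennreal ((t - u) powr (-?p)) * indicator {0..t} u)) \<partial>lborel)"
  proof (rule nn_integral_mono_AE, use AE_lborel_singleton[of 0] AE_lborel_singleton[of t] in eventually_elim)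
    fix u assume "u \<noteq> 0" "u \<noteq> t"
    then show "ennreal (vol_kernel \<mu> t u * exp (- \<theta> * (t - u))) * indicator {0..t} u
      \<le> ennreal (\<theta> powr (-\<eta>)) * (ennreal ((u - 0) powr (-?p)) * indicator {0..t} u + 2 * (ennreal ((t - u) powr (-?p)) * indicator {0..t} u))"
      using ennreal_leI[OF pt[of u]] by (auto split: split_indicator simp: ennreal_mult ennreal_plus)
  qed
  also have "\<dots> = ennreal (\<theta> powr (-\<eta>)) * (ennreal ((t - 0) powr (1 - ?p) / (1 - ?p)) + 2 * ennreal ((t - 0) powr (1 - ?p) / (1 - ?p)))"
    using t \<eta> by (subst nn_integral_cmult, measurable) (subst nn_integral_add, measurable, subst nn_integral_cmult, measurable,
       simp only: nn_integral_powr_left nn_integral_powr_right less_imp_le)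
  also have "\<dots> = ennreal (\<theta> powr (-\<eta>) * (3 * t powr \<eta> / \<eta>))"
    unfolding \<eta>(3) using \<eta> by (subst ennreal_numeral[symmetric]) (simp add: ennreal_mult[symmetric] ennreal_plus[symmetric] del: ennreal_plus ennreal_numeral)
  also have "\<dots> \<le> ennreal (\<theta> powr (-\<eta>) * (3 * T powr \<eta> / \<eta>))"
    using t \<eta> by (intro ennreal_leI mult_left_mono divide_right_mono powr_mono2) auto
  finally show ?thesis .
qed

text \<open>Let \<open>\<psi>\<close> be the supremum of \<open>\<phi> t * exp (- \<theta> t)\<close>. For large \<open>\<theta>\<close> the weighted kernel has
  integral at most \<open>1/2\<close>, so \<open>\<psi> \<le> A + \<psi>/2\<close>; the bound \<open>B\<close> serves to make \<open>\<psi>\<close> finite, and then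
  \<open>\<psi> \<le> 2 A\<close>. The factor \<open>G\<close> does not depend on \<open>\<phi>\<close>, \<open>A\<close> or \<open>B\<close>.\<close>

lemma singular_gronwall:
  assumes \<mu>: "0 < \<mu>" "\<mu> < 1" and C: "0 \<le> C" and T: "0 < T"
  obtains G where "0 \<le> G"
    "\<And>\<phi> A B. \<lbrakk>\<phi> \<in> borel_measurable borel; \<And>t. t \<in> {0<..<T} \<Longrightarrow> \<phi> t \<le> ennreal B;
       \<And>t. t \<in> {0<..<T} \<Longrightarrow> \<phi> t \<le> A + ennreal C * (\<integral>\<^sup>+u\<in>{0..t}. \<phi> u * ennreal (vol_kernel \<mu> t u) \<partial>lborel)\<rbrakk>
     \<Longrightarrow> \<forall>t\<in>{0<..<T}. \<phi> t \<le> ennreal G * A"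
proof -
  define \<eta> where "\<eta> = (1 - \<mu>) / 2"
  have \<eta>: "0 < \<eta>" using \<mu> by (simp add: \<eta>_def)
  define D where "D = C * (3 * T powr \<eta> / \<eta>)"
  have D: "0 \<le> D" using C \<eta> by (simp add: D_def)
  \<comment> \<open>chosen so that \<open>D * \<theta> powr (- \<eta>) \<le> 1/2\<close>\<close>
  define \<theta> where "\<theta> = (2 * D + 1) powr (1 / \<eta>)"
  have \<theta>: "0 < \<theta>" using D by (simp add: \<theta>_def)
  have "\<theta> powr (-\<eta>) = 1 / (2 * D + 1)" using D \<eta> by (simp add: \<theta>_def powr_powr powr_minus_divide)
  then have "C * (\<theta> powr (-\<eta>) * (3 * T powr \<eta> / \<eta>)) = D * (1 / (2 * D + 1))"
    unfolding D_def by simp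
  also have "\<dots> \<le> 1/2" using D by (simp add: field_simps)
  finally have half: "C * (\<theta> powr (-\<eta>) * (3 * T powr \<eta> / \<eta>)) \<le> 1/2" .
  show ?thesis
  proof (rule that[of "2 * exp (\<theta> * T)"])
    fix \<phi> :: "real \<Rightarrow> ennreal" and A B
    assume m [measurable]: "\<phi> \<in> borel_measurable borel"
      and bd: "\<And>t. t \<in> {0<..<T} \<Longrightarrow> \<phi> t \<le> ennreal B"
      and ineq: "\<And>t. t \<in> {0<..<T} \<Longrightarrow> \<phi> t \<le> A + ennreal C * (\<integral>\<^sup>+u\<in>{0..t}. \<phi> u * ennreal (vol_kernel \<mu> t u) \<partial>lborel)"
    define \<psi> where "\<psi> = (SUP t\<in>{0<..<T}. \<phi> t * ennreal (exp (- \<theta> * t)))"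
    have \<psi>_ge: "\<phi> t * ennreal (exp (- \<theta> * t)) \<le> \<psi>" if "t \<in> {0<..<T}" for t
      unfolding \<psi>_def using that by (rule SUP_upper)
    have ee: "ennreal (exp x) * ennreal (exp (- x)) = 1" for x :: real
      by (simp add: ennreal_mult[symmetric] exp_add[symmetric])
    have \<phi>_le: "\<phi> t \<le> \<psi> * ennreal (exp (\<theta> * t))" if "t \<in> {0<..<T}" for t
    proof -
      have "\<phi> t = \<phi> t * (ennreal (exp (\<theta> * t)) * ennreal (exp (- (\<theta> * t))))" unfolding ee by simp
      also have "\<dots> = (\<phi> t * ennreal (exp (- \<theta> * t))) * ennreal (exp (\<theta> * t))" by (simp add: mult_ac)
      also have "\<dots> \<le> \<psi> * ennreal (exp (\<theta> * t))" by (intro mult_right_mono \<psi>_ge that) auto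
      finally show ?thesis .
    qed
    have "\<psi> \<le> ennreal B"
      unfolding \<psi>_def
    proof (rule SUP_least)
      fix t assume t: "t \<in> {0<..<T}"
      have "\<phi> t * ennreal (exp (- \<theta> * t)) \<le> ennreal B * 1"
        using t \<theta> by (intro mult_mono bd) (auto simp flip: ennreal_1 intro!: ennreal_leI simp del: ennreal_1)
      then show "\<phi> t * ennreal (exp (- \<theta> * t)) \<le> ennreal B" by simp
    qed
    then have fin: "\<psi> < \<top>" by (rule le_less_trans) simp
    have "\<psi> \<le> A + ennreal (1/2) * \<psi>"
      unfolding \<psi>_def
    proof (rule SUP_least, fold \<psi>_def)
      fix t assume t: "t \<in> {0<..<T}"
      have "(\<integral>\<^sup>+u\<in>{0..t}. \<phi> u * ennreal (vol_kernel \<mu> t u) \<partial>lborel) * ennreal (exp (- \<theta> * t))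
        \<le> (\<integral>\<^sup>+u. \<psi> * (ennreal (vol_kernel \<mu> t u * exp (- \<theta> * (t - u))) * indicator {0..t} u) \<partial>lborel)"
      proof (subst nn_integral_multc[symmetric], measurable, rule nn_integral_mono_AE, use AE_lborel_singleton[of 0] in eventually_elim)
        fix u :: real assume u0: "u \<noteq> 0"
        show "\<phi> u * ennreal (vol_kernel \<mu> t u) * indicator {0..t} u * ennreal (exp (- \<theta> * t))
          \<le> \<psi> * (ennreal (vol_kernel \<mu> t u * exp (- \<theta> * (t - u))) * indicator {0..t} u)"
        proof (cases "u \<in> {0..t}")
          case True
          have ex: "exp (\<theta> * u) * exp (- \<theta> * t) = exp (- \<theta> * (t - u))"
            by (simp add: exp_add[symmetric] algebra_simps)
          have "\<phi> u * ennreal (vol_kernel \<mu> t u) * ennreal (exp (- \<theta> * t))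
             \<le> (\<psi> * ennreal (exp (\<theta> * u))) * ennreal (vol_kernel \<mu> t u) * ennreal (exp (- \<theta> * t))"
            using True t u0 by (intro mult_right_mono \<phi>_le) auto
          also have "\<dots> = \<psi> * ennreal (vol_kernel \<mu> t u * (exp (\<theta> * u) * exp (- \<theta> * t)))"
            using vol_kernel_nonneg[of \<mu> t u] by (simp add: ennreal_mult mult_ac)
          finally show ?thesis unfolding ex using True by simp
        qed simp
      qed
      also have "\<dots> = \<psi> * (\<integral>\<^sup>+u\<in>{0..t}. ennreal (vol_kernel \<mu> t u * exp (- \<theta> * (t - u))) \<partial>lborel)"
        by (rule nn_integral_cmult) measurable
      also have "\<dots> \<le> \<psi> * ennreal (\<theta> powr (-\<eta>) * (3 * T powr \<eta> / \<eta>))"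
        unfolding \<eta>_def using t by (intro mult_left_mono vol_kernel_exp_integral \<mu> \<theta>) auto
      finally have I: "(\<integral>\<^sup>+u\<in>{0..t}. \<phi> u * ennreal (vol_kernel \<mu> t u) \<partial>lborel) * ennreal (exp (- \<theta> * t)) \<le> \<dots>" .
      have "\<phi> t * ennreal (exp (- \<theta> * t)) \<le>
         (A + ennreal C * (\<integral>\<^sup>+u\<in>{0..t}. \<phi> u * ennreal (vol_kernel \<mu> t u) \<partial>lborel)) * ennreal (exp (- \<theta> * t))"
        by (intro mult_right_mono ineq t) auto
      also have "\<dots> = A * ennreal (exp (- \<theta> * t)) + ennreal C * ((\<integral>\<^sup>+u\<in>{0..t}. \<phi> u * ennreal (vol_kernel \<mu> t u) \<partial>lborel) * ennreal (exp (- \<theta> * t)))"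
        by (simp add: distrib_right mult.assoc)
      also have "\<dots> \<le> A * 1 + ennreal C * (\<psi> * ennreal (\<theta> powr (-\<eta>) * (3 * T powr \<eta> / \<eta>)))"
        using t \<theta> by (intro add_mono mult_left_mono I) (auto simp flip: ennreal_1 intro!: ennreal_leI simp del: ennreal_1)
      also have "ennreal C * (\<psi> * ennreal (\<theta> powr (-\<eta>) * (3 * T powr \<eta> / \<eta>))) = ennreal (C * (\<theta> powr (-\<eta>) * (3 * T powr \<eta> / \<eta>))) * \<psi>"
        proof -
        have "0 \<le> \<theta> powr (-\<eta>) * (3 * T powr \<eta> / \<eta>)" using \<eta> by simp
        from ennreal_mult[OF C this] show ?thesis by (simp only: mult_ac)
      qed
      also have "\<dots> \<le> ennreal (1/2) * \<psi>" by (intro mult_right_mono ennreal_leI half) auto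
      finally show "\<phi> t * ennreal (exp (- \<theta> * t)) \<le> A + ennreal (1/2) * \<psi>" by (auto intro: add_left_mono)
    qed
    then have \<psi>A: "\<psi> \<le> 2 * A"
    proof (cases A)
      case (real r)
      obtain s where s: "\<psi> = ennreal s" "0 \<le> s" using fin by (cases \<psi>) auto
      have "ennreal r + ennreal (1/2) * ennreal s = ennreal (r + 1/2 * s)"
        using s(2) real by (subst ennreal_mult[symmetric], simp, simp, subst ennreal_plus[symmetric]) auto
      with \<open>\<psi> \<le> A + ennreal (1/2) * \<psi>\<close> have "ennreal s \<le> ennreal (r + 1/2 * s)"
        unfolding s(1) real by simp
      then have "s \<le> 2 * r" using s(2) real by (subst (asm) ennreal_le_iff) auto
      then have "ennreal s \<le> ennreal (2 * r)" by (rule ennreal_leI)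
      then show ?thesis unfolding s(1) real using real by (simp add: ennreal_mult)
    qed (simp add: ennreal_mult_top)
    show "\<forall>t\<in>{0<..<T}. \<phi> t \<le> ennreal (2 * exp (\<theta> * T)) * A"
    proof
      fix t assume t: "t \<in> {0<..<T}"
      have "\<phi> t \<le> \<psi> * ennreal (exp (\<theta> * t))" by (rule \<phi>_le[OF t])
      also have "\<dots> \<le> (2 * A) * ennreal (exp (\<theta> * T))"
        using t \<theta> by (intro mult_mono \<psi>A ennreal_leI) auto
      also have "\<dots> = ennreal (2 * exp (\<theta> * T)) * A"
        by (simp add: ennreal_mult mult_ac)
      finally show "\<phi> t \<le> ennreal (2 * exp (\<theta> * T)) * A" .
    qed
  qed simp
qed

section \<open>The It\^o integral of simple processes\<close>

definition strict_partition :: "nat \<Rightarrow> (nat \<Rightarrow> real) \<Rightarrow> bool" where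
  "strict_partition m q \<longleftrightarrow> (\<forall>i<m. q i < q (Suc i))"

lemma strict_partitionD: "strict_partition m q \<Longrightarrow> i < m \<Longrightarrow> q i < q (Suc i)"
  by (simp add: strict_partition_def)

lemma enumerate_finite_set:
  fixes Q :: "real set"
  assumes "finite Q" "Q \<noteq> {}"
  obtains m q where "strict_partition m q" "q ` {..m} = Q"
proof -
  define l where "l = sorted_list_of_set Q"
  define m where "m = length l - 1"
  have l: "sorted_wrt (<) l" "set l = Q" using assms by (auto simp: l_def)
  have len: "length l = Suc m" using assms l(2) by (cases l) (auto simp: m_def)
  show ?thesis
  proof (rule that[of m "\<lambda>i. l ! i"])
    show "strict_partition m (\<lambda>i. l ! i)"
      using sorted_wrt_nth_less[OF l(1)] len by (simp add: strict_partition_def)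
    show "(\<lambda>i. l ! i) ` {..m} = Q"
      using l(2) len by (auto simp: set_conv_nth less_Suc_eq_le image_iff)
  qed
qed

lemma strict_partition_less:
  fixes q :: "nat \<Rightarrow> real"
  assumes q: "strict_partition m q" and "i < j" "j \<le> m"
  shows "q i < q j"
  using assms(2,3)
proof (induction j)
  case (Suc j)
  then show ?case using strict_partitionD[OF q, of j] by (cases "i = j") auto
qed simp

lemma strict_partition_iff:
  fixes q :: "nat \<Rightarrow> real"
  assumes q: "strict_partition m q" and "i \<le> m" "j \<le> m"
  shows "q i < q j \<longleftrightarrow> i < j" "q i \<le> q j \<longleftrightarrow> i \<le> j"
  using strict_partition_less[OF q, of i j] strict_partition_less[OF q, of j i] assms(2,3)
  by (cases i j rule: linorder_cases; simp)+

lemma strict_partition_telescope: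
  fixes q :: "nat \<Rightarrow> real" and f :: "real \<Rightarrow> real"
  assumes q: "strict_partition m q" and "a \<in> q ` {..m}" "b \<in> q ` {..m}" "a \<le> b"
  shows "(\<Sum>j<m. indicator {a<..b} (q (Suc j)) * (f (q (Suc j)) - f (q j))) = f b - f a"
proof -
  obtain ja jb where j: "a = q ja" "b = q jb" "ja \<le> m" "jb \<le> m" using assms by auto
  have le: "ja \<le> jb" using strict_partition_iff(2)[OF q j(3,4)] assms(4) j by simp
  have "(\<Sum>j<m. indicator {a<..b} (q (Suc j)) * (f (q (Suc j)) - f (q j))) = (\<Sum>j\<in>{ja..<jb}. f (q (Suc j)) - f (q j))"
  proof (rule sum.mono_neutral_cong_right)
    show "{ja..<jb} \<subseteq> {..<m}" using j by auto
    show "\<forall>i\<in>{..<m} - {ja..<jb}. indicator {a<..b} (q (Suc i)) * (f (q (Suc i)) - f (q i)) = 0"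
      using strict_partition_iff[OF q] j by (auto simp: indicator_def)
    show "indicator {a<..b} (q (Suc i)) * (f (q (Suc i)) - f (q i)) = f (q (Suc i)) - f (q i)" if "i \<in> {ja..<jb}" for i
      using strict_partition_iff[OF q] j that by (auto simp: indicator_def)
  qed auto
  also have "\<dots> = f b - f a" unfolding j using le by (rule sum_Suc_diff')
  finally show ?thesis .
qed

text \<open>Add to the given points a regular grid of width \<open>\<delta>\<close>, cut off at \<open>t\<close>.\<close>

lemma fine_partition:
  fixes s t \<delta> :: real
  assumes "s < t" "finite P" "P \<subseteq> {s..t}" "0 < \<delta>"
  obtains m q where "strict_partition m q" "P \<subseteq> q ` {..m}" "q ` {..m} \<subseteq> {s..t}"
    "q 0 = s" "q m = t" "\<And>i. i < m \<Longrightarrow> q (Suc i) - q i \<le> \<delta>"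
proof -
  define k where "k = nat \<lceil>(t - s) / \<delta>\<rceil>"
  have k: "t \<le> s + real k * \<delta>"
  proof -
    have "(t - s) / \<delta> \<le> real k" unfolding k_def by linarith
    then show ?thesis using assms by (simp add: field_simps)
  qed
  define Q where "Q = P \<union> (\<lambda>i. min t (s + real i * \<delta>)) ` {..k}"
  have tQ: "t \<in> Q" unfolding Q_def using k by (auto intro!: image_eqI[of _ _ k])
  have sQ: "s \<in> Q" unfolding Q_def using assms by (auto intro!: image_eqI[of _ _ 0])
  have sub: "Q \<subseteq> {s..t}" unfolding Q_def using assms by auto
  obtain m q where mq: "strict_partition m q" "q ` {..m} = Q"
    using enumerate_finite_set[of Q] tQ assms(2) unfolding Q_def by blast
  note iff = strict_partition_iff[OF mq(1)]
  have q0: "q 0 = s"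
  proof -
    obtain i where "i \<le> m" "q i = s" using sQ mq(2) by auto
    then have "q 0 \<le> s" using iff(2)[of 0 i] by auto
    moreover have "s \<le> q 0" using sub mq(2) by auto
    ultimately show ?thesis by simp
  qed
  have qm: "q m = t"
  proof -
    obtain i where "i \<le> m" "q i = t" using tQ mq(2) by auto
    then have "t \<le> q m" using iff(2)[of i m] by auto
    moreover have "q m \<le> t" using sub mq(2) by auto
    ultimately show ?thesis by simp
  qed
  have mesh: "q (Suc i) - q i \<le> \<delta>" if i: "i < m" for i
  proof -
    have "q i < t" using iff(1)[of i m] qm i by simp
    have "q i \<in> Q" using mq(2) i by (metis atMost_iff image_eqI less_imp_le)
    then have "q i \<ge> s" using sub by auto
    define j where "j = nat (\<lfloor>(q i - s) / \<delta>\<rfloor> + 1)"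
    have j: "real j = real_of_int \<lfloor>(q i - s) / \<delta>\<rfloor> + 1" using \<open>q i \<ge> s\<close> assms by (simp add: j_def)
    have "(q i - s) / \<delta> < real j" "real j \<le> (q i - s) / \<delta> + 1" unfolding j by linarith+
    then have j1: "q i < s + real j * \<delta>" "s + real j * \<delta> \<le> q i + \<delta>" using assms by (auto simp: field_simps)
    have g: "min t (s + real j * \<delta>) \<in> Q"
    proof (cases "j \<le> k")
      case False
      then have "real k * \<delta> \<le> real j * \<delta>" using assms by (intro mult_right_mono) auto
      then have "min t (s + real j * \<delta>) = t" using k by auto
      then show ?thesis using tQ by simp
    qed (auto simp: Q_def)
    then obtain l where l: "l \<le> m" "q l = min t (s + real j * \<delta>)" using mq(2) by (metis atMost_iff imageE)
    then have "i < l" using iff(1)[of i l] j1 \<open>q i < t\<close> i by simp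
    then have "q (Suc i) \<le> q l" using iff(2)[of "Suc i" l] l i by simp
    then show ?thesis using l j1 by simp
  qed
  show ?thesis
    using that[of m q] mq sub q0 qm mesh unfolding Q_def by blast
qed

text \<open>The points of \<open>p\<close> partition \<open>[0, T]\<close>, whereas \<open>q\<close> partitions \<open>[s, t]\<close>; clamping them to
  \<open>[s, t]\<close> does not change the increment over \<open>[s, t]\<close> of an integral along \<open>p\<close>.\<close>

definition refines :: "nat \<Rightarrow> (nat \<Rightarrow> real) \<Rightarrow> real \<Rightarrow> real \<Rightarrow> nat \<Rightarrow> (nat \<Rightarrow> real) \<Rightarrow> bool" where
  "refines m q s t n p \<longleftrightarrow> strict_partition m q \<and> q 0 = s \<and> q m = t \<and>
     (\<forall>i\<le>n. max s (min (p i) t) \<in> q ` {..m})"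

lemma refines_le_iff:
  assumes r: "refines m q s t n p" and "i \<le> n" "j < m"
  shows "p i < q (Suc j) \<longleftrightarrow> p i \<le> q j"
proof
  have q: "strict_partition m q" using r by (auto simp: refines_def)
  have bd: "s \<le> q j" "q (Suc j) \<le> t"
    using r strict_partition_iff(2)[OF q, of 0 j] strict_partition_iff(2)[OF q, of "Suc j" m] \<open>j < m\<close>
    by (auto simp: refines_def)
  obtain l where l: "l \<le> m" "q l = max s (min (p i) t)" using r \<open>i \<le> n\<close> unfolding refines_def by (metis atMost_iff imageE)
  assume "p i < q (Suc j)"
  then have "q l < q (Suc j)" using l bd strict_partitionD[OF q \<open>j < m\<close>] by auto
  then have "l \<le> j" using strict_partition_iff(1)[OF q, of l "Suc j"] l \<open>j < m\<close> by simp
  then have "q l \<le> q j" using strict_partition_iff(2)[OF q, of l j] l \<open>j < m\<close> by simp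
  then show "p i \<le> q j" using l bd strict_partitionD[OF q \<open>j < m\<close>] by (auto simp: max_def min_def split: if_splits)
next
  assume "p i \<le> q j" then show "p i < q (Suc j)" using r \<open>j < m\<close> unfolding refines_def by (meson order_le_less_trans strict_partitionD)
qed

lemma simple_val_const:
  assumes r: "refines m q s t n p" and "j < m" "q j < u" "u \<le> q (Suc j)"
  shows "simple_val n p \<xi> u \<omega> = simple_val n p \<xi> (q (Suc j)) \<omega>"
  unfolding simple_val_def
proof (rule sum.cong[OF refl])
  fix i assume "i \<in> {..<n}"
  then have "p i < u \<longleftrightarrow> p i < q (Suc j)" "p (Suc i) < u \<longleftrightarrow> p (Suc i) < q (Suc j)"
    using refines_le_iff[OF r, of i j] refines_le_iff[OF r, of "Suc i" j] assms(2-4) by auto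
  then show "\<xi> i \<omega> * indicator {p i<..p (Suc i)} u = \<xi> i \<omega> * indicator {p i<..p (Suc i)} (q (Suc j))"
    by (simp add: indicator_def not_less[symmetric])
qed

lemma simple_integral_increment:
  assumes sp: "simple_process M F T n p \<xi>" and r: "refines m q s t n p" and st: "0 \<le> s" "s \<le> t" "t \<le> T"
  shows "simple_integral W n p \<xi> t \<omega> - simple_integral W n p \<xi> s \<omega>
    = (\<Sum>j<m. simple_val n p \<xi> (q (Suc j)) \<omega> * (W (q (Suc j)) \<omega> - W (q j) \<omega>))"
proof -
  have q: "strict_partition m q" using r by (auto simp: refines_def)
  let ?c = "\<lambda>x. max s (min x t)"
  have W: "W (min x t) \<omega> - W (min x s) \<omega> = W (?c x) \<omega> - W s \<omega>" for x
    using st by (auto simp: max_def min_def)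
  have "simple_integral W n p \<xi> t \<omega> - simple_integral W n p \<xi> s \<omega> = (\<Sum>i<n. \<xi> i \<omega> * (W (?c (p (Suc i))) \<omega> - W (?c (p i)) \<omega>))"
    unfolding simple_integral_def sum_subtractf[symmetric] right_diff_distrib[symmetric]
  proof (intro sum.cong refl arg_cong2[where f="(*)"])
    fix i
    show "W (min (p (Suc i)) t) \<omega> - W (min (p i) t) \<omega> - (W (min (p (Suc i)) s) \<omega> - W (min (p i) s) \<omega>)
      = W (?c (p (Suc i))) \<omega> - W (?c (p i)) \<omega>"
      using W[of "p (Suc i)"] W[of "p i"] by linarith
  qed
  also have "\<dots> = (\<Sum>i<n. \<Sum>j<m. \<xi> i \<omega> * (indicator {p i<..p (Suc i)} (q (Suc j)) * (W (q (Suc j)) \<omega> - W (q j) \<omega>)))"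
  proof (intro sum.cong refl)
    fix i assume i: "i \<in> {..<n}"
    have "p i < p (Suc i)" using sp i by (auto simp: simple_process_def)
    then have "W (?c (p (Suc i))) \<omega> - W (?c (p i)) \<omega> = (\<Sum>j<m. indicator {?c (p i)<..?c (p (Suc i))} (q (Suc j)) * (W (q (Suc j)) \<omega> - W (q j) \<omega>))"
      using r i by (intro strict_partition_telescope[OF q, where f="\<lambda>x. W x \<omega>", symmetric]) (auto simp: refines_def)
    also have "\<dots> = (\<Sum>j<m. indicator {p i<..p (Suc i)} (q (Suc j)) * (W (q (Suc j)) \<omega> - W (q j) \<omega>))"
    proof (intro sum.cong refl arg_cong2[where f="(*)"])
      fix j assume j: "j \<in> {..<m}"
      then have "s < q (Suc j)" "q (Suc j) \<le> t"
        using r strict_partition_less[OF q, of 0 "Suc j"] strict_partition_iff(2)[OF q, of "Suc j" m] by (auto simp: refines_def)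
      then show "(indicator {?c (p i)<..?c (p (Suc i))} (q (Suc j)) :: real) = indicator {p i<..p (Suc i)} (q (Suc j))"
        by (auto simp: indicator_def)
    qed
    finally show "\<xi> i \<omega> * (W (?c (p (Suc i))) \<omega> - W (?c (p i)) \<omega>)
       = (\<Sum>j<m. \<xi> i \<omega> * (indicator {p i<..p (Suc i)} (q (Suc j)) * (W (q (Suc j)) \<omega> - W (q j) \<omega>)))"
      by (simp only: sum_distrib_left)
  qed
  also have "\<dots> = (\<Sum>j<m. simple_val n p \<xi> (q (Suc j)) \<omega> * (W (q (Suc j)) \<omega> - W (q j) \<omega>))"
    unfolding simple_val_def sum_distrib_right by (subst sum.swap) (simp add: mult.assoc)
  finally show ?thesis .
qed

lemma standard_filtrationD:
  assumes "standard_filtration M F T" "t \<in> {0..T}"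
  shows "space (F t) = space M" "sets (F t) \<subseteq> sets M" "\<And>s. s \<in> {0..t} \<Longrightarrow> sets (F s) \<subseteq> sets (F t)"
    "null_sets M \<subseteq> sets (F t)"
proof -
  show "space (F t) = space M" "sets (F t) \<subseteq> sets M"
    using assms by (auto simp: standard_filtration_def subalgebra_def)
  show *: "sets (F s) \<subseteq> sets (F t)" if "s \<in> {0..t}" for s
    using assms that unfolding standard_filtration_def by auto
  have "null_sets M \<subseteq> sets (F 0)" using assms unfolding standard_filtration_def by blast
  also have "\<dots> \<subseteq> sets (F t)" using assms by (intro *) auto
  finally show "null_sets M \<subseteq> sets (F t)" .
qed

lemma standard_filtration_measurable_mono:
  assumes "standard_filtration M F T" "f \<in> measurable (F s) N" "s \<in> {0..t}" "t \<in> {0..T}"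
  shows "f \<in> measurable (F t) N"
proof (rule measurable_mono[THEN subsetD, OF order_refl refl _ _ assms(2)])
  show "sets (F s) \<subseteq> sets (F t)" using standard_filtrationD(3)[OF assms(1,4,3)] .
  show "space (F s) = space (F t)" using standard_filtrationD(1)[OF assms(1)] assms(3,4) by auto
qed

lemma standard_filtration_measurable_M:
  assumes "standard_filtration M F T" "f \<in> measurable (F t) N" "t \<in> {0..T}"
  shows "f \<in> measurable M N"
proof (rule measurable_mono[THEN subsetD, OF order_refl refl _ _ assms(2)])
  show "sets (F t) \<subseteq> sets M" "space (F t) = space M" using standard_filtrationD[OF assms(1,3)] by auto
qed

text \<open>All intervals of \<open>p\<close> that contain \<open>q (Suc j)\<close> begin at or before \<open>q j\<close>, so the value on
  the \<open>j\<close>-th interval is known at its left end.\<close>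

lemma simple_val_measurable:
  assumes fil: "standard_filtration M F T" and sp: "simple_process M F T n p \<xi>" and r: "refines m q s t n p" and st: "0 \<le> s" "s \<le> t" "t \<le> T"
    and j: "j < m"
  shows "simple_val n p \<xi> (q (Suc j)) \<in> borel_measurable (F (q j))"
    and "\<exists>B. \<forall>\<omega>\<in>space M. \<bar>simple_val n p \<xi> (q (Suc j)) \<omega>\<bar> \<le> B"
proof -
  have q: "strict_partition m q" using r by (auto simp: refines_def)
  have qj: "q j \<in> {0..T}" using r st j strict_partition_iff(2)[OF q, of 0 j] strict_partition_iff(2)[OF q, of j m] by (auto simp: refines_def)
  have pos: "0 \<le> p i" if "i \<le> n" for i
    using sp strict_partition_iff(2)[of n p 0 i] that by (auto simp: simple_process_def strict_partition_def)
  have "(\<lambda>\<omega>. \<Sum>i<n. \<xi> i \<omega> * indicator {p i<..p (Suc i)} (q (Suc j))) \<in> borel_measurable (F (q j))"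
  proof (rule borel_measurable_sum)
    fix i assume i: "i \<in> {..<n}"
    show "(\<lambda>\<omega>. \<xi> i \<omega> * indicator {p i<..p (Suc i)} (q (Suc j))) \<in> borel_measurable (F (q j))"
    proof (cases "p i < q (Suc j)")
      case True
      then have "p i \<le> q j" using refines_le_iff[OF r, of i j] i j by auto
      then have "\<xi> i \<in> borel_measurable (F (q j))"
        using sp i pos[of i] qj
        by (intro standard_filtration_measurable_mono[where F=F and s="p i" and t="q j", OF fil]) (simp_all add: simple_process_def)
      then show ?thesis by measurable
    qed (simp add: indicator_def)
  qed
  then show "simple_val n p \<xi> (q (Suc j)) \<in> borel_measurable (F (q j))" unfolding simple_val_def[abs_def] .
  obtain B where B: "\<And>i \<omega>. i < n \<Longrightarrow> \<omega> \<in> space M \<Longrightarrow> \<bar>\<xi> i \<omega>\<bar> \<le> B i" using sp unfolding simple_process_def by metis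
  have "\<bar>simple_val n p \<xi> (q (Suc j)) \<omega>\<bar> \<le> (\<Sum>i<n. B i)" if "\<omega> \<in> space M" for \<omega>
    unfolding simple_val_def
  proof (rule order_trans[OF sum_abs], rule sum_mono)
    fix i assume "i \<in> {..<n}"
    then have "\<bar>\<xi> i \<omega>\<bar> \<le> B i" using B that by auto
    then show "\<bar>\<xi> i \<omega> * indicator {p i<..p (Suc i)} (q (Suc j))\<bar> \<le> B i"
      by (auto simp: indicator_def)
  qed
  then show "\<exists>B. \<forall>\<omega>\<in>space M. \<bar>simple_val n p \<xi> (q (Suc j)) \<omega>\<bar> \<le> B" by blast
qed

lemma wiener_increment:
  assumes "prob_space M" and fil: "standard_filtration M F T" and w: "wiener_process M F T W"
    and st: "0 \<le> s" "s < t" "t \<le> T"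
    and Y: "Y \<in> borel_measurable (F s)" "integrable M Y"
  shows "integrable M (\<lambda>\<omega>. Y \<omega> * (W t \<omega> - W s \<omega>))" "(\<integral>\<omega>. Y \<omega> * (W t \<omega> - W s \<omega>) \<partial>M) = 0"
    "integrable M (\<lambda>\<omega>. Y \<omega> * (W t \<omega> - W s \<omega>)\<^sup>2)" "(\<integral>\<omega>. Y \<omega> * (W t \<omega> - W s \<omega>)\<^sup>2 \<partial>M) = (t - s) * (\<integral>\<omega>. Y \<omega> \<partial>M)"
    "integrable M (\<lambda>\<omega>. (W t \<omega> - W s \<omega>)\<^sup>2)"
proof -
  interpret prob_space M by fact
  let ?D = "\<lambda>\<omega>. W t \<omega> - W s \<omega>"
  have s: "s \<in> {0..T}" "t \<in> {s<..T}" using st by auto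
  have dist: "distributed M lborel ?D (normal_density 0 (sqrt (t - s)))"
    and ind: "indep_set (sets (F s)) {?D -` B \<inter> space M | B. B \<in> sets borel}"
    using w s unfolding wiener_process_def by blast+
  have sg: "0 < sqrt (t - s)" using st by simp
  have Dm [measurable]: "?D \<in> borel_measurable M" using distributed_measurable[OF dist] by simp
  have "indep_set (sigma_sets (space M) {Y -` A \<inter> space M | A. A \<in> sets borel}) (sigma_sets (space M) {?D -` A \<inter> space M | A. A \<in> sets borel})"
  proof (rule indep_set_sigma_sets)
    show "indep_set {Y -` A \<inter> space M |A. A \<in> sets borel} {?D -` A \<inter> space M | A. A \<in> sets borel}"
      unfolding indep_set_def
    proof (rule indep_sets_mono_sets[OF ind[unfolded indep_set_def]])
      fix i :: bool
      show "(case i of True \<Rightarrow> {Y -` A \<inter> space M |A. A \<in> sets borel} | False \<Rightarrow> {?D -` A \<inter> space M | A. A \<in> sets borel})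
        \<subseteq> (case i of True \<Rightarrow> sets (F s) | False \<Rightarrow> {?D -` B \<inter> space M | B. B \<in> sets borel})"
        using measurable_sets[OF Y(1)] standard_filtrationD(1)[OF fil s(1)] by (auto split: bool.split)
    qed
    have "Int_stable {f -` A \<inter> space M |A. A \<in> sets borel}" for f :: "'a \<Rightarrow> real"
    proof (rule Int_stableI)
      fix a b assume "a \<in> {f -` A \<inter> space M |A. A \<in> sets borel}" "b \<in> {f -` A \<inter> space M |A. A \<in> sets borel}"
      then obtain A B where "a = f -` A \<inter> space M" "b = f -` B \<inter> space M" "A \<in> sets borel" "B \<in> sets borel" by auto
      then show "a \<inter> b \<in> {f -` A \<inter> space M |A. A \<in> sets borel}"
        by (auto intro!: exI[of _ "A \<inter> B"])
    qed
    then show "Int_stable {Y -` A \<inter> space M |A. A \<in> sets borel}" "Int_stable {?D -` A \<inter> space M | A. A \<in> sets borel}"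
      by blast+
  qed
  then have iv: "indep_var borel Y borel ?D"
    unfolding indep_var_eq using Y(2) by auto
  have iv2: "indep_var borel Y borel (\<lambda>\<omega>. (?D \<omega>)\<^sup>2)"
    using indep_var_compose[OF iv, of "\<lambda>x. x" borel "\<lambda>x. x\<^sup>2" borel] by (simp add: comp_def)
  have D1: "integrable M ?D"
    by (rule distributed_integrable_var[OF dist]) (use integrable_normal_moment_nz_1[OF sg, of 0] in auto)
  have E1: "expectation ?D = 0" by (rule normal_distributed_expectation[OF sg dist])
  have "integrable lborel (\<lambda>x. normal_density 0 (sqrt (t - s)) x * x\<^sup>2)"
    using integrable_normal_moment[OF sg, of 0 2] by simp
  then show D2: "integrable M (\<lambda>\<omega>. (?D \<omega>)\<^sup>2)"
    using distributed_integrable[OF dist, of "\<lambda>x. x\<^sup>2"] by simp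
  have E2: "expectation (\<lambda>\<omega>. (?D \<omega>)\<^sup>2) = t - s"
    using normal_distributed_variance[OF sg dist] E1 st by simp
  show "integrable M (\<lambda>\<omega>. Y \<omega> * ?D \<omega>)" by (rule indep_var_integrable[OF iv Y(2) D1])
  show "(\<integral>\<omega>. Y \<omega> * ?D \<omega> \<partial>M) = 0" using indep_var_lebesgue_integral[OF iv Y(2) D1] E1 by simp
  show "integrable M (\<lambda>\<omega>. Y \<omega> * (?D \<omega>)\<^sup>2)" by (rule indep_var_integrable[OF iv2 Y(2) D2])
  show "(\<integral>\<omega>. Y \<omega> * (?D \<omega>)\<^sup>2 \<partial>M) = (t - s) * (\<integral>\<omega>. Y \<omega> \<partial>M)"
    using indep_var_lebesgue_integral[OF iv2 Y(2) D2] E2 by simp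
qed

text \<open>Induction on the number of intervals: the new increment of \<open>W\<close> is centred and independent
  of the past, so the mixed term vanishes and the square contributes the length of the interval.\<close>

lemma discrete_ito_isometry:
  assumes ps: "prob_space M" and fil: "standard_filtration M F T" and w: "wiener_process M F T W"
    and q: "strict_partition m q" "0 \<le> q 0" "q m \<le> T"
    and \<eta>: "\<And>j. j < m \<Longrightarrow> \<eta> j \<in> borel_measurable (F (q j))" "\<And>j. j < m \<Longrightarrow> \<exists>B. \<forall>\<omega>\<in>space M. \<bar>\<eta> j \<omega>\<bar> \<le> B"
  shows "(\<lambda>\<omega>. \<Sum>j<m. \<eta> j \<omega> * (W (q (Suc j)) \<omega> - W (q j) \<omega>)) \<in> borel_measurable M"
    and "(\<lambda>\<omega>. \<Sum>j<m. (\<eta> j \<omega>)\<^sup>2 * (q (Suc j) - q j)) \<in> borel_measurable M"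
    and "(\<integral>\<^sup>+\<omega>. ennreal ((\<Sum>j<m. \<eta> j \<omega> * (W (q (Suc j)) \<omega> - W (q j) \<omega>))\<^sup>2) \<partial>M)
       = (\<integral>\<^sup>+\<omega>. ennreal (\<Sum>j<m. (\<eta> j \<omega>)\<^sup>2 * (q (Suc j) - q j)) \<partial>M)"
proof -
  interpret prob_space M by fact
  have qT: "q j \<in> {0..T}" if "j \<le> m" for j
    using strict_partition_iff(2)[OF q(1), of 0 j] strict_partition_iff(2)[OF q(1), of j m] q(2,3) that by auto
  have WF: "W (q i) \<in> borel_measurable (F (q j))" if "i \<le> j" "j \<le> m" for i j
  proof (rule standard_filtration_measurable_mono[OF fil])
    show "W (q i) \<in> borel_measurable (F (q i))" using w qT[of i] that by (auto simp: wiener_process_def adapted_def)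
  qed (use qT[of i] qT[of j] that strict_partition_iff(2)[OF q(1), of i j] in auto)
  let ?S = "\<lambda>k \<omega>. \<Sum>j<k. \<eta> j \<omega> * (W (q (Suc j)) \<omega> - W (q j) \<omega>)"
  let ?V = "\<lambda>k \<omega>. \<Sum>j<k. (\<eta> j \<omega>)\<^sup>2 * (q (Suc j) - q j)"
  have main: "?S k \<in> borel_measurable (F (q k)) \<and> integrable M (\<lambda>\<omega>. (?S k \<omega>)\<^sup>2) \<and> integrable M (?V k) \<and>
     (\<integral>\<omega>. (?S k \<omega>)\<^sup>2 \<partial>M) = (\<integral>\<omega>. ?V k \<omega> \<partial>M)" if "k \<le> m" for k
    using that
  proof (induction k)
    case (Suc k)
    then have k: "k < m" "k \<le> m" by auto
    note IH = Suc.IH[OF k(2)]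
    have qk: "0 \<le> q k" "q k < q (Suc k)" "q (Suc k) \<le> T" using qT[of k] qT[of "Suc k"] strict_partitionD[OF q(1), of k] Suc.prems by auto
    let ?D = "\<lambda>\<omega>. W (q (Suc k)) \<omega> - W (q k) \<omega>"
    obtain B where B: "\<And>\<omega>. \<omega> \<in> space M \<Longrightarrow> \<bar>\<eta> k \<omega>\<bar> \<le> B" using \<eta>(2)[OF k(1)] by blast
    have \<eta>M [measurable]: "\<eta> k \<in> borel_measurable M"
      using standard_filtration_measurable_M[OF fil \<eta>(1)[OF k(1)] qT[OF k(2)]] .
    have SF: "?S k \<in> borel_measurable (F (q k))" using IH by blast
    have SM [measurable]: "?S k \<in> borel_measurable M"
      using standard_filtration_measurable_M[OF fil SF qT[OF k(2)]] .
    have S2: "integrable M (\<lambda>\<omega>. (?S k \<omega>)\<^sup>2)" using IH by blast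
    have S1: "integrable M (?S k)"
      using square_integrable_imp_integrable[OF SM S2] .
    have Y1F: "(\<lambda>\<omega>. 2 * (?S k \<omega> * \<eta> k \<omega>)) \<in> borel_measurable (F (q k))"
      using SF \<eta>(1)[OF k(1)] by (intro borel_measurable_times) auto
    have Y1: "integrable M (\<lambda>\<omega>. 2 * (?S k \<omega> * \<eta> k \<omega>))"
    proof (rule Bochner_Integration.integrable_bound[where f="\<lambda>\<omega>. 2 * (B * ?S k \<omega>)"])
      show "integrable M (\<lambda>\<omega>. 2 * (B * ?S k \<omega>))" using S1 by (intro integrable_mult_right)
      show "AE \<omega> in M. norm (2 * (?S k \<omega> * \<eta> k \<omega>)) \<le> norm (2 * (B * ?S k \<omega>))"
        using B by (intro AE_I2) (auto simp: abs_mult mult.commute[of B] intro!: mult_left_mono intro: order_trans[OF _ abs_ge_self])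
    qed measurable
    have Y2F: "(\<lambda>\<omega>. (\<eta> k \<omega>)\<^sup>2) \<in> borel_measurable (F (q k))" using \<eta>(1)[OF k(1)] by measurable
    have Y2: "integrable M (\<lambda>\<omega>. (\<eta> k \<omega>)\<^sup>2)"
    proof (rule integrable_const_bound[where B="B\<^sup>2"])
      show "AE \<omega> in M. norm ((\<eta> k \<omega>)\<^sup>2) \<le> B\<^sup>2"
        using power_mono[OF B, of _ 2] by (intro AE_I2) auto
    qed measurable
    note w1 = wiener_increment[OF ps fil w qk Y1F Y1]
    note w2 = wiener_increment[OF ps fil w qk Y2F Y2]
    have e: "(?S (Suc k) \<omega>)\<^sup>2 = (?S k \<omega>)\<^sup>2 + (2 * (?S k \<omega> * \<eta> k \<omega>)) * ?D \<omega> + (\<eta> k \<omega>)\<^sup>2 * (?D \<omega>)\<^sup>2" for \<omega>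
      by (simp add: power2_sum power_mult_distrib algebra_simps power2_eq_square)
    show ?case
    proof (intro conjI)
      have "?S k \<in> borel_measurable (F (q (Suc k)))" "\<eta> k \<in> borel_measurable (F (q (Suc k)))"
        using qT[of "Suc k"] qk k by (auto intro!: standard_filtration_measurable_mono[OF fil SF] standard_filtration_measurable_mono[OF fil \<eta>(1)])
      then show "?S (Suc k) \<in> borel_measurable (F (q (Suc k)))"
        using WF[of "Suc k" "Suc k"] WF[of k "Suc k"] Suc.prems by simp
      show "integrable M (\<lambda>\<omega>. (?S (Suc k) \<omega>)\<^sup>2)" unfolding e using S2 w1(1) w2(3) by auto
      have V: "integrable M (?V k)" using IH by blast
      then show "integrable M (?V (Suc k))" using Y2 by simp
      have "(\<integral>\<omega>. (?S (Suc k) \<omega>)\<^sup>2 \<partial>M) = (\<integral>\<omega>. (?S k \<omega>)\<^sup>2 \<partial>M) + (q (Suc k) - q k) * (\<integral>\<omega>. (\<eta> k \<omega>)\<^sup>2 \<partial>M)"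
        unfolding e using S2 w1(1,2) w2(3,4) by simp
      also have "\<dots> = (\<integral>\<omega>. ?V k \<omega> \<partial>M) + (\<integral>\<omega>. (\<eta> k \<omega>)\<^sup>2 * (q (Suc k) - q k) \<partial>M)"
        using IH by (simp add: mult.commute)
      also have "\<dots> = (\<integral>\<omega>. ?V (Suc k) \<omega> \<partial>M)"
        using V Y2 by simp
      finally show "(\<integral>\<omega>. (?S (Suc k) \<omega>)\<^sup>2 \<partial>M) = (\<integral>\<omega>. ?V (Suc k) \<omega> \<partial>M)" .
    qed
  qed simp
  show "?S m \<in> borel_measurable M"
    using standard_filtration_measurable_M[OF fil _ qT[of m]] main[of m] by blast
  show "?V m \<in> borel_measurable M" using main[of m] by auto
  have "0 \<le> ?V m \<omega>" for \<omega> using strict_partitionD[OF q(1)] by (intro sum_nonneg mult_nonneg_nonneg) (auto intro: less_imp_le)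
  then show "(\<integral>\<^sup>+\<omega>. ennreal ((?S m \<omega>)\<^sup>2) \<partial>M) = (\<integral>\<^sup>+\<omega>. ennreal (?V m \<omega>) \<partial>M)"
    using main[of m] by (subst nn_integral_eq_integral, simp, simp, subst nn_integral_eq_integral) auto
qed

section \<open>A localized It\^o isometry\<close>

lemma tends_to_zero_in_prob_add:
  assumes "prob_space M" "tends_to_zero_in_prob M X" "tends_to_zero_in_prob M Y"
  shows "tends_to_zero_in_prob M (\<lambda>k \<omega>. X k \<omega> + Y k \<omega>)"
  unfolding tends_to_zero_in_prob_def
proof (intro conjI allI impI)
  interpret prob_space M by fact
  have [measurable]: "X k \<in> borel_measurable M" "Y k \<in> borel_measurable M" for k
    using assms by (auto simp: tends_to_zero_in_prob_def)
  show "(\<lambda>\<omega>. X k \<omega> + Y k \<omega>) \<in> borel_measurable M" for k by measurable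
  fix \<epsilon> :: real assume \<epsilon>: "0 < \<epsilon>"
  let ?P = "\<lambda>Z e k. measure M {\<omega>\<in>space M. Z k \<omega> > ennreal e}"
  have lim: "(\<lambda>k. ?P X (\<epsilon>/2) k + ?P Y (\<epsilon>/2) k) \<longlonglongrightarrow> 0"
    using assms(2,3) \<epsilon> unfolding tends_to_zero_in_prob_def by (intro tendsto_add_zero) auto
  have le: "measure M {\<omega> \<in> space M. ennreal \<epsilon> < X k \<omega> + Y k \<omega>} \<le> ?P X (\<epsilon>/2) k + ?P Y (\<epsilon>/2) k" for k
  proof -
    have "{\<omega> \<in> space M. ennreal \<epsilon> < X k \<omega> + Y k \<omega>} \<subseteq> {\<omega>\<in>space M. X k \<omega> > ennreal (\<epsilon>/2)} \<union> {\<omega>\<in>space M. Y k \<omega> > ennreal (\<epsilon>/2)}"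
    proof (rule subsetI, rule ccontr)
      fix \<omega> assume a: "\<omega> \<in> {\<omega> \<in> space M. ennreal \<epsilon> < X k \<omega> + Y k \<omega>}"
        and b: "\<omega> \<notin> {\<omega>\<in>space M. X k \<omega> > ennreal (\<epsilon>/2)} \<union> {\<omega>\<in>space M. Y k \<omega> > ennreal (\<epsilon>/2)}"
      then have "X k \<omega> + Y k \<omega> \<le> ennreal (\<epsilon>/2) + ennreal (\<epsilon>/2)" by (intro add_mono) auto
      also have "\<dots> = ennreal \<epsilon>" using \<epsilon> by (subst ennreal_plus[symmetric]) auto
      finally show False using a by auto
    qed
    then have "measure M {\<omega> \<in> space M. ennreal \<epsilon> < X k \<omega> + Y k \<omega>}
      \<le> measure M ({\<omega>\<in>space M. X k \<omega> > ennreal (\<epsilon>/2)} \<union> {\<omega>\<in>space M. Y k \<omega> > ennreal (\<epsilon>/2)})"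
      by (intro finite_measure_mono) measurable
    also have "\<dots> \<le> ?P X (\<epsilon>/2) k + ?P Y (\<epsilon>/2) k" by (intro measure_Un_le) measurable
    finally show ?thesis .
  qed
  show "(\<lambda>k. measure M {\<omega> \<in> space M. ennreal \<epsilon> < X k \<omega> + Y k \<omega>}) \<longlonglongrightarrow> 0"
    by (rule tendsto_sandwich[OF always_eventually always_eventually tendsto_const lim]) (auto intro: le)
qed

text \<open>By the Borel-Cantelli lemma, along indices \<open>r k\<close> with exceptional probabilities of at most
  \<open>2\<^sup>-\<^sup>k\<close>.\<close>

lemma tends_to_zero_in_prob_AE_subseq:
  assumes "prob_space M" "tends_to_zero_in_prob M Y"
  obtains r :: "nat \<Rightarrow> nat" where "AE \<omega> in M. (\<lambda>k. Y (r k) \<omega>) \<longlonglongrightarrow> 0"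
proof -
  interpret prob_space M by fact
  have [measurable]: "Y k \<in> borel_measurable M" for k
    using assms by (auto simp: tends_to_zero_in_prob_def)
  have "\<exists>n. measure M {\<omega>\<in>space M. Y n \<omega> > ennreal ((1/2)^k)} \<le> (1/2)^k" for k
  proof -
    have "(\<lambda>n. measure M {\<omega>\<in>space M. Y n \<omega> > ennreal ((1/2)^k)}) \<longlonglongrightarrow> 0"
      using assms(2) unfolding tends_to_zero_in_prob_def by auto
    then have "\<forall>\<^sub>F n in sequentially. measure M {\<omega>\<in>space M. Y n \<omega> > ennreal ((1/2)^k)} < (1/2)^k"
      by (rule order_tendstoD) simp
    then show ?thesis by (auto simp: eventually_sequentially intro: less_imp_le)
  qed
  then obtain r where r: "\<And>k. measure M {\<omega>\<in>space M. Y (r k) \<omega> > ennreal ((1/2)^k)} \<le> (1/2)^k" by metis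
  have "AE \<omega> in M. eventually (\<lambda>k. \<omega> \<in> space M - {\<omega>\<in>space M. Y (r k) \<omega> > ennreal ((1/2)^k)}) sequentially"
  proof (rule borel_cantelli_AE1)
    show "summable (\<lambda>k. measure M {\<omega>\<in>space M. Y (r k) \<omega> > ennreal ((1/2)^k)})"
      by (rule summable_comparison_test'[where g="\<lambda>k. (1/2)^k" and N=0]) (auto simp: r summable_geometric)
  qed (auto simp: less_top[symmetric])
  then have "AE \<omega> in M. (\<lambda>k. Y (r k) \<omega>) \<longlonglongrightarrow> 0"
  proof eventually_elim
    case (elim \<omega>)
    have "(\<lambda>k. ennreal ((1/2)^k)) \<longlonglongrightarrow> ennreal 0" by (intro tendsto_ennrealI LIMSEQ_power_zero) simp
    then have g: "(\<lambda>k. ennreal ((1/2)^k)) \<longlonglongrightarrow> 0" by simp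
    show ?case
      by (rule tendsto_sandwich[OF _ _ tendsto_const g]) (use elim in \<open>auto elim!: eventually_mono simp: not_less\<close>)
  qed
  then show ?thesis by (rule that)
qed

lemma square_le_double: "(x::real)\<^sup>2 \<le> 2 * (x - y)\<^sup>2 + 2 * y\<^sup>2"
proof -
  have "0 \<le> (x - 2 * y)\<^sup>2" by simp
  then show ?thesis by (simp add: power2_eq_square algebra_simps)
qed

text \<open>The energy of a step function \<open>V\<close>, restricted to those intervals at whose left end \<open>g\<close>
  holds, is compared with the energy of \<open>D\<close> on \<open>{u. g u}\<close>. As \<open>g\<close> is decreasing, the
  restrictions differ only on the interval in which \<open>g\<close> ceases to hold. Its length is at most
  \<open>\<delta>\<close>; in the induction its contribution is charged to the last summand, which becomes positive
  once \<open>g\<close> has ceased to hold.\<close>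

lemma partition_energy_bound:
  fixes v :: "nat \<Rightarrow> real" and V D :: "real \<Rightarrow> real"
  assumes q: "strict_partition m q" "q 0 = s" "q m = t"
    and V: "\<And>j u. j < m \<Longrightarrow> q j < u \<Longrightarrow> u \<le> q (Suc j) \<Longrightarrow> V u = v j"
    and [measurable]: "V \<in> borel_measurable borel" "D \<in> borel_measurable borel" "Measurable.pred borel g"
    and g: "\<And>u w. s \<le> u \<Longrightarrow> u \<le> w \<Longrightarrow> w \<le> t \<Longrightarrow> g w \<Longrightarrow> g u"
    and B: "\<And>u. s \<le> u \<Longrightarrow> u \<le> t \<Longrightarrow> \<bar>D u\<bar> \<le> B" and mesh: "\<And>j. j < m \<Longrightarrow> q (Suc j) - q j \<le> \<delta>" and "0 \<le> \<delta>"
  shows "ennreal (\<Sum>j<m. (v j * of_bool (g (q j)))\<^sup>2 * (q (Suc j) - q j)) \<le>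
    2 * (\<integral>\<^sup>+u\<in>{s..t}. ennreal ((V u - D u)\<^sup>2) \<partial>lborel) + 2 * (\<integral>\<^sup>+u\<in>{s..t}. ennreal ((D u)\<^sup>2) * of_bool (g u) \<partial>lborel)
      + ennreal (2 * B\<^sup>2 * \<delta>)"
proof -
  define h where "h u = 2 * ennreal ((V u - D u)\<^sup>2) + 2 * (ennreal ((D u)\<^sup>2) * of_bool (g u))" for u
  have [measurable]: "h \<in> borel_measurable borel" unfolding h_def by measurable
  have main: "ennreal (\<Sum>j<k. (v j * of_bool (g (q j)))\<^sup>2 * (q (Suc j) - q j))
     \<le> (\<integral>\<^sup>+u\<in>{q 0<..q k}. h u \<partial>lborel) + ennreal (2 * B\<^sup>2 * \<delta> * (1 - of_bool (g (q k))))" if "k \<le> m" for k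
    using that
  proof (induction k)
    case (Suc k)
    then have k: "k < m" "k \<le> m" by auto
    have qk: "q k < q (Suc k)" "s \<le> q k" "q (Suc k) \<le> t"
      using strict_partitionD[OF q(1) k(1)] strict_partition_iff(2)[OF q(1), of 0 k] strict_partition_iff(2)[OF q(1), of "Suc k" m] k q by auto
    define \<Delta> where "\<Delta> = q (Suc k) - q k"
    have \<Delta>: "0 < \<Delta>" "\<Delta> \<le> \<delta>" using qk mesh[OF k(1)] by (auto simp: \<Delta>_def)
    let ?I = "{q k<..q (Suc k)}"
    have em: "(\<integral>\<^sup>+u\<in>?I. ennreal c \<partial>lborel) = ennreal (c * \<Delta>)" if "0 \<le> c" for c
      using that qk by (simp add: nn_integral_cmult_indicator \<Delta>_def ennreal_mult)
    have split: "(\<integral>\<^sup>+u\<in>{q 0<..q (Suc k)}. h u \<partial>lborel) = (\<integral>\<^sup>+u\<in>{q 0<..q k}. h u \<partial>lborel) + (\<integral>\<^sup>+u\<in>?I. h u \<partial>lborel)"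
      using qk q(2) by (subst nn_integral_add[symmetric]) (auto intro!: nn_integral_cong split: split_indicator)
    have step: "ennreal ((v k * of_bool (g (q k)))\<^sup>2 * \<Delta>) + ennreal (2 * B\<^sup>2 * \<delta> * (1 - of_bool (g (q k))))
      \<le> (\<integral>\<^sup>+u\<in>?I. h u \<partial>lborel) + ennreal (2 * B\<^sup>2 * \<delta> * (1 - of_bool (g (q (Suc k)))))"
    proof (cases "g (q k)")
      case False
      then have "\<not> g (q (Suc k))" using g[of "q k" "q (Suc k)"] qk by auto
      then show ?thesis using False by simp
    next
      case True
      have v2: "(v k)\<^sup>2 \<le> 2 * (V u - D u)\<^sup>2 + 2 * (D u)\<^sup>2" if "u \<in> ?I" for u
        using square_le_double[of "v k" "D u"] V[OF k(1), of u] that by auto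
      have "ennreal ((v k)\<^sup>2 * \<Delta>) = (\<integral>\<^sup>+u\<in>?I. ennreal ((v k)\<^sup>2) \<partial>lborel)" by (rule em[symmetric]) simp
      also have "\<dots> \<le> (\<integral>\<^sup>+u\<in>?I. h u \<partial>lborel) + ennreal (2 * B\<^sup>2 * \<delta> * (1 - of_bool (g (q (Suc k)))))"
      proof (cases "g (q (Suc k))")
        case True
        have "(\<integral>\<^sup>+u\<in>?I. ennreal ((v k)\<^sup>2) \<partial>lborel) \<le> (\<integral>\<^sup>+u\<in>?I. h u \<partial>lborel)"
        proof (intro nn_integral_mono)
          fix u
          show "ennreal ((v k)\<^sup>2) * indicator ?I u \<le> h u * indicator ?I u"
          proof (cases "u \<in> ?I")
            case u: True
            then have "g u" using g[of u "q (Suc k)"] True qk by auto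
            then have "h u = ennreal (2 * (V u - D u)\<^sup>2 + 2 * (D u)\<^sup>2)" unfolding h_def by (simp add: ennreal_mult)
            then show ?thesis using ennreal_leI[OF v2[OF u]] u by simp
          qed simp
        qed
        then show ?thesis using True by simp
      next
        case False
        have "(\<integral>\<^sup>+u\<in>?I. ennreal ((v k)\<^sup>2) \<partial>lborel) \<le> (\<integral>\<^sup>+u. h u * indicator ?I u + ennreal (2 * B\<^sup>2) * indicator ?I u \<partial>lborel)"
        proof (intro nn_integral_mono)
          fix u
          show "ennreal ((v k)\<^sup>2) * indicator ?I u \<le> h u * indicator ?I u + ennreal (2 * B\<^sup>2) * indicator ?I u"
          proof (cases "u \<in> ?I")
            case u: True
            have "(D u)\<^sup>2 \<le> B\<^sup>2" using power_mono[OF B[of u], of 2] u qk by auto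
            then have "(v k)\<^sup>2 \<le> 2 * (V u - D u)\<^sup>2 + 2 * B\<^sup>2" using v2[OF u] by linarith
            then have "ennreal ((v k)\<^sup>2) \<le> 2 * ennreal ((V u - D u)\<^sup>2) + ennreal (2 * B\<^sup>2)"
              using ennreal_leI by (fastforce simp: ennreal_mult)
            also have "\<dots> \<le> h u + ennreal (2 * B\<^sup>2)" unfolding h_def by (intro add_right_mono) simp
            finally show ?thesis using u by simp
          qed simp
        qed
        also have "\<dots> = (\<integral>\<^sup>+u\<in>?I. h u \<partial>lborel) + ennreal (2 * B\<^sup>2 * \<Delta>)"
          by (subst nn_integral_add) (use em[of "2 * B\<^sup>2"] in auto)
        also have "\<dots> \<le> (\<integral>\<^sup>+u\<in>?I. h u \<partial>lborel) + ennreal (2 * B\<^sup>2 * \<delta>)"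
          using \<Delta> by (intro add_left_mono ennreal_leI mult_left_mono) auto
        finally show ?thesis using False by simp
      qed
      finally show ?thesis using True by simp
    qed
    have nn: "0 \<le> (\<Sum>j<k. (v j * of_bool (g (q j)))\<^sup>2 * (q (Suc j) - q j))"
      using strict_partitionD[OF q(1)] k by (intro sum_nonneg mult_nonneg_nonneg) (auto intro: less_imp_le)
    have "ennreal (\<Sum>j<Suc k. (v j * of_bool (g (q j)))\<^sup>2 * (q (Suc j) - q j))
      = ennreal (\<Sum>j<k. (v j * of_bool (g (q j)))\<^sup>2 * (q (Suc j) - q j)) + ennreal ((v k * of_bool (g (q k)))\<^sup>2 * \<Delta>)"
      using nn \<Delta> by (simp add: \<Delta>_def[symmetric] ennreal_plus[symmetric] del: ennreal_plus)
    also have "\<dots> \<le> ((\<integral>\<^sup>+u\<in>{q 0<..q k}. h u \<partial>lborel) + ennreal (2 * B\<^sup>2 * \<delta> * (1 - of_bool (g (q k))))) + ennreal ((v k * of_bool (g (q k)))\<^sup>2 * \<Delta>)"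
      by (intro add_right_mono Suc.IH k)
    also have "\<dots> = (\<integral>\<^sup>+u\<in>{q 0<..q k}. h u \<partial>lborel) + (ennreal ((v k * of_bool (g (q k)))\<^sup>2 * \<Delta>) + ennreal (2 * B\<^sup>2 * \<delta> * (1 - of_bool (g (q k)))))"
      by (simp only: add_ac)
    also have "\<dots> \<le> (\<integral>\<^sup>+u\<in>{q 0<..q k}. h u \<partial>lborel) + ((\<integral>\<^sup>+u\<in>?I. h u \<partial>lborel) + ennreal (2 * B\<^sup>2 * \<delta> * (1 - of_bool (g (q (Suc k))))))"
      by (intro add_left_mono step)
    also have "\<dots> = (\<integral>\<^sup>+u\<in>{q 0<..q (Suc k)}. h u \<partial>lborel) + ennreal (2 * B\<^sup>2 * \<delta> * (1 - of_bool (g (q (Suc k)))))"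
      unfolding split by (simp only: add_ac)
    finally show ?case .
  qed simp
  have "ennreal (\<Sum>j<m. (v j * of_bool (g (q j)))\<^sup>2 * (q (Suc j) - q j))
     \<le> (\<integral>\<^sup>+u\<in>{q 0<..q m}. h u \<partial>lborel) + ennreal (2 * B\<^sup>2 * \<delta> * (1 - of_bool (g (q m))))" by (rule main) simp
  also have "\<dots> \<le> (\<integral>\<^sup>+u\<in>{s..t}. h u \<partial>lborel) + ennreal (2 * B\<^sup>2 * \<delta>)"
    using q \<open>0 \<le> \<delta>\<close> by (intro add_mono nn_integral_mono ennreal_leI) (auto split: split_indicator)
  also have "(\<integral>\<^sup>+u\<in>{s..t}. h u \<partial>lborel) = 2 * (\<integral>\<^sup>+u\<in>{s..t}. ennreal ((V u - D u)\<^sup>2) \<partial>lborel) + 2 * (\<integral>\<^sup>+u\<in>{s..t}. ennreal ((D u)\<^sup>2) * of_bool (g u) \<partial>lborel)"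
    unfolding h_def by (subst (1 2) nn_integral_cmult[symmetric], measurable, subst nn_integral_add[symmetric], measurable)
      (auto intro!: nn_integral_cong split: split_indicator)
  finally show ?thesis .
qed

text \<open>A coefficient is dropped as soon as the energy, its own included, exceeds \<open>c\<close>. Thus it
  depends on the coefficients up to its index only, which preserves adaptedness.\<close>

lemma truncated_energy_le:
  fixes e d :: "nat \<Rightarrow> real"
  assumes "\<And>j. j < k \<Longrightarrow> 0 \<le> d j" "0 \<le> c"
  shows "(\<Sum>j<k. (e j * of_bool ((\<Sum>l<Suc j. (e l)\<^sup>2 * d l) \<le> c))\<^sup>2 * d j) \<le> c"
    and "(\<Sum>j<k. (e j * of_bool ((\<Sum>l<Suc j. (e l)\<^sup>2 * d l) \<le> c))\<^sup>2 * d j) \<le> (\<Sum>j<k. (e j)\<^sup>2 * d j)"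
    and "(\<Sum>j<k. (e j)\<^sup>2 * d j) \<le> c \<Longrightarrow> j < k \<Longrightarrow> e j * of_bool ((\<Sum>l<Suc j. (e l)\<^sup>2 * d l) \<le> c) = e j"
proof -
  have *: "(\<Sum>j<i. (e j * of_bool ((\<Sum>l<Suc j. (e l)\<^sup>2 * d l) \<le> c))\<^sup>2 * d j) \<le> (\<Sum>j<i. (e j)\<^sup>2 * d j)" if "i \<le> k" for i
    using assms that by (intro sum_mono mult_right_mono) auto
  then show "(\<Sum>j<k. (e j * of_bool ((\<Sum>l<Suc j. (e l)\<^sup>2 * d l) \<le> c))\<^sup>2 * d j) \<le> (\<Sum>j<k. (e j)\<^sup>2 * d j)" by simp
  have "(\<Sum>j<i. (e j * of_bool ((\<Sum>l<Suc j. (e l)\<^sup>2 * d l) \<le> c))\<^sup>2 * d j) \<le> c" if "i \<le> k" for i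
    using that
  proof (induction i)
    case (Suc i)
    then show ?case
    proof (cases "(\<Sum>l<Suc i. (e l)\<^sup>2 * d l) \<le> c")
      case True
      then show ?thesis using *[OF Suc.prems] by linarith
    qed simp
  qed (use assms in simp)
  then show "(\<Sum>j<k. (e j * of_bool ((\<Sum>l<Suc j. (e l)\<^sup>2 * d l) \<le> c))\<^sup>2 * d j) \<le> c" by simp
  assume a: "(\<Sum>j<k. (e j)\<^sup>2 * d j) \<le> c" "j < k"
  have "(\<Sum>l<Suc j. (e l)\<^sup>2 * d l) \<le> (\<Sum>j<k. (e j)\<^sup>2 * d j)"
    using a assms by (intro sum_mono2) auto
  then show "e j * of_bool ((\<Sum>l<Suc j. (e l)\<^sup>2 * d l) \<le> c) = e j" using a by simp
qed

lemma ennreal_tendsto_0_le: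
  fixes f g :: "nat \<Rightarrow> ennreal"
  assumes "\<And>k. f k \<le> g k" "g \<longlonglongrightarrow> 0"
  shows "f \<longlonglongrightarrow> 0"
  by (rule tendsto_sandwich[of "\<lambda>_. 0" f _ g]) (use assms in auto)

text \<open>On \<open>G t\<close> all events \<open>G u\<close> with \<open>u \<le> t\<close> hold, so there the integral of \<open>D\<close> agrees with that
  of \<open>D\<close> times the indicator of \<open>G u\<close>. To make this precise, the two sequences of simple
  processes that define the It\^o integrals are written along common fine partitions of \<open>[s, t]\<close>
  and multiplied by the indicators of \<open>G\<close> at the left end points. They converge in probability
  only, and their energies need not be uniformly bounded; hence the energy is truncated at a
  level that, on \<open>G t\<close>, is not reached in the limit. The isometry for simple processes, Fatou's
  lemma for the left-hand side and the reverse Fatou lemma for the bounded energies give the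
  claim along an almost surely convergent subsequence. The factor \<open>2\<close> comes from
  \<open>V\<^sup>2 \<le> 2 (V - D)\<^sup>2 + 2 D\<^sup>2\<close> and is harmless here.\<close>

lemma ito_localized_isometry:
  fixes D :: "real \<Rightarrow> 'a \<Rightarrow> real"
  assumes ps: "prob_space M" and fil: "standard_filtration M F T" and w: "wiener_process M F T W"
    and ito: "has_ito_integral M F T W H I" and itob: "has_ito_integral M F T W Hb Ib"
    and st: "0 \<le> s" "s < t" "t \<le> T"
    and G: "\<And>u. u \<in> {0..T} \<Longrightarrow> G u \<in> sets (F u)" "\<And>u v. 0 \<le> u \<Longrightarrow> u \<le> v \<Longrightarrow> v \<le> T \<Longrightarrow> G v \<subseteq> G u"
    and Gm: "(\<lambda>(u, \<omega>). indicator (G u) \<omega> :: ennreal) \<in> borel_measurable (borel \<Otimes>\<^sub>M M)"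
    and D: "(\<lambda>(u, \<omega>). D u \<omega>) \<in> borel_measurable (borel \<Otimes>\<^sub>M M)"
    and DAE: "AE \<omega> in M. \<forall>u\<in>{0..T}. D u \<omega> = H u \<omega> - Hb u \<omega>"
    and Dbd: "\<And>\<omega>. \<omega> \<in> space M \<Longrightarrow> \<exists>B. \<forall>u\<in>{s..t}. \<bar>D u \<omega>\<bar> \<le> B"
    and \<kappa>: "0 \<le> \<kappa>" "\<And>\<omega>. \<omega> \<in> space M \<Longrightarrow> \<omega> \<in> G t \<Longrightarrow> (\<integral>\<^sup>+u\<in>{s..t}. ennreal ((D u \<omega>)\<^sup>2) \<partial>lborel) \<le> ennreal \<kappa>"
  shows "(\<integral>\<^sup>+\<omega>. ennreal (((I t \<omega> - Ib t \<omega>) - (I s \<omega> - Ib s \<omega>))\<^sup>2) * indicator (G t) \<omega> \<partial>M)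
    \<le> 2 * (\<integral>\<^sup>+\<omega>. (\<integral>\<^sup>+u\<in>{s..t}. ennreal ((D u \<omega>)\<^sup>2) * indicator (G u) \<omega> \<partial>lborel) \<partial>M)"
proof -
  interpret prob_space M by fact
  note [measurable] = D Gm
  obtain n p \<xi> where A: "\<And>k. simple_process M F T (n k) (p k) (\<xi> k)"
    "tends_to_zero_in_prob M (\<lambda>k \<omega>. \<integral>\<^sup>+s\<in>{0..T}. ennreal ((simple_val (n k) (p k) (\<xi> k) s \<omega> - H s \<omega>)\<^sup>2) \<partial>lborel)"
    "\<And>t. t \<in> {0..T} \<Longrightarrow> tends_to_zero_in_prob M (\<lambda>k \<omega>. ennreal \<bar>simple_integral W (n k) (p k) (\<xi> k) t \<omega> - I t \<omega>\<bar>)"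
    using ito unfolding has_ito_integral_def by blast
  obtain nb pb \<xi>b where Ab: "\<And>k. simple_process M F T (nb k) (pb k) (\<xi>b k)"
    "tends_to_zero_in_prob M (\<lambda>k \<omega>. \<integral>\<^sup>+s\<in>{0..T}. ennreal ((simple_val (nb k) (pb k) (\<xi>b k) s \<omega> - Hb s \<omega>)\<^sup>2) \<partial>lborel)"
    "\<And>t. t \<in> {0..T} \<Longrightarrow> tends_to_zero_in_prob M (\<lambda>k \<omega>. ennreal \<bar>simple_integral W (nb k) (pb k) (\<xi>b k) t \<omega> - Ib t \<omega>\<bar>)"
    using itob unfolding has_ito_integral_def by blast
  have tT: "t \<in> {0..T}" "s \<in> {0..T}" using st by auto
  define Y1 where "Y1 k \<omega> = (\<integral>\<^sup>+s\<in>{0..T}. ennreal ((simple_val (n k) (p k) (\<xi> k) s \<omega> - H s \<omega>)\<^sup>2) \<partial>lborel)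
     + (\<integral>\<^sup>+s\<in>{0..T}. ennreal ((simple_val (nb k) (pb k) (\<xi>b k) s \<omega> - Hb s \<omega>)\<^sup>2) \<partial>lborel)" for k \<omega>
  define Y2 where "Y2 k u \<omega> = ennreal \<bar>simple_integral W (n k) (p k) (\<xi> k) u \<omega> - I u \<omega>\<bar>
     + ennreal \<bar>simple_integral W (nb k) (pb k) (\<xi>b k) u \<omega> - Ib u \<omega>\<bar>" for k u \<omega>
  have "tends_to_zero_in_prob M (\<lambda>k \<omega>. Y1 k \<omega> + (Y2 k t \<omega> + Y2 k s \<omega>))"
    unfolding Y1_def Y2_def by (intro tends_to_zero_in_prob_add[OF ps] A(2,3) Ab(2,3) tT)
  then obtain r where r: "AE \<omega> in M. (\<lambda>k. Y1 (r k) \<omega> + (Y2 (r k) t \<omega> + Y2 (r k) s \<omega>)) \<longlonglongrightarrow> 0"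
    by (rule tends_to_zero_in_prob_AE_subseq[OF ps])
  define S where "S k = simple_val (n (r k)) (p (r k)) (\<xi> (r k))" for k
  define Sb where "Sb k = simple_val (nb (r k)) (pb (r k)) (\<xi>b (r k))" for k
  define \<delta> where "\<delta> k = (t - s) / real (Suc k)" for k
  have \<delta>: "0 < \<delta> k" for k using st by (simp add: \<delta>_def)
  have "\<exists>m q. refines m q s t (n (r k)) (p (r k)) \<and> refines m q s t (nb (r k)) (pb (r k)) \<and> (\<forall>j<m. q (Suc j) - q j \<le> \<delta> k)" for k
  proof -
    let ?P = "(\<lambda>i. max s (min (p (r k) i) t)) ` {..n (r k)} \<union> (\<lambda>i. max s (min (pb (r k) i) t)) ` {..nb (r k)}"
    have P: "finite ?P" "?P \<subseteq> {s..t}" using st by auto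
    obtain m q where "strict_partition m q" "?P \<subseteq> q ` {..m}" "q 0 = s" "q m = t" "\<And>i. i < m \<Longrightarrow> q (Suc i) - q i \<le> \<delta> k"
      by (rule fine_partition[OF st(2) P \<delta>[of k]]) blast
    then show ?thesis unfolding refines_def by (intro exI[of _ m] exI[of _ q]) auto
  qed
  then obtain m q where q: "\<And>k. refines (m k) (q k) s t (n (r k)) (p (r k))" "\<And>k. refines (m k) (q k) s t (nb (r k)) (pb (r k))"
     "\<And>k j. j < m k \<Longrightarrow> q k (Suc j) - q k j \<le> \<delta> k" by metis
  have sp: "strict_partition (m k) (q k)" "q k 0 = s" "q k (m k) = t" for k using q(1)[of k] by (auto simp: refines_def)
  have qT: "q k j \<in> {s..t}" if "j \<le> m k" for k j
    using strict_partition_iff(2)[OF sp(1), of 0 k j] strict_partition_iff(2)[OF sp(1), of j k "m k"] sp(2,3)[of k] that by auto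
  have q0T: "q k j \<in> {0..T}" if "j \<le> m k" for k j using qT[OF that] st by auto
  have dq: "0 \<le> q k (Suc j) - q k j" if "j < m k" for k j using strict_partitionD[OF sp(1) that] by simp
  define V where "V k u \<omega> = S k u \<omega> - Sb k u \<omega>" for k u \<omega>
  define e where "e k j \<omega> = V k (q k (Suc j)) \<omega> * of_bool (\<omega> \<in> G (q k j))" for k j \<omega>
  \<comment> \<open>On \<open>G t\<close> the energies have an upper limit of at most \<open>2 \<kappa>\<close>, so eventually they are below \<open>c\<close>.\<close>
  define c where "c = 2 * \<kappa> + 1"
  have c: "0 \<le> c" using \<kappa> by (simp add: c_def)
  define en where "en k j \<omega> = (\<Sum>l<j. (e k l \<omega>)\<^sup>2 * (q k (Suc l) - q k l))" for k j \<omega>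
  define \<eta> where "\<eta> k j \<omega> = e k j \<omega> * of_bool (en k (Suc j) \<omega> \<le> c)" for k j \<omega>
  have VF: "V k (q k (Suc j)) \<in> borel_measurable (F (q k j))" "\<exists>B. \<forall>\<omega>\<in>space M. \<bar>V k (q k (Suc j)) \<omega>\<bar> \<le> B" if "j < m k" for k j
  proof -
    note a = simple_val_measurable[OF fil A(1) q(1) st(1) less_imp_le[OF st(2)] st(3) that]
      simple_val_measurable[OF fil Ab(1) q(2) st(1) less_imp_le[OF st(2)] st(3) that]
    show "V k (q k (Suc j)) \<in> borel_measurable (F (q k j))"
      unfolding V_def[abs_def] S_def Sb_def using a(1,3) by (rule borel_measurable_diff)
    obtain B B' where "\<forall>\<omega>\<in>space M. \<bar>S k (q k (Suc j)) \<omega>\<bar> \<le> B" "\<forall>\<omega>\<in>space M. \<bar>Sb k (q k (Suc j)) \<omega>\<bar> \<le> B'"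
      using a(2,4) unfolding S_def Sb_def by blast
    then show "\<exists>B. \<forall>\<omega>\<in>space M. \<bar>V k (q k (Suc j)) \<omega>\<bar> \<le> B"
      unfolding V_def by (intro exI[of _ "B + B'"]) fastforce
  qed
  have eF: "e k j \<in> borel_measurable (F (q k j))" if "j < m k" for k j
  proof -
    have [measurable]: "G (q k j) \<in> sets (F (q k j))" using q0T[of j k] that by (intro G(1)) auto
    note VF(1)[OF that, measurable]
    have "(\<lambda>\<omega>. V k (q k (Suc j)) \<omega> * indicator (G (q k j)) \<omega>) \<in> borel_measurable (F (q k j))" by measurable
    then show ?thesis unfolding e_def[abs_def] by (simp add: indicator_def of_bool_def)
  qed
  have enF: "en k (Suc j) \<in> borel_measurable (F (q k j))" if j: "j < m k" for k j
    unfolding en_def[abs_def]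
  proof (rule borel_measurable_sum)
    fix l assume l: "l \<in> {..<Suc j}"
    then have lm: "l < m k" "l \<le> m k" "j \<le> m k" "l \<le> j" using j by auto
    have [measurable]: "e k l \<in> borel_measurable (F (q k j))"
    proof (rule standard_filtration_measurable_mono[OF fil eF[OF lm(1)]])
      show "q k l \<in> {0..q k j}" using strict_partition_iff(2)[OF sp(1), of l k j] lm q0T[of l k] by auto
      show "q k j \<in> {0..T}" using q0T[of j k] lm by auto
    qed
    show "(\<lambda>\<omega>. (e k l \<omega>)\<^sup>2 * (q k (Suc l) - q k l)) \<in> borel_measurable (F (q k j))" by measurable
  qed
  have \<eta>F: "\<eta> k j \<in> borel_measurable (F (q k j))" if "j < m k" for k j
  proof -
    note eF[OF that, measurable] enF[OF that, measurable]
    show ?thesis unfolding \<eta>_def[abs_def] by measurable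
  qed
  have \<eta>B: "\<exists>B. \<forall>\<omega>\<in>space M. \<bar>\<eta> k j \<omega>\<bar> \<le> B" if j: "j < m k" for k j
  proof -
    obtain B where B: "\<forall>\<omega>\<in>space M. \<bar>V k (q k (Suc j)) \<omega>\<bar> \<le> B" using VF(2)[OF j] by blast
    have "\<bar>\<eta> k j \<omega>\<bar> \<le> B" if "\<omega> \<in> space M" for \<omega>
      using B[rule_format, OF that] unfolding \<eta>_def e_def by (auto simp: of_bool_def)
    then show ?thesis by blast
  qed
  define \<Phi> where "\<Phi> k \<omega> = (\<Sum>j<m k. \<eta> k j \<omega> * (W (q k (Suc j)) \<omega> - W (q k j) \<omega>))" for k \<omega>
  define L where "L k \<omega> = (\<Sum>j<m k. (\<eta> k j \<omega>)\<^sup>2 * (q k (Suc j) - q k j))" for k \<omega>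
  have q00: "0 \<le> q k 0" "q k (m k) \<le> T" for k using sp[of k] st by auto
  have \<Phi>M [measurable]: "\<Phi> k \<in> borel_measurable M" and LM [measurable]: "L k \<in> borel_measurable M"
    and iso: "(\<integral>\<^sup>+\<omega>. ennreal ((\<Phi> k \<omega>)\<^sup>2) \<partial>M) = (\<integral>\<^sup>+\<omega>. ennreal (L k \<omega>) \<partial>M)" for k
    using discrete_ito_isometry[OF ps fil w sp(1) q00 \<eta>F \<eta>B, of k] unfolding \<Phi>_def L_def by blast+
  have Lc: "L k \<omega> \<le> c" and Le: "L k \<omega> \<le> en k (m k) \<omega>"
    and \<eta>e: "en k (m k) \<omega> \<le> c \<Longrightarrow> j < m k \<Longrightarrow> \<eta> k j \<omega> = e k j \<omega>" for k j \<omega>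
    using truncated_energy_le[where d="\<lambda>j. q k (Suc j) - q k j" and k="m k" and e="\<lambda>j. e k j \<omega>", OF dq c]
    unfolding L_def en_def \<eta>_def by blast+
  define Dg where "Dg \<omega> = (\<integral>\<^sup>+u\<in>{s..t}. ennreal ((D u \<omega>)\<^sup>2) * indicator (G u) \<omega> \<partial>lborel)" for \<omega>
  have Dgm [measurable]: "Dg \<in> borel_measurable M" unfolding Dg_def[abs_def] by measurable
  define dV where "dV k \<omega> = (\<integral>\<^sup>+u\<in>{s..t}. ennreal ((V k u \<omega> - D u \<omega>)\<^sup>2) \<partial>lborel)" for k \<omega>
  have Sm: "(\<lambda>u. S k u \<omega>) \<in> borel_measurable borel" "(\<lambda>u. Sb k u \<omega>) \<in> borel_measurable borel" for k \<omega>
    unfolding S_def Sb_def simple_val_def by measurable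
  have enB: "ennreal (en k (m k) \<omega>) \<le> 2 * dV k \<omega> + 2 * Dg \<omega> + ennreal (2 * B\<^sup>2 * \<delta> k)"
    if \<omega>: "\<omega> \<in> space M" and B: "\<forall>u\<in>{s..t}. \<bar>D u \<omega>\<bar> \<le> B" for k \<omega> B
  proof -
    have Gb: "of_bool (\<omega> \<in> G u) = (indicator (G u) \<omega> :: ennreal)" for u by (simp add: indicator_def)
    have "(\<lambda>u. indicator (G u) \<omega> :: ennreal) \<in> borel_measurable borel" using \<omega> by measurable
    then have "(\<lambda>u. indicator (G u) \<omega> = (1::ennreal)) \<in> measurable borel (count_space UNIV)" by measurable
    then have g: "Measurable.pred borel (\<lambda>u. \<omega> \<in> G u)" by (simp add: indicator_def)
    have Vm: "(\<lambda>u. V k u \<omega>) \<in> borel_measurable borel" unfolding V_def using Sm[of k \<omega>] by measurable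
    have Dm: "(\<lambda>u. D u \<omega>) \<in> borel_measurable borel" using \<omega> by measurable
    show ?thesis
      unfolding en_def e_def dV_def Dg_def Gb[symmetric]
    proof (rule partition_energy_bound[OF sp[of k] _ Vm Dm g])
      show "V k u \<omega> = V k (q k (Suc j)) \<omega>" if "j < m k" "q k j < u" "u \<le> q k (Suc j)" for j u
        unfolding V_def S_def Sb_def
        by (intro arg_cong2[where f="(-)"] simple_val_const[OF q(1) that] simple_val_const[OF q(2) that])
      show "\<omega> \<in> G u" if "s \<le> u" "u \<le> w'" "w' \<le> t" "\<omega> \<in> G w'" for u w'
        using G(2)[of u w'] that st by auto
    qed (use B q(3) less_imp_le[OF \<delta>] in auto)
  qed
  have main: "AE \<omega> in M. limsup (\<lambda>k. ennreal (L k \<omega>)) \<le> 2 * Dg \<omega> \<and>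
     ennreal (((I t \<omega> - Ib t \<omega>) - (I s \<omega> - Ib s \<omega>))\<^sup>2) * indicator (G t) \<omega> \<le> liminf (\<lambda>k. ennreal ((\<Phi> k \<omega>)\<^sup>2))"
  proof -
    have Hm: "AE \<omega> in M. set_borel_measurable lborel {0..T} (\<lambda>s. H s \<omega>)" "AE \<omega> in M. set_borel_measurable lborel {0..T} (\<lambda>s. Hb s \<omega>)"
      using ito itob by (auto simp: has_ito_integral_def)
    show ?thesis
      using r DAE Hm AE_space
    proof eventually_elim
      case (elim \<omega>)
      note lim = elim(1)
      have zero: "(\<lambda>k. f k) \<longlonglongrightarrow> (0::ennreal)" if "\<And>k. f k \<le> Y1 (r k) \<omega> + (Y2 (r k) t \<omega> + Y2 (r k) s \<omega>)" for f
        by (rule ennreal_tendsto_0_le[OF that lim])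
      have Y1: "(\<lambda>k. Y1 (r k) \<omega>) \<longlonglongrightarrow> 0" by (rule zero) simp
      obtain B where B: "\<forall>u\<in>{s..t}. \<bar>D u \<omega>\<bar> \<le> B" using Dbd[OF elim(5)] by blast
      have dVY: "dV k \<omega> \<le> 2 * Y1 (r k) \<omega>" for k
      proof -
        define h where "h u = indicator {0..T} u *\<^sub>R H u \<omega>" for u
        define hb where "hb u = indicator {0..T} u *\<^sub>R Hb u \<omega>" for u
        have [measurable]: "h \<in> borel_measurable borel" "hb \<in> borel_measurable borel"
          using elim(3,4) unfolding h_def[abs_def] hb_def[abs_def] set_borel_measurable_def by auto
        note Sm[of k \<omega>, measurable]
        have "dV k \<omega> \<le> (\<integral>\<^sup>+u. 2 * (ennreal ((S k u \<omega> - h u)\<^sup>2) * indicator {0..T} u + ennreal ((Sb k u \<omega> - hb u)\<^sup>2) * indicator {0..T} u) \<partial>lborel)"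
          unfolding dV_def
        proof (intro nn_integral_mono)
          fix u
          show "ennreal ((V k u \<omega> - D u \<omega>)\<^sup>2) * indicator {s..t} u \<le>
            2 * (ennreal ((S k u \<omega> - h u)\<^sup>2) * indicator {0..T} u + ennreal ((Sb k u \<omega> - hb u)\<^sup>2) * indicator {0..T} u)"
          proof (cases "u \<in> {s..t}")
            case True
            then have u: "u \<in> {0..T}" using st by auto
            have "(V k u \<omega> - D u \<omega>)\<^sup>2 \<le> 2 * ((S k u \<omega> - H u \<omega>)\<^sup>2 + (Sb k u \<omega> - Hb u \<omega>)\<^sup>2)"
            proof -
              have "V k u \<omega> - D u \<omega> = (S k u \<omega> - H u \<omega>) - (Sb k u \<omega> - Hb u \<omega>)"
                using elim(2) u by (auto simp: V_def)
              moreover have "(x - y)\<^sup>2 \<le> 2 * (x\<^sup>2 + y\<^sup>2)" for x y :: real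
                using square_le_double[of "x - y" "- y"] by simp
              ultimately show ?thesis by metis
            qed
            then have "ennreal ((V k u \<omega> - D u \<omega>)\<^sup>2) \<le> ennreal (2 * ((S k u \<omega> - H u \<omega>)\<^sup>2 + (Sb k u \<omega> - Hb u \<omega>)\<^sup>2))"
              by (rule ennreal_leI)
            then show ?thesis using True u by (simp add: h_def hb_def ennreal_mult ennreal_plus)
          qed simp
        qed
        also have "\<dots> = 2 * ((\<integral>\<^sup>+u\<in>{0..T}. ennreal ((S k u \<omega> - h u)\<^sup>2) \<partial>lborel) + (\<integral>\<^sup>+u\<in>{0..T}. ennreal ((Sb k u \<omega> - hb u)\<^sup>2) \<partial>lborel))"
          by (subst nn_integral_cmult, measurable) (subst nn_integral_add, auto)
        also have "\<dots> = 2 * Y1 (r k) \<omega>"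
        proof -
          have "(\<integral>\<^sup>+u\<in>{0..T}. ennreal ((S k u \<omega> - h u)\<^sup>2) \<partial>lborel) = (\<integral>\<^sup>+u\<in>{0..T}. ennreal ((S k u \<omega> - H u \<omega>)\<^sup>2) \<partial>lborel)"
            "(\<integral>\<^sup>+u\<in>{0..T}. ennreal ((Sb k u \<omega> - hb u)\<^sup>2) \<partial>lborel) = (\<integral>\<^sup>+u\<in>{0..T}. ennreal ((Sb k u \<omega> - Hb u \<omega>)\<^sup>2) \<partial>lborel)"
            by (auto intro!: nn_integral_cong simp: h_def hb_def split: split_indicator)
          then show ?thesis unfolding Y1_def S_def[symmetric] Sb_def[symmetric] by simp
        qed
        finally show ?thesis .
      qed
      have "(\<lambda>k. 2 * Y1 (r k) \<omega>) \<longlonglongrightarrow> 2 * 0" by (intro ennreal_tendsto_cmult Y1) simp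
      then have Y10: "(\<lambda>k. 2 * Y1 (r k) \<omega>) \<longlonglongrightarrow> 0" by simp
      have dV0: "(\<lambda>k. dV k \<omega>) \<longlonglongrightarrow> 0" by (rule ennreal_tendsto_0_le[OF dVY Y10])
      have "(\<lambda>k. 2 * B\<^sup>2 * \<delta> k) \<longlonglongrightarrow> 2 * B\<^sup>2 * 0"
        unfolding \<delta>_def by (intro tendsto_mult tendsto_const LIMSEQ_Suc[OF lim_const_over_n])
      then have d0: "(\<lambda>k. ennreal (2 * B\<^sup>2 * \<delta> k)) \<longlonglongrightarrow> ennreal 0" by (intro tendsto_ennrealI) simp
      have "(\<lambda>k. 2 * dV k \<omega> + 2 * Dg \<omega> + ennreal (2 * B\<^sup>2 * \<delta> k)) \<longlonglongrightarrow> 2 * 0 + 2 * Dg \<omega> + ennreal 0"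
        by (intro tendsto_add ennreal_tendsto_cmult dV0 tendsto_const d0) simp
      then have blim: "(\<lambda>k. 2 * dV k \<omega> + 2 * Dg \<omega> + ennreal (2 * B\<^sup>2 * \<delta> k)) \<longlonglongrightarrow> 2 * Dg \<omega>" by simp
      have "limsup (\<lambda>k. ennreal (L k \<omega>)) \<le> limsup (\<lambda>k. 2 * dV k \<omega> + 2 * Dg \<omega> + ennreal (2 * B\<^sup>2 * \<delta> k))"
        by (intro Limsup_mono always_eventually allI order_trans[OF ennreal_leI[OF Le] enB[OF elim(5) B]])
      also have "\<dots> = 2 * Dg \<omega>" by (rule lim_imp_Limsup[OF _ blim]) simp
      finally have 1: "limsup (\<lambda>k. ennreal (L k \<omega>)) \<le> 2 * Dg \<omega>" .
      have 2: "ennreal (((I t \<omega> - Ib t \<omega>) - (I s \<omega> - Ib s \<omega>))\<^sup>2) * indicator (G t) \<omega> \<le> liminf (\<lambda>k. ennreal ((\<Phi> k \<omega>)\<^sup>2))"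
      proof (cases "\<omega> \<in> G t")
        case True
        have "Dg \<omega> \<le> (\<integral>\<^sup>+u\<in>{s..t}. ennreal ((D u \<omega>)\<^sup>2) \<partial>lborel)"
          unfolding Dg_def by (intro nn_integral_mono) (auto split: split_indicator)
        also have "\<dots> \<le> ennreal \<kappa>" by (rule \<kappa>(2)[OF elim(5) True])
        finally have "2 * Dg \<omega> \<le> 2 * ennreal \<kappa>" by (rule mult_left_mono) simp
        also have "\<dots> = ennreal (2 * \<kappa>)" using \<kappa> by (simp add: ennreal_mult)
        also have "\<dots> < ennreal c" using \<kappa> by (intro ennreal_lessI) (auto simp: c_def)
        finally have ev: "\<forall>\<^sub>F k in sequentially. 2 * dV k \<omega> + 2 * Dg \<omega> + ennreal (2 * B\<^sup>2 * \<delta> k) < ennreal c"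
          by (rule order_tendstoD(2)[OF blim])
        define R where "R k u = (simple_integral W (n (r k)) (p (r k)) (\<xi> (r k)) u \<omega> - simple_integral W (nb (r k)) (pb (r k)) (\<xi>b (r k)) u \<omega>)" for k u
        have \<Phi>R: "\<forall>\<^sub>F k in sequentially. R k t - R k s = \<Phi> k \<omega>"
          using ev
        proof eventually_elim
          case (elim k)
          have "ennreal (en k (m k) \<omega>) < ennreal c" using enB[OF \<open>\<omega> \<in> space M\<close> B, of k] elim by (rule le_less_trans)
          then have "ennreal (en k (m k) \<omega>) \<le> ennreal c" by (rule less_imp_le)
          then have enc: "en k (m k) \<omega> \<le> c" by (simp only: ennreal_le_iff[OF c])
          have "\<eta> k j \<omega> = V k (q k (Suc j)) \<omega>" if j: "j < m k" for j
          proof -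
            have "q k j \<le> t" "0 \<le> q k j" using qT[of j k] q0T[of j k] j by auto
            then have "\<omega> \<in> G (q k j)" using G(2)[of "q k j" t] True st by auto
            then show ?thesis using \<eta>e[OF enc j] by (simp add: e_def)
          qed
          then have "\<Phi> k \<omega> = (\<Sum>j<m k. S k (q k (Suc j)) \<omega> * (W (q k (Suc j)) \<omega> - W (q k j) \<omega>))
             - (\<Sum>j<m k. Sb k (q k (Suc j)) \<omega> * (W (q k (Suc j)) \<omega> - W (q k j) \<omega>))"
            unfolding \<Phi>_def V_def by (simp add: left_diff_distrib sum_subtractf)
          also have "\<dots> = R k t - R k s"
            unfolding R_def S_def Sb_def
              simple_integral_increment[OF A(1) q(1) st(1) less_imp_le[OF st(2)] st(3), symmetric]
              simple_integral_increment[OF Ab(1) q(2) st(1) less_imp_le[OF st(2)] st(3), symmetric]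
            by simp
          finally show ?case by simp
        qed
        have RI: "(\<lambda>k. R k u) \<longlonglongrightarrow> I u \<omega> - Ib u \<omega>" if u: "u = s \<or> u = t" for u
        proof -
          have Y2: "(\<lambda>k. Y2 (r k) u \<omega>) \<longlonglongrightarrow> 0" using u by (intro zero) (auto intro: add_increasing)
          have "(\<lambda>k. ennreal \<bar>simple_integral W (n (r k)) (p (r k)) (\<xi> (r k)) u \<omega> - I u \<omega>\<bar>) \<longlonglongrightarrow> 0"
            by (rule ennreal_tendsto_0_le[OF _ Y2]) (simp add: Y2_def)
          then have 1: "(\<lambda>k. simple_integral W (n (r k)) (p (r k)) (\<xi> (r k)) u \<omega> - I u \<omega>) \<longlonglongrightarrow> 0"
            by (subst (asm) ennreal_0[symmetric], subst (asm) tendsto_ennreal_iff) (auto simp: tendsto_rabs_zero_iff)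
          have "(\<lambda>k. ennreal \<bar>simple_integral W (nb (r k)) (pb (r k)) (\<xi>b (r k)) u \<omega> - Ib u \<omega>\<bar>) \<longlonglongrightarrow> 0"
            by (rule ennreal_tendsto_0_le[OF _ Y2]) (simp add: Y2_def)
          then have 2: "(\<lambda>k. simple_integral W (nb (r k)) (pb (r k)) (\<xi>b (r k)) u \<omega> - Ib u \<omega>) \<longlonglongrightarrow> 0"
            by (subst (asm) ennreal_0[symmetric], subst (asm) tendsto_ennreal_iff) (auto simp: tendsto_rabs_zero_iff)
          show ?thesis unfolding R_def by (rule tendsto_diff[OF LIM_zero_cancel[OF 1] LIM_zero_cancel[OF 2]])
        qed
        have "(\<lambda>k. R k t - R k s) \<longlonglongrightarrow> (I t \<omega> - Ib t \<omega>) - (I s \<omega> - Ib s \<omega>)" by (intro tendsto_diff RI) auto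
        then have "(\<lambda>k. \<Phi> k \<omega>) \<longlonglongrightarrow> (I t \<omega> - Ib t \<omega>) - (I s \<omega> - Ib s \<omega>)" by (rule Lim_transform_eventually) (rule \<Phi>R)
        then have "(\<lambda>k. ennreal ((\<Phi> k \<omega>)\<^sup>2)) \<longlonglongrightarrow> ennreal (((I t \<omega> - Ib t \<omega>) - (I s \<omega> - Ib s \<omega>))\<^sup>2)"
          by (intro tendsto_ennrealI tendsto_power)
        then have "liminf (\<lambda>k. ennreal ((\<Phi> k \<omega>)\<^sup>2)) = ennreal (((I t \<omega> - Ib t \<omega>) - (I s \<omega> - Ib s \<omega>))\<^sup>2)"
          by (intro lim_imp_Liminf) simp_all
        then show ?thesis using True by simp
      qed simp
      from 1 2 show ?case by blast
    qed
  qed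
  have "(\<integral>\<^sup>+\<omega>. ennreal (((I t \<omega> - Ib t \<omega>) - (I s \<omega> - Ib s \<omega>))\<^sup>2) * indicator (G t) \<omega> \<partial>M)
     \<le> (\<integral>\<^sup>+\<omega>. liminf (\<lambda>k. ennreal ((\<Phi> k \<omega>)\<^sup>2)) \<partial>M)"
    by (rule nn_integral_mono_AE) (use main in eventually_elim, simp)
  also have "\<dots> \<le> liminf (\<lambda>k. \<integral>\<^sup>+\<omega>. ennreal ((\<Phi> k \<omega>)\<^sup>2) \<partial>M)" by (intro nn_integral_liminf) measurable
  also have "\<dots> = liminf (\<lambda>k. \<integral>\<^sup>+\<omega>. ennreal (L k \<omega>) \<partial>M)" by (simp add: iso)
  also have "\<dots> \<le> limsup (\<lambda>k. \<integral>\<^sup>+\<omega>. ennreal (L k \<omega>) \<partial>M)" by (rule Liminf_le_Limsup) simp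
  also have "\<dots> \<le> (\<integral>\<^sup>+\<omega>. limsup (\<lambda>k. ennreal (L k \<omega>)) \<partial>M)"
  proof (rule nn_integral_limsup[where w="\<lambda>_. ennreal c"])
    show "AE \<omega> in M. ennreal (L k \<omega>) \<le> ennreal c" for k using Lc by (intro AE_I2 ennreal_leI)
    show "(\<integral>\<^sup>+\<omega>. ennreal c \<partial>M) < \<infinity>" by (simp add: emeasure_space_1)
  qed measurable
  also have "\<dots> \<le> (\<integral>\<^sup>+\<omega>. 2 * Dg \<omega> \<partial>M)" by (rule nn_integral_mono_AE) (use main in eventually_elim, simp)
  also have "\<dots> = 2 * (\<integral>\<^sup>+\<omega>. Dg \<omega> \<partial>M)" by (rule nn_integral_cmult) measurable
  finally show ?thesis unfolding Dg_def .
qed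

section \<open>Measurability of the norms and stopping\<close>

text \<open>The process is the limit of the processes that are constant on the intervals of length
  \<open>1/(k + 1)\<close>.\<close>

lemma continuous_process_joint_measurable:
  fixes Y :: "real \<Rightarrow> 'a \<Rightarrow> real"
  assumes Y: "\<And>t. Y t \<in> borel_measurable M" and c: "\<And>\<omega>. \<omega> \<in> space M \<Longrightarrow> continuous_on UNIV (\<lambda>t. Y t \<omega>)"
  shows "(\<lambda>(t, \<omega>). Y t \<omega>) \<in> borel_measurable (borel \<Otimes>\<^sub>M M)"
proof (rule borel_measurable_LIMSEQ_real)
  let ?a = "\<lambda>k (t::real). real_of_int \<lfloor>t * real (Suc k)\<rfloor> / real (Suc k)"
  show "(\<lambda>(t::real, \<omega>). Y (?a k t) \<omega>) \<in> borel_measurable (borel \<Otimes>\<^sub>M M)" for k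
  proof -
    have [measurable]: "(\<lambda>x. Y (real_of_int i / real (Suc k)) (snd x)) \<in> borel_measurable (borel \<Otimes>\<^sub>M M)" for i
      using Y by measurable
    have "(\<lambda>x. (\<lambda>i x. Y (real_of_int i / real (Suc k)) (snd x)) \<lfloor>fst x * real (Suc k)\<rfloor> x) \<in> borel_measurable (borel \<Otimes>\<^sub>M M)"
      by (rule measurable_compose_countable) measurable
    then show ?thesis by (simp add: case_prod_beta')
  qed
  fix x assume "x \<in> space ((borel :: real measure) \<Otimes>\<^sub>M M)"
  then obtain t \<omega> where x: "x = (t, \<omega>)" "\<omega> \<in> space M" by (auto simp: space_pair_measure)
  have "(\<lambda>k. ?a k t) \<longlonglongrightarrow> t"
  proof (rule tendsto_sandwich[of "\<lambda>k. t - 1 / real (Suc k)" _ _ "\<lambda>_. t"])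
    have "(\<lambda>k. t - 1 / real (Suc k)) \<longlonglongrightarrow> t - 0" by (intro tendsto_diff tendsto_const LIMSEQ_Suc[OF lim_const_over_n])
    then show "(\<lambda>k. t - 1 / real (Suc k)) \<longlonglongrightarrow> t" by simp
    show "\<forall>\<^sub>F k in sequentially. t - 1 / real (Suc k) \<le> ?a k t"
    proof (intro always_eventually allI)
      fix k
      have "t * real (Suc k) - 1 \<le> real_of_int \<lfloor>t * real (Suc k)\<rfloor>" by linarith
      then have "(t * real (Suc k) - 1) / real (Suc k) \<le> ?a k t" by (intro divide_right_mono) auto
      then show "t - 1 / real (Suc k) \<le> ?a k t" by (simp add: diff_divide_distrib)
    qed
    show "\<forall>\<^sub>F k in sequentially. ?a k t \<le> t"
      by (intro always_eventually allI) (auto simp: divide_le_eq)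
  qed auto
  moreover have "isCont (\<lambda>t. Y t \<omega>) t" using c[OF x(2)] by (simp add: continuous_on_eq_continuous_at)
  ultimately have "(\<lambda>k. Y (?a k t) \<omega>) \<longlonglongrightarrow> Y t \<omega>" by (rule isCont_tendsto_compose[rotated])
  then show "(\<lambda>k. (\<lambda>(t::real, \<omega>). Y (?a k t) \<omega>) x) \<longlonglongrightarrow> (\<lambda>(t, \<omega>). Y t \<omega>) x" unfolding x by simp
qed

definition clamp_time :: "real \<Rightarrow> real \<Rightarrow> real" where
  "clamp_time T t = max 0 (min t T)"

text \<open>The exceptional null set belongs to all \<open>F t\<close>, so resetting the process to \<open>0\<close> on it
  preserves adaptedness. The paths are extended by constants beyond \<open>[0, T]\<close>, so that they are
  continuous on the whole line.\<close>

lemma continuous_version: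
  assumes fil: "standard_filtration M F T" and T: "0 \<le> T" and X: "adapted F T X" "continuous_process M T X"
  obtains X' where "\<And>\<omega>. continuous_on UNIV (\<lambda>t. X' t \<omega>)"
    "\<And>t. t \<in> {0..T} \<Longrightarrow> X' t \<in> borel_measurable (F t)"
    "\<And>t \<omega>. X' (clamp_time T t) \<omega> = X' t \<omega>"
    "AE \<omega> in M. \<forall>t\<in>{0..T}. X' t \<omega> = X t \<omega>"
proof -
  obtain N where N: "N \<in> null_sets M" "{\<omega> \<in> space M. \<not> continuous_on {0..T} (\<lambda>t. X t \<omega>)} \<subseteq> N"
    using X(2) unfolding continuous_process_def by (elim AE_E) (auto simp: null_sets_def)
  define X' where "X' t \<omega> = (if \<omega> \<in> space M - N then X (clamp_time T t) \<omega> else 0)" for t \<omega>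
  show ?thesis
  proof (rule that[of X'])
    show "continuous_on UNIV (\<lambda>t. X' t \<omega>)" for \<omega>
    proof (cases "\<omega> \<in> space M - N")
      case True
      then have c: "continuous_on {0..T} (\<lambda>t. X t \<omega>)" using N by auto
      have "continuous_on UNIV (\<lambda>t. X (clamp_time T t) \<omega>)"
        by (rule continuous_on_compose2[OF c]) (auto simp: clamp_time_def T intro!: continuous_intros)
      moreover have e: "(\<lambda>t. X' t \<omega>) = (\<lambda>t. X (clamp_time T t) \<omega>)" using True by (simp add: X'_def)
      ultimately show ?thesis unfolding e by blast
    next
      case False
      then have e: "(\<lambda>t. X' t \<omega>) = (\<lambda>t. 0)" by (auto simp: X'_def)
      show ?thesis unfolding e by simp
    qed
    show "X' t \<in> borel_measurable (F t)" if t: "t \<in> {0..T}" for t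
    proof -
      have [measurable]: "N \<in> sets (F t)" using standard_filtrationD(4)[OF fil t] N by auto
      have [measurable]: "X t \<in> borel_measurable (F t)" using X(1) t by (simp add: adapted_def)
      have "(\<lambda>\<omega>. if \<omega> \<in> space (F t) - N then X t \<omega> else 0) \<in> borel_measurable (F t)" by measurable
      moreover have e: "clamp_time T t = t" using t by (simp add: clamp_time_def)
      ultimately show ?thesis unfolding X'_def[abs_def] e using standard_filtrationD(1)[OF fil t] by simp
    qed
    show "X' (clamp_time T t) \<omega> = X' t \<omega>" for t \<omega> using T by (simp add: X'_def clamp_time_def)
    have "AE \<omega> in M. \<omega> \<notin> N" using N(1) by (rule AE_not_in)
    then show "AE \<omega> in M. \<forall>t\<in>{0..T}. X' t \<omega> = X t \<omega>"
      using AE_space by eventually_elim (auto simp: X'_def clamp_time_def)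
  qed
qed

lemma clamped_adapted_measurable:
  assumes fil: "standard_filtration M F T" and T: "0 \<le> T"
    and Y: "\<And>t. t \<in> {0..T} \<Longrightarrow> Y t \<in> borel_measurable (F t)" "\<And>t \<omega>. Y (clamp_time T t) \<omega> = Y t \<omega>"
  shows "Y u \<in> borel_measurable M"
proof -
  have c: "clamp_time T u \<in> {0..T}" using T by (auto simp: clamp_time_def)
  have "Y (clamp_time T u) \<in> borel_measurable M" by (rule standard_filtration_measurable_M[OF fil Y(1)[OF c] c])
  moreover have "Y (clamp_time T u) = Y u" using Y(2) by auto
  ultimately show ?thesis by simp
qed

lemma hoelder_process_continuous:
  assumes h: "hoelder_process M T \<gamma> Y" and \<gamma>: "0 < \<gamma>"
  shows "continuous_process M T Y"
  using h unfolding hoelder_process_def continuous_process_def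
proof eventually_elim
  case (elim \<omega>)
  then obtain L where L: "\<And>s t. s \<in> {0..T} \<Longrightarrow> t \<in> {0..T} \<Longrightarrow> \<bar>Y t \<omega> - Y s \<omega>\<bar> \<le> L * \<bar>t - s\<bar> powr \<gamma>" by blast
  show ?case
    unfolding continuous_on_def
  proof
    fix s assume s: "s \<in> {0..T}"
    have "((\<lambda>t. L * \<bar>t - s\<bar> powr \<gamma>) \<longlongrightarrow> L * 0) (at s within {0..T})"
      using \<gamma> by (intro tendsto_mult tendsto_const) (auto intro!: tendsto_eq_intros tendsto_powr' eventually_at_filter[THEN iffD2])
    then have "((\<lambda>t. L * \<bar>t - s\<bar> powr \<gamma>) \<longlongrightarrow> 0) (at s within {0..T})" by simp
    then show "((\<lambda>t. Y t \<omega>) \<longlongrightarrow> Y s \<omega>) (at s within {0..T})"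
      by (intro Lim_transform_bound[where f="\<lambda>t. Y t \<omega> - Y s \<omega>", THEN LIM_zero_cancel])
        (auto simp: eventually_at_filter intro!: always_eventually order_trans[OF L abs_ge_self] s)
  qed
qed

lemma norm_at_joint_measurable:
  assumes Y [measurable]: "(\<lambda>(t, \<omega>). Y t \<omega>) \<in> borel_measurable (borel \<Otimes>\<^sub>M M)"
  shows "(\<lambda>(t, \<omega>). norm_at \<alpha> t (\<lambda>s. Y s \<omega>)) \<in> borel_measurable (borel \<Otimes>\<^sub>M M)"
proof -
  have "(\<lambda>(t, \<omega>). norm_at \<alpha> t (\<lambda>s. Y s \<omega>)) = (\<lambda>x. ennreal \<bar>Y (fst x) (snd x)\<bar> +
     (\<integral>\<^sup>+s. ennreal (\<bar>Y (fst x) (snd x) - Y s (snd x)\<bar> * (fst x - s) powr (- 1 - \<alpha>)) * indicator {(t, s). 0 \<le> s \<and> s \<le> t} (fst x, s) \<partial>lborel))"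
    unfolding norm_at_def case_prod_beta'
    by (intro ext arg_cong2[where f="(+)"] refl nn_integral_cong) (auto split: split_indicator)
  also have "\<dots> \<in> borel_measurable (borel \<Otimes>\<^sub>M M)" by measurable
  finally show ?thesis .
qed

lemma norm_at_adapted:
  assumes fil: "standard_filtration M F T" and c: "\<And>\<omega>. continuous_on UNIV (\<lambda>t. X t \<omega>)"
    and X: "\<And>t. t \<in> {0..T} \<Longrightarrow> X t \<in> borel_measurable (F t)" and t: "t \<in> {0..T}"
  shows "(\<lambda>\<omega>. norm_at \<alpha> t (\<lambda>s. X s \<omega>)) \<in> borel_measurable (F t)"
proof -
  have "(\<lambda>(s, \<omega>). X (clamp_time t s) \<omega>) \<in> borel_measurable (borel \<Otimes>\<^sub>M F t)"
  proof (rule continuous_process_joint_measurable)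
    show "X (clamp_time t s) \<in> borel_measurable (F t)" for s
      using t by (intro standard_filtration_measurable_mono[OF fil X]) (auto simp: clamp_time_def)
    show "continuous_on UNIV (\<lambda>s. X (clamp_time t s) \<omega>)" for \<omega>
      by (rule continuous_on_compose2[OF c]) (auto simp: clamp_time_def intro!: continuous_intros)
  qed
  note norm_at_joint_measurable[OF this, measurable]
  have "(\<lambda>\<omega>. norm_at \<alpha> t (\<lambda>s. X (clamp_time t s) \<omega>)) \<in> borel_measurable (F t)" by measurable
  also have "(\<lambda>\<omega>. norm_at \<alpha> t (\<lambda>s. X (clamp_time t s) \<omega>)) = (\<lambda>\<omega>. norm_at \<alpha> t (\<lambda>s. X s \<omega>))"
    using t by (intro ext norm_at_cong) (auto simp: clamp_time_def)
  finally show ?thesis .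
qed

text \<open>By Fatou's lemma \<open>norm_at\<close> is lower semicontinuous in the time along a continuous path.
  The values \<open>\<bar>f s\<bar>\<close> and \<open>\<bar>g s\<bar>\<close> are written as integrals over \<open>[-1, 0)\<close>, disjoint from
  \<open>[0, s]\<close>, so that Fatou's lemma is applied to a single integrand \<open>H\<close>.\<close>

lemma norm_at_sum_lsc:
  assumes f: "continuous_on UNIV f" and g: "continuous_on UNIV g" and t: "0 < t"
    and le: "\<And>r. r \<in> \<rat> \<Longrightarrow> 0 < r \<Longrightarrow> r < t \<Longrightarrow> norm_at \<alpha> r f + norm_at \<alpha> r g \<le> C"
  shows "norm_at \<alpha> t f + norm_at \<alpha> t g \<le> C"
proof -
  have [measurable]: "f \<in> borel_measurable borel" "g \<in> borel_measurable borel"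
    using f g by (auto intro: borel_measurable_continuous_onI)
  have "\<exists>r\<in>\<rat>. max 0 (t - 1 / real (Suc k)) < r \<and> r < t" for k
    using Rats_dense_in_real[of "max 0 (t - 1 / real (Suc k))" t] t by auto
  then obtain r where r: "\<And>k. r k \<in> \<rat>" "\<And>k. max 0 (t - 1 / real (Suc k)) < r k" "\<And>k. r k < t" by metis
  have rt: "r \<longlonglongrightarrow> t"
  proof (rule tendsto_sandwich[of "\<lambda>k. t - 1 / real (Suc k)" _ _ "\<lambda>_. t"])
    have "(\<lambda>k. t - 1 / real (Suc k)) \<longlonglongrightarrow> t - 0" by (intro tendsto_diff tendsto_const LIMSEQ_Suc[OF lim_const_over_n])
    then show "(\<lambda>k. t - 1 / real (Suc k)) \<longlonglongrightarrow> t" by simp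
  qed (use r in \<open>auto intro!: always_eventually less_imp_le simp: less_imp_le\<close>)
  define H where "H s x = (ennreal \<bar>f s\<bar> + ennreal \<bar>g s\<bar>) * indicator {-1..<0} x +
     (ennreal (\<bar>f s - f x\<bar> * (s - x) powr (- 1 - \<alpha>)) + ennreal (\<bar>g s - g x\<bar> * (s - x) powr (- 1 - \<alpha>))) * indicator {0..s} x" for s x :: real
  have [measurable]: "H s \<in> borel_measurable lborel" for s unfolding H_def by measurable
  have H: "(\<integral>\<^sup>+x. H s x \<partial>lborel) = norm_at \<alpha> s f + norm_at \<alpha> s g" for s
  proof -
    have "(\<integral>\<^sup>+x. (ennreal \<bar>f s\<bar> + ennreal \<bar>g s\<bar>) * indicator {-1..<0::real} x \<partial>lborel) = ennreal \<bar>f s\<bar> + ennreal \<bar>g s\<bar>"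
      by (subst nn_integral_cmult_indicator) auto
    then show ?thesis unfolding H_def norm_at_def
      by (subst nn_integral_add, measurable) (simp add: distrib_right nn_integral_add add_ac)
  qed
  have "AE x in lborel. H t x \<le> liminf (\<lambda>k. H (r k) x)"
    using AE_lborel_singleton[of t]
  proof eventually_elim
    fix x assume "x \<noteq> t"
    have ct: "(\<lambda>k. f (r k)) \<longlonglongrightarrow> f t" "(\<lambda>k. g (r k)) \<longlonglongrightarrow> g t"
      using f g rt by (simp_all add: continuous_on_eq_continuous_at isCont_tendsto_compose)
    have "(\<lambda>k. H (r k) x) \<longlonglongrightarrow> H t x" if x: "x < t"
    proof -
      have "\<forall>\<^sub>F k in sequentially. x < r k" by (rule order_tendstoD(1)[OF rt x])
      then have ind: "\<forall>\<^sub>F k in sequentially. indicator {0..t} x = (indicator {0..r k} x :: ennreal)"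
        by eventually_elim (use x r(3) in \<open>auto simp: indicator_def\<close>)
      let ?F = "\<lambda>s. ennreal (\<bar>f s - f x\<bar> * (s - x) powr (- 1 - \<alpha>)) + ennreal (\<bar>g s - g x\<bar> * (s - x) powr (- 1 - \<alpha>))"
      have F: "(\<lambda>k. ?F (r k)) \<longlonglongrightarrow> ?F t"
        using x by (intro tendsto_intros tendsto_ennrealI ct rt) auto
      have "(\<lambda>k. ?F (r k) * indicator {0..t} x) \<longlonglongrightarrow> ?F t * indicator {0..t} x"
      proof (cases "x \<in> {0..t}")
        case True
        then show ?thesis using F by simp
      qed simp
      then have a: "(\<lambda>k. ?F (r k) * indicator {0..r k} x) \<longlonglongrightarrow> ?F t * indicator {0..t} x"
        by (rule Lim_transform_eventually) (use ind in eventually_elim, simp)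
      have b: "(\<lambda>k. (ennreal \<bar>f (r k)\<bar> + ennreal \<bar>g (r k)\<bar>) * indicator {-1..<0} x) \<longlonglongrightarrow> (ennreal \<bar>f t\<bar> + ennreal \<bar>g t\<bar>) * indicator {-1..<0} x"
        by (cases "x \<in> {-1..<0}") (auto intro!: tendsto_intros tendsto_ennrealI ct)
      show ?thesis unfolding H_def by (intro tendsto_add a b)
    qed
    moreover have "H t x = 0" if "x > t" using that t by (auto simp: H_def)
    ultimately show "H t x \<le> liminf (\<lambda>k. H (r k) x)"
      using \<open>x \<noteq> t\<close> by (cases "x < t") (auto simp: lim_imp_Liminf)
  qed
  then have "(\<integral>\<^sup>+x. H t x \<partial>lborel) \<le> (\<integral>\<^sup>+x. liminf (\<lambda>k. H (r k) x) \<partial>lborel)" by (rule nn_integral_mono_AE)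
  also have "\<dots> \<le> liminf (\<lambda>k. \<integral>\<^sup>+x. H (r k) x \<partial>lborel)" by (rule nn_integral_liminf) measurable
  also have "\<dots> \<le> liminf (\<lambda>k. C)"
    unfolding H using r by (intro Liminf_mono always_eventually allI le) (auto intro: le_less_trans[of 0])
  finally show ?thesis unfolding H by (simp add: Liminf_const)
qed

text \<open>The same argument as for \<open>norm_at_sum_lsc\<close>; here the difference quotient is spread over a
  unit interval to the left of \<open>[u, v]\<close>.\<close>

lemma zero_term_lsc:
  assumes f: "continuous_on UNIV f" and uv: "u < v" and lim: "x \<longlonglongrightarrow> u" "y \<longlonglongrightarrow> v"
    and le: "\<And>k. zero_term \<alpha> f (x k) (y k) \<le> C"
  shows "zero_term \<alpha> f u v \<le> C"
proof -
  have [measurable]: "f \<in> borel_measurable borel" using f by (auto intro: borel_measurable_continuous_onI)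
  define H where "H a b z = ennreal (\<bar>f b - f a\<bar> / (b - a) powr (1 - \<alpha>)) * indicator {u-2..<u-1} z +
     ennreal (\<bar>f a - f z\<bar> / (z - a) powr (2 - \<alpha>)) * indicator {a..b} z" for a b z :: real
  have [measurable]: "H a b \<in> borel_measurable lborel" for a b unfolding H_def by measurable
  have H: "(\<integral>\<^sup>+z. H a b z \<partial>lborel) = zero_term \<alpha> f a b" for a b
    unfolding H_def zero_term_def by (subst nn_integral_add, measurable) (subst nn_integral_cmult_indicator, auto)
  have ct: "(\<lambda>k. f (x k)) \<longlonglongrightarrow> f u" "(\<lambda>k. f (y k)) \<longlonglongrightarrow> f v"
    using f lim by (simp_all add: continuous_on_eq_continuous_at isCont_tendsto_compose)
  have "AE z in lborel. H u v z \<le> liminf (\<lambda>k. H (x k) (y k) z)"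
    using AE_lborel_singleton[of u] AE_lborel_singleton[of v]
  proof eventually_elim
    fix z assume z: "z \<noteq> u" "z \<noteq> v"
    show "H u v z \<le> liminf (\<lambda>k. H (x k) (y k) z)"
    proof (cases "u < z \<and> z < v")
      case True
      then have "\<forall>\<^sub>F k in sequentially. x k < z" "\<forall>\<^sub>F k in sequentially. z < y k"
        using order_tendstoD(2)[OF lim(1)] order_tendstoD(1)[OF lim(2)] by auto
      then have ev: "\<forall>\<^sub>F k in sequentially. ennreal (\<bar>f (x k) - f z\<bar> / (z - x k) powr (2 - \<alpha>)) = H (x k) (y k) z"
        by eventually_elim (use True in \<open>auto simp: H_def indicator_def\<close>)
      have "(\<lambda>k. ennreal (\<bar>f (x k) - f z\<bar> / (z - x k) powr (2 - \<alpha>))) \<longlonglongrightarrow> ennreal (\<bar>f u - f z\<bar> / (z - u) powr (2 - \<alpha>))"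
        using True by (intro tendsto_intros tendsto_ennrealI ct lim) auto
      then have "(\<lambda>k. H (x k) (y k) z) \<longlonglongrightarrow> ennreal (\<bar>f u - f z\<bar> / (z - u) powr (2 - \<alpha>))"
        by (rule Lim_transform_eventually) (rule ev)
      moreover have "H u v z = ennreal (\<bar>f u - f z\<bar> / (z - u) powr (2 - \<alpha>))" using True by (auto simp: H_def indicator_def)
      ultimately show ?thesis by (simp add: lim_imp_Liminf)
    next
      case False
      show ?thesis
      proof (cases "z \<in> {u-2..<u-1}")
        case True
        have "(\<lambda>k. ennreal (\<bar>f (y k) - f (x k)\<bar> / (y k - x k) powr (1 - \<alpha>))) \<longlonglongrightarrow> ennreal (\<bar>f v - f u\<bar> / (v - u) powr (1 - \<alpha>))"
          using uv by (intro tendsto_intros tendsto_ennrealI ct lim) auto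
        then have "liminf (\<lambda>k. ennreal (\<bar>f (y k) - f (x k)\<bar> / (y k - x k) powr (1 - \<alpha>))) = ennreal (\<bar>f v - f u\<bar> / (v - u) powr (1 - \<alpha>))"
          by (intro lim_imp_Liminf) auto
        moreover have "H u v z = ennreal (\<bar>f v - f u\<bar> / (v - u) powr (1 - \<alpha>))" using True by (auto simp: H_def indicator_def)
        moreover have "liminf (\<lambda>k. ennreal (\<bar>f (y k) - f (x k)\<bar> / (y k - x k) powr (1 - \<alpha>))) \<le> liminf (\<lambda>k. H (x k) (y k) z)"
          using True by (intro Liminf_mono always_eventually allI) (auto simp: H_def)
        ultimately show ?thesis by simp
      next
        case False2: False
        then have "H u v z = 0" using False z by (auto simp: H_def indicator_def)
        then show ?thesis by simp
      qed
    qed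
  qed
  then have "(\<integral>\<^sup>+z. H u v z \<partial>lborel) \<le> (\<integral>\<^sup>+z. liminf (\<lambda>k. H (x k) (y k) z) \<partial>lborel)" by (rule nn_integral_mono_AE)
  also have "\<dots> \<le> liminf (\<lambda>k. \<integral>\<^sup>+z. H (x k) (y k) z \<partial>lborel)" by (rule nn_integral_liminf) measurable
  also have "\<dots> \<le> liminf (\<lambda>k. C)"
    unfolding H by (intro Liminf_mono always_eventually allI le)
  finally show ?thesis unfolding H by (simp add: Liminf_const)
qed

text \<open>For rational \<open>x k\<close> and \<open>y k\<close> that decrease to \<open>u\<close> and \<open>v\<close>, the term at \<open>(u, v)\<close> is at most
  the supremum of those at \<open>(x k, y k)\<close>. Being a countable supremum, the norm of a random path
  is measurable.\<close>

lemma norm_zero_eq_rational: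
  assumes f: "continuous_on UNIV f"
  shows "norm_zero \<alpha> t f = (SUP (u, v)\<in>{(u, v). u \<in> \<rat> \<and> v \<in> \<rat> \<and> 0 \<le> u \<and> u < v \<and> v < t}. zero_term \<alpha> f u v)" (is "_ = ?R")
proof (rule antisym)
  show "?R \<le> norm_zero \<alpha> t f" unfolding norm_zero_eq by (intro SUP_subset_mono) auto
  show "norm_zero \<alpha> t f \<le> ?R"
  proof (rule norm_zero_leI)
    fix u v assume uv: "0 \<le> u" "u < v" "v < t"
    define w where "w = (u + v) / 2"
    have w: "u < w" "w < v" using uv by (auto simp: w_def)
    have "\<exists>r\<in>\<rat>. u < r \<and> r < min w (u + 1 / real (Suc k))" for k
      using Rats_dense_in_real[of u "min w (u + 1 / real (Suc k))"] w by auto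
    then obtain x where x: "\<And>k. x k \<in> \<rat>" "\<And>k. u < x k" "\<And>k. x k < min w (u + 1 / real (Suc k))" by metis
    have "\<exists>r\<in>\<rat>. v < r \<and> r < min t (v + 1 / real (Suc k))" for k
      using Rats_dense_in_real[of v "min t (v + 1 / real (Suc k))"] uv by auto
    then obtain y where y: "\<And>k. y k \<in> \<rat>" "\<And>k. v < y k" "\<And>k. y k < min t (v + 1 / real (Suc k))" by metis
    have lim: "h \<longlonglongrightarrow> a" if "\<And>k. a < h k" "\<And>k. h k < a + 1 / real (Suc k)" for h and a :: real
    proof (rule tendsto_sandwich[of "\<lambda>_. a" _ _ "\<lambda>k. a + 1 / real (Suc k)"])
      have "(\<lambda>k. a + 1 / real (Suc k)) \<longlonglongrightarrow> a + 0" by (intro tendsto_add tendsto_const LIMSEQ_Suc[OF lim_const_over_n])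
      then show "(\<lambda>k. a + 1 / real (Suc k)) \<longlonglongrightarrow> a" by simp
    qed (use that in \<open>auto intro!: always_eventually less_imp_le\<close>)
    show "zero_term \<alpha> f u v \<le> ?R"
    proof (rule zero_term_lsc[OF f uv(2), of x y])
      show "x \<longlonglongrightarrow> u" "y \<longlonglongrightarrow> v" using x y by (auto intro!: lim)
      show "zero_term \<alpha> f (x k) (y k) \<le> ?R" for k
        using x[of k] y[of k] w uv by (intro SUP_upper2[of "(x k, y k)"]) auto
    qed
  qed
qed

lemma norm_zero_measurable:
  assumes c: "\<And>\<omega>. \<omega> \<in> space M \<Longrightarrow> continuous_on UNIV (\<lambda>t. Y t \<omega>)" and Y: "\<And>t. Y t \<in> borel_measurable M"
  shows "(\<lambda>\<omega>. norm_zero \<alpha> t (\<lambda>s. Y s \<omega>)) \<in> borel_measurable M"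
proof -
  note continuous_process_joint_measurable[OF Y c, measurable]
  have Z: "(\<lambda>\<omega>. zero_term \<alpha> (\<lambda>s. Y s \<omega>) u v) \<in> borel_measurable M" for u v
    unfolding zero_term_def by measurable
  have "countable {(u::real, v). u \<in> \<rat> \<and> v \<in> \<rat> \<and> 0 \<le> u \<and> u < v \<and> v < t}"
    by (rule countable_subset[of _ "\<rat> \<times> \<rat>"]) (auto intro: countable_rat)
  then have "(\<lambda>\<omega>. SUP (u, v)\<in>{(u, v). u \<in> \<rat> \<and> v \<in> \<rat> \<and> 0 \<le> u \<and> u < v \<and> v < t}. zero_term \<alpha> (\<lambda>s. Y s \<omega>) u v) \<in> borel_measurable M"
    by (rule borel_measurable_SUP) (auto intro: Z)
  then show ?thesis by (rule measurable_cong[THEN iffD2, rotated]) (simp add: norm_zero_eq_rational[OF c])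
qed

lemma zero_term_diff_le:
  assumes [measurable]: "f \<in> borel_measurable borel" "g \<in> borel_measurable borel"
  shows "zero_term \<alpha> (\<lambda>s. f s - g s) u v \<le> zero_term \<alpha> f u v + zero_term \<alpha> g u v"
proof -
  have tri: "ennreal (\<bar>x - y\<bar> / w) \<le> ennreal (\<bar>x\<bar> / w) + ennreal (\<bar>y\<bar> / w)" if "0 \<le> w" for x y w :: real
    using that by (subst ennreal_plus[symmetric]) (auto intro!: ennreal_leI divide_right_mono simp del: ennreal_plus simp flip: add_divide_distrib)
  have "(\<integral>\<^sup>+z\<in>{u..v}. ennreal (\<bar>(f u - g u) - (f z - g z)\<bar> / (z - u) powr (2 - \<alpha>)) \<partial>lborel)
    \<le> (\<integral>\<^sup>+z. ennreal (\<bar>f u - f z\<bar> / (z - u) powr (2 - \<alpha>)) * indicator {u..v} z +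
      ennreal (\<bar>g u - g z\<bar> / (z - u) powr (2 - \<alpha>)) * indicator {u..v} z \<partial>lborel)"
  proof (intro nn_integral_mono)
    fix z
    show "ennreal (\<bar>(f u - g u) - (f z - g z)\<bar> / (z - u) powr (2 - \<alpha>)) * indicator {u..v} z \<le>
      ennreal (\<bar>f u - f z\<bar> / (z - u) powr (2 - \<alpha>)) * indicator {u..v} z + ennreal (\<bar>g u - g z\<bar> / (z - u) powr (2 - \<alpha>)) * indicator {u..v} z"
      using tri[of "(z - u) powr (2 - \<alpha>)" "f u - f z" "g u - g z"] by (auto split: split_indicator simp: algebra_simps)
  qed
  also have "\<dots> = (\<integral>\<^sup>+z\<in>{u..v}. ennreal (\<bar>f u - f z\<bar> / (z - u) powr (2 - \<alpha>)) \<partial>lborel) +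
     (\<integral>\<^sup>+z\<in>{u..v}. ennreal (\<bar>g u - g z\<bar> / (z - u) powr (2 - \<alpha>)) \<partial>lborel)"
    by (rule nn_integral_add) measurable
  finally have I: "(\<integral>\<^sup>+z\<in>{u..v}. ennreal (\<bar>(f u - g u) - (f z - g z)\<bar> / (z - u) powr (2 - \<alpha>)) \<partial>lborel) \<le> \<dots>" .
  have "ennreal (\<bar>(f v - g v) - (f u - g u)\<bar> / (v - u) powr (1 - \<alpha>)) \<le>
    ennreal (\<bar>f v - f u\<bar> / (v - u) powr (1 - \<alpha>)) + ennreal (\<bar>g v - g u\<bar> / (v - u) powr (1 - \<alpha>))"
    using tri[of "(v - u) powr (1 - \<alpha>)" "f v - f u" "g v - g u"] by (simp add: algebra_simps)
  from add_mono[OF this I] show ?thesis unfolding zero_term_def by (simp add: add_ac)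
qed

lemma norm_zero_cong: "(\<And>s. s \<in> {0..<t} \<Longrightarrow> f s = g s) \<Longrightarrow> norm_zero \<alpha> t f = norm_zero \<alpha> t g"
  unfolding norm_zero_eq zero_term_def
  by (intro SUP_cong refl) (auto intro!: arg_cong2[where f="(+)"] nn_integral_cong split: split_indicator)

lemma norm_zero_mono: "s \<le> t \<Longrightarrow> norm_zero \<alpha> s f \<le> norm_zero \<alpha> t f"
  unfolding norm_zero_eq by (intro SUP_subset_mono) auto

lemma stop_time_range: "0 \<le> T \<Longrightarrow> stop_time \<alpha> T N Y \<omega> \<in> {0..T}"
  unfolding stop_time_def by (auto intro!: cInf_greatest cInf_lower bdd_belowI[of _ 0])

text \<open>The norm increases with the time, so it suffices to test rational times.\<close>

lemma stop_time_less_iff: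
  assumes "0 \<le> T"
  shows "stop_time \<alpha> T N Y \<omega> < r \<longleftrightarrow> T < r \<or> (\<exists>q\<in>\<rat>. q \<in> {0..T} \<and> q < r \<and> norm_zero \<alpha> q (\<lambda>s. Y s \<omega>) \<ge> ennreal N)"
proof -
  let ?S = "insert T {t\<in>{0..T}. norm_zero \<alpha> t (\<lambda>s. Y s \<omega>) \<ge> ennreal N}"
  have bdd: "bdd_below ?S" using assms by (intro bdd_belowI[of _ 0]) auto
  have "Inf ?S < r \<longleftrightarrow> (\<exists>x\<in>?S. x < r)" by (rule cInf_less_iff) (use bdd in auto)
  also have "\<dots> \<longleftrightarrow> T < r \<or> (\<exists>q\<in>\<rat>. q \<in> {0..T} \<and> q < r \<and> norm_zero \<alpha> q (\<lambda>s. Y s \<omega>) \<ge> ennreal N)"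
  proof (cases "T < r")
    case False
    have "\<exists>q\<in>\<rat>. q \<in> {0..T} \<and> q < r \<and> norm_zero \<alpha> q (\<lambda>s. Y s \<omega>) \<ge> ennreal N"
      if t: "t \<in> {0..T}" "t < r" "norm_zero \<alpha> t (\<lambda>s. Y s \<omega>) \<ge> ennreal N" for t
    proof -
      obtain q where q: "q \<in> \<rat>" "t < q" "q < r" using Rats_dense_in_real[OF t(2)] by auto
      then show ?thesis using t False norm_zero_mono[of t q \<alpha> "\<lambda>s. Y s \<omega>"] by (intro bexI[of _ q]) auto
    qed
    then show ?thesis using False by auto
  qed auto
  finally show ?thesis unfolding stop_time_def .
qed

lemma stopped_measurable:
  assumes T: "0 \<le> T" and c: "\<And>\<omega>. continuous_on UNIV (\<lambda>t. Y t \<omega>)" and Y: "\<And>t. Y t \<in> borel_measurable M"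
  shows "stopped \<alpha> T N Y t \<in> borel_measurable M"
proof -
  have nz: "(\<lambda>\<omega>. norm_zero \<alpha> q (\<lambda>s. Y s \<omega>)) \<in> borel_measurable M" for q
    by (rule norm_zero_measurable[OF c Y])
  have [measurable]: "stop_time \<alpha> T N Y \<in> borel_measurable M"
  proof (rule borel_measurableI_less)
    fix r
    note nz[measurable]
    have "{\<omega> \<in> space M. stop_time \<alpha> T N Y \<omega> < r} = {\<omega>\<in>space M. T < r} \<union>
      (\<Union>q\<in>{q\<in>\<rat>. q \<in> {0..T} \<and> q < r}. {\<omega>\<in>space M. norm_zero \<alpha> q (\<lambda>s. Y s \<omega>) \<ge> ennreal N})"
      unfolding stop_time_less_iff[OF T] by auto
    also have "\<dots> \<in> sets M"
      by (intro sets.Un sets.countable_UN'' countable_subset[OF _ countable_rat]) (auto, measurable)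
    finally show "{\<omega> \<in> space M. stop_time \<alpha> T N Y \<omega> < r} \<in> sets M" .
  qed
  note continuous_process_joint_measurable[OF Y c, measurable]
  show ?thesis unfolding stopped_def[abs_def] by measurable
qed

lemma stopped_continuous:
  assumes "continuous_on UNIV (\<lambda>t. Y t \<omega>)"
  shows "continuous_on UNIV (\<lambda>t. stopped \<alpha> T N Y t \<omega>)"
  unfolding stopped_def by (rule continuous_on_compose2[OF assms]) (auto intro!: continuous_intros)

lemma stopped_cong:
  assumes T: "0 \<le> T" and eq: "\<forall>t\<in>{0..T}. Y t \<omega> = Z t \<omega>" and t: "t \<in> {0..T}"
  shows "stopped \<alpha> T N Y t \<omega> = stopped \<alpha> T N Z t \<omega>"
proof -
  have "norm_zero \<alpha> s (\<lambda>s. Y s \<omega>) = norm_zero \<alpha> s (\<lambda>s. Z s \<omega>)" if "s \<in> {0..T}" for s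
    using eq that by (intro norm_zero_cong) auto
  then have "stop_time \<alpha> T N Y \<omega> = stop_time \<alpha> T N Z \<omega>"
    unfolding stop_time_def by (intro arg_cong[where f=Inf] arg_cong[where f="insert T"]) auto
  moreover have "min t (stop_time \<alpha> T N Z \<omega>) \<in> {0..T}" using stop_time_range[OF T, of \<alpha> N Z \<omega>] t by auto
  ultimately show ?thesis using eq unfolding stopped_def by simp
qed

text \<open>Before the stopping time \<open>\<tau>\<close> the norm is below \<open>N\<close>, and by lower semicontinuity the terms
  that end at \<open>\<tau>\<close> are at most \<open>N\<close>. After \<open>\<tau>\<close> the path is constant, so for \<open>u < \<tau> \<le> v\<close> the
  difference quotient only decreases and the integral over \<open>[\<tau>, v]\<close> adds at most
  \<open>N / (1 - \<alpha>) \<le> 2 N\<close>.\<close>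

lemma norm_zero_stopped_le:
  assumes \<alpha>: "0 < \<alpha>" "\<alpha> < 1/2" and N: "0 \<le> N" and T: "0 \<le> T" and c: "continuous_on UNIV (\<lambda>t. Y t \<omega>)"
  shows "norm_zero \<alpha> T (\<lambda>t. stopped \<alpha> T N Y t \<omega>) \<le> ennreal (4 * N)"
proof (rule norm_zero_leI)
  fix u v assume uv: "0 \<le> u" "u < v" "v < T"
  define \<tau> where "\<tau> = stop_time \<alpha> T N Y \<omega>"
  let ?f = "\<lambda>t. Y t \<omega>"
  have [measurable]: "?f \<in> borel_measurable borel" using c by (rule borel_measurable_continuous_onI)
  have \<tau>: "\<tau> \<in> {0..T}" unfolding \<tau>_def by (rule stop_time_range[OF T])
  have low: "zero_term \<alpha> ?f a b \<le> ennreal N" if ab: "0 \<le> a" "a < b" "b < \<tau>" for a b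
  proof -
    define s where "s = (b + \<tau>) / 2"
    have s: "b < s" "s < \<tau>" using ab by (auto simp: s_def)
    have "\<not> ennreal N \<le> norm_zero \<alpha> s ?f"
    proof
      assume "ennreal N \<le> norm_zero \<alpha> s ?f"
      then have "\<tau> \<le> s" unfolding \<tau>_def stop_time_def using ab s \<tau> T
        by (intro cInf_lower bdd_belowI[of _ 0]) auto
      then show False using s by simp
    qed
    then show ?thesis using zero_term_le_norm_zero[OF ab(1,2) s(1), of \<alpha> ?f] by auto
  qed
  have st: "stopped \<alpha> T N Y t \<omega> = ?f (min t \<tau>)" for t by (simp add: stopped_def \<tau>_def)
  have N4: "ennreal N \<le> ennreal (4 * N)" using N by (intro ennreal_leI) auto
  consider "v < \<tau>" | "u < \<tau>" "\<tau> \<le> v" | "\<tau> \<le> u" by linarith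
  then show "zero_term \<alpha> (\<lambda>t. stopped \<alpha> T N Y t \<omega>) u v \<le> ennreal (4 * N)"
  proof cases
    case 1
    have "zero_term \<alpha> (\<lambda>t. stopped \<alpha> T N Y t \<omega>) u v = zero_term \<alpha> ?f u v"
      unfolding zero_term_def st using 1 uv by (intro arg_cong2[where f="(+)"] nn_integral_cong) (auto split: split_indicator)
    then show ?thesis using low[OF uv(1,2) 1] N4 by simp
  next
    case 3
    then have m: "min z \<tau> = \<tau>" if "u \<le> z" for z using that by (simp add: min_def)
    have "(\<integral>\<^sup>+z\<in>{u..v}. ennreal (\<bar>?f (min u \<tau>) - ?f (min z \<tau>)\<bar> / (z - u) powr (2 - \<alpha>)) \<partial>lborel) = (\<integral>\<^sup>+z. 0 \<partial>(lborel :: real measure))"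
      by (intro nn_integral_cong) (simp add: m split: split_indicator)
    moreover have "?f (min v \<tau>) = ?f (min u \<tau>)" using m uv by simp
    ultimately have "zero_term \<alpha> (\<lambda>t. stopped \<alpha> T N Y t \<omega>) u v = 0" unfolding zero_term_def st by simp
    then show ?thesis by simp
  next
    case 2
    \<comment> \<open>The denominator exceeds \<open>1\<close>, which keeps \<open>y 0\<close> above \<open>u\<close>.\<close>
    define y where "y k = \<tau> - (\<tau> - u) / real (k + 2)" for k
    have y1: "u < y k" "y k < \<tau>" for k
    proof -
      have "(\<tau> - u) / real (k + 2) < \<tau> - u"
        using divide_strict_left_mono[of 1 "real (k + 2)" "\<tau> - u"] 2 by simp
      then show "u < y k" unfolding y_def by linarith
      have "0 < (\<tau> - u) / real (k + 2)" using 2 by simp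
      then show "y k < \<tau>" unfolding y_def by linarith
    qed
    have ylim: "y \<longlonglongrightarrow> \<tau>"
    proof -
      have "(\<lambda>k. \<tau> - (\<tau> - u) / real (k + 2)) \<longlonglongrightarrow> \<tau> - 0"
        by (intro tendsto_diff tendsto_const LIMSEQ_ignore_initial_segment[OF lim_const_over_n])
      then show ?thesis by (simp add: y_def[abs_def])
    qed
    have lowt: "zero_term \<alpha> ?f u \<tau> \<le> ennreal N"
      by (rule zero_term_lsc[OF c 2(1) tendsto_const ylim]) (rule low[OF uv(1) y1])
    have "ennreal (\<bar>?f \<tau> - ?f u\<bar> / (\<tau> - u) powr (1 - \<alpha>)) \<le> ennreal N"
      using lowt unfolding zero_term_def by (rule order_trans[rotated]) simp
    then have h0: "\<bar>?f \<tau> - ?f u\<bar> / (\<tau> - u) powr (1 - \<alpha>) \<le> N" using N by simp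
    then have h: "\<bar>?f \<tau> - ?f u\<bar> \<le> N * (\<tau> - u) powr (1 - \<alpha>)" using 2 by (simp add: field_simps)
    have i1: "(\<integral>\<^sup>+z\<in>{u..\<tau>}. ennreal (\<bar>?f u - ?f z\<bar> / (z - u) powr (2 - \<alpha>)) \<partial>lborel) \<le> ennreal N"
      using lowt unfolding zero_term_def by (rule order_trans[rotated]) simp
    have t1: "ennreal (\<bar>?f \<tau> - ?f u\<bar> / (v - u) powr (1 - \<alpha>)) \<le> ennreal N"
    proof -
      have "\<bar>?f \<tau> - ?f u\<bar> / (v - u) powr (1 - \<alpha>) \<le> \<bar>?f \<tau> - ?f u\<bar> / (\<tau> - u) powr (1 - \<alpha>)"
        using 2 \<alpha> by (intro divide_left_mono powr_mono2 mult_pos_pos) auto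
      then show ?thesis using h0 by (intro ennreal_leI) linarith
    qed
    have pw: "a / z powr (2 - \<alpha>) = a * z powr (\<alpha> - 2)" for a z :: real
      using powr_minus_divide[of z "2 - \<alpha>"] by simp
    have i2: "(\<integral>\<^sup>+z\<in>{\<tau>..v}. ennreal (\<bar>?f u - ?f \<tau>\<bar> / (z - u) powr (2 - \<alpha>)) \<partial>lborel) \<le> ennreal (2 * N)"
    proof -
      have "(\<integral>\<^sup>+z\<in>{\<tau>..v}. ennreal (\<bar>?f u - ?f \<tau>\<bar> / (z - u) powr (2 - \<alpha>)) \<partial>lborel)
        = (\<integral>\<^sup>+z. ennreal \<bar>?f \<tau> - ?f u\<bar> * (ennreal ((z - u) powr (-1 - (1 - \<alpha>))) * indicator {\<tau>..v} z) \<partial>lborel)"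
        by (intro nn_integral_cong) (simp add: pw ennreal_mult[symmetric] abs_minus_commute split: split_indicator)
      also have "\<dots> = ennreal \<bar>?f \<tau> - ?f u\<bar> * (\<integral>\<^sup>+z\<in>{\<tau>..v}. ennreal ((z - u) powr (-1 - (1 - \<alpha>))) \<partial>lborel)"
        by (rule nn_integral_cmult) measurable
      also have "\<dots> \<le> ennreal (N * (\<tau> - u) powr (1 - \<alpha>)) * ennreal ((\<tau> - u) powr (-(1 - \<alpha>)) / (1 - \<alpha>))"
        using 2 \<alpha> by (intro mult_mono ennreal_leI h nn_integral_powr_head) auto
      also have "\<dots> = ennreal (N * ((\<tau> - u) powr (1 - \<alpha>) * (\<tau> - u) powr (-(1 - \<alpha>))) / (1 - \<alpha>))"
        using N \<alpha> by (simp add: ennreal_mult[symmetric])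
      also have "(\<tau> - u) powr (1 - \<alpha>) * (\<tau> - u) powr (-(1 - \<alpha>)) = 1"
        using 2 by (simp add: powr_add[symmetric])
      also have "ennreal (N * 1 / (1 - \<alpha>)) \<le> ennreal (2 * N)"
      proof (rule ennreal_leI)
        have "N * 1 \<le> N * (2 * (1 - \<alpha>))" using N \<alpha> by (intro mult_left_mono) auto
        then show "N * 1 / (1 - \<alpha>) \<le> 2 * N" using \<alpha> by (simp add: field_simps)
      qed
      finally show ?thesis .
    qed
    have "(\<integral>\<^sup>+z\<in>{u..v}. ennreal (\<bar>?f (min u \<tau>) - ?f (min z \<tau>)\<bar> / (z - u) powr (2 - \<alpha>)) \<partial>lborel)
      \<le> (\<integral>\<^sup>+z. ennreal (\<bar>?f u - ?f z\<bar> / (z - u) powr (2 - \<alpha>)) * indicator {u..\<tau>} z + ennreal (\<bar>?f u - ?f \<tau>\<bar> / (z - u) powr (2 - \<alpha>)) * indicator {\<tau>..v} z \<partial>lborel)"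
      using 2 by (intro nn_integral_mono) (auto split: split_indicator simp: min_def)
    also have "\<dots> = (\<integral>\<^sup>+z\<in>{u..\<tau>}. ennreal (\<bar>?f u - ?f z\<bar> / (z - u) powr (2 - \<alpha>)) \<partial>lborel) + (\<integral>\<^sup>+z\<in>{\<tau>..v}. ennreal (\<bar>?f u - ?f \<tau>\<bar> / (z - u) powr (2 - \<alpha>)) \<partial>lborel)"
      by (rule nn_integral_add) measurable
    also have "\<dots> \<le> ennreal N + ennreal (2 * N)" by (rule add_mono[OF i1 i2])
    finally have i3: "(\<integral>\<^sup>+z\<in>{u..v}. ennreal (\<bar>?f (min u \<tau>) - ?f (min z \<tau>)\<bar> / (z - u) powr (2 - \<alpha>)) \<partial>lborel) \<le> \<dots>" .
    have "zero_term \<alpha> (\<lambda>t. stopped \<alpha> T N Y t \<omega>) u v \<le> ennreal N + (ennreal N + ennreal (2 * N))"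
    proof -
      have m: "min v \<tau> = \<tau>" "min u \<tau> = u" using 2 by auto
      show ?thesis unfolding zero_term_def st using t1 by (intro add_mono i3) (simp only: m)
    qed
    also have "\<dots> = ennreal (4 * N)" using N by (simp add: ennreal_plus[symmetric] del: ennreal_plus)
    finally show ?thesis .
  qed
qed

section \<open>Expected norm of a stochastic integral\<close>

lemma ennreal_add_square_le:
  fixes a b :: ennreal
  shows "(a + b)\<^sup>2 \<le> 2 * a\<^sup>2 + 2 * b\<^sup>2"
proof (cases a; cases b)
  fix x y assume xy: "a = ennreal x" "0 \<le> x" "b = ennreal y" "0 \<le> y"
  have "(x + y)\<^sup>2 \<le> 2 * x\<^sup>2 + 2 * y\<^sup>2"
    using square_le_double[of "x + y" y] by simp
  then have "ennreal ((x + y)\<^sup>2) \<le> ennreal (2 * x\<^sup>2 + 2 * y\<^sup>2)" by (rule ennreal_leI)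
  then show ?thesis using xy
    by (simp add: ennreal_power[symmetric] ennreal_plus ennreal_mult)
qed (auto simp: power2_eq_square ennreal_top_mult ennreal_mult_top)

lemma nn_integral_square_le_kernel:
  assumes [measurable]: "f \<in> borel_measurable M" "w \<in> borel_measurable M"
  shows "(\<integral>\<^sup>+x. f x * ennreal (w x) \<partial>M)\<^sup>2 \<le> (\<integral>\<^sup>+x. ennreal (w x) \<partial>M) * (\<integral>\<^sup>+x. (f x)\<^sup>2 * ennreal (w x) \<partial>M)"
proof -
  have e: "ennreal (sqrt (max 0 x)) * ennreal (sqrt (max 0 x)) = ennreal x" for x
    by (cases "0 \<le> x") (auto simp: ennreal_mult[symmetric] ennreal_neg)
  have "(\<integral>\<^sup>+x. f x * ennreal (w x) \<partial>M) = (\<integral>\<^sup>+x. ennreal (sqrt (max 0 (w x))) * (f x * ennreal (sqrt (max 0 (w x)))) \<partial>M)"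
    by (intro nn_integral_cong) (simp only: mult.left_commute[of _ "f _"] e)
  also have "\<dots>\<^sup>2 \<le> (\<integral>\<^sup>+x. (ennreal (sqrt (max 0 (w x))))\<^sup>2 \<partial>M) * (\<integral>\<^sup>+x. (f x * ennreal (sqrt (max 0 (w x))))\<^sup>2 \<partial>M)"
    by (rule Cauchy_Schwarz_nn_integral) measurable
  also have "\<dots> = (\<integral>\<^sup>+x. ennreal (w x) \<partial>M) * (\<integral>\<^sup>+x. (f x)\<^sup>2 * ennreal (w x) \<partial>M)"
    by (simp only: power_mult_distrib e[folded power2_eq_square])
  finally show ?thesis .
qed

lemma ito_integral_initial_zero:
  assumes ps: "prob_space M" and ito: "has_ito_integral M F T W H I" and T: "0 \<le> T"
  shows "AE \<omega> in M. I 0 \<omega> = 0"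
proof -
  obtain n p \<xi> where A: "\<And>k. simple_process M F T (n k) (p k) (\<xi> k)"
    "\<And>t. t \<in> {0..T} \<Longrightarrow> tends_to_zero_in_prob M (\<lambda>k \<omega>. ennreal \<bar>simple_integral W (n k) (p k) (\<xi> k) t \<omega> - I t \<omega>\<bar>)"
    using ito unfolding has_ito_integral_def by blast
  have pos: "0 \<le> p k i" if "i \<le> n k" for k i
    using A(1)[of k] strict_partition_iff(2)[of "n k" "p k" 0 i] that by (auto simp: simple_process_def strict_partition_def)
  have z: "simple_integral W (n k) (p k) (\<xi> k) 0 \<omega> = 0" for k \<omega>
  proof -
    have "min (p k i) 0 = 0" if "i \<le> n k" for i using pos[OF that] by (rule min_absorb2)
    then show ?thesis unfolding simple_integral_def by (intro sum.neutral) simp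
  qed
  have "tends_to_zero_in_prob M (\<lambda>k \<omega>. ennreal \<bar>I 0 \<omega>\<bar>)"
    using A(2)[of 0] T by (simp add: z)
  then obtain r :: "nat \<Rightarrow> nat" where "AE \<omega> in M. (\<lambda>k. ennreal \<bar>I 0 \<omega>\<bar>) \<longlonglongrightarrow> 0"
    by (rule tends_to_zero_in_prob_AE_subseq[OF ps])
  then show ?thesis
  proof eventually_elim
    case (elim \<omega>)
    then have "ennreal \<bar>I 0 \<omega>\<bar> = 0" by (simp add: LIMSEQ_const_iff)
    then show ?case by simp
  qed
qed

text \<open>Cauchy-Schwarz inequality with \<open>(t - s) powr (- 1 - \<alpha>)\<close> written as
  \<open>(t - s) powr (- \<mu> / 2) * (t - s) powr (- (1 + \<mu>) / 2)\<close>, for \<open>\<mu> = \<alpha> + 1/2\<close>: the square of the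
  first factor is integrable as \<open>\<mu> < 1\<close>.\<close>

lemma norm_at_square_le:
  fixes J :: "real \<Rightarrow> real"
  assumes \<mu>: "1/2 < \<mu>" "\<mu> < 1" and t: "0 < t" "t \<le> T" and [measurable]: "J \<in> borel_measurable borel"
  shows "(norm_at (\<mu> - 1/2) t J)\<^sup>2 \<le> 2 * ennreal ((J t)\<^sup>2) + ennreal (2 * (T powr (1 - \<mu>) / (1 - \<mu>))) *
     (\<integral>\<^sup>+s\<in>{0..t}. ennreal ((J t - J s)\<^sup>2 * (t - s) powr (- 1 - \<mu>)) \<partial>lborel)"
proof -
  define w where "w s = (t - s) powr (- \<mu>) * indicator {0..<t} s" for s
  define f where "f s = ennreal (\<bar>J t - J s\<bar> * (t - s) powr (- (1/2)))" for s
  have w0: "0 \<le> w s" for s by (simp add: w_def)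
  have [measurable]: "w \<in> borel_measurable borel" "f \<in> borel_measurable borel" unfolding w_def f_def by measurable
  have 1: "(\<integral>\<^sup>+s\<in>{0..t}. ennreal (\<bar>J t - J s\<bar> * (t - s) powr (- 1 - (\<mu> - 1/2))) \<partial>lborel) = (\<integral>\<^sup>+s. f s * ennreal (w s) \<partial>lborel)"
  proof (intro nn_integral_cong)
    fix s
    have "(t - s) powr (- (1/2)) * (t - s) powr (- \<mu>) = (t - s) powr (- 1 - (\<mu> - 1/2))"
      by (simp add: powr_add[symmetric])
    then have "\<bar>J t - J s\<bar> * (t - s) powr (- (1/2)) * (t - s) powr (- \<mu>) = \<bar>J t - J s\<bar> * (t - s) powr (- 1 - (\<mu> - 1/2))"
      by (simp only: mult.assoc)
    then show "ennreal (\<bar>J t - J s\<bar> * (t - s) powr (- 1 - (\<mu> - 1/2))) * indicator {0..t} s = f s * ennreal (w s)"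
      unfolding f_def w_def by (cases "s = t") (auto simp: ennreal_mult[symmetric] split: split_indicator)
  qed
  have 2: "(\<integral>\<^sup>+s. (f s)\<^sup>2 * ennreal (w s) \<partial>lborel) = (\<integral>\<^sup>+s\<in>{0..t}. ennreal ((J t - J s)\<^sup>2 * (t - s) powr (- 1 - \<mu>)) \<partial>lborel)"
  proof (intro nn_integral_cong)
    fix s
    have "((t - s) powr (- (1/2)))\<^sup>2 * (t - s) powr (- \<mu>) = (t - s) powr (- 1 - \<mu>)"
      by (simp only: power2_eq_square powr_add[symmetric]) (rule arg_cong2[where f="(powr)"], simp_all)
    then have "(\<bar>J t - J s\<bar> * (t - s) powr (- (1/2)))\<^sup>2 * (t - s) powr (- \<mu>) = (J t - J s)\<^sup>2 * (t - s) powr (- 1 - \<mu>)"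
      by (simp only: power_mult_distrib power2_abs mult.assoc)
    then show "(f s)\<^sup>2 * ennreal (w s) = ennreal ((J t - J s)\<^sup>2 * (t - s) powr (- 1 - \<mu>)) * indicator {0..t} s"
      unfolding f_def w_def by (cases "s = t") (auto simp: ennreal_mult[symmetric] ennreal_power split: split_indicator)
  qed
  have 3: "(\<integral>\<^sup>+s. ennreal (w s) \<partial>lborel) \<le> ennreal (T powr (1 - \<mu>) / (1 - \<mu>))"
  proof -
    have "(\<integral>\<^sup>+s. ennreal (w s) \<partial>lborel) \<le> (\<integral>\<^sup>+s\<in>{0..t}. ennreal ((t - s) powr (- \<mu>)) \<partial>lborel)"
      by (intro nn_integral_mono) (auto simp: w_def split: split_indicator)
    also have "\<dots> = ennreal (t powr (1 - \<mu>) / (1 - \<mu>))" using t \<mu> nn_integral_powr_right[of 0 t \<mu>] by simp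
    also have "\<dots> \<le> ennreal (T powr (1 - \<mu>) / (1 - \<mu>))" using t \<mu> by (intro ennreal_leI divide_right_mono powr_mono2) auto
    finally show ?thesis .
  qed
  have "(norm_at (\<mu> - 1/2) t J)\<^sup>2 \<le> 2 * (ennreal \<bar>J t\<bar>)\<^sup>2 + 2 * (\<integral>\<^sup>+s. f s * ennreal (w s) \<partial>lborel)\<^sup>2"
    unfolding norm_at_def 1 by (rule ennreal_add_square_le)
  also have "\<dots> \<le> 2 * (ennreal \<bar>J t\<bar>)\<^sup>2 + 2 * (ennreal (T powr (1 - \<mu>) / (1 - \<mu>)) * (\<integral>\<^sup>+s. (f s)\<^sup>2 * ennreal (w s) \<partial>lborel))"
    by (intro add_left_mono mult_left_mono order_trans[OF nn_integral_square_le_kernel mult_right_mono[OF 3]]) auto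
  also have "\<dots> = 2 * ennreal ((J t)\<^sup>2) + ennreal (2 * (T powr (1 - \<mu>) / (1 - \<mu>))) * (\<integral>\<^sup>+s. (f s)\<^sup>2 * ennreal (w s) \<partial>lborel)"
  proof -
    have "ennreal (2 * (T powr (1 - \<mu>) / (1 - \<mu>))) = 2 * ennreal (T powr (1 - \<mu>) / (1 - \<mu>))"
      using \<mu> by (subst ennreal_mult) auto
    then show ?thesis by (simp only: mult.assoc) (simp add: ennreal_power)
  qed
  finally show ?thesis unfolding 2 .
qed

text \<open>Insert the isometry into \<open>norm_at_square_le\<close> and exchange the integrations over \<open>s\<close> and
  \<open>u\<close>: the weight of the second moment of \<open>D u\<close> is
  \<open>\<integral>\<^sub>0\<^sup>u (t - s) powr (- 1 - \<mu>) ds \<le> (t - u) powr (- \<mu>) / \<mu>\<close>.\<close>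

lemma ito_norm_estimate:
  fixes J D :: "real \<Rightarrow> 'a \<Rightarrow> real" and G :: "real \<Rightarrow> 'a set"
  assumes ps: "prob_space M" and \<mu>: "1/2 < \<mu>" "\<mu> < 1" and t: "0 < t" "t \<le> T"
    and J: "(\<lambda>(u, \<omega>). J u \<omega>) \<in> borel_measurable (borel \<Otimes>\<^sub>M M)" and J0: "AE \<omega> in M. J 0 \<omega> = 0"
    and G: "G t \<in> sets M" "(\<lambda>(u, \<omega>). indicator (G u) \<omega> :: ennreal) \<in> borel_measurable (borel \<Otimes>\<^sub>M M)"
    and D: "(\<lambda>(u, \<omega>). D u \<omega>) \<in> borel_measurable (borel \<Otimes>\<^sub>M M)"
    and iso: "\<And>s. 0 \<le> s \<Longrightarrow> s < t \<Longrightarrow> (\<integral>\<^sup>+\<omega>. ennreal ((J t \<omega> - J s \<omega>)\<^sup>2) * indicator (G t) \<omega> \<partial>M)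
      \<le> 2 * (\<integral>\<^sup>+\<omega>. (\<integral>\<^sup>+u\<in>{s..t}. ennreal ((D u \<omega>)\<^sup>2) * indicator (G u) \<omega> \<partial>lborel) \<partial>M)"
  shows "(\<integral>\<^sup>+\<omega>. (norm_at (\<mu> - 1/2) t (\<lambda>s. J s \<omega>))\<^sup>2 * indicator (G t) \<omega> \<partial>M)
    \<le> ennreal (4 * T powr \<mu> + 4 * (T powr (1 - \<mu>) / (1 - \<mu>)) / \<mu>) *
      (\<integral>\<^sup>+u\<in>{0..t}. (\<integral>\<^sup>+\<omega>. ennreal ((D u \<omega>)\<^sup>2) * indicator (G u) \<omega> \<partial>M) * ennreal (vol_kernel \<mu> t u) \<partial>lborel)"
proof -
  interpret prob_space M by fact
  interpret P: pair_sigma_finite lborel M ..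
  note [measurable] = J G D
  define \<psi> where "\<psi> u = (\<integral>\<^sup>+\<omega>. ennreal ((D u \<omega>)\<^sup>2) * indicator (G u) \<omega> \<partial>M)" for u
  have \<psi>m [measurable]: "\<psi> \<in> borel_measurable borel" unfolding \<psi>_def[abs_def] by measurable
  define \<Theta> where "\<Theta> = (\<integral>\<^sup>+u\<in>{0..t}. \<psi> u * ennreal (vol_kernel \<mu> t u) \<partial>lborel)"
  have iso': "(\<integral>\<^sup>+\<omega>. ennreal ((J t \<omega> - J s \<omega>)\<^sup>2) * indicator (G t) \<omega> \<partial>M) \<le> 2 * (\<integral>\<^sup>+u\<in>{s..t}. \<psi> u \<partial>lborel)"
    if s: "0 \<le> s" "s < t" for s
  proof -
    have "(\<integral>\<^sup>+\<omega>. (\<integral>\<^sup>+u\<in>{s..t}. ennreal ((D u \<omega>)\<^sup>2) * indicator (G u) \<omega> \<partial>lborel) \<partial>M)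
      = (\<integral>\<^sup>+u. (\<integral>\<^sup>+\<omega>. ennreal ((D u \<omega>)\<^sup>2) * indicator (G u) \<omega> * indicator {s..t} u \<partial>M) \<partial>lborel)"
      by (rule P.Fubini') measurable
    also have "\<dots> = (\<integral>\<^sup>+u\<in>{s..t}. \<psi> u \<partial>lborel)"
      unfolding \<psi>_def by (intro nn_integral_cong nn_integral_multc) measurable
    finally show ?thesis using iso[OF s] by simp
  qed
  have T1: "(\<integral>\<^sup>+\<omega>. ennreal ((J t \<omega>)\<^sup>2) * indicator (G t) \<omega> \<partial>M) \<le> ennreal (2 * T powr \<mu>) * \<Theta>"
  proof -
    have "(\<integral>\<^sup>+\<omega>. ennreal ((J t \<omega>)\<^sup>2) * indicator (G t) \<omega> \<partial>M) = (\<integral>\<^sup>+\<omega>. ennreal ((J t \<omega> - J 0 \<omega>)\<^sup>2) * indicator (G t) \<omega> \<partial>M)"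
      by (rule nn_integral_cong_AE) (use J0 in eventually_elim, simp)
    also have "\<dots> \<le> 2 * (\<integral>\<^sup>+u\<in>{0..t}. \<psi> u \<partial>lborel)" by (rule iso') (use t in auto)
    also have "(\<integral>\<^sup>+u\<in>{0..t}. \<psi> u \<partial>lborel) \<le> (\<integral>\<^sup>+u. ennreal (T powr \<mu>) * (\<psi> u * ennreal (vol_kernel \<mu> t u) * indicator {0..t} u) \<partial>lborel)"
    proof (rule nn_integral_mono_AE, use AE_lborel_singleton[of 0] in eventually_elim)
      fix u :: real assume "u \<noteq> 0"
      show "\<psi> u * indicator {0..t} u \<le> ennreal (T powr \<mu>) * (\<psi> u * ennreal (vol_kernel \<mu> t u) * indicator {0..t} u)"
      proof (cases "u \<in> {0..t}")
        case True
        have "1 \<le> T powr \<mu> * u powr (-\<mu>)"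
          using powr_neg_exponent_mono[of u T 0 \<mu>] True \<open>u \<noteq> 0\<close> t \<mu> by simp
        also have "\<dots> \<le> T powr \<mu> * vol_kernel \<mu> t u" unfolding vol_kernel_def by (intro mult_left_mono) auto
        finally have "\<psi> u * ennreal 1 \<le> \<psi> u * ennreal (T powr \<mu> * vol_kernel \<mu> t u)" by (intro mult_left_mono ennreal_leI) auto
        then show ?thesis using True vol_kernel_nonneg[of \<mu> t u] by (simp add: ennreal_mult mult_ac)
      qed simp
    qed
    also have "\<dots> = ennreal (T powr \<mu>) * \<Theta>" unfolding \<Theta>_def by (rule nn_integral_cmult) measurable
    finally show ?thesis by (simp add: ennreal_mult mult.assoc mult_left_mono)
  qed
  have T2: "(\<integral>\<^sup>+\<omega>. (\<integral>\<^sup>+s\<in>{0..t}. ennreal ((J t \<omega> - J s \<omega>)\<^sup>2 * (t - s) powr (- 1 - \<mu>)) \<partial>lborel) * indicator (G t) \<omega> \<partial>M)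
     \<le> ennreal (2 / \<mu>) * \<Theta>"
  proof -
    have "(\<integral>\<^sup>+\<omega>. (\<integral>\<^sup>+s\<in>{0..t}. ennreal ((J t \<omega> - J s \<omega>)\<^sup>2 * (t - s) powr (- 1 - \<mu>)) \<partial>lborel) * indicator (G t) \<omega> \<partial>M)
      = (\<integral>\<^sup>+\<omega>. (\<integral>\<^sup>+s. ennreal ((t - s) powr (- 1 - \<mu>)) * indicator {0..t} s * (ennreal ((J t \<omega> - J s \<omega>)\<^sup>2) * indicator (G t) \<omega>) \<partial>lborel) \<partial>M)"
      by (intro nn_integral_cong, subst nn_integral_multc[symmetric], measurable)
        (auto intro!: nn_integral_cong simp: ennreal_mult mult_ac)
    also have "\<dots> = (\<integral>\<^sup>+s. (\<integral>\<^sup>+\<omega>. ennreal ((t - s) powr (- 1 - \<mu>)) * indicator {0..t} s * (ennreal ((J t \<omega> - J s \<omega>)\<^sup>2) * indicator (G t) \<omega>) \<partial>M) \<partial>lborel)"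
      by (rule P.Fubini') measurable
    also have "\<dots> = (\<integral>\<^sup>+s. ennreal ((t - s) powr (- 1 - \<mu>)) * indicator {0..t} s * (\<integral>\<^sup>+\<omega>. ennreal ((J t \<omega> - J s \<omega>)\<^sup>2) * indicator (G t) \<omega> \<partial>M) \<partial>lborel)"
      by (intro nn_integral_cong nn_integral_cmult) measurable
    also have "\<dots> \<le> (\<integral>\<^sup>+s. (\<integral>\<^sup>+u. ennreal ((t - s) powr (- 1 - \<mu>)) * (if 0 \<le> s \<and> s \<le> u \<and> u \<le> t then 1 else 0) * (2 * \<psi> u) \<partial>lborel) \<partial>lborel)"
    proof (intro nn_integral_mono)
      fix s
      show "ennreal ((t - s) powr (- 1 - \<mu>)) * indicator {0..t} s * (\<integral>\<^sup>+\<omega>. ennreal ((J t \<omega> - J s \<omega>)\<^sup>2) * indicator (G t) \<omega> \<partial>M)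
        \<le> (\<integral>\<^sup>+u. ennreal ((t - s) powr (- 1 - \<mu>)) * (if 0 \<le> s \<and> s \<le> u \<and> u \<le> t then 1 else 0) * (2 * \<psi> u) \<partial>lborel)"
      proof (cases "0 \<le> s \<and> s < t")
        case True
        have "ennreal ((t - s) powr (- 1 - \<mu>)) * indicator {0..t} s * (\<integral>\<^sup>+\<omega>. ennreal ((J t \<omega> - J s \<omega>)\<^sup>2) * indicator (G t) \<omega> \<partial>M)
          \<le> ennreal ((t - s) powr (- 1 - \<mu>)) * (2 * (\<integral>\<^sup>+u\<in>{s..t}. \<psi> u \<partial>lborel))"
          using True iso'[of s] by (auto intro!: mult_left_mono)
        also have "\<dots> = (\<integral>\<^sup>+u. ennreal ((t - s) powr (- 1 - \<mu>)) * (2 * (\<psi> u * indicator {s..t} u)) \<partial>lborel)"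
          by (subst nn_integral_cmult, measurable, subst nn_integral_cmult, auto)
        also have "\<dots> = (\<integral>\<^sup>+u. ennreal ((t - s) powr (- 1 - \<mu>)) * (if 0 \<le> s \<and> s \<le> u \<and> u \<le> t then 1 else 0) * (2 * \<psi> u) \<partial>lborel)"
          using True by (intro nn_integral_cong) (auto split: split_indicator)
        finally show ?thesis .
      next
        case False
        then consider "s = t" | "s \<notin> {0..t}" by force
        then show ?thesis by cases auto
      qed
    qed
    also have "\<dots> = (\<integral>\<^sup>+u. (\<integral>\<^sup>+s. ennreal ((t - s) powr (- 1 - \<mu>)) * (if 0 \<le> s \<and> s \<le> u \<and> u \<le> t then 1 else 0) * (2 * \<psi> u) \<partial>lborel) \<partial>lborel)"
      by (rule lborel_pair.Fubini') measurable
    also have "\<dots> = (\<integral>\<^sup>+u. (\<integral>\<^sup>+s. ennreal ((t - s) powr (- 1 - \<mu>)) * (if 0 \<le> s \<and> s \<le> u \<and> u \<le> t then 1 else 0) \<partial>lborel) * (2 * \<psi> u) \<partial>lborel)"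
      by (intro nn_integral_cong nn_integral_multc) measurable
    also have "\<dots> \<le> (\<integral>\<^sup>+u. ennreal (2 / \<mu>) * (\<psi> u * ennreal (vol_kernel \<mu> t u) * indicator {0..t} u) \<partial>lborel)"
    proof (rule nn_integral_mono_AE, use AE_lborel_singleton[of t] in eventually_elim)
      fix u assume "u \<noteq> t"
      show "(\<integral>\<^sup>+s. ennreal ((t - s) powr (- 1 - \<mu>)) * (if 0 \<le> s \<and> s \<le> u \<and> u \<le> t then 1 else 0) \<partial>lborel) * (2 * \<psi> u)
        \<le> ennreal (2 / \<mu>) * (\<psi> u * ennreal (vol_kernel \<mu> t u) * indicator {0..t} u)"
      proof (cases "u \<in> {0..t}")
        case True
        then have u: "0 \<le> u" "u < t" using \<open>u \<noteq> t\<close> by auto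
        have "(\<integral>\<^sup>+s. ennreal ((t - s) powr (- 1 - \<mu>)) * (if 0 \<le> s \<and> s \<le> u \<and> u \<le> t then 1 else 0) \<partial>lborel)
          = (\<integral>\<^sup>+s\<in>{0..u}. ennreal ((t - s) powr (- 1 - \<mu>)) \<partial>lborel)"
          using True by (intro nn_integral_cong) (auto split: split_indicator)
        also have "\<dots> \<le> ennreal ((t - u) powr (-\<mu>) / \<mu>)" using u \<mu> by (intro nn_integral_powr_tail) auto
        also have "\<dots> \<le> ennreal (vol_kernel \<mu> t u / \<mu>)" using \<mu> by (intro ennreal_leI divide_right_mono) (auto simp: vol_kernel_def)
        finally have "(\<integral>\<^sup>+s. ennreal ((t - s) powr (- 1 - \<mu>)) * (if 0 \<le> s \<and> s \<le> u \<and> u \<le> t then 1 else 0) \<partial>lborel) * (2 * \<psi> u)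
          \<le> ennreal (vol_kernel \<mu> t u / \<mu>) * (ennreal 2 * \<psi> u)" by (simp add: mult_right_mono)
        also have "\<dots> = (ennreal (vol_kernel \<mu> t u / \<mu>) * ennreal 2) * \<psi> u" by (simp only: mult.assoc)
        also have "ennreal (vol_kernel \<mu> t u / \<mu>) * ennreal 2 = ennreal (2 / \<mu>) * ennreal (vol_kernel \<mu> t u)"
          using \<mu> vol_kernel_nonneg[of \<mu> t u] by (simp only: ennreal_mult[symmetric] divide_nonneg_pos) (simp add: ennreal_mult[symmetric] mult.commute)
        finally show ?thesis using True by (simp add: mult_ac)
      next
        case False
        then have "(\<integral>\<^sup>+s. ennreal ((t - s) powr (- 1 - \<mu>)) * (if 0 \<le> s \<and> s \<le> u \<and> u \<le> t then 1 else 0) \<partial>lborel) = (\<integral>\<^sup>+s. 0 \<partial>(lborel :: real measure))"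
          by (intro nn_integral_cong) (auto split: split_indicator)
        then show ?thesis by simp
      qed
    qed
    also have "\<dots> = ennreal (2 / \<mu>) * \<Theta>" unfolding \<Theta>_def by (rule nn_integral_cmult) measurable
    finally show ?thesis .
  qed
  let ?c = "T powr (1 - \<mu>) / (1 - \<mu>)"
  have c0: "0 \<le> ?c" using \<mu> by simp
  have Jm: "(\<lambda>s. J s \<omega>) \<in> borel_measurable borel" if "\<omega> \<in> space M" for \<omega> using that by measurable
  have "(\<integral>\<^sup>+\<omega>. (norm_at (\<mu> - 1/2) t (\<lambda>s. J s \<omega>))\<^sup>2 * indicator (G t) \<omega> \<partial>M)
    \<le> (\<integral>\<^sup>+\<omega>. 2 * (ennreal ((J t \<omega>)\<^sup>2) * indicator (G t) \<omega>) + ennreal (2 * ?c) *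
     ((\<integral>\<^sup>+s\<in>{0..t}. ennreal ((J t \<omega> - J s \<omega>)\<^sup>2 * (t - s) powr (- 1 - \<mu>)) \<partial>lborel) * indicator (G t) \<omega>) \<partial>M)"
  proof (rule nn_integral_mono)
    fix \<omega> assume "\<omega> \<in> space M"
    from norm_at_square_le[OF \<mu> t Jm[OF this]]
    show "(norm_at (\<mu> - 1/2) t (\<lambda>s. J s \<omega>))\<^sup>2 * indicator (G t) \<omega> \<le> 2 * (ennreal ((J t \<omega>)\<^sup>2) * indicator (G t) \<omega>) + ennreal (2 * ?c) *
     ((\<integral>\<^sup>+s\<in>{0..t}. ennreal ((J t \<omega> - J s \<omega>)\<^sup>2 * (t - s) powr (- 1 - \<mu>)) \<partial>lborel) * indicator (G t) \<omega>)"
      by (cases "\<omega> \<in> G t") auto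
  qed
  also have "\<dots> = 2 * (\<integral>\<^sup>+\<omega>. ennreal ((J t \<omega>)\<^sup>2) * indicator (G t) \<omega> \<partial>M) + ennreal (2 * ?c) *
     (\<integral>\<^sup>+\<omega>. (\<integral>\<^sup>+s\<in>{0..t}. ennreal ((J t \<omega> - J s \<omega>)\<^sup>2 * (t - s) powr (- 1 - \<mu>)) \<partial>lborel) * indicator (G t) \<omega> \<partial>M)"
    by (subst nn_integral_add, measurable) (subst nn_integral_cmult, measurable, subst nn_integral_cmult, measurable)
  also have "\<dots> \<le> 2 * (ennreal (2 * T powr \<mu>) * \<Theta>) + ennreal (2 * ?c) * (ennreal (2 / \<mu>) * \<Theta>)"
    by (intro add_mono mult_left_mono T1 T2) auto
  also have "\<dots> = (ennreal 2 * ennreal (2 * T powr \<mu>) + ennreal (2 * ?c) * ennreal (2 / \<mu>)) * \<Theta>"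
    by (simp add: distrib_right mult.assoc)
  also have "ennreal 2 * ennreal (2 * T powr \<mu>) + ennreal (2 * ?c) * ennreal (2 / \<mu>) = ennreal (4 * T powr \<mu> + 4 * ?c / \<mu>)"
    using c0 \<mu> by (subst ennreal_mult[symmetric], simp, simp, subst ennreal_mult[symmetric], simp, simp, subst ennreal_plus[symmetric]) (auto simp: field_simps)
  finally show ?thesis unfolding \<Theta>_def \<psi>_def .
qed

section \<open>The inequality for the expected norms\<close>

lemma vol_kernel_integral:
  assumes \<mu>: "0 < \<mu>" "\<mu> < 1" and t: "0 < t" "t \<le> T"
  shows "(\<integral>\<^sup>+r\<in>{0..t}. ennreal (vol_kernel \<mu> t r) \<partial>lborel) \<le> ennreal (2 * (T powr (1 - \<mu>) / (1 - \<mu>)))"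
proof -
  have "(\<integral>\<^sup>+r\<in>{0..t}. ennreal (vol_kernel \<mu> t r) \<partial>lborel)
    = (\<integral>\<^sup>+r. ennreal ((r - 0) powr (-\<mu>)) * indicator {0..t} r + ennreal ((t - r) powr (-\<mu>)) * indicator {0..t} r \<partial>lborel)"
    by (intro nn_integral_cong) (auto simp: vol_kernel_def split: split_indicator)
  also have "\<dots> = ennreal (t powr (1 - \<mu>) / (1 - \<mu>)) + ennreal (t powr (1 - \<mu>) / (1 - \<mu>))"
    using t \<mu> nn_integral_powr_left[of 0 t \<mu>] nn_integral_powr_right[of 0 t \<mu>] by (subst nn_integral_add) auto
  also have "\<dots> = ennreal (2 * (t powr (1 - \<mu>) / (1 - \<mu>)))"
    using \<mu> by (subst ennreal_plus[symmetric]) auto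
  also have "\<dots> \<le> ennreal (2 * (T powr (1 - \<mu>) / (1 - \<mu>)))"
    using t \<mu> by (intro ennreal_leI mult_left_mono divide_right_mono powr_mono2) auto
  finally show ?thesis .
qed

lemma norm_at_diff_le:
  assumes [measurable]: "f \<in> borel_measurable borel" "g \<in> borel_measurable borel"
  shows "norm_at \<alpha> t (\<lambda>s. f s - g s) \<le> norm_at \<alpha> t f + norm_at \<alpha> t g"
proof -
  have "norm_at \<alpha> t (\<lambda>s. f s + - g s) \<le> norm_at \<alpha> t f + norm_at \<alpha> t (\<lambda>s. - g s)"
    by (rule norm_at_add_le) measurable
  also have "norm_at \<alpha> t (\<lambda>s. - g s) = norm_at \<alpha> t g"
    unfolding norm_at_def by (simp add: abs_minus_commute)
  finally show ?thesis by simp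
qed

text \<open>The integral is squared by the Cauchy-Schwarz inequality with respect to the kernel, whose
  total mass is at most \<open>k\<close>. The square of \<open>z\<close> is reduced to its first power by \<open>z \<le> Z\<close>.\<close>

lemma square_volterra_estimate:
  fixes n :: "real \<Rightarrow> ennreal"
  assumes \<mu>: "0 < \<mu>" "\<mu> < 1" and t: "0 < t" "t \<le> T" and [measurable]: "n \<in> borel_measurable borel"
    and z: "0 \<le> z" "z \<le> Z" and C: "0 \<le> C"
    and le: "n t \<le> j + ennreal C * (\<integral>\<^sup>+r\<in>{0..t}. (n r + ennreal z) * ennreal (vol_kernel \<mu> t r) \<partial>lborel)"
  defines "k \<equiv> 2 * (T powr (1 - \<mu>) / (1 - \<mu>))"
  shows "(n t)\<^sup>2 \<le> 2 * j\<^sup>2 + ennreal (4 * C\<^sup>2 * k) * (\<integral>\<^sup>+r\<in>{0..t}. (n r)\<^sup>2 * ennreal (vol_kernel \<mu> t r) \<partial>lborel)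
    + ennreal (4 * C\<^sup>2 * k\<^sup>2 * Z) * ennreal z"
proof -
  have k: "0 \<le> k" using \<mu> by (simp add: k_def)
  define w where "w r = vol_kernel \<mu> t r * indicator {0..t} r" for r
  have [measurable]: "w \<in> borel_measurable borel" unfolding w_def by measurable
  have w: "ennreal (w r) = ennreal (vol_kernel \<mu> t r) * indicator {0..t} r" for r
    by (auto simp: w_def split: split_indicator)
  have kw: "(\<integral>\<^sup>+r. ennreal (w r) \<partial>lborel) \<le> ennreal k"
    unfolding w k_def by (rule vol_kernel_integral[OF \<mu> t])
  let ?I = "\<integral>\<^sup>+r. (n r + ennreal z) * ennreal (w r) \<partial>lborel"
  let ?S = "\<integral>\<^sup>+r. (n r)\<^sup>2 * ennreal (w r) \<partial>lborel"
  have le': "n t \<le> j + ennreal C * ?I" using le by (simp add: w mult.assoc)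
  have "?I\<^sup>2 \<le> (\<integral>\<^sup>+r. ennreal (w r) \<partial>lborel) * (\<integral>\<^sup>+r. (n r + ennreal z)\<^sup>2 * ennreal (w r) \<partial>lborel)"
    by (rule nn_integral_square_le_kernel) measurable
  also have "\<dots> \<le> ennreal k * (2 * ?S + 2 * (ennreal z)\<^sup>2 * ennreal k)"
  proof (intro mult_mono kw)
    have "(\<integral>\<^sup>+r. (n r + ennreal z)\<^sup>2 * ennreal (w r) \<partial>lborel) \<le> (\<integral>\<^sup>+r. 2 * ((n r)\<^sup>2 * ennreal (w r)) + 2 * (ennreal z)\<^sup>2 * ennreal (w r) \<partial>lborel)"
      using mult_right_mono[OF ennreal_add_square_le] by (intro nn_integral_mono) (simp add: distrib_right mult.assoc)
    also have "\<dots> = 2 * ?S + 2 * (ennreal z)\<^sup>2 * (\<integral>\<^sup>+r. ennreal (w r) \<partial>lborel)"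
      by (subst nn_integral_add, measurable) (subst nn_integral_cmult, measurable, subst nn_integral_cmult, measurable)
    also have "\<dots> \<le> 2 * ?S + 2 * (ennreal z)\<^sup>2 * ennreal k" by (intro add_left_mono mult_left_mono kw) auto
    finally show "(\<integral>\<^sup>+r. (n r + ennreal z)\<^sup>2 * ennreal (w r) \<partial>lborel) \<le> 2 * ?S + 2 * (ennreal z)\<^sup>2 * ennreal k" .
  qed auto
  finally have I: "?I\<^sup>2 \<le> ennreal k * (2 * ?S + 2 * (ennreal z)\<^sup>2 * ennreal k)" .
  have "(n t)\<^sup>2 \<le> (j + ennreal C * ?I)\<^sup>2" by (intro power_mono le') auto
  also have "\<dots> \<le> 2 * j\<^sup>2 + 2 * (ennreal C * ?I)\<^sup>2" by (rule ennreal_add_square_le)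
  also have "\<dots> \<le> 2 * j\<^sup>2 + 2 * ((ennreal C)\<^sup>2 * (ennreal k * (2 * ?S + 2 * (ennreal z)\<^sup>2 * ennreal k)))"
    unfolding power_mult_distrib by (intro add_left_mono mult_left_mono I) auto
  also have "\<dots> = 2 * j\<^sup>2 + (2 * (ennreal C)\<^sup>2 * ennreal k * 2) * ?S + (2 * (ennreal C)\<^sup>2 * ennreal k * 2 * ennreal k) * (ennreal z)\<^sup>2"
    by (simp add: distrib_left mult_ac add.assoc)
  also have "2 * (ennreal C)\<^sup>2 * ennreal k * 2 = ennreal (4 * C\<^sup>2 * k)"
  proof -
    have "4 * C\<^sup>2 * k = 2 * C\<^sup>2 * k * 2" by simp
    then show ?thesis using C k by (simp only: ennreal_mult ennreal_power[symmetric] mult_nonneg_nonneg zero_le_power2) (simp add: ennreal_power ennreal_mult)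
  qed
  also have "ennreal (4 * C\<^sup>2 * k) * ennreal k * (ennreal z)\<^sup>2 \<le> ennreal (4 * C\<^sup>2 * k\<^sup>2 * Z) * ennreal z"
  proof -
    have "4 * C\<^sup>2 * k * k * z\<^sup>2 = (4 * C\<^sup>2 * k\<^sup>2) * (z * z)" by (simp add: power2_eq_square)
    also have "\<dots> \<le> (4 * C\<^sup>2 * k\<^sup>2) * (Z * z)" using z by (intro mult_left_mono mult_right_mono) auto
    finally have "4 * C\<^sup>2 * k * k * z\<^sup>2 \<le> (4 * C\<^sup>2 * k\<^sup>2 * Z) * z" by (simp add: mult.assoc)
    then have "ennreal (4 * C\<^sup>2 * k * k * z\<^sup>2) \<le> ennreal ((4 * C\<^sup>2 * k\<^sup>2 * Z) * z)" by (rule ennreal_leI)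
    moreover have "ennreal (4 * C\<^sup>2 * k) * ennreal k * (ennreal z)\<^sup>2 = ennreal (4 * C\<^sup>2 * k * k * z\<^sup>2)"
      using C k z by (simp add: ennreal_power ennreal_mult[symmetric])
    moreover have "ennreal ((4 * C\<^sup>2 * k\<^sup>2 * Z) * z) = ennreal (4 * C\<^sup>2 * k\<^sup>2 * Z) * ennreal z"
      using z by (intro ennreal_mult) auto
    ultimately show ?thesis by simp
  qed
  finally show ?thesis unfolding w by (simp add: mult.assoc add_left_mono)
qed

text \<open>Only rational times before \<open>u\<close> are used, so that the event is known at the time \<open>u\<close>; by
  lower semicontinuity the bound then holds at all times in \<open>(0, u]\<close>.\<close>

definition good_event :: "'a measure \<Rightarrow> real \<Rightarrow> real \<Rightarrow> (real \<Rightarrow> 'a \<Rightarrow> real) \<Rightarrow> (real \<Rightarrow> 'a \<Rightarrow> real) \<Rightarrow> real \<Rightarrow> 'a set" where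
  "good_event M \<alpha> R X Xb u = {\<omega>\<in>space M. \<forall>q\<in>\<rat>. 0 < q \<and> q < u \<longrightarrow>
     norm_at \<alpha> q (\<lambda>s. X s \<omega>) + norm_at \<alpha> q (\<lambda>s. Xb s \<omega>) \<le> ennreal R}"

lemma good_event_antimono: "u \<le> v \<Longrightarrow> good_event M \<alpha> R X Xb v \<subseteq> good_event M \<alpha> R X Xb u"
  unfolding good_event_def by auto

lemma good_event_bound:
  assumes "\<omega> \<in> good_event M \<alpha> R X Xb u" "0 < t" "t \<le> u"
    and "continuous_on UNIV (\<lambda>s. X s \<omega>)" "continuous_on UNIV (\<lambda>s. Xb s \<omega>)"
  shows "norm_at \<alpha> t (\<lambda>s. X s \<omega>) + norm_at \<alpha> t (\<lambda>s. Xb s \<omega>) \<le> ennreal R"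
  using assms(4,5,2) by (rule norm_at_sum_lsc) (use assms(1,3) in \<open>auto simp: good_event_def\<close>)

lemma sets_Collect_countable_all:
  assumes "countable Q" "\<And>q. q \<in> Q \<Longrightarrow> {x\<in>space M. P q x} \<in> sets M"
  shows "{x\<in>space M. \<forall>q\<in>Q. P q x} \<in> sets M"
proof -
  have "{x\<in>space M. \<forall>q\<in>Q. P q x} = space M - (\<Union>q\<in>Q. space M - {x\<in>space M. P q x})" by auto
  also have "\<dots> \<in> sets M" by (intro sets.Diff sets.top sets.countable_UN'' assms)
  finally show ?thesis .
qed

lemma good_event_adapted:
  assumes fil: "standard_filtration M F T"
    and X: "\<And>\<omega>. continuous_on UNIV (\<lambda>t. X t \<omega>)" "\<And>t. t \<in> {0..T} \<Longrightarrow> X t \<in> borel_measurable (F t)"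
    and Xb: "\<And>\<omega>. continuous_on UNIV (\<lambda>t. Xb t \<omega>)" "\<And>t. t \<in> {0..T} \<Longrightarrow> Xb t \<in> borel_measurable (F t)"
    and u: "u \<in> {0..T}"
  shows "good_event M \<alpha> R X Xb u \<in> sets (F u)"
proof -
  have m: "(\<lambda>\<omega>. norm_at \<alpha> q (\<lambda>s. X s \<omega>) + norm_at \<alpha> q (\<lambda>s. Xb s \<omega>)) \<in> borel_measurable (F u)" if q: "0 < q" "q < u" for q
    using q u by (intro borel_measurable_add standard_filtration_measurable_mono[OF fil norm_at_adapted[OF fil X]]
      standard_filtration_measurable_mono[OF fil norm_at_adapted[OF fil Xb]]) auto
  have "{\<omega>\<in>space (F u). \<forall>q\<in>{q\<in>\<rat>. 0 < q \<and> q < u}. norm_at \<alpha> q (\<lambda>s. X s \<omega>) + norm_at \<alpha> q (\<lambda>s. Xb s \<omega>) \<le> ennreal R} \<in> sets (F u)"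
  proof (rule sets_Collect_countable_all)
    fix q assume "q \<in> {q\<in>\<rat>. 0 < q \<and> q < u}"
    then have [measurable]: "(\<lambda>\<omega>. norm_at \<alpha> q (\<lambda>s. X s \<omega>) + norm_at \<alpha> q (\<lambda>s. Xb s \<omega>)) \<in> borel_measurable (F u)" by (intro m) auto
    show "{\<omega>\<in>space (F u). norm_at \<alpha> q (\<lambda>s. X s \<omega>) + norm_at \<alpha> q (\<lambda>s. Xb s \<omega>) \<le> ennreal R} \<in> sets (F u)" by measurable
  qed (rule countable_subset[OF _ countable_rat], auto)
  also have "{\<omega>\<in>space (F u). \<forall>q\<in>{q\<in>\<rat>. 0 < q \<and> q < u}. norm_at \<alpha> q (\<lambda>s. X s \<omega>) + norm_at \<alpha> q (\<lambda>s. Xb s \<omega>) \<le> ennreal R}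
     = good_event M \<alpha> R X Xb u"
    unfolding good_event_def standard_filtrationD(1)[OF fil u] by auto
  finally show ?thesis .
qed

lemma good_event_joint_measurable:
  assumes X [measurable]: "(\<lambda>(t, \<omega>). X t \<omega>) \<in> borel_measurable (borel \<Otimes>\<^sub>M M)"
    and Xb [measurable]: "(\<lambda>(t, \<omega>). Xb t \<omega>) \<in> borel_measurable (borel \<Otimes>\<^sub>M M)"
  shows "(\<lambda>(u, \<omega>). indicator (good_event M \<alpha> R X Xb u) \<omega> :: ennreal) \<in> borel_measurable (borel \<Otimes>\<^sub>M M)"
proof -
  note norm_at_joint_measurable[OF X, measurable] norm_at_joint_measurable[OF Xb, measurable]
  let ?P = "\<lambda>q x. 0 < q \<and> q < fst x \<longrightarrow> norm_at \<alpha> q (\<lambda>s. X s (snd x)) + norm_at \<alpha> q (\<lambda>s. Xb s (snd x)) \<le> ennreal R"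
  have [measurable]: "{x\<in>space (borel \<Otimes>\<^sub>M M). \<forall>q\<in>\<rat>. ?P q x} \<in> sets (borel \<Otimes>\<^sub>M M)"
  proof (rule sets_Collect_countable_all)
    fix q :: real
    show "{x\<in>space (borel \<Otimes>\<^sub>M M). ?P q x} \<in> sets (borel \<Otimes>\<^sub>M M)" by measurable
  qed (rule countable_rat)
  have "(indicator {x\<in>space (borel \<Otimes>\<^sub>M M). \<forall>q\<in>\<rat>. ?P q x} :: _ \<Rightarrow> ennreal) \<in> borel_measurable (borel \<Otimes>\<^sub>M M)" by measurable
  then show ?thesis
    by (rule measurable_cong[THEN iffD1, rotated]) (auto simp: good_event_def space_pair_measure indicator_def)
qed

text \<open>The squared pathwise estimate is multiplied by the indicator of the event at the time \<open>t\<close>;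
  inside the time integral it may be replaced by the one at the time \<open>r \<le> t\<close>, since the events
  decrease. Taking expectations, the term with the stochastic integral is bounded by
  \<open>ito_norm_estimate\<close>, in which the second moment of \<open>b(X) - b(Xb)\<close> is at most \<open>K\<^sup>2\<close> times \<open>\<phi>\<close>.\<close>

lemma expected_volterra_inequality:
  fixes X Xb I Ib g gb :: "real \<Rightarrow> 'a \<Rightarrow> real"
  assumes ps: "prob_space M" and fil: "standard_filtration M F T" and w: "wiener_process M F T W"
    and \<alpha>: "0 < \<alpha>" "\<alpha> < 1/2" and \<beta>: "1/2 < \<beta>" and K: "0 < K" and R: "0 < R" and N: "0 \<le> N" and T: "0 < T"
    and cc: "coefficient_conditions T \<beta> K a b c"
    and cont: "\<And>\<omega>. continuous_on UNIV (\<lambda>t. X t \<omega>)" "\<And>\<omega>. continuous_on UNIV (\<lambda>t. Xb t \<omega>)"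
      "\<And>\<omega>. continuous_on UNIV (\<lambda>t. I t \<omega>)" "\<And>\<omega>. continuous_on UNIV (\<lambda>t. Ib t \<omega>)"
      "\<And>\<omega>. continuous_on UNIV (\<lambda>t. g t \<omega>)" "\<And>\<omega>. continuous_on UNIV (\<lambda>t. gb t \<omega>)"
    and ad: "\<And>t. t \<in> {0..T} \<Longrightarrow> X t \<in> borel_measurable (F t)" "\<And>t. t \<in> {0..T} \<Longrightarrow> Xb t \<in> borel_measurable (F t)"
      "\<And>t. t \<in> {0..T} \<Longrightarrow> I t \<in> borel_measurable (F t)" "\<And>t. t \<in> {0..T} \<Longrightarrow> Ib t \<in> borel_measurable (F t)"
    and cl: "\<And>t \<omega>. X (clamp_time T t) \<omega> = X t \<omega>" "\<And>t \<omega>. Xb (clamp_time T t) \<omega> = Xb t \<omega>"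
      "\<And>t \<omega>. I (clamp_time T t) \<omega> = I t \<omega>" "\<And>t \<omega>. Ib (clamp_time T t) \<omega> = Ib t \<omega>"
    and gm: "\<And>t. g t \<in> borel_measurable M" "\<And>t. gb t \<in> borel_measurable M"
    and gN: "\<And>\<omega>. norm_zero \<alpha> T (\<lambda>t. g t \<omega>) \<le> ennreal (4 * N)" "\<And>\<omega>. norm_zero \<alpha> T (\<lambda>t. gb t \<omega>) \<le> ennreal (4 * N)"
    and ito: "has_ito_integral M F T W H IH" "has_ito_integral M F T W Hb IHb"
    and itoE: "AE \<omega> in M. \<forall>t\<in>{0..T}. H t \<omega> = b t (X t \<omega>) \<and> Hb t \<omega> = b t (Xb t \<omega>) \<and> IH t \<omega> = I t \<omega> \<and> IHb t \<omega> = Ib t \<omega>"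
    and eqX: "AE \<omega> in M. \<forall>t\<in>{0..T}. gls_integrable \<alpha> 0 t (\<lambda>r. c r (X r \<omega>)) (\<lambda>r. g r \<omega>) \<and>
       complex_of_real (X t \<omega>) = of_real (x0 + (LINT r:{0..t}|lborel. a r (X r \<omega>)) + I t \<omega>) + gls_integral \<alpha> 0 t (\<lambda>r. c r (X r \<omega>)) (\<lambda>r. g r \<omega>)"
    and eqXb: "AE \<omega> in M. \<forall>t\<in>{0..T}. gls_integrable \<alpha> 0 t (\<lambda>r. c r (Xb r \<omega>)) (\<lambda>r. gb r \<omega>) \<and>
       complex_of_real (Xb t \<omega>) = of_real (x0 + (LINT r:{0..t}|lborel. a r (Xb r \<omega>)) + Ib t \<omega>) + gls_integral \<alpha> 0 t (\<lambda>r. c r (Xb r \<omega>)) (\<lambda>r. gb r \<omega>)"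
    and t: "0 < t" "t < T"
  defines "\<mu> \<equiv> \<alpha> + 1/2" and "C \<equiv> path_const \<alpha> \<beta> K T R (4 * N)"
  defines "k \<equiv> 2 * (T powr (1 - \<mu>) / (1 - \<mu>))" and "cI \<equiv> 4 * T powr \<mu> + 4 * (T powr (1 - \<mu>) / (1 - \<mu>)) / \<mu>"
  defines "\<phi> \<equiv> \<lambda>t. \<integral>\<^sup>+\<omega>. (norm_at \<alpha> t (\<lambda>s. X s \<omega> - Xb s \<omega>))\<^sup>2 * indicator (good_event M \<alpha> R X Xb t) \<omega> \<partial>M"
  shows "\<phi> t \<le> ennreal (4 * C\<^sup>2 * k\<^sup>2 * (8 * N)) * (\<integral>\<^sup>+\<omega>. norm_zero \<alpha> T (\<lambda>s. g s \<omega> - gb s \<omega>) \<partial>M)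
    + ennreal (2 * cI * K\<^sup>2 + 4 * C\<^sup>2 * k) * (\<integral>\<^sup>+u\<in>{0..t}. \<phi> u * ennreal (vol_kernel \<mu> t u) \<partial>lborel)"
    and "\<phi> \<in> borel_measurable borel"
    and "\<phi> t \<le> ennreal (R\<^sup>2)"
proof -
  interpret prob_space M by fact
  interpret P: pair_sigma_finite lborel M ..
  have \<mu>: "1/2 < \<mu>" "\<mu> < 1" "0 < \<mu>" "\<mu> - 1/2 = \<alpha>" using \<alpha> by (auto simp: \<mu>_def)
  have \<beta>0: "0 < \<beta>" using \<beta> by simp
  have C: "0 \<le> C" unfolding C_def using \<alpha> \<beta> K R N by (intro path_const_nonneg) auto
  have k: "0 \<le> k" and cI: "0 \<le> cI" using \<mu> by (auto simp: k_def cI_def)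
  have ct: "clamp_time T u \<in> {0..T}" for u using T by (auto simp: clamp_time_def)
  note toM = clamped_adapted_measurable[OF fil less_imp_le[OF T]]
  note XM = toM[OF ad(1) cl(1)] and XbM = toM[OF ad(2) cl(2)] and IM = toM[OF ad(3) cl(3)] and IbM = toM[OF ad(4) cl(4)]
  have Xj [measurable]: "(\<lambda>(u, \<omega>). X u \<omega>) \<in> borel_measurable (borel \<Otimes>\<^sub>M M)"
    by (rule continuous_process_joint_measurable[OF XM cont(1)])
  have Xbj [measurable]: "(\<lambda>(u, \<omega>). Xb u \<omega>) \<in> borel_measurable (borel \<Otimes>\<^sub>M M)"
    by (rule continuous_process_joint_measurable[OF XbM cont(2)])
  have Ij [measurable]: "(\<lambda>(u, \<omega>). I u \<omega>) \<in> borel_measurable (borel \<Otimes>\<^sub>M M)"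
    by (rule continuous_process_joint_measurable[OF IM cont(3)])
  have Ibj [measurable]: "(\<lambda>(u, \<omega>). Ib u \<omega>) \<in> borel_measurable (borel \<Otimes>\<^sub>M M)"
    by (rule continuous_process_joint_measurable[OF IbM cont(4)])
  let ?G = "good_event M \<alpha> R X Xb"
  have Gj [measurable]: "(\<lambda>(u, \<omega>). indicator (?G u) \<omega> :: ennreal) \<in> borel_measurable (borel \<Otimes>\<^sub>M M)"
    by (rule good_event_joint_measurable[OF Xj Xbj])
  have GF: "?G u \<in> sets (F u)" if "u \<in> {0..T}" for u
    by (rule good_event_adapted[OF fil cont(1) ad(1) cont(2) ad(2) that])
  have GM: "?G u \<in> sets M" if "u \<in> {0..T}" for u using GF[OF that] standard_filtrationD(2)[OF fil that] by auto
  have Dj: "(\<lambda>(u, \<omega>). X u \<omega> - Xb u \<omega>) \<in> borel_measurable (borel \<Otimes>\<^sub>M M)" by measurable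
  have Jj: "(\<lambda>(u, \<omega>). I u \<omega> - Ib u \<omega>) \<in> borel_measurable (borel \<Otimes>\<^sub>M M)" by measurable
  let ?n = "\<lambda>u \<omega>. norm_at \<alpha> u (\<lambda>s. X s \<omega> - Xb s \<omega>)"
  let ?j = "\<lambda>\<omega>. norm_at \<alpha> t (\<lambda>s. I s \<omega> - Ib s \<omega>)"
  have nj [measurable]: "(\<lambda>(u, \<omega>). ?n u \<omega>) \<in> borel_measurable (borel \<Otimes>\<^sub>M M)" by (rule norm_at_joint_measurable[OF Dj])
  have jj [measurable]: "(\<lambda>(u, \<omega>). norm_at \<alpha> u (\<lambda>s. I s \<omega> - Ib s \<omega>)) \<in> borel_measurable (borel \<Otimes>\<^sub>M M)" by (rule norm_at_joint_measurable[OF Jj])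
  show \<phi>m [measurable]: "\<phi> \<in> borel_measurable borel" unfolding \<phi>_def by measurable
  have pm: "(\<lambda>t. X t \<omega>) \<in> borel_measurable borel" "(\<lambda>t. Xb t \<omega>) \<in> borel_measurable borel" "(\<lambda>t. I t \<omega>) \<in> borel_measurable borel"
    "(\<lambda>t. Ib t \<omega>) \<in> borel_measurable borel" "(\<lambda>t. g t \<omega>) \<in> borel_measurable borel" "(\<lambda>t. gb t \<omega>) \<in> borel_measurable borel" for \<omega>
    by (rule borel_measurable_continuous_onI, rule cont)+
  have nR: "?n u \<omega> \<le> ennreal R" if "\<omega> \<in> ?G v" "0 < u" "u \<le> v" for u v \<omega>
    using order_trans[OF norm_at_diff_le[OF pm(1,2)] good_event_bound[OF that cont(1,2)]] .
  have Dn: "ennreal \<bar>X u \<omega> - Xb u \<omega>\<bar> \<le> ?n u \<omega>" for u \<omega> unfolding norm_at_def by simp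
  show "\<phi> t \<le> ennreal (R\<^sup>2)"
  proof -
    have "\<phi> t \<le> (\<integral>\<^sup>+\<omega>. ennreal (R\<^sup>2) \<partial>M)"
      unfolding \<phi>_def
    proof (rule nn_integral_mono)
      fix \<omega>
      show "(?n t \<omega>)\<^sup>2 * indicator (?G t) \<omega> \<le> ennreal (R\<^sup>2)"
        using power_mono[OF nR[of \<omega> t t], of 2] t R by (cases "\<omega> \<in> ?G t") (auto simp: ennreal_power)
    qed
    then show ?thesis by (simp add: emeasure_space_1)
  qed
  let ?\<zeta> = "\<lambda>\<omega>. norm_zero \<alpha> T (\<lambda>s. g s \<omega> - gb s \<omega>)"
  have \<zeta>m [measurable]: "?\<zeta> \<in> borel_measurable M"
    by (rule norm_zero_measurable) (auto intro!: continuous_on_diff cont borel_measurable_diff gm)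
  have \<zeta>N: "?\<zeta> \<omega> \<le> ennreal (8 * N)" for \<omega>
  proof (rule norm_zero_leI)
    fix u v assume uv: "0 \<le> u" "u < v" "v < T"
    have "zero_term \<alpha> (\<lambda>s. g s \<omega> - gb s \<omega>) u v \<le> ennreal (4 * N) + ennreal (4 * N)"
      by (intro order_trans[OF zero_term_diff_le[OF pm(5,6)]] add_mono order_trans[OF zero_term_le_norm_zero[OF uv] gN(1)]
        order_trans[OF zero_term_le_norm_zero[OF uv] gN(2)])
    also have "\<dots> = ennreal (8 * N)" using N by (simp add: ennreal_plus[symmetric] del: ennreal_plus)
    finally show "zero_term \<alpha> (\<lambda>s. g s \<omega> - gb s \<omega>) u v \<le> ennreal (8 * N)" .
  qed
  have path: "AE \<omega> in M. (?n t \<omega>)\<^sup>2 * indicator (?G t) \<omega> \<le> 2 * ((?j \<omega>)\<^sup>2 * indicator (?G t) \<omega>)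
     + (ennreal (4 * C\<^sup>2 * k) * (\<integral>\<^sup>+r. (?n r \<omega>)\<^sup>2 * indicator (?G r) \<omega> * (ennreal (vol_kernel \<mu> t r) * indicator {0..t} r) \<partial>lborel)
     + ennreal (4 * C\<^sup>2 * k\<^sup>2 * (8 * N)) * ?\<zeta> \<omega>)"
    using eqX eqXb
  proof eventually_elim
    case (elim \<omega>)
    show ?case
    proof (cases "\<omega> \<in> ?G t")
      case True
      obtain z where z: "0 \<le> z" "z \<le> 8 * N" "?\<zeta> \<omega> = ennreal z"
        using \<zeta>N[of \<omega>] N by (cases "?\<zeta> \<omega>") (auto simp: top_unique)
      have "?n t \<omega> \<le> ?j \<omega> + ennreal C * (\<integral>\<^sup>+r\<in>{0..t}. (?n r \<omega> + ennreal z) * ennreal (vol_kernel (\<alpha> + 1/2) t r) \<partial>lborel)"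
        unfolding C_def
      proof (rule pathwise_estimate[OF cc K \<alpha> \<beta> less_imp_le[OF R] _ z(1) t pm(1,2,5,6,3,4)])
        show "0 \<le> 4 * N" using N by simp
        show "continuous_on {0..T} (\<lambda>t. X t \<omega>)" "continuous_on {0..T} (\<lambda>t. Xb t \<omega>)"
          using cont(1,2)[of \<omega>] by (auto intro: continuous_on_subset)
        show "norm_at \<alpha> s (\<lambda>t. X t \<omega>) + norm_at \<alpha> s (\<lambda>t. Xb t \<omega>) \<le> ennreal R" if "s \<in> {0<..t}" for s
          using that by (intro good_event_bound[OF True _ _ cont(1,2)]) auto
      qed (use gN z elim t in auto)
      from square_volterra_estimate[OF \<mu>(3,2) t(1) less_imp_le[OF t(2)] _ z(1,2) C this[folded \<mu>_def], folded k_def]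
      have "(?n t \<omega>)\<^sup>2 \<le> 2 * (?j \<omega>)\<^sup>2 + ennreal (4 * C\<^sup>2 * k) * (\<integral>\<^sup>+r\<in>{0..t}. (?n r \<omega>)\<^sup>2 * ennreal (vol_kernel \<mu> t r) \<partial>lborel)
        + ennreal (4 * C\<^sup>2 * k\<^sup>2 * (8 * N)) * ?\<zeta> \<omega>"
        unfolding z(3) using pm by measurable
      also have "(\<integral>\<^sup>+r\<in>{0..t}. (?n r \<omega>)\<^sup>2 * ennreal (vol_kernel \<mu> t r) \<partial>lborel)
         = (\<integral>\<^sup>+r. (?n r \<omega>)\<^sup>2 * indicator (?G r) \<omega> * (ennreal (vol_kernel \<mu> t r) * indicator {0..t} r) \<partial>lborel)"
        using True good_event_antimono[of _ t M \<alpha> R X Xb] by (intro nn_integral_cong) (auto split: split_indicator)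
      finally show ?thesis using True by (simp add: add.assoc)
    qed simp
  qed
  \<comment> \<open>The conditions on \<open>b\<close> concern \<open>[0, T]\<close> only; clamping makes \<open>D\<close> continuous on the whole line.\<close>
  let ?D = "\<lambda>u \<omega>. b (clamp_time T u) (X u \<omega>) - b (clamp_time T u) (Xb u \<omega>)"
  have bcont: "continuous_on UNIV (\<lambda>u. b (clamp_time T u) (Y u \<omega>))"
    if "\<And>\<omega>. continuous_on UNIV (\<lambda>t. Y t \<omega>)" "\<And>t \<omega>. Y (clamp_time T t) \<omega> = Y t \<omega>" for Y :: "real \<Rightarrow> 'a \<Rightarrow> real" and \<omega>
  proof -
    have "continuous_on {0..T} (\<lambda>s. b s (Y s \<omega>))"
      using continuous_on_subset[OF that(1)[of \<omega>]] by (intro coeff_continuous(2)[OF cc \<beta>0]) auto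
    then have "continuous_on UNIV (\<lambda>u. b (clamp_time T u) (Y (clamp_time T u) \<omega>))"
      by (rule continuous_on_compose2) (use ct in \<open>auto simp: clamp_time_def[abs_def] intro!: continuous_intros\<close>)
    then show ?thesis using that(2) by simp
  qed
  have bm: "b (clamp_time T u) \<in> borel_measurable borel" for u
  proof (rule borel_measurable_continuous_onI)
    have "K-lipschitz_on UNIV (b (clamp_time T u))"
      using coeff_lipschitz(2)[OF cc ct] K by (intro lipschitz_onI) (auto simp: dist_real_def)
    then show "continuous_on UNIV (b (clamp_time T u))" by (rule lipschitz_on_continuous_on)
  qed
  have DM: "?D u \<in> borel_measurable M" for u
    using XM[of u] XbM[of u] bm[of u] by (intro borel_measurable_diff) (auto intro: measurable_compose)
  have Dc: "continuous_on UNIV (\<lambda>u. ?D u \<omega>)" for \<omega>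
    by (intro continuous_on_diff bcont cont cl)
  have DJ [measurable]: "(\<lambda>(u, \<omega>). ?D u \<omega>) \<in> borel_measurable (borel \<Otimes>\<^sub>M M)"
    by (rule continuous_process_joint_measurable[OF DM Dc])
  have Dle: "\<bar>?D u \<omega>\<bar> \<le> K * \<bar>X u \<omega> - Xb u \<omega>\<bar>" for u \<omega> by (rule coeff_lipschitz(2)[OF cc ct])
  have D2n: "ennreal ((?D u \<omega>)\<^sup>2) \<le> ennreal (K\<^sup>2) * (?n u \<omega>)\<^sup>2" for u \<omega>
  proof -
    have "(?D u \<omega>)\<^sup>2 \<le> K\<^sup>2 * \<bar>X u \<omega> - Xb u \<omega>\<bar>\<^sup>2"
      using power_mono[OF Dle[of u \<omega>], of 2] by (simp add: power_mult_distrib)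
    then have "ennreal ((?D u \<omega>)\<^sup>2) \<le> ennreal (K\<^sup>2) * (ennreal \<bar>X u \<omega> - Xb u \<omega>\<bar>)\<^sup>2"
      by (subst ennreal_power) (auto simp: ennreal_mult[symmetric] intro!: ennreal_leI)
    also have "\<dots> \<le> ennreal (K\<^sup>2) * (?n u \<omega>)\<^sup>2" by (intro mult_left_mono power_mono Dn) auto
    finally show ?thesis .
  qed
  have iso: "(\<integral>\<^sup>+\<omega>. ennreal (((I t \<omega> - Ib t \<omega>) - (I s \<omega> - Ib s \<omega>))\<^sup>2) * indicator (?G t) \<omega> \<partial>M)
      \<le> 2 * (\<integral>\<^sup>+\<omega>. (\<integral>\<^sup>+u\<in>{s..t}. ennreal ((?D u \<omega>)\<^sup>2) * indicator (?G u) \<omega> \<partial>lborel) \<partial>M)"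
    if s: "0 \<le> s" "s < t" for s
  proof -
    have "(\<integral>\<^sup>+\<omega>. ennreal (((I t \<omega> - Ib t \<omega>) - (I s \<omega> - Ib s \<omega>))\<^sup>2) * indicator (?G t) \<omega> \<partial>M)
      = (\<integral>\<^sup>+\<omega>. ennreal (((IH t \<omega> - IHb t \<omega>) - (IH s \<omega> - IHb s \<omega>))\<^sup>2) * indicator (?G t) \<omega> \<partial>M)"
      by (rule nn_integral_cong_AE) (use itoE in eventually_elim, use s t in auto)
    also have "\<dots> \<le> 2 * (\<integral>\<^sup>+\<omega>. (\<integral>\<^sup>+u\<in>{s..t}. ennreal ((?D u \<omega>)\<^sup>2) * indicator (?G u) \<omega> \<partial>lborel) \<partial>M)"
    proof (rule ito_localized_isometry[OF ps fil w ito s less_imp_le[OF t(2)] GF _ Gj DJ])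
      show "?G v \<subseteq> ?G u" if "u \<le> v" for u v using that by (rule good_event_antimono)
      show "AE \<omega> in M. \<forall>u\<in>{0..T}. ?D u \<omega> = H u \<omega> - Hb u \<omega>"
        using itoE by eventually_elim (auto simp: clamp_time_def)
      show "\<exists>B. \<forall>u\<in>{s..t}. \<bar>?D u \<omega>\<bar> \<le> B" for \<omega>
      proof -
        have "compact ((\<lambda>u. ?D u \<omega>) ` {s..t})"
          by (intro compact_continuous_image continuous_on_subset[OF Dc]) auto
        then have "bounded ((\<lambda>u. ?D u \<omega>) ` {s..t})" by (rule compact_imp_bounded)
        then obtain B where B: "\<forall>x\<in>(\<lambda>u. ?D u \<omega>) ` {s..t}. norm x \<le> B"
          unfolding bounded_iff ..
        show ?thesis
        proof (intro exI[of _ B] ballI)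
          fix u assume "u \<in> {s..t}"
          from bspec[OF B imageI[OF this]] show "\<bar>?D u \<omega>\<bar> \<le> B" by (simp only: real_norm_def)
        qed
      qed
      show "0 \<le> K\<^sup>2 * R\<^sup>2 * T" using T by simp
      show "(\<integral>\<^sup>+u\<in>{s..t}. ennreal ((?D u \<omega>)\<^sup>2) \<partial>lborel) \<le> ennreal (K\<^sup>2 * R\<^sup>2 * T)" if "\<omega> \<in> ?G t" for \<omega>
      proof -
        have "(\<integral>\<^sup>+u\<in>{s..t}. ennreal ((?D u \<omega>)\<^sup>2) \<partial>lborel) \<le> (\<integral>\<^sup>+u\<in>{s..t}. ennreal (K\<^sup>2 * R\<^sup>2) \<partial>lborel)"
        \<comment> \<open>\<open>good_event_bound\<close> does not cover the time \<open>0\<close>.\<close>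
        proof (rule nn_integral_mono_AE, use AE_lborel_singleton[of 0] in eventually_elim)
          fix u :: real assume "u \<noteq> 0"
          show "ennreal ((?D u \<omega>)\<^sup>2) * indicator {s..t} u \<le> ennreal (K\<^sup>2 * R\<^sup>2) * indicator {s..t} u"
          proof (cases "u \<in> {s..t}")
            case True
            have "ennreal ((?D u \<omega>)\<^sup>2) \<le> ennreal (K\<^sup>2) * (?n u \<omega>)\<^sup>2" by (rule D2n)
            also have "\<dots> \<le> ennreal (K\<^sup>2) * (ennreal R)\<^sup>2"
              using True s \<open>u \<noteq> 0\<close> by (intro mult_left_mono power_mono nR[OF that]) auto
            also have "\<dots> = ennreal (K\<^sup>2 * R\<^sup>2)" using R by (simp add: ennreal_power ennreal_mult)
            finally show ?thesis using True by simp
          qed simp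
        qed
        also have "\<dots> = ennreal (K\<^sup>2 * R\<^sup>2) * ennreal (t - s)" using s by (subst nn_integral_cmult_indicator) auto
        also have "\<dots> \<le> ennreal (K\<^sup>2 * R\<^sup>2) * ennreal T" using s t by (intro mult_left_mono ennreal_leI) auto
        also have "\<dots> = ennreal (K\<^sup>2 * R\<^sup>2 * T)" by (rule ennreal_mult[symmetric]) (use T in auto)
        finally show ?thesis .
      qed
    qed
    finally show ?thesis .
  qed
  have J0: "AE \<omega> in M. I 0 \<omega> - Ib 0 \<omega> = 0"
    using ito_integral_initial_zero[OF ps ito(1) less_imp_le[OF T]] ito_integral_initial_zero[OF ps ito(2) less_imp_le[OF T]] itoE
    by eventually_elim (use T in auto)
  have tT: "t \<in> {0..T}" using t by simp
  have "(\<integral>\<^sup>+\<omega>. (?j \<omega>)\<^sup>2 * indicator (?G t) \<omega> \<partial>M)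
    \<le> ennreal cI * (\<integral>\<^sup>+u\<in>{0..t}. (\<integral>\<^sup>+\<omega>. ennreal ((?D u \<omega>)\<^sup>2) * indicator (?G u) \<omega> \<partial>M) * ennreal (vol_kernel \<mu> t u) \<partial>lborel)"
    using ito_norm_estimate[OF ps \<mu>(1,2) t(1) less_imp_le[OF t(2)] Jj J0 GM[OF tT] Gj DJ iso]
    unfolding \<mu>(4) cI_def .
  also have "\<dots> \<le> ennreal cI * (\<integral>\<^sup>+u. ennreal (K\<^sup>2) * (\<phi> u * ennreal (vol_kernel \<mu> t u) * indicator {0..t} u) \<partial>lborel)"
  proof (intro mult_left_mono nn_integral_mono)
    fix u
    have "(\<integral>\<^sup>+\<omega>. ennreal ((?D u \<omega>)\<^sup>2) * indicator (?G u) \<omega> \<partial>M) \<le> (\<integral>\<^sup>+\<omega>. ennreal (K\<^sup>2) * ((?n u \<omega>)\<^sup>2 * indicator (?G u) \<omega>) \<partial>M)"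
      unfolding mult.assoc[symmetric] by (intro nn_integral_mono mult_right_mono D2n) auto
    also have "\<dots> = ennreal (K\<^sup>2) * \<phi> u" unfolding \<phi>_def by (rule nn_integral_cmult) measurable
    finally have D\<phi>: "(\<integral>\<^sup>+\<omega>. ennreal ((?D u \<omega>)\<^sup>2) * indicator (?G u) \<omega> \<partial>M) \<le> ennreal (K\<^sup>2) * \<phi> u" .
    show "(\<integral>\<^sup>+\<omega>. ennreal ((?D u \<omega>)\<^sup>2) * indicator (?G u) \<omega> \<partial>M) * ennreal (vol_kernel \<mu> t u) * indicator {0..t} u
      \<le> ennreal (K\<^sup>2) * (\<phi> u * ennreal (vol_kernel \<mu> t u) * indicator {0..t} u)"
      unfolding mult.assoc[symmetric] by (intro mult_right_mono D\<phi>) auto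
  qed simp
  also have "\<dots> = ennreal cI * (ennreal (K\<^sup>2) * (\<integral>\<^sup>+u\<in>{0..t}. \<phi> u * ennreal (vol_kernel \<mu> t u) \<partial>lborel))"
    by (subst nn_integral_cmult) auto
  finally have jE: "(\<integral>\<^sup>+\<omega>. (?j \<omega>)\<^sup>2 * indicator (?G t) \<omega> \<partial>M) \<le> \<dots>" .
  let ?\<Theta> = "\<integral>\<^sup>+u\<in>{0..t}. \<phi> u * ennreal (vol_kernel \<mu> t u) \<partial>lborel"
  have fub: "(\<integral>\<^sup>+\<omega>. (\<integral>\<^sup>+r. (?n r \<omega>)\<^sup>2 * indicator (?G r) \<omega> * (ennreal (vol_kernel \<mu> t r) * indicator {0..t} r) \<partial>lborel) \<partial>M) = ?\<Theta>"
  proof -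
    have "(\<integral>\<^sup>+\<omega>. (\<integral>\<^sup>+r. (?n r \<omega>)\<^sup>2 * indicator (?G r) \<omega> * (ennreal (vol_kernel \<mu> t r) * indicator {0..t} r) \<partial>lborel) \<partial>M)
      = (\<integral>\<^sup>+r. (\<integral>\<^sup>+\<omega>. (?n r \<omega>)\<^sup>2 * indicator (?G r) \<omega> * (ennreal (vol_kernel \<mu> t r) * indicator {0..t} r) \<partial>M) \<partial>lborel)"
      by (rule P.Fubini') measurable
    also have "\<dots> = (\<integral>\<^sup>+r. \<phi> r * (ennreal (vol_kernel \<mu> t r) * indicator {0..t} r) \<partial>lborel)"
      unfolding \<phi>_def by (intro nn_integral_cong nn_integral_multc) measurable
    finally show ?thesis by (simp add: mult.assoc)
  qed
  have "\<phi> t \<le> (\<integral>\<^sup>+\<omega>. 2 * ((?j \<omega>)\<^sup>2 * indicator (?G t) \<omega>)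
     + (ennreal (4 * C\<^sup>2 * k) * (\<integral>\<^sup>+r. (?n r \<omega>)\<^sup>2 * indicator (?G r) \<omega> * (ennreal (vol_kernel \<mu> t r) * indicator {0..t} r) \<partial>lborel)
     + ennreal (4 * C\<^sup>2 * k\<^sup>2 * (8 * N)) * ?\<zeta> \<omega>) \<partial>M)"
    unfolding \<phi>_def by (rule nn_integral_mono_AE[OF path])
  also have "\<dots> = 2 * (\<integral>\<^sup>+\<omega>. (?j \<omega>)\<^sup>2 * indicator (?G t) \<omega> \<partial>M) + (ennreal (4 * C\<^sup>2 * k) * ?\<Theta>
     + ennreal (4 * C\<^sup>2 * k\<^sup>2 * (8 * N)) * (\<integral>\<^sup>+\<omega>. ?\<zeta> \<omega> \<partial>M))"
    unfolding fub[symmetric]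
    by (subst nn_integral_add, measurable, subst nn_integral_cmult, measurable, subst nn_integral_add, measurable,
      subst nn_integral_cmult, measurable, subst nn_integral_cmult, measurable)
  also have "\<dots> \<le> 2 * (ennreal cI * (ennreal (K\<^sup>2) * ?\<Theta>)) + (ennreal (4 * C\<^sup>2 * k) * ?\<Theta>
     + ennreal (4 * C\<^sup>2 * k\<^sup>2 * (8 * N)) * (\<integral>\<^sup>+\<omega>. ?\<zeta> \<omega> \<partial>M))"
    by (intro add_right_mono mult_left_mono jE) auto
  also have "\<dots> = ennreal (4 * C\<^sup>2 * k\<^sup>2 * (8 * N)) * (\<integral>\<^sup>+\<omega>. ?\<zeta> \<omega> \<partial>M) + (2 * ennreal cI * ennreal (K\<^sup>2) + ennreal (4 * C\<^sup>2 * k)) * ?\<Theta>"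
    by (simp add: distrib_right mult.assoc add_ac)
  also have "2 * ennreal cI * ennreal (K\<^sup>2) + ennreal (4 * C\<^sup>2 * k) = ennreal (2 * cI * K\<^sup>2 + 4 * C\<^sup>2 * k)"
    using cI k by (simp add: ennreal_plus ennreal_mult)
  finally show "\<phi> t \<le> ennreal (4 * C\<^sup>2 * k\<^sup>2 * (8 * N)) * (\<integral>\<^sup>+\<omega>. ?\<zeta> \<omega> \<partial>M)
    + ennreal (2 * cI * K\<^sup>2 + 4 * C\<^sup>2 * k) * ?\<Theta>" .
qed

lemma gls_cong:
  assumes "\<And>s. s \<in> {0..t} \<Longrightarrow> f s = f' s" "\<And>s. s \<in> {0..t} \<Longrightarrow> g s = g' s"
  shows "gls_integral \<alpha> 0 t f g = gls_integral \<alpha> 0 t f' g'" "gls_integrable \<alpha> 0 t f g \<longleftrightarrow> gls_integrable \<alpha> 0 t f' g'"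
proof -
  have f: "f s = f' s" if "0 < s" "s < t" for s using assms(1) that by auto
  have g: "g s = g' s" if "0 < s" "s \<le> t" for s using assms(2) that by auto
  have L: "frac_deriv_left \<alpha> 0 f x = frac_deriv_left \<alpha> 0 f' x" if x: "x \<in> {0<..<t}" for x
  proof -
    have "(LINT y:{0<..<x}|lborel. (f x - f y) / (x - y) powr (1 + \<alpha>)) = (LINT y:{0<..<x}|lborel. (f' x - f' y) / (x - y) powr (1 + \<alpha>))"
      using x by (intro set_lebesgue_integral_cong) (auto simp: f)
    then show ?thesis unfolding frac_deriv_left_def using x by (simp add: f)
  qed
  have R: "frac_deriv_right \<alpha> t (\<lambda>y. g y - g t) x = frac_deriv_right \<alpha> t (\<lambda>y. g' y - g' t) x" if x: "x \<in> {0<..<t}" for x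
  proof -
    have "(LINT y:{x<..<t}|lborel. ((g x - g t) - (g y - g t)) / (y - x) powr (2 - \<alpha>)) = (LINT y:{x<..<t}|lborel. ((g' x - g' t) - (g' y - g' t)) / (y - x) powr (2 - \<alpha>))"
      using x by (intro set_lebesgue_integral_cong) (auto simp: g)
    then show ?thesis unfolding frac_deriv_right_def using x by (simp add: g)
  qed
  show "gls_integral \<alpha> 0 t f g = gls_integral \<alpha> 0 t f' g'"
    unfolding gls_integral_def by (intro arg_cong2[where f="(*)"] refl set_lebesgue_integral_cong) (auto simp: L R)
  have 1: "set_integrable lborel {0<..<x} (\<lambda>y. (f x - f y) / (x - y) powr (1 + \<alpha>)) = set_integrable lborel {0<..<x} (\<lambda>y. (f' x - f' y) / (x - y) powr (1 + \<alpha>))"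
    if "x \<in> {0<..<t}" for x using that by (intro set_integrable_cong) (auto simp: f)
  have 2: "set_integrable lborel {0<..<t} (frac_deriv_left \<alpha> 0 f) = set_integrable lborel {0<..<t} (frac_deriv_left \<alpha> 0 f')"
    by (intro set_integrable_cong) (auto simp: L)
  have 3: "set_integrable lborel {x<..<t} (\<lambda>y. (g x - g y) / (y - x) powr (2 - \<alpha>)) = set_integrable lborel {x<..<t} (\<lambda>y. (g' x - g' y) / (y - x) powr (2 - \<alpha>))"
    if "x \<in> {0<..<t}" for x using that by (intro set_integrable_cong) (auto simp: g)
  have 4: "set_borel_measurable lborel {0<..<t} (frac_deriv_right \<alpha> t (\<lambda>y. g y - g t)) = set_borel_measurable lborel {0<..<t} (frac_deriv_right \<alpha> t (\<lambda>y. g' y - g' t))"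
    unfolding set_borel_measurable_def by (rule measurable_cong) (auto simp: R split: split_indicator)
  show "gls_integrable \<alpha> 0 t f g \<longleftrightarrow> gls_integrable \<alpha> 0 t f' g'"
    unfolding gls_integrable_def 2 4
    by (intro arg_cong2[where f="(\<and>)"] arg_cong[where f=Ex] ext AE_cong refl) (auto simp: 1 3 R)
qed

lemma norm_two_sq_cong: "(\<And>s. s \<in> {0..t} \<Longrightarrow> f s = g s) \<Longrightarrow> norm_two_sq \<alpha> t f = norm_two_sq \<alpha> t g"
  unfolding norm_two_sq_def
  by (intro nn_integral_cong) (auto split: split_indicator intro!: arg_cong2[where f="(*)"] arg_cong[where f="\<lambda>x. x\<^sup>2"] norm_at_cong)

lemma norm_two_weight_integral:
  assumes "0 < \<alpha>" "\<alpha> < 1/2" "0 < T"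
  shows "(\<integral>\<^sup>+s\<in>{0..T}. ennreal (s powr (- \<alpha>) + (T - s) powr (- \<alpha> - 1/2)) \<partial>lborel)
    = ennreal (T powr (1 - \<alpha>) / (1 - \<alpha>) + T powr (1/2 - \<alpha>) / (1/2 - \<alpha>))"
proof -
  have e: "- \<alpha> - 1/2 = - (\<alpha> + 1/2)" "1 - (\<alpha> + 1/2) = 1/2 - \<alpha>" by auto
  have "(\<integral>\<^sup>+s\<in>{0..T}. ennreal (s powr (- \<alpha>) + (T - s) powr (- \<alpha> - 1/2)) \<partial>lborel)
    = (\<integral>\<^sup>+s. ennreal ((s - 0) powr (- \<alpha>)) * indicator {0..T} s + ennreal ((T - s) powr (- (\<alpha> + 1/2))) * indicator {0..T} s \<partial>lborel)"
    unfolding e(1) by (intro nn_integral_cong) (auto split: split_indicator)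
  also have "\<dots> = ennreal ((T - 0) powr (1 - \<alpha>) / (1 - \<alpha>)) + ennreal ((T - 0) powr (1 - (\<alpha> + 1/2)) / (1 - (\<alpha> + 1/2)))"
    using assms by (subst nn_integral_add, measurable) (subst nn_integral_powr_left, simp, simp, subst nn_integral_powr_right, auto)
  also have "\<dots> = ennreal (T powr (1 - \<alpha>) / (1 - \<alpha>) + T powr (1/2 - \<alpha>) / (1/2 - \<alpha>))"
    unfolding e(2) using assms by (subst ennreal_plus[symmetric]) auto
  finally show ?thesis .
qed

theorem lemma4p1:
  fixes T \<alpha> \<beta> K x0 N R :: real
  assumes "T > 0" and "\<beta> > 1/2" and "K > 0" and "N \<ge> 1" and "R > 0"
  shows "\<exists>C::real. C \<ge> 0 \<and>
    (\<forall>(M :: 'a measure) F \<gamma> W Z Zb a b c X Xb.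
      prob_space M \<longrightarrow> complete_measure M \<longrightarrow> standard_filtration M F T \<longrightarrow>
      \<gamma> \<in> {1/2<..1} \<longrightarrow> \<alpha> \<in> {1 - \<gamma><..<1/2} \<longrightarrow>
      wiener_process M F T W \<longrightarrow>
      adapted F T Z \<longrightarrow> hoelder_process M T \<gamma> Z \<longrightarrow>
      adapted F T Zb \<longrightarrow> hoelder_process M T \<gamma> Zb \<longrightarrow>
      coefficient_conditions T \<beta> K a b c \<longrightarrow>
      sde_solution M F T \<alpha> x0 a b c W (stopped \<alpha> T N Z) X \<longrightarrow>
      (AE \<omega> in M. norm_infty \<alpha> T (\<lambda>t. X t \<omega>) < \<infinity>) \<longrightarrow>
      sde_solution M F T \<alpha> x0 a b c W (stopped \<alpha> T N Zb) Xb \<longrightarrow>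
      (AE \<omega> in M. norm_infty \<alpha> T (\<lambda>t. Xb t \<omega>) < \<infinity>) \<longrightarrow>
      (\<integral>\<^sup>+\<omega>. norm_two_sq \<alpha> T (\<lambda>t. X t \<omega> - Xb t \<omega>) *
          indicator {\<omega>. norm_infty \<alpha> T (\<lambda>t. X t \<omega>) + norm_infty \<alpha> T (\<lambda>t. Xb t \<omega>) \<le> ennreal R} \<omega> \<partial>M)
        \<le> ennreal C *
          (\<integral>\<^sup>+\<omega>. norm_zero \<alpha> T (\<lambda>t. stopped \<alpha> T N Z t \<omega> - stopped \<alpha> T N Zb t \<omega>) \<partial>M))"
proof (cases "0 < \<alpha> \<and> \<alpha> < 1/2")
  case False
  \<comment> \<open>No \<open>\<gamma>\<close> is admissible, as \<open>1 - \<gamma> < \<alpha> < 1/2\<close> and \<open>\<gamma> \<le> 1\<close> imply \<open>0 < \<alpha> < 1/2\<close>.\<close>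
  then show ?thesis by (intro exI[of _ 0]) auto
next
  case True
  then have \<alpha>: "0 < \<alpha>" "\<alpha> < 1/2" by auto
  have T: "0 < T" "0 \<le> T" and N: "0 \<le> N" using assms by auto
  define \<mu> where "\<mu> = \<alpha> + 1/2"
  have \<mu>: "0 < \<mu>" "\<mu> < 1" using \<alpha> by (auto simp: \<mu>_def)
  define C where "C = path_const \<alpha> \<beta> K T R (4 * N)"
  define k where "k = 2 * (T powr (1 - \<mu>) / (1 - \<mu>))"
  define cI where "cI = 4 * T powr \<mu> + 4 * (T powr (1 - \<mu>) / (1 - \<mu>)) / \<mu>"
  define c3 where "c3 = 2 * cI * K\<^sup>2 + 4 * C\<^sup>2 * k"
  define c4 where "c4 = 4 * C\<^sup>2 * k\<^sup>2 * (8 * N)"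
  define c5 where "c5 = T powr (1 - \<alpha>) / (1 - \<alpha>) + T powr (1/2 - \<alpha>) / (1/2 - \<alpha>)"
  have k: "0 \<le> k" and cI: "0 \<le> cI" using \<mu> by (auto simp: k_def cI_def)
  have c: "0 \<le> c3" "0 \<le> c4" "0 \<le> c5" using k cI N \<alpha> by (auto simp: c3_def c4_def c5_def)
  obtain Gr where Gr: "0 \<le> Gr"
    "\<And>\<phi> A B. \<lbrakk>\<phi> \<in> borel_measurable borel; \<And>t. t \<in> {0<..<T} \<Longrightarrow> \<phi> t \<le> ennreal B;
       \<And>t. t \<in> {0<..<T} \<Longrightarrow> \<phi> t \<le> A + ennreal c3 * (\<integral>\<^sup>+u\<in>{0..t}. \<phi> u * ennreal (vol_kernel \<mu> t u) \<partial>lborel)\<rbrakk>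
     \<Longrightarrow> \<forall>t\<in>{0<..<T}. \<phi> t \<le> ennreal Gr * A"
    by (rule singular_gronwall[OF \<mu> c(1) T(1)]) blast
  show ?thesis
  proof (intro exI[of _ "c5 * (Gr * c4)"] conjI allI impI)
    show "0 \<le> c5 * (Gr * c4)" using c Gr(1) by simp
  next
    fix M :: "'a measure" and F \<gamma> W Z Zb a b c X Xb
    assume ps: "prob_space M" and fil: "standard_filtration M F T"
      and "\<gamma> \<in> {1/2<..1}" and w: "wiener_process M F T W"
      and Z: "adapted F T Z" "hoelder_process M T \<gamma> Z" and Zb: "adapted F T Zb" "hoelder_process M T \<gamma> Zb"
      and cc: "coefficient_conditions T \<beta> K a b c"
      and sX: "sde_solution M F T \<alpha> x0 a b c W (stopped \<alpha> T N Z) X"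
      and sXb: "sde_solution M F T \<alpha> x0 a b c W (stopped \<alpha> T N Zb) Xb"
    then have \<gamma>: "0 < \<gamma>" by simp
    interpret prob_space M by fact
    interpret P: pair_sigma_finite lborel M ..
    obtain I where I: "has_ito_integral M F T W (\<lambda>s \<omega>. b s (X s \<omega>)) I"
      "AE \<omega> in M. \<forall>t\<in>{0..T}. gls_integrable \<alpha> 0 t (\<lambda>s. c s (X s \<omega>)) (\<lambda>s. stopped \<alpha> T N Z s \<omega>) \<and>
           complex_of_real (X t \<omega>) = of_real (x0 + (LINT s:{0..t}|lborel. a s (X s \<omega>)) + I t \<omega>)
             + gls_integral \<alpha> 0 t (\<lambda>s. c s (X s \<omega>)) (\<lambda>s. stopped \<alpha> T N Z s \<omega>)"
      and X: "adapted F T X" "continuous_process M T X"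
      using sX unfolding sde_solution_def by blast
    obtain Ib where Ib: "has_ito_integral M F T W (\<lambda>s \<omega>. b s (Xb s \<omega>)) Ib"
      "AE \<omega> in M. \<forall>t\<in>{0..T}. gls_integrable \<alpha> 0 t (\<lambda>s. c s (Xb s \<omega>)) (\<lambda>s. stopped \<alpha> T N Zb s \<omega>) \<and>
           complex_of_real (Xb t \<omega>) = of_real (x0 + (LINT s:{0..t}|lborel. a s (Xb s \<omega>)) + Ib t \<omega>)
             + gls_integral \<alpha> 0 t (\<lambda>s. c s (Xb s \<omega>)) (\<lambda>s. stopped \<alpha> T N Zb s \<omega>)"
      and Xb: "adapted F T Xb" "continuous_process M T Xb"
      using sXb unfolding sde_solution_def by blast
    have IA: "adapted F T I" "continuous_process M T I" "adapted F T Ib" "continuous_process M T Ib"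
      using I(1) Ib(1) by (auto simp: has_ito_integral_def)
    obtain X' where X': "\<And>\<omega>. continuous_on UNIV (\<lambda>t. X' t \<omega>)" "\<And>t. t \<in> {0..T} \<Longrightarrow> X' t \<in> borel_measurable (F t)"
      "\<And>t \<omega>. X' (clamp_time T t) \<omega> = X' t \<omega>" "AE \<omega> in M. \<forall>t\<in>{0..T}. X' t \<omega> = X t \<omega>"
      by (rule continuous_version[OF fil T(2) X]) blast
    obtain Xb' where Xb': "\<And>\<omega>. continuous_on UNIV (\<lambda>t. Xb' t \<omega>)" "\<And>t. t \<in> {0..T} \<Longrightarrow> Xb' t \<in> borel_measurable (F t)"
      "\<And>t \<omega>. Xb' (clamp_time T t) \<omega> = Xb' t \<omega>" "AE \<omega> in M. \<forall>t\<in>{0..T}. Xb' t \<omega> = Xb t \<omega>"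
      by (rule continuous_version[OF fil T(2) Xb]) blast
    obtain I' where I': "\<And>\<omega>. continuous_on UNIV (\<lambda>t. I' t \<omega>)" "\<And>t. t \<in> {0..T} \<Longrightarrow> I' t \<in> borel_measurable (F t)"
      "\<And>t \<omega>. I' (clamp_time T t) \<omega> = I' t \<omega>" "AE \<omega> in M. \<forall>t\<in>{0..T}. I' t \<omega> = I t \<omega>"
      by (rule continuous_version[OF fil T(2) IA(1,2)]) blast
    obtain Ib' where Ib': "\<And>\<omega>. continuous_on UNIV (\<lambda>t. Ib' t \<omega>)" "\<And>t. t \<in> {0..T} \<Longrightarrow> Ib' t \<in> borel_measurable (F t)"
      "\<And>t \<omega>. Ib' (clamp_time T t) \<omega> = Ib' t \<omega>" "AE \<omega> in M. \<forall>t\<in>{0..T}. Ib' t \<omega> = Ib t \<omega>"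
      by (rule continuous_version[OF fil T(2) IA(3,4)]) blast
    obtain Z' where Z': "\<And>\<omega>. continuous_on UNIV (\<lambda>t. Z' t \<omega>)" "\<And>t. t \<in> {0..T} \<Longrightarrow> Z' t \<in> borel_measurable (F t)"
      "\<And>t \<omega>. Z' (clamp_time T t) \<omega> = Z' t \<omega>" "AE \<omega> in M. \<forall>t\<in>{0..T}. Z' t \<omega> = Z t \<omega>"
      by (rule continuous_version[OF fil T(2) Z(1) hoelder_process_continuous[OF Z(2) \<gamma>]]) blast
    obtain Zb' where Zb': "\<And>\<omega>. continuous_on UNIV (\<lambda>t. Zb' t \<omega>)" "\<And>t. t \<in> {0..T} \<Longrightarrow> Zb' t \<in> borel_measurable (F t)"
      "\<And>t \<omega>. Zb' (clamp_time T t) \<omega> = Zb' t \<omega>" "AE \<omega> in M. \<forall>t\<in>{0..T}. Zb' t \<omega> = Zb t \<omega>"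
      by (rule continuous_version[OF fil T(2) Zb(1) hoelder_process_continuous[OF Zb(2) \<gamma>]]) blast
    define g where "g = stopped \<alpha> T N Z'"
    define gb where "gb = stopped \<alpha> T N Zb'"
    note toM = clamped_adapted_measurable[OF fil T(2)]
    have g: "\<And>\<omega>. continuous_on UNIV (\<lambda>t. g t \<omega>)" "\<And>\<omega>. continuous_on UNIV (\<lambda>t. gb t \<omega>)"
      "\<And>t. g t \<in> borel_measurable M" "\<And>t. gb t \<in> borel_measurable M"
      "\<And>\<omega>. norm_zero \<alpha> T (\<lambda>t. g t \<omega>) \<le> ennreal (4 * N)" "\<And>\<omega>. norm_zero \<alpha> T (\<lambda>t. gb t \<omega>) \<le> ennreal (4 * N)"
      unfolding g_def gb_def
      subgoal by (rule stopped_continuous[OF Z'(1)])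
      subgoal by (rule stopped_continuous[OF Zb'(1)])
      subgoal by (rule stopped_measurable[OF T(2) Z'(1) toM[OF Z'(2,3)]])
      subgoal by (rule stopped_measurable[OF T(2) Zb'(1) toM[OF Zb'(2,3)]])
      subgoal by (rule norm_zero_stopped_le[OF \<alpha> N T(2) Z'(1)])
      subgoal by (rule norm_zero_stopped_le[OF \<alpha> N T(2) Zb'(1)])
      done
    have gZ: "AE \<omega> in M. \<forall>t\<in>{0..T}. g t \<omega> = stopped \<alpha> T N Z t \<omega> \<and> gb t \<omega> = stopped \<alpha> T N Zb t \<omega>"
      using Z'(4) Zb'(4) unfolding g_def gb_def
      by eventually_elim (blast intro: stopped_cong[OF T(2)])
    have itoE: "AE \<omega> in M. \<forall>t\<in>{0..T}. b t (X t \<omega>) = b t (X' t \<omega>) \<and> b t (Xb t \<omega>) = b t (Xb' t \<omega>) \<and> I t \<omega> = I' t \<omega> \<and> Ib t \<omega> = Ib' t \<omega>"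
      using X'(4) Xb'(4) I'(4) Ib'(4) by eventually_elim auto
    have eqt: "AE \<omega> in M. \<forall>t\<in>{0..T}. gls_integrable \<alpha> 0 t (\<lambda>s. c s (Y' s \<omega>)) (\<lambda>s. h' s \<omega>) \<and>
           complex_of_real (Y' t \<omega>) = of_real (x0 + (LINT s:{0..t}|lborel. a s (Y' s \<omega>)) + J' t \<omega>)
             + gls_integral \<alpha> 0 t (\<lambda>s. c s (Y' s \<omega>)) (\<lambda>s. h' s \<omega>)"
      if "AE \<omega> in M. \<forall>t\<in>{0..T}. gls_integrable \<alpha> 0 t (\<lambda>s. c s (Y s \<omega>)) (\<lambda>s. h s \<omega>) \<and>
           complex_of_real (Y t \<omega>) = of_real (x0 + (LINT s:{0..t}|lborel. a s (Y s \<omega>)) + J t \<omega>)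
             + gls_integral \<alpha> 0 t (\<lambda>s. c s (Y s \<omega>)) (\<lambda>s. h s \<omega>)"
        "AE \<omega> in M. \<forall>t\<in>{0..T}. Y' t \<omega> = Y t \<omega>" "AE \<omega> in M. \<forall>t\<in>{0..T}. h' t \<omega> = h t \<omega>" "AE \<omega> in M. \<forall>t\<in>{0..T}. J' t \<omega> = J t \<omega>"
      for Y Y' h h' J J' :: "real \<Rightarrow> 'a \<Rightarrow> real"
      using that
    proof eventually_elim
      case (elim \<omega>)
      show ?case
      proof
        fix t assume t: "t \<in> {0..T}"
        have 1: "gls_integral \<alpha> 0 t (\<lambda>s. c s (Y' s \<omega>)) (\<lambda>s. h' s \<omega>) = gls_integral \<alpha> 0 t (\<lambda>s. c s (Y s \<omega>)) (\<lambda>s. h s \<omega>)"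
          "gls_integrable \<alpha> 0 t (\<lambda>s. c s (Y' s \<omega>)) (\<lambda>s. h' s \<omega>) = gls_integrable \<alpha> 0 t (\<lambda>s. c s (Y s \<omega>)) (\<lambda>s. h s \<omega>)"
          by (rule gls_cong; use elim t in simp)+
        have 2: "(LINT s:{0..t}|lborel. a s (Y' s \<omega>)) = (LINT s:{0..t}|lborel. a s (Y s \<omega>))"
          using elim t by (intro set_lebesgue_integral_cong) auto
        show "gls_integrable \<alpha> 0 t (\<lambda>s. c s (Y' s \<omega>)) (\<lambda>s. h' s \<omega>) \<and>
           complex_of_real (Y' t \<omega>) = of_real (x0 + (LINT s:{0..t}|lborel. a s (Y' s \<omega>)) + J' t \<omega>)
             + gls_integral \<alpha> 0 t (\<lambda>s. c s (Y' s \<omega>)) (\<lambda>s. h' s \<omega>)"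
          unfolding 1 2 using elim t by simp
      qed
    qed
    have gZ1: "AE \<omega> in M. \<forall>t\<in>{0..T}. g t \<omega> = stopped \<alpha> T N Z t \<omega>" and gZ2: "AE \<omega> in M. \<forall>t\<in>{0..T}. gb t \<omega> = stopped \<alpha> T N Zb t \<omega>"
      using gZ by (auto elim: eventually_mono)
    define \<phi> where "\<phi> t = (\<integral>\<^sup>+\<omega>. (norm_at \<alpha> t (\<lambda>s. X' s \<omega> - Xb' s \<omega>))\<^sup>2 * indicator (good_event M \<alpha> R X' Xb' t) \<omega> \<partial>M)" for t
    let ?E = "\<integral>\<^sup>+\<omega>. norm_zero \<alpha> T (\<lambda>s. g s \<omega> - gb s \<omega>) \<partial>M"
    note ev = expected_volterra_inequality[OF ps fil w \<alpha> assms(2,3,5) N T(1) cc X'(1) Xb'(1) I'(1) Ib'(1) g(1,2)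
        X'(2) Xb'(2) I'(2) Ib'(2) X'(3) Xb'(3) I'(3) Ib'(3) g(3-6) I(1) Ib(1) itoE
        eqt[OF I(2) X'(4) gZ1 I'(4)] eqt[OF Ib(2) Xb'(4) gZ2 Ib'(4)],
        folded \<mu>_def C_def, folded k_def cI_def, folded c3_def c4_def, folded \<phi>_def]
    \<comment> \<open>\<open>ev\<close> speaks of times in \<open>(0, T)\<close>; any such time yields the measurability of \<open>\<phi>\<close>.\<close>
    have Th: "T / 2 \<in> {0<..<T}" using T by simp
    have \<phi>m [measurable]: "\<phi> \<in> borel_measurable borel" using ev(2)[of "T/2"] Th unfolding \<phi>_def[abs_def] by simp
    have gron: "\<forall>t\<in>{0<..<T}. \<phi> t \<le> ennreal Gr * (ennreal c4 * ?E)"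
      by (rule Gr(2)[OF \<phi>m, of "R\<^sup>2"]) (use ev(1,3) in auto)
    let ?w = "\<lambda>s. ennreal (s powr (- \<alpha>) + (T - s) powr (- \<alpha> - 1/2))"
    let ?n = "\<lambda>u \<omega>. norm_at \<alpha> u (\<lambda>s. X' s \<omega> - Xb' s \<omega>)"
    let ?G = "good_event M \<alpha> R X' Xb'"
    have Xj [measurable]: "(\<lambda>(u, \<omega>). X' u \<omega>) \<in> borel_measurable (borel \<Otimes>\<^sub>M M)"
      by (rule continuous_process_joint_measurable[OF toM[OF X'(2,3)] X'(1)])
    have Xbj [measurable]: "(\<lambda>(u, \<omega>). Xb' u \<omega>) \<in> borel_measurable (borel \<Otimes>\<^sub>M M)"
      by (rule continuous_process_joint_measurable[OF toM[OF Xb'(2,3)] Xb'(1)])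
    note good_event_joint_measurable[OF Xj Xbj, measurable]
    have Dj: "(\<lambda>(u, \<omega>). X' u \<omega> - Xb' u \<omega>) \<in> borel_measurable (borel \<Otimes>\<^sub>M M)" by measurable
    note norm_at_joint_measurable[OF Dj, measurable]
    have "(\<integral>\<^sup>+\<omega>. norm_two_sq \<alpha> T (\<lambda>t. X t \<omega> - Xb t \<omega>) *
          indicator {\<omega>. norm_infty \<alpha> T (\<lambda>t. X t \<omega>) + norm_infty \<alpha> T (\<lambda>t. Xb t \<omega>) \<le> ennreal R} \<omega> \<partial>M)
      \<le> (\<integral>\<^sup>+\<omega>. (\<integral>\<^sup>+s. (?n s \<omega>)\<^sup>2 * indicator (?G s) \<omega> * (?w s * indicator {0..T} s) \<partial>lborel) \<partial>M)"
    proof (rule nn_integral_mono_AE, use X'(4) Xb'(4) AE_space in eventually_elim)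
      fix \<omega> assume e: "\<forall>t\<in>{0..T}. X' t \<omega> = X t \<omega>" "\<forall>t\<in>{0..T}. Xb' t \<omega> = Xb t \<omega>" "\<omega> \<in> space M"
      show "norm_two_sq \<alpha> T (\<lambda>t. X t \<omega> - Xb t \<omega>) *
          indicator {\<omega>. norm_infty \<alpha> T (\<lambda>t. X t \<omega>) + norm_infty \<alpha> T (\<lambda>t. Xb t \<omega>) \<le> ennreal R} \<omega>
        \<le> (\<integral>\<^sup>+s. (?n s \<omega>)\<^sup>2 * indicator (?G s) \<omega> * (?w s * indicator {0..T} s) \<partial>lborel)"
      proof (cases "norm_infty \<alpha> T (\<lambda>t. X t \<omega>) + norm_infty \<alpha> T (\<lambda>t. Xb t \<omega>) \<le> ennreal R")
        case True
        have "norm_at \<alpha> q (\<lambda>s. X' s \<omega>) + norm_at \<alpha> q (\<lambda>s. Xb' s \<omega>) \<le> ennreal R" if q: "0 < q" "q < T" for q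
        proof -
          have "norm_at \<alpha> q (\<lambda>s. X' s \<omega>) = norm_at \<alpha> q (\<lambda>s. X s \<omega>)" "norm_at \<alpha> q (\<lambda>s. Xb' s \<omega>) = norm_at \<alpha> q (\<lambda>s. Xb s \<omega>)"
            using e q by (auto intro!: norm_at_cong)
          moreover have "norm_at \<alpha> q (\<lambda>s. X s \<omega>) \<le> norm_infty \<alpha> T (\<lambda>s. X s \<omega>)" "norm_at \<alpha> q (\<lambda>s. Xb s \<omega>) \<le> norm_infty \<alpha> T (\<lambda>s. Xb s \<omega>)"
            unfolding norm_infty_def using q by (auto intro!: SUP_upper)
          ultimately show ?thesis using order_trans[OF add_mono True] by metis
        qed
        then have G: "\<omega> \<in> ?G s" if "s \<in> {0..T}" for s using that e(3) unfolding good_event_def by auto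
        have "norm_two_sq \<alpha> T (\<lambda>t. X t \<omega> - Xb t \<omega>) = norm_two_sq \<alpha> T (\<lambda>t. X' t \<omega> - Xb' t \<omega>)"
          using e by (intro norm_two_sq_cong) auto
        also have "\<dots> = (\<integral>\<^sup>+s. (?n s \<omega>)\<^sup>2 * indicator (?G s) \<omega> * (?w s * indicator {0..T} s) \<partial>lborel)"
          unfolding norm_two_sq_def using G by (intro nn_integral_cong) (auto split: split_indicator)
        finally show ?thesis using True by simp
      qed simp
    qed
    also have "\<dots> = (\<integral>\<^sup>+s. (\<integral>\<^sup>+\<omega>. (?n s \<omega>)\<^sup>2 * indicator (?G s) \<omega> * (?w s * indicator {0..T} s) \<partial>M) \<partial>lborel)"
      by (rule P.Fubini') measurable
    also have "\<dots> = (\<integral>\<^sup>+s. \<phi> s * (?w s * indicator {0..T} s) \<partial>lborel)"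
      unfolding \<phi>_def by (intro nn_integral_cong nn_integral_multc) measurable
    also have "\<dots> \<le> (\<integral>\<^sup>+s. (ennreal Gr * (ennreal c4 * ?E)) * (?w s * indicator {0..T} s) \<partial>lborel)"
    proof (rule nn_integral_mono_AE, use AE_lborel_singleton[of 0] AE_lborel_singleton[of T] in eventually_elim)
      fix s assume "s \<noteq> 0" "s \<noteq> T"
      then show "\<phi> s * (?w s * indicator {0..T} s) \<le> (ennreal Gr * (ennreal c4 * ?E)) * (?w s * indicator {0..T} s)"
        using gron by (cases "s \<in> {0..T}") (auto intro!: mult_right_mono)
    qed
    also have "\<dots> = (ennreal Gr * (ennreal c4 * ?E)) * ennreal c5"
      unfolding c5_def norm_two_weight_integral[OF \<alpha> T(1), symmetric] by (rule nn_integral_cmult) measurable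
    also have "?E = (\<integral>\<^sup>+\<omega>. norm_zero \<alpha> T (\<lambda>t. stopped \<alpha> T N Z t \<omega> - stopped \<alpha> T N Zb t \<omega>) \<partial>M)"
      by (rule nn_integral_cong_AE) (use gZ in eventually_elim, auto intro!: norm_zero_cong)
    also have "(ennreal Gr * (ennreal c4 * \<dots>)) * ennreal c5 = ennreal (c5 * (Gr * c4)) * \<dots>"
      using c Gr(1) by (simp add: ennreal_mult mult_ac)
    finally show "(\<integral>\<^sup>+\<omega>. norm_two_sq \<alpha> T (\<lambda>t. X t \<omega> - Xb t \<omega>) *
          indicator {\<omega>. norm_infty \<alpha> T (\<lambda>t. X t \<omega>) + norm_infty \<alpha> T (\<lambda>t. Xb t \<omega>) \<le> ennreal R} \<omega> \<partial>M)
        \<le> ennreal (c5 * (Gr * c4)) *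
          (\<integral>\<^sup>+\<omega>. norm_zero \<alpha> T (\<lambda>t. stopped \<alpha> T N Z t \<omega> - stopped \<alpha> T N Zb t \<omega>) \<partial>M)" .
  qed
qed

end
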